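(* Fix $\lambda\in(0,1/2)$ and $\nu\in\{2,3,\ldots\}$, and let $\mathbf X$ be the space that corresponds to the choices $\mathfrak C=\mathfrak C(\lambda)$ and $\mathfrak D=\frac1{1-2\lambda^\nu}\mathfrak C(\lambda^\nu)$. Then, for $1\le p<\infty$, $\mathbf X$ supports a $p$-Poincar\'e inequality if and only if $p>\mathfrak p_0$, where $$\mathfrak p_0=\frac{1+\nu+2\nu\log_2\lambda}{1+\nu\log_2\lambda}.$$
   Context: For $\lambda\in(0,1/2)$, $\mathfrak C(\lambda)\subset[0,1]$ is the self-similar Cantor set: start with $I_{0,1}=[0,1]$; at each step remove from every closed interval $I$ of the previous step its central open interval of length $(1-2\lambda)|I|$. After step $k$ there remain $2^k$ closed surviving intervals $I_{k,1},\ldots,I_{k,2^k}$ (from left to right), each of length $\lambda^k$; $\mathfrak C(\lambda)=\bigcap_k\bigcup_jI_{k,j}$. Let $\mathfrak C=\mathfrak C(\lambda)$ with surviving intervals $I_{k,j}$, and $\mathfrak D=\frac1{1-2\lambda^\nu}\mathfrak C(\lambda^\nu)$ (dilation of $\mathfrak C(\lambda^\nu)$). Let $\mathcal J$ be the collection of closures of the connected components of $[\inf\mathfrak D,\sup\mathfrak D]\setminus\mathfrak D$; each $J\in\mathcal J$ has length $\lambda^{k\nu}$ for some $k\in\{0,1,\ldots\}$. For $J\in\mathcal J$ with $|J|=\lambda^{m}$, the squares $I_{m,j}\times J$, $j=1,\ldots,2^{m}$, are called cubes. $\mathbf X'$ is the union of all cubes over all $J\in\mathcal J$, and $\mathbf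 X$ is the closure of $\mathbf X'$ in $\mathbb R^2$. $\mathbf X$ is equipped with the restriction $\mu$ of Lebesgue measure on $\mathbb R^2$ and with the length metric $d(p,q)=\inf\{\ell(\gamma):\gamma\text{ a path in }\mathbf X\text{ joining }p\text{ to }q\}$ ($\ell$ is Euclidean length), which is bi-Lipschitz equivalent to the Euclidean metric on $\mathbf X$. A Borel $g\ge0$ is an upper gradient of a continuous $u\colon U\to\mathbb R$ if $|u(x)-u(y)|\le\int_\gamma g\,ds$ for all $x,y\in U$ and every rectifiable curve $\gamma$ in $U$ joining $x$ and $y$. A metric measure space supports a $p$-Poincar\'e inequality ($1\le p<\infty$) if there are $\kappa\ge1$, $C>0$ such that for every ball $B$, every bounded continuous $u\colon\kappa B\to\mathbb R$ and every upper gradient $g$ of $u$ on $\kappa B$, $\frac1{\mu(B)}\int_B|u-u_B|\,d\mu\le C(\operatorname{diam}B)\Bigl(\frac1{\mu(\kappa B)}\int_{\kappa B}g^p\,d\mu\Bigr)^{1/p}$, where $u_B=\frac1{\mu(B)}\int_Bu\,d\mu$ and $\kappa B(x,r)=B(x,\kappa r)$. *)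

theory Defs
  imports "HOL-Analysis.Analysis"
begin

section \<open>The Cantor sets and the space X\<close>

text \<open>The surviving intervals after step \<open>k\<close>, listed from left to right as pairs of endpoints.\<close>

definition remove_central :: "real \<Rightarrow> real \<times> real \<Rightarrow> (real \<times> real) list" where
  "remove_central l = (\<lambda>(a, b).
     [(a, (a + b) / 2 - (1 - 2 * l) * (b - a) / 2),
      ((a + b) / 2 + (1 - 2 * l) * (b - a) / 2, b)])"

primrec cantor_endpoints :: "real \<Rightarrow> nat \<Rightarrow> (real \<times> real) list" where
  "cantor_endpoints l 0 = [(0, 1)]"
| "cantor_endpoints l (Suc k) = concat (map (remove_central l) (cantor_endpoints l k))"

definition surviving_interval :: "real \<Rightarrow> nat \<Rightarrow> nat \<Rightarrow> real set" where
  "surviving_interval l k j =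
     {fst (cantor_endpoints l k ! (j - 1)) .. snd (cantor_endpoints l k ! (j - 1))}"

definition cantor_set :: "real \<Rightarrow> real set" where
  "cantor_set l = (\<Inter>k. \<Union>j\<in>{1..2 ^ k}. surviving_interval l k j)"

definition dilated_cantor_set :: "real \<Rightarrow> nat \<Rightarrow> real set" where
  "dilated_cantor_set l \<nu> = (\<lambda>x. 1 / (1 - 2 * l ^ \<nu>) * x) ` cantor_set (l ^ \<nu>)"

definition closed_gaps :: "real set \<Rightarrow> real set set" where
  "closed_gaps D = closure ` components ({Inf D..Sup D} - D)"

definition cubes :: "real \<Rightarrow> nat \<Rightarrow> (real \<times> real) set set" where
  "cubes l \<nu> =
     {surviving_interval l m j \<times> J | m j J.
        J \<in> closed_gaps (dilated_cantor_set l \<nu>) \<and> measure lborel J = l ^ m \<and> j \<in> {1..2 ^ m}}"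

definition X_space :: "real \<Rightarrow> nat \<Rightarrow> (real \<times> real) set" where
  "X_space l \<nu> = closure (\<Union>(cubes l \<nu>))"

section \<open>Curves\<close>

text \<open>Length, with respect to \<open>d\<close>, of the restriction of \<open>\<gamma>\<close> to \<open>[a, b]\<close>: the supremum of the
  inscribed polygonal sums over all partitions \<open>a = t\<^sub>0 \<le> \<dots> \<le> t\<^sub>n = b\<close>.\<close>

definition curve_length :: "('a \<Rightarrow> 'a \<Rightarrow> real) \<Rightarrow> (real \<Rightarrow> 'a) \<Rightarrow> real \<Rightarrow> real \<Rightarrow> ennreal" where
  "curve_length d \<gamma> a b =
     (SUP (n, t) \<in> {(n :: nat, t). t 0 = a \<and> t n = b \<and> (\<forall>i<n. t i \<le> t (Suc i))}.
        \<Sum>i<n. ennreal (d (\<gamma> (t i)) (\<gamma> (t (Suc i)))))"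

text \<open>Real-valued: meaningful when any two points of \<open>X\<close> are joined by a path of finite
  Euclidean length in \<open>X\<close>. The norm on \<open>real \<times> real\<close> is the Euclidean one.\<close>

definition length_dist :: "(real \<times> real) set \<Rightarrow> real \<times> real \<Rightarrow> real \<times> real \<Rightarrow> real" where
  "length_dist X p q =
     enn2real (INF \<gamma> \<in> {\<gamma>. path \<gamma> \<and> path_image \<gamma> \<subseteq> X \<and> pathstart \<gamma> = p \<and> pathfinish \<gamma> = q}.
       curve_length dist \<gamma> 0 1)"

text \<open>\<open>\<integral>\<^sub>\<gamma> g ds\<close> for a curve \<open>\<gamma>\<close> of finite length on \<open>[0, 1]\<close>, via the arc-length parametrization. The
  latter does not depend on the choice of \<open>t\<close>: two admissible parameters bound a piece of
  \<open>\<gamma>\<close> of length zero, on which \<open>\<gamma>\<close> is constant.\<close>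

definition arc_length_param :: "('a \<Rightarrow> 'a \<Rightarrow> real) \<Rightarrow> (real \<Rightarrow> 'a) \<Rightarrow> real \<Rightarrow> 'a" where
  "arc_length_param d \<gamma> s = \<gamma> (SOME t. t \<in> {0..1} \<and> curve_length d \<gamma> 0 t = ennreal s)"

definition curve_integral :: "('a \<Rightarrow> 'a \<Rightarrow> real) \<Rightarrow> (real \<Rightarrow> 'a) \<Rightarrow> ('a \<Rightarrow> ennreal) \<Rightarrow> ennreal" where
  "curve_integral d \<gamma> g =
     (\<integral>\<^sup>+ s \<in> {0..enn2real (curve_length d \<gamma> 0 1)}. g (arc_length_param d \<gamma> s) \<partial>lborel)"

section \<open>Upper gradients and Poincare inequalities\<close>

text \<open>Used only for \<open>a > 0\<close>.\<close>

definition ennreal_powr :: "ennreal \<Rightarrow> real \<Rightarrow> ennreal" where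
  "ennreal_powr x a = (if x = \<infinity> then \<infinity> else ennreal (enn2real x powr a))"

context Metric_space
begin

definition rectifiable_curve_in :: "'a set \<Rightarrow> (real \<Rightarrow> 'a) \<Rightarrow> bool" where
  "rectifiable_curve_in U \<gamma> \<longleftrightarrow>
     pathin (subtopology mtopology U) \<gamma> \<and> curve_length d \<gamma> 0 1 < \<infinity>"

definition borel_function_on :: "'a set \<Rightarrow> ('a \<Rightarrow> ennreal) \<Rightarrow> bool" where
  "borel_function_on U g \<longleftrightarrow>
     g \<in> borel_measurable (sigma U {V. openin (subtopology mtopology U) V})"

text \<open>Upper gradients take values in \<open>[0, \<infinity>]\<close>.\<close>

definition upper_gradient_on :: "'a set \<Rightarrow> ('a \<Rightarrow> real) \<Rightarrow> ('a \<Rightarrow> ennreal) \<Rightarrow> bool" where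
  "upper_gradient_on U u g \<longleftrightarrow>
     borel_function_on U g \<and>
     (\<forall>x\<in>U. \<forall>y\<in>U. \<forall>\<gamma>. rectifiable_curve_in U \<gamma> \<and> \<gamma> 0 = x \<and> \<gamma> 1 = y \<longrightarrow>
        ennreal \<bar>u x - u y\<bar> \<le> curve_integral d \<gamma> g)"

definition mdiam :: "'a set \<Rightarrow> real" where
  "mdiam B = (SUP (x, y) \<in> B \<times> B. d x y)"

definition mean_value :: "'a measure \<Rightarrow> 'a set \<Rightarrow> ('a \<Rightarrow> real) \<Rightarrow> real" where
  "mean_value \<mu> B u = 1 / measure \<mu> B * (LINT y:B|\<mu>. u y)"

definition supports_Poincare :: "'a measure \<Rightarrow> real \<Rightarrow> bool" where
  "supports_Poincare \<mu> p \<longleftrightarrow>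
     (\<exists>\<kappa>\<ge>1. \<exists>C>0. \<forall>x\<in>M. \<forall>r>0. \<forall>u g.
        continuous_map (subtopology mtopology (mball x (\<kappa> * r))) euclideanreal u \<and>
        bounded (u ` mball x (\<kappa> * r)) \<and>
        upper_gradient_on (mball x (\<kappa> * r)) u g \<longrightarrow>
        ennreal (mean_value \<mu> (mball x r) (\<lambda>y. \<bar>u y - mean_value \<mu> (mball x r) u\<bar>))
        \<le> ennreal (C * mdiam (mball x r)) *
           ennreal_powr
             ((\<integral>\<^sup>+ y \<in> mball x (\<kappa> * r). ennreal_powr (g y) p \<partial>\<mu>) / emeasure \<mu> (mball x (\<kappa> * r)))
             (1 / p))"

end

end

theory Submission
  imports Defs
begin

text \<open>
  Write \<open>q = l ^ \<nu>\<close>, and let \<open>s\<close> be the dimension of the Cantor set, so that \<open>l powr s = 1 / 2\<close>. Cubes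
  over different gaps are joined only through the lines \<open>{x} \<times> [0, L]\<close> with \<open>x\<close> in the Cantor set.

  Above the critical exponent, every \<open>\<omega>\<close> (uniform on the Cantor set) and \<open>\<tau> \<in> [0, 1]\<close> determine a Lipschitz graph
  over the vertical axis which, at a height \<open>y\<close> at distance \<open>h\<close> from \<open>D\<close>, lies in a segment of length \<open>h\<close> of the
  cube around \<open>\<omega>\<close> at relative position \<open>\<tau>\<close>. The oscillation of \<open>u\<close> is controlled by the average of the
  integrals of \<open>g\<close> along these graphs. At such a height they have density at most \<open>C h powr (s - 1)\<close>
  with respect to Lebesgue measure, so by Young's inequality the average is
  controlled by the integral of \<open>g powr p\<close> as soon as \<open>h powr (- (1 - s) / (p - 1))\<close> is integrable in \<open>y\<close>,
  which holds if and only if \<open>p\<close> exceeds the critical exponent.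

  At or below it, the functions \<open>u (x, y) = U y\<close>, where \<open>U\<close> grows linearly on the gaps of levels \<open>2, \<dots>, m + 1\<close>
  in one band, by the same total amount on each level, increase by \<open>m / 4\<close> while the integral of \<open>g powr p\<close> is
  a geometric sum with ratio at most 1. It is thus \<open>O(m)\<close>, and \<open>O(1)\<close> if \<open>p = 1\<close>.
\<close>

section \<open>Length of curves\<close>

text \<open>The lines over the Cantor set carry no area, so vertical lines alone cannot be compared
  with Lebesgue measure; the parameter \<tau> turns each of them into a family that fills area, thin
  enough near \<open>D\<close> for the curves to stay Lipschitz. The two halves use upper gradients
  in opposite ways. The positive half tests them on explicit Lipschitz curves and needs only an
  upper bound for \<open>curve_integral\<close>. The negative half must verify the condition on
  every rectifiable curve, for which arc length first has to be shown continuous. Young's inequality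
  is kept with a free factor through all estimates in \<open>ennreal\<close> and optimized only
  once, for balls, where finite and infinite energy are separated. The critical exponent is a count.
  Level k has \<open>2 ^ k\<close> gaps, each contributing about \<open>(q ^ k) powr (1 - a)\<close>
  with \<open>a = (1 - s) / (p - 1)\<close>, so convergence means
  \<open>2 * q powr (1 - a) < 1\<close>. For p > 1 the energy ratio
  \<open>(2 * q) powr (1 - p) * (2 * l) ^ \<nu>\<close> of the negative half is at most 1 exactly
  when this fails.\<close>

lemma curve_length_upper:
  assumes "t 0 = a" "t n = b" "\<forall>i<n. t i \<le> t (Suc i)"
  shows "(\<Sum>i<n. ennreal (d (\<gamma> (t i)) (\<gamma> (t (Suc i))))) \<le> curve_length d \<gamma> a b"
  unfolding curve_length_def
  by (rule SUP_upper2[of "(n, t)"]) (use assms in auto)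

lemma curve_length_least:
  assumes "\<And>n t. t 0 = a \<Longrightarrow> t n = b \<Longrightarrow> \<forall>i<n. t i \<le> t (Suc i) \<Longrightarrow>
    (\<Sum>i<n. ennreal (d (\<gamma> (t i)) (\<gamma> (t (Suc i))))) \<le> K"
  shows "curve_length d \<gamma> a b \<le> K"
  unfolding curve_length_def
  by (rule SUP_least) (use assms in auto)

lemma partition_mono:
  fixes t :: "nat \<Rightarrow> real"
  assumes "\<forall>i<n. t i \<le> t (Suc i)" "i \<le> j" "j \<le> n"
  shows "t i \<le> t j"
  using assms(2,3)
proof (induction j rule: dec_induct)
  case (step k)
  then show ?case using assms(1) by (meson Suc_le_eq Suc_leD order_trans)
qed simp

lemma curve_length_cong:
  assumes "\<And>t. a \<le> t \<Longrightarrow> t \<le> b \<Longrightarrow> \<gamma> t = \<gamma>' t"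
  shows "curve_length d \<gamma> a b = curve_length d \<gamma>' a b"
proof -
  have *: "curve_length d \<gamma> a b \<le> curve_length d \<gamma>' a b"
    if eq: "\<And>t. a \<le> t \<Longrightarrow> t \<le> b \<Longrightarrow> \<gamma> t = \<gamma>' t" for \<gamma> \<gamma>'
  proof (rule curve_length_least)
    fix n t assume t: "t 0 = a" "t n = b" "\<forall>i<n. t i \<le> t (Suc i)"
    have "\<gamma> (t i) = \<gamma>' (t i)" if "i \<le> n" for i
      using partition_mono[OF t(3), of 0 i] partition_mono[OF t(3), of i n] t that
      by (intro eq) auto
    then have "(\<Sum>i<n. ennreal (d (\<gamma> (t i)) (\<gamma> (t (Suc i))))) =
        (\<Sum>i<n. ennreal (d (\<gamma>' (t i)) (\<gamma>' (t (Suc i)))))"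
      by (intro sum.cong) auto
    then show "(\<Sum>i<n. ennreal (d (\<gamma> (t i)) (\<gamma> (t (Suc i))))) \<le> curve_length d \<gamma>' a b"
      using curve_length_upper[OF t] by simp
  qed
  show ?thesis by (intro antisym *) (use assms in auto)
qed

lemma dist_le_curve_length:
  assumes "a \<le> b"
  shows "ennreal (d (\<gamma> a) (\<gamma> b)) \<le> curve_length d \<gamma> a b"
  using curve_length_upper[of "\<lambda>i. if i = 0 then a else b" a 1 b d \<gamma>] assms by simp

lemma curve_length_superadditive:
  assumes "a \<le> b" "b \<le> c"
  shows "curve_length d \<gamma> a b + curve_length d \<gamma> b c \<le> curve_length d \<gamma> a c"
proof -
  let ?P = "\<lambda>a b. {(n :: nat, t). t 0 = a \<and> t n = b \<and> (\<forall>i<n. t i \<le> t (Suc i))}"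
  let ?S = "\<lambda>(n, t). \<Sum>i<n. ennreal (d (\<gamma> (t i)) (\<gamma> (t (Suc i))))"
  have ne: "?P a b \<noteq> {}" if "a \<le> b" for a b :: real
  proof -
    have "(1, \<lambda>i. if i = 0 then a else b) \<in> ?P a b" using that by auto
    then show ?thesis by blast
  qed
  have *: "?S p + ?S r \<le> curve_length d \<gamma> a c" if pr: "p \<in> ?P a b" "r \<in> ?P b c" for p r
  proof -
    obtain n t where p: "p = (n, t)" "t 0 = a" "t n = b" "\<forall>i<n. t i \<le> t (Suc i)"
      using pr(1) by auto
    obtain m u where r: "r = (m, u)" "u 0 = b" "u m = c" "\<forall>i<m. u i \<le> u (Suc i)"
      using pr(2) by auto
    \<comment> \<open>At \<open>i = n\<close> both pieces give \<open>b\<close>, so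
      \<open>w (n + i) = u i\<close> holds from \<open>i = 0\<close> on.\<close>
    define w where "w i = (if i \<le> n then t i else u (i - n))" for i
    have w2: "w (n + i) = u i" for i
      using p r by (auto simp: w_def)
    have mono: "w i \<le> w (Suc i)" if "i < n + m" for i
    proof (cases "i < n")
      case True then show ?thesis using p(4) by (auto simp: w_def)
    next
      case False
      then obtain j where "i = n + j" by (metis le_add_diff_inverse not_less)
      then show ?thesis using w2[of j] w2[of "Suc j"] r(4) that by simp
    qed
    have "?S p + ?S r = (\<Sum>i<n + m. ennreal (d (\<gamma> (w i)) (\<gamma> (w (Suc i)))))"
    proof -
      have "(\<Sum>i<n + m. ennreal (d (\<gamma> (w i)) (\<gamma> (w (Suc i))))) =
          (\<Sum>i<n. ennreal (d (\<gamma> (w i)) (\<gamma> (w (Suc i))))) +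
          (\<Sum>i<m. ennreal (d (\<gamma> (w (n + i))) (\<gamma> (w (n + Suc i)))))"
        by (induction m) (auto simp: ac_simps)
      also have "(\<Sum>i<n. ennreal (d (\<gamma> (w i)) (\<gamma> (w (Suc i))))) = ?S p"
        by (simp add: p(1)) (intro sum.cong, auto simp: w_def)
      finally show ?thesis unfolding w2 by (simp add: r(1))
    qed
    also have "\<dots> \<le> curve_length d \<gamma> a c"
      by (rule curve_length_upper)
        (use mono w2[of m] p r in \<open>auto simp: w_def\<close>)
    finally show ?thesis .
  qed
  have "?S p + curve_length d \<gamma> b c \<le> curve_length d \<gamma> a c" if "p \<in> ?P a b" for p
    unfolding curve_length_def[of d \<gamma> b c]
    by (subst ennreal_SUP_add_right[OF ne[OF assms(2)]]) (intro SUP_least *[OF that])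
  then show ?thesis
    unfolding curve_length_def[of d \<gamma> a b]
    by (subst ennreal_SUP_add_left[OF ne[OF assms(1)], symmetric]) (intro SUP_least)
qed

lemma curve_length_mono_interval:
  assumes "a \<le> a'" "a' \<le> b'" "b' \<le> b"
  shows "curve_length d \<gamma> a' b' \<le> curve_length d \<gamma> a b"
proof -
  have "curve_length d \<gamma> a' b' \<le> curve_length d \<gamma> a a' + curve_length d \<gamma> a' b'" by simp
  also have "\<dots> \<le> curve_length d \<gamma> a b'"
    using assms by (intro curve_length_superadditive) auto
  also have "\<dots> \<le> curve_length d \<gamma> a b' + curve_length d \<gamma> b' b" by simp
  also have "\<dots> \<le> curve_length d \<gamma> a b"
    using assms by (intro curve_length_superadditive) auto
  finally show ?thesis .
qed

lemma curve_length_reparam: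
  assumes "\<And>x y. a \<le> x \<Longrightarrow> x \<le> y \<Longrightarrow> y \<le> b \<Longrightarrow> \<phi> x \<le> \<phi> y"
  shows "curve_length d (\<lambda>t. \<gamma> (\<phi> t)) a b \<le> curve_length d \<gamma> (\<phi> a) (\<phi> b)"
proof (rule curve_length_least)
  fix n t assume t: "t 0 = a" "t n = b" "\<forall>i<n. t i \<le> t (Suc i)"
  have "\<phi> (t i) \<le> \<phi> (t (Suc i))" if "i < n" for i
    using partition_mono[OF t(3), of 0 i] partition_mono[OF t(3), of "Suc i" n] t that
    by (intro assms) auto
  then show "(\<Sum>i<n. ennreal (d (\<gamma> (\<phi> (t i))) (\<gamma> (\<phi> (t (Suc i)))))) \<le> curve_length d \<gamma> (\<phi> a) (\<phi> b)"
    using curve_length_upper[of "\<lambda>i. \<phi> (t i)" "\<phi> a" n "\<phi> b" d \<gamma>] t by simp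
qed

lemma curve_length_reparam_antimono:
  assumes "\<And>x y. a \<le> x \<Longrightarrow> x \<le> y \<Longrightarrow> y \<le> b \<Longrightarrow> \<phi> y \<le> \<phi> x"
    and sym: "\<And>x y. d x y = d y x"
  shows "curve_length d (\<lambda>t. \<gamma> (\<phi> t)) a b \<le> curve_length d \<gamma> (\<phi> b) (\<phi> a)"
proof (rule curve_length_least)
  fix n t assume t: "t 0 = a" "t n = b" "\<forall>i<n. t i \<le> t (Suc i)"
  have *: "\<phi> (t (Suc i)) \<le> \<phi> (t i)" if "i < n" for i
    using partition_mono[OF t(3), of 0 i] partition_mono[OF t(3), of "Suc i" n] t that
    by (intro assms) auto
  \<comment> \<open>The points \<open>\<phi> (t i)\<close> run backwards; reversing the order of
    summation makes them a partition, and \<open>sym\<close> flips each chord.\<close>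
  have "(\<Sum>i<n. ennreal (d (\<gamma> (\<phi> (t i))) (\<gamma> (\<phi> (t (Suc i)))))) =
      (\<Sum>i<n. ennreal (d (\<gamma> (\<phi> (t (n - Suc i)))) (\<gamma> (\<phi> (t (Suc (n - Suc i)))))))"
    by (subst sum.nat_diff_reindex[symmetric]) (rule refl)
  also have "\<dots> = (\<Sum>i<n. ennreal (d (\<gamma> (\<phi> (t (n - i)))) (\<gamma> (\<phi> (t (n - Suc i))))))"
    by (intro sum.cong) (auto simp: Suc_diff_Suc sym)
  also have "\<dots> \<le> curve_length d \<gamma> (\<phi> b) (\<phi> a)"
  proof (rule curve_length_upper[of "\<lambda>i. \<phi> (t (n - i))"])
    show "\<forall>i<n. \<phi> (t (n - i)) \<le> \<phi> (t (n - Suc i))"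
      using * by (metis Suc_diff_Suc diff_less zero_less_Suc less_nat_zero_code neq0_conv)
  qed (use t in auto)
  finally show "(\<Sum>i<n. ennreal (d (\<gamma> (\<phi> (t i))) (\<gamma> (\<phi> (t (Suc i)))))) \<le> curve_length d \<gamma> (\<phi> b) (\<phi> a)" .
qed

lemma curve_length_lipschitz:
  assumes "\<And>x y. a \<le> x \<Longrightarrow> x \<le> y \<Longrightarrow> y \<le> b \<Longrightarrow> d (\<gamma> x) (\<gamma> y) \<le> K * (y - x)"
    and nn: "\<And>x y. 0 \<le> d x y"
  shows "curve_length d \<gamma> a b \<le> ennreal (K * (b - a))"
proof (rule curve_length_least)
  fix n t assume t: "t 0 = a" "t n = b" "\<forall>i<n. t i \<le> t (Suc i)"
  have "(\<Sum>i<n. ennreal (d (\<gamma> (t i)) (\<gamma> (t (Suc i))))) = ennreal (\<Sum>i<n. d (\<gamma> (t i)) (\<gamma> (t (Suc i))))"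
    by (intro sum_ennreal nn)
  also have "\<dots> \<le> ennreal (\<Sum>i<n. K * (t (Suc i) - t i))"
  proof (intro ennreal_leI sum_mono)
    fix i assume "i \<in> {..<n}"
    then show "d (\<gamma> (t i)) (\<gamma> (t (Suc i))) \<le> K * (t (Suc i) - t i)"
      using partition_mono[OF t(3), of 0 i] partition_mono[OF t(3), of "Suc i" n] t
      by (intro assms) auto
  qed
  also have "(\<Sum>i<n. K * (t (Suc i) - t i)) = K * (b - a)"
    using t by (simp add: sum_distrib_left[symmetric] sum_lessThan_telescope)
  finally show "(\<Sum>i<n. ennreal (d (\<gamma> (t i)) (\<gamma> (t (Suc i))))) \<le> ennreal (K * (b - a))" .
qed

context Metric_space
begin

lemma curve_length_subadditive:
  assumes "\<And>t. a \<le> t \<Longrightarrow> t \<le> c \<Longrightarrow> \<gamma> t \<in> M" "a \<le> b" "b \<le> c"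
  shows "curve_length d \<gamma> a c \<le> curve_length d \<gamma> a b + curve_length d \<gamma> b c"
proof (rule curve_length_least)
  fix n t assume t: "t 0 = a" "t n = c" "\<forall>i<n. t i \<le> t (Suc i)"
  \<comment> \<open>Capping the partition at \<open>b\<close> from above and from below gives
    partitions of the two halves; only the step that straddles \<open>b\<close> uses the triangle
    inequality.\<close>
  have *: "ennreal (d (\<gamma> (t i)) (\<gamma> (t (Suc i)))) \<le>
      ennreal (d (\<gamma> (min (t i) b)) (\<gamma> (min (t (Suc i)) b))) +
      ennreal (d (\<gamma> (max (t i) b)) (\<gamma> (max (t (Suc i)) b)))" if "i < n" for i
  proof -
    have r: "a \<le> t i" "t i \<le> t (Suc i)" "t (Suc i) \<le> c"
      using partition_mono[OF t(3), of 0 i] partition_mono[OF t(3), of "Suc i" n] t that by auto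
    have M: "\<gamma> (t i) \<in> M" "\<gamma> (t (Suc i)) \<in> M" "\<gamma> b \<in> M"
      using r assms by auto
    have "d (\<gamma> (t i)) (\<gamma> (t (Suc i))) \<le>
        d (\<gamma> (min (t i) b)) (\<gamma> (min (t (Suc i)) b)) + d (\<gamma> (max (t i) b)) (\<gamma> (max (t (Suc i)) b))"
      using r M triangle[of "\<gamma> (t i)" "\<gamma> b" "\<gamma> (t (Suc i))"]
      by (auto simp: min_def max_def)
    then show ?thesis
      by (simp flip: ennreal_plus)
  qed
  have "(\<Sum>i<n. ennreal (d (\<gamma> (t i)) (\<gamma> (t (Suc i))))) \<le>
      (\<Sum>i<n. ennreal (d (\<gamma> (min (t i) b)) (\<gamma> (min (t (Suc i)) b)))) +
      (\<Sum>i<n. ennreal (d (\<gamma> (max (t i) b)) (\<gamma> (max (t (Suc i)) b))))"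
    unfolding sum.distrib[symmetric] by (intro sum_mono *) auto
  also have "\<dots> \<le> curve_length d \<gamma> a b + curve_length d \<gamma> b c"
    by (intro add_mono curve_length_upper[of "\<lambda>i. min (t i) b"] curve_length_upper[of "\<lambda>i. max (t i) b"])
      (use t assms in \<open>auto simp: min_def max_def intro: order_trans\<close>)
  finally show "(\<Sum>i<n. ennreal (d (\<gamma> (t i)) (\<gamma> (t (Suc i))))) \<le>
      curve_length d \<gamma> a b + curve_length d \<gamma> b c" .
qed

lemma curve_length_additive:
  assumes "\<And>t. a \<le> t \<Longrightarrow> t \<le> c \<Longrightarrow> \<gamma> t \<in> M" "a \<le> b" "b \<le> c"
  shows "curve_length d \<gamma> a c = curve_length d \<gamma> a b + curve_length d \<gamma> b c"
  using assms by (intro antisym curve_length_subadditive curve_length_superadditive)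

end

section \<open>Integration along arc length\<close>

lemma emeasure_lborel_interval_le:
  fixes W :: "real set"
  assumes "\<And>c d. c \<in> W \<Longrightarrow> d \<in> W \<Longrightarrow> c \<le> d \<Longrightarrow> ennreal (d - c) \<le> m"
  shows "emeasure lborel W \<le> m"
proof (cases "W = {} \<or> m = \<infinity>")
  case False
  then obtain x where x: "x \<in> W" by auto
  obtain r where r: "m = ennreal r" "r \<ge> 0" using False by (cases m) auto
  have le: "d - c \<le> r" if "c \<in> W" "d \<in> W" for c d
  proof (cases "c \<le> d")
    case True then show ?thesis using assms[of c d] that r by simp
  next
    case False then show ?thesis using r by simp
  qed
  have bdd: "bdd_below W" "bdd_above W"
    using le[OF x] le[OF _ x] by (auto intro!: bdd_belowI[of _ "x - r"] bdd_aboveI[of _ "x + r"] simp: field_simps)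
  have "W \<subseteq> {Inf W..Sup W}" using bdd by (auto intro: cInf_lower cSup_upper)
  then have "emeasure lborel W \<le> emeasure lborel {Inf W..Sup W}"
    by (intro emeasure_mono) auto
  also have "\<dots> = ennreal (Sup W - Inf W)"
    using cInf_lower[OF x bdd(1)] cSup_upper[OF x bdd(2)] by simp
  also have "Sup W - Inf W \<le> r"
  proof -
    have "Sup W \<le> r + Inf W"
    proof (rule cSup_least)
      fix d assume "d \<in> W"
      then have "d - r \<le> Inf W" using x le[of _ d] by (intro cInf_greatest) (auto simp: field_simps)
      then show "d \<le> r + Inf W" by simp
    qed (use x in auto)
    then show ?thesis by simp
  qed
  finally show ?thesis using r by (simp add: ennreal_leI)
qed auto

text \<open>Outer regularity of the image measure reduces the comparison to intervals.\<close>

lemma nn_integral_mono_lipschitz_le: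
  fixes \<sigma> :: "real \<Rightarrow> real" and F :: "real \<Rightarrow> ennreal"
  assumes ab: "a \<le> b" and K: "0 \<le> K"
    and mono: "\<And>x y. a \<le> x \<Longrightarrow> x \<le> y \<Longrightarrow> y \<le> b \<Longrightarrow> \<sigma> x \<le> \<sigma> y"
    and lip: "\<And>x y. a \<le> x \<Longrightarrow> x \<le> y \<Longrightarrow> y \<le> b \<Longrightarrow> \<sigma> y - \<sigma> x \<le> K * (y - x)"
    and F[measurable]: "F \<in> borel_measurable borel"
  shows "(\<integral>\<^sup>+ s\<in>{\<sigma> a..\<sigma> b}. F s \<partial>lborel) \<le> ennreal K * (\<integral>\<^sup>+ t\<in>{a..b}. F (\<sigma> t) \<partial>lborel)"
proof -
  \<comment> \<open>Composing with the projection onto [a, b] makes \<open>S\<close> monotone on the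
    whole line, hence Borel.\<close>
  define cl where "cl t = max a (min b t)" for t
  define S where "S t = \<sigma> (cl t)" for t
  have cl: "a \<le> cl t" "cl t \<le> b" for t using ab by (auto simp: cl_def)
  have cl_id: "cl t = t" if "a \<le> t" "t \<le> b" for t using that by (auto simp: cl_def)
  have "S x \<le> S y" if "x \<le> y" for x y
    unfolding S_def using that cl by (intro mono) (auto simp: cl_def)
  then have "mono S" by (rule monoI)
  then have [measurable]: "S \<in> borel_measurable borel" by (rule borel_measurable_mono)
  \<comment> \<open>\<open>N\<close> is the image under \<open>S\<close> of K times Lebesgue measure
    on [a, b], and \<open>A\<close> is Lebesgue measure on the image interval; the lemma amounts to
    \<open>A \<le> N\<close>.\<close>
  define N where "N = distr (density lborel (\<lambda>t. ennreal K * indicator {a..b} t)) borel S"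
  define A where "A = density lborel (\<lambda>s. indicator {\<sigma> a..\<sigma> b} s :: ennreal)"
  have sN: "sets N = sets borel" and sA: "sets A = sets borel" by (auto simp: N_def A_def)
  have eN: "emeasure N E = ennreal K * emeasure lborel (S -` E \<inter> {a..b})" if "E \<in> sets borel" for E
  proof -
    have [measurable]: "S -` E \<in> sets borel"
      using that by (rule measurable_sets_borel[rotated]) simp
    show ?thesis
      using that
      by (simp add: N_def emeasure_distr emeasure_density nn_integral_cmult mult.assoc
          indicator_inter_arith[symmetric] Int_commute)
  qed
  have eA: "emeasure A E = emeasure lborel (E \<inter> {\<sigma> a..\<sigma> b})" if "E \<in> sets borel" for E
    using that by (simp add: A_def emeasure_density indicator_inter_arith[symmetric] Int_commute)
  have cont: "continuous_on {a..b} \<sigma>"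
  proof (rule lipschitz_on_continuous_on)
    show "K-lipschitz_on {a..b} \<sigma>"
    proof (rule lipschitz_onI)
      fix x y assume "x \<in> {a..b}" "y \<in> {a..b}"
      then show "dist (\<sigma> x) (\<sigma> y) \<le> K * dist x y"
        using lip[of x y] lip[of y x] mono[of x y] mono[of y x]
        by (cases "x \<le> y") (auto simp: dist_real_def)
    qed (rule K)
  qed
  \<comment> \<open>Two points of \<open>V\<close> have preimages by the intermediate value theorem.
    The parameter interval between these is mapped into \<open>V\<close>, and K times its length is
    at least \<open>d - c\<close>.\<close>
  have interval: "emeasure A V \<le> emeasure N V" if V: "connected V" "V \<in> sets borel" for V
    unfolding eA[OF V(2)]
  proof (rule emeasure_lborel_interval_le)
    fix c d assume cd: "c \<in> V \<inter> {\<sigma> a..\<sigma> b}" "d \<in> V \<inter> {\<sigma> a..\<sigma> b}" "c \<le> d"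
    obtain tc where tc: "a \<le> tc" "tc \<le> b" "\<sigma> tc = c"
      using IVT'[of \<sigma> a c b] cd cont ab by auto
    obtain td where td: "a \<le> td" "td \<le> b" "\<sigma> td = d"
      using IVT'[of \<sigma> a d b] cd cont ab by auto
    show "ennreal (d - c) \<le> emeasure N V"
    proof (cases "tc \<le> td")
      case True
      have "{tc..td} \<subseteq> S -` V \<inter> {a..b}"
      proof
        fix t assume t: "t \<in> {tc..td}"
        then have "c \<le> \<sigma> t" "\<sigma> t \<le> d" using mono[of tc t] mono[of t td] tc td by auto
        then have "\<sigma> t \<in> V" using V(1) cd by (metis IntD1 connected_contains_Icc atLeastAtMost_iff subsetD)
        then show "t \<in> S -` V \<inter> {a..b}" using t tc td by (auto simp: S_def cl_id)
      qed
      then have "emeasure lborel {tc..td} \<le> emeasure lborel (S -` V \<inter> {a..b})"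
        by (intro emeasure_mono) (use V(2) in \<open>auto intro!: measurable_sets_borel\<close>)
      then have "ennreal (td - tc) \<le> emeasure lborel (S -` V \<inter> {a..b})" using True by simp
      have "ennreal (d - c) \<le> ennreal (K * (td - tc))"
        using lip[of tc td] tc td True by (intro ennreal_leI) auto
      also have "\<dots> = ennreal K * ennreal (td - tc)" using K True by (simp add: ennreal_mult)
      also have "\<dots> \<le> emeasure N V"
        unfolding eN[OF V(2)] by (intro mult_left_mono) (auto simp: \<open>ennreal (td - tc) \<le> _\<close>)
      finally show ?thesis .
    next
      case False
      then have "c = d" using mono[of td tc] tc td cd by auto
      then show ?thesis by simp
    qed
  qed
  have openc: "emeasure A U \<le> emeasure N U" if U: "open U" for U
  proof -
    have op: "open V" if "V \<in> components U" for V using open_components[OF U that] .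
    have cnt: "countable (components U)"
      using countable_disjoint_open_subsets[of "components U"] op
      using pairwise_disjoint_components[of U] by (simp add: pairwise_def disjnt_def)
    have dis: "disjoint_family_on (\<lambda>V. V) (components U)"
      by (auto simp: disjoint_family_on_def components_nonoverlap)
    have "emeasure Q U = (\<integral>\<^sup>+V. emeasure Q V \<partial>count_space (components U))" if "sets Q = sets borel" for Q
    proof -
      have "emeasure Q (\<Union>V\<in>components U. V) = (\<integral>\<^sup>+V. emeasure Q V \<partial>count_space (components U))"
        by (rule emeasure_UN_countable[OF _ cnt dis]) (use op that in auto)
      then show ?thesis using Union_components[of U] by simp
    qed
    moreover have "emeasure A V \<le> emeasure N V" if "V \<in> components U" for V
      using interval[OF in_components_connected[OF that]] op[OF that] by simp
    ultimately show ?thesis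
      by (auto simp: sN sA intro!: nn_integral_mono)
  qed
  \<comment> \<open>Outer regularity is applied to \<open>N\<close> and asks for a finite
    measure.\<close>
  have fin: "emeasure N (space N) \<noteq> \<infinity>"
  proof -
    have "emeasure lborel (S -` space borel \<inter> {a..b}) \<le> emeasure lborel {a..b}"
      by (intro emeasure_mono) auto
    also have "\<dots> < \<infinity>" using ab by simp
    finally show ?thesis
      unfolding sets_eq_imp_space_eq[OF sN] by (subst eN) (simp_all add: ennreal_mult_eq_top_iff)
  qed
  have le: "emeasure A E \<le> emeasure N E" if E: "E \<in> sets borel" for E
    unfolding outer_regular[OF sN fin E]
  proof (rule INF_greatest)
    fix U assume "U \<in> {U. E \<subseteq> U \<and> open U}"
    then have "emeasure A E \<le> emeasure A U" by (intro emeasure_mono) (auto simp: sA)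
    also have "\<dots> \<le> emeasure N U" using \<open>U \<in> _\<close> by (intro openc) auto
    finally show "emeasure A E \<le> emeasure N U" .
  qed
  have "A \<le> N"
    using le by (simp add: le_measure sN sA)
  then have "nn_integral A F \<le> nn_integral N F"
    by (intro nn_integral_mono_measure) (auto simp: sN sA)
  moreover have "nn_integral A F = (\<integral>\<^sup>+ s\<in>{\<sigma> a..\<sigma> b}. F s \<partial>lborel)"
    by (simp add: A_def nn_integral_density mult.commute)
  moreover have "nn_integral N F = ennreal K * (\<integral>\<^sup>+ t\<in>{a..b}. F (\<sigma> t) \<partial>lborel)"
  proof -
    have "nn_integral N F = (\<integral>\<^sup>+ t. ennreal K * (F (S t) * indicator {a..b} t) \<partial>lborel)"
      by (simp add: N_def nn_integral_distr nn_integral_density mult_ac)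
    also have "\<dots> = ennreal K * (\<integral>\<^sup>+ t. F (S t) * indicator {a..b} t \<partial>lborel)"
      by (rule nn_integral_cmult) simp
    also have "(\<integral>\<^sup>+ t. F (S t) * indicator {a..b} t \<partial>lborel) = (\<integral>\<^sup>+ t\<in>{a..b}. F (\<sigma> t) \<partial>lborel)"
      by (intro nn_integral_cong) (auto simp: S_def cl_id split: split_indicator)
    finally show ?thesis .
  qed
  ultimately show ?thesis by simp
qed

context Metric_space
begin

lemma arc_length_le:
  assumes M: "\<And>t. t \<in> {0..1} \<Longrightarrow> \<gamma> t \<in> M"
    and fin: "curve_length d \<gamma> 0 1 < \<infinity>" and "0 \<le> x" "x \<le> y" "y \<le> 1"
  shows "curve_length d \<gamma> 0 y = ennreal (enn2real (curve_length d \<gamma> 0 y))"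
    and "enn2real (curve_length d \<gamma> 0 y) - enn2real (curve_length d \<gamma> 0 x) = enn2real (curve_length d \<gamma> x y)"
    and "curve_length d \<gamma> x y = ennreal (enn2real (curve_length d \<gamma> x y))"
    and "enn2real (curve_length d \<gamma> 0 x) + d (\<gamma> x) (\<gamma> y) \<le> enn2real (curve_length d \<gamma> 0 y)"
proof -
  have f: "curve_length d \<gamma> a b < \<infinity>" if "0 \<le> a" "a \<le> b" "b \<le> 1" for a b
    using curve_length_mono_interval[OF that, of d \<gamma>] fin by (rule order.strict_trans1)
  show 1: "curve_length d \<gamma> 0 y = ennreal (enn2real (curve_length d \<gamma> 0 y))"
    using f[of 0 y] assms by simp
  show 2: "curve_length d \<gamma> x y = ennreal (enn2real (curve_length d \<gamma> x y))"
    using f[of x y] assms by simp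
  have "curve_length d \<gamma> 0 y = curve_length d \<gamma> 0 x + curve_length d \<gamma> x y"
    using assms by (intro curve_length_additive M) auto
  then show 3: "enn2real (curve_length d \<gamma> 0 y) - enn2real (curve_length d \<gamma> 0 x) = enn2real (curve_length d \<gamma> x y)"
    using f[of x y] f[of 0 x] assms by (simp add: enn2real_plus)
  have "d (\<gamma> x) (\<gamma> y) \<le> enn2real (curve_length d \<gamma> x y)"
    using dist_le_curve_length[OF \<open>x \<le> y\<close>, of d \<gamma>] 2 by (metis enn2real_nonneg ennreal_le_iff)
  then show "enn2real (curve_length d \<gamma> 0 x) + d (\<gamma> x) (\<gamma> y) \<le> enn2real (curve_length d \<gamma> 0 y)"
    using 3 by simp
qed

lemma arc_length_param_eq:
  assumes M: "\<And>t. t \<in> {0..1} \<Longrightarrow> \<gamma> t \<in> M"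
    and fin: "curve_length d \<gamma> 0 1 < \<infinity>" and t: "t \<in> {0..1}" and s: "enn2real (curve_length d \<gamma> 0 t) = s"
  shows "arc_length_param d \<gamma> s = \<gamma> t"
proof -
  define t' where "t' = (SOME t. t \<in> {0..1} \<and> curve_length d \<gamma> 0 t = ennreal s)"
  have "t \<in> {0..1} \<and> curve_length d \<gamma> 0 t = ennreal s"
    using arc_length_le(1)[OF M fin, of t t] t s by auto
  then have t': "t' \<in> {0..1} \<and> curve_length d \<gamma> 0 t' = ennreal s"
    unfolding t'_def by (rule someI)
  have s': "enn2real (curve_length d \<gamma> 0 t') = s" using t' s enn2real_nonneg by (metis enn2real_ennreal)
  have "d (\<gamma> t) (\<gamma> t') \<le> 0"
    using arc_length_le(4)[OF M fin, of t t'] arc_length_le(4)[OF M fin, of t' t] t t' s s'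
    by (cases "t \<le> t'") (auto simp: commute)
  then have "\<gamma> t' = \<gamma> t" using M t t' by (metis nonneg order_antisym zero)
  then show ?thesis by (simp add: arc_length_param_def t'_def)
qed

text \<open>Parametrized by arc length, \<open>\<gamma>\<close> is the composition of an almost inverse with \<open>\<gamma>\<close>.\<close>

lemma curve_integral_lipschitz_le:
  assumes M: "\<And>t. t \<in> {0..1} \<Longrightarrow> \<gamma> t \<in> M" and K: "0 \<le> K"
    and lip: "\<And>x y. 0 \<le> x \<Longrightarrow> x \<le> y \<Longrightarrow> y \<le> 1 \<Longrightarrow> d (\<gamma> x) (\<gamma> y) \<le> K * (y - x)"
    and U: "\<And>t. t \<in> {0..1} \<Longrightarrow> \<gamma> t \<in> U"
    and g: "borel_function_on U g"
  shows "curve_integral d \<gamma> g \<le> ennreal K * (\<integral>\<^sup>+ t\<in>{0..1}. g (\<gamma> t) \<partial>lborel)"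
    and "rectifiable_curve_in U \<gamma>"
proof -
  have fin: "curve_length d \<gamma> 0 1 < \<infinity>"
    using curve_length_lipschitz[of 0 1 d \<gamma> K] lip nonneg by (auto intro: order.strict_trans1)
  define \<sigma> where "\<sigma> t = enn2real (curve_length d \<gamma> 0 t)" for t
  have lip\<sigma>: "\<sigma> y - \<sigma> x \<le> K * (y - x)" if "0 \<le> x" "x \<le> y" "y \<le> 1" for x y
  proof -
    have "curve_length d \<gamma> x y \<le> ennreal (K * (y - x))"
      using that by (intro curve_length_lipschitz lip) auto
    then show ?thesis
      unfolding \<sigma>_def using K that by (subst arc_length_le(2)[OF M fin that]) (auto intro!: enn2real_leI)
  qed
  have mono\<sigma>: "\<sigma> x \<le> \<sigma> y" if "0 \<le> x" "x \<le> y" "y \<le> 1" for x y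
    using arc_length_le(2)[OF M fin that] enn2real_nonneg unfolding \<sigma>_def by (metis diff_ge_0_iff_ge)
  have \<sigma>0: "\<sigma> 0 = 0" using lip\<sigma>[of 0 0] arc_length_le(2)[OF M fin, of 0 0]
    curve_length_lipschitz[of 0 0 d \<gamma> K] lip nonneg by (simp add: \<sigma>_def)
  have cont: "continuous_on {0..1} \<sigma>"
  proof (rule lipschitz_on_continuous_on)
    show "K-lipschitz_on {0..1} \<sigma>"
    proof (rule lipschitz_onI)
      fix x y :: real assume "x \<in> {0..1}" "y \<in> {0..1}"
      then show "dist (\<sigma> x) (\<sigma> y) \<le> K * dist x y"
        using lip\<sigma>[of x y] lip\<sigma>[of y x] mono\<sigma>[of x y] mono\<sigma>[of y x]
        by (cases "x \<le> y") (auto simp: dist_real_def)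
    qed (rule K)
  qed
  define \<alpha> where "\<alpha> s = arc_length_param d \<gamma> s" for s
  have \<alpha>: "\<alpha> (\<sigma> t) = \<gamma> t" if "t \<in> {0..1}" for t
    unfolding \<alpha>_def \<sigma>_def by (rule arc_length_param_eq[OF M fin that refl])
  have surj: "\<exists>t\<in>{0..1}. \<sigma> t = s" if "s \<in> {0..\<sigma> 1}" for s
    using IVT'[of \<sigma> 0 s 1] cont that \<sigma>0 by auto
  have \<alpha>lip: "d (\<alpha> s) (\<alpha> s') \<le> \<bar>s - s'\<bar>" "\<alpha> s \<in> U \<inter> M" if "s \<in> {0..\<sigma> 1}" "s' \<in> {0..\<sigma> 1}" for s s'
  proof -
    obtain t t' where t: "t \<in> {0..1}" "\<sigma> t = s" "t' \<in> {0..1}" "\<sigma> t' = s'"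
      using surj \<open>s \<in> _\<close> \<open>s' \<in> _\<close> by metis
    then have \<alpha>t: "\<alpha> s = \<gamma> t" "\<alpha> s' = \<gamma> t'" using \<alpha> by auto
    show "\<alpha> s \<in> U \<inter> M" using \<alpha>t t M U by auto
    show "d (\<alpha> s) (\<alpha> s') \<le> \<bar>s - s'\<bar>"
      using arc_length_le(4)[OF M fin, of t t'] arc_length_le(4)[OF M fin, of t' t] t
      by (cases "t \<le> t'") (auto simp: \<alpha>t \<sigma>_def commute)
  qed
  \<comment> \<open>Applied to \<gamma>, for rectifiability, and to the arc-length parametrization
    \<alpha>, for the measurability of \<open>g\<close> along it.\<close>
  have lip_cont: "continuous_map (subtopology euclideanreal I) (subtopology mtopology U) h"
    if h: "\<And>x. x \<in> I \<Longrightarrow> h x \<in> U \<inter> M" and C: "0 \<le> C"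
      and l: "\<And>x y. x \<in> I \<Longrightarrow> y \<in> I \<Longrightarrow> d (h x) (h y) \<le> C * \<bar>x - y\<bar>" for h I C
  proof -
    have "continuous_map (top_of_set I) mtopology h"
    proof -
      interpret I: Submetric UNIV dist I by unfold_locales simp
      have "I.sub.mtopology = top_of_set I"
        using I.mtopology_submetric by simp
      moreover have "continuous_map I.sub.mtopology mtopology h"
        unfolding I.sub.metric_continuous_map[OF Metric_space_axioms]
      proof (intro conjI ballI allI impI)
        fix a e assume ae: "a \<in> I" "(0::real) < e"
        have "d (h a) (h x) < e" if "x \<in> I" "dist a x < e / (C + 1)" for x
        proof -
          have "d (h a) (h x) \<le> C * dist a x" using l ae that by (simp add: dist_real_def)
          also have "\<dots> \<le> (C + 1) * dist a x" by (simp add: mult_right_mono)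
          also have "\<dots> < e" using that C by (simp add: field_simps)
          finally show ?thesis .
        qed
        then show "\<exists>\<delta>>0. \<forall>x. x \<in> I \<and> dist a x < \<delta> \<longrightarrow> d (h a) (h x) < e"
          using ae C by (intro exI[of _ "e / (C + 1)"]) auto
      qed (use h in auto)
      ultimately show ?thesis by simp
    qed
    then show ?thesis
      using h by (auto simp: continuous_map_in_subtopology)
  qed
  show "rectifiable_curve_in U \<gamma>"
    unfolding rectifiable_curve_in_def pathin_def
  proof (intro conjI fin)
    show "continuous_map (top_of_set {0..1}) (subtopology mtopology U) \<gamma>"
    proof (rule lip_cont)
      show "d (\<gamma> x) (\<gamma> y) \<le> K * \<bar>x - y\<bar>" if "x \<in> {0..1}" "y \<in> {0..1}" for x y
        using that lip[of x y] lip[of y x] by (cases "x \<le> y") (auto simp: commute)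
    qed (use M U K in auto)
  qed
  \<comment> \<open>\<open>g\<close> is measurable for the Borel sets of \<open>U\<close> only;
    composed with the continuous \<alpha> and extended by 0 it becomes a Borel function on the
    line.\<close>
  define F where "F s = (if s \<in> {0..\<sigma> 1} then g (\<alpha> s) else 0)" for s
  have F: "F \<in> borel_measurable borel"
  proof -
    let ?S = "sigma U {V. openin (subtopology mtopology U) V}"
    have "continuous_map (top_of_set {0..\<sigma> 1}) (subtopology mtopology U) \<alpha>"
      by (rule lip_cont[of _ _ 1]) (use \<alpha>lip in auto)
    then have pre: "openin (top_of_set {0..\<sigma> 1}) {s \<in> {0..\<sigma> 1}. \<alpha> s \<in> V}"
      if "openin (subtopology mtopology U) V" for V
      using openin_continuous_map_preimage that by fastforce
    have "\<alpha> \<in> measurable (restrict_space borel {0..\<sigma> 1}) ?S"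
    proof (rule measurable_measure_of)
      show "{V. openin (subtopology mtopology U) V} \<subseteq> Pow U"
        by (auto dest!: openin_subset)
      show "\<alpha> \<in> space (restrict_space borel {0..\<sigma> 1}) \<rightarrow> U"
        using \<alpha>lip(2) by (simp add: space_restrict_space Pi_iff)
      fix V assume "V \<in> {V. openin (subtopology mtopology U) V}"
      then obtain T where T: "open T" "{s \<in> {0..\<sigma> 1}. \<alpha> s \<in> V} = {0..\<sigma> 1} \<inter> T"
        using pre by (auto simp: openin_open)
      have "\<alpha> -` V \<inter> space (restrict_space borel {0..\<sigma> 1}) = {0..\<sigma> 1} \<inter> T"
        unfolding T(2)[symmetric] by (auto simp: space_restrict_space)
      then show "\<alpha> -` V \<inter> space (restrict_space borel {0..\<sigma> 1}) \<in> sets (restrict_space borel {0..\<sigma> 1})"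
        using T(1) by (auto simp: sets_restrict_space)
    qed
    then have "(\<lambda>s. g (\<alpha> s)) \<in> borel_measurable (restrict_space borel {0..\<sigma> 1})"
      using g unfolding borel_function_on_def by (rule measurable_compose)
    then have "(\<lambda>s. g (\<alpha> s) * indicator {0..\<sigma> 1} s) \<in> borel_measurable borel"
      by (subst (asm) borel_measurable_restrict_space_iff_ennreal) auto
    moreover have "F = (\<lambda>s. g (\<alpha> s) * indicator {0..\<sigma> 1} s)"
      by (auto simp: F_def fun_eq_iff split: split_indicator)
    ultimately show ?thesis by simp
  qed
  have "curve_integral d \<gamma> g = (\<integral>\<^sup>+ s\<in>{\<sigma> 0..\<sigma> 1}. F s \<partial>lborel)"
    unfolding curve_integral_def \<sigma>0 by (intro nn_integral_cong) (auto simp: F_def \<alpha>_def \<sigma>_def split: split_indicator)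
  also have "\<dots> \<le> ennreal K * (\<integral>\<^sup>+ t\<in>{0..1}. F (\<sigma> t) \<partial>lborel)"
    by (rule nn_integral_mono_lipschitz_le) (use K lip\<sigma> mono\<sigma> F in auto)
  also have "(\<integral>\<^sup>+ t\<in>{0..1}. F (\<sigma> t) \<partial>lborel) = (\<integral>\<^sup>+ t\<in>{0..1}. g (\<gamma> t) \<partial>lborel)"
  proof (intro nn_integral_cong)
    fix t :: real
    show "F (\<sigma> t) * indicator {0..1} t = g (\<gamma> t) * indicator {0..1} t"
      using mono\<sigma>[of 0 t] mono\<sigma>[of t 1] \<sigma>0 \<alpha>[of t] by (auto simp: F_def split: split_indicator)
  qed
  finally show "curve_integral d \<gamma> g \<le> ennreal K * (\<integral>\<^sup>+ t\<in>{0..1}. g (\<gamma> t) \<partial>lborel)" .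
qed


text \<open>Arc length cannot jump at \<open>b\<close>: a partition that misses less than
  \<open>e / 2\<close> of the length has all its points below \<open>b\<close> to the left of some
  \<open>t'\<close>, so beyond \<open>t'\<close> it sees a single chord. By continuity this chord is
  shorter than \<open>e / 2\<close>, hence the length left beyond \<open>t'\<close> is less than
  \<open>e\<close>.\<close>

lemma curve_length_left_small:
  assumes M: "\<And>t. a \<le> t \<Longrightarrow> t \<le> b \<Longrightarrow> \<gamma> t \<in> M" and fin: "curve_length d \<gamma> a b < \<infinity>"
    and "a < b" "0 < e"
    and cont: "\<And>e. 0 < e \<Longrightarrow> \<exists>\<delta>>0. \<forall>t. a \<le> t \<longrightarrow> t \<le> b \<longrightarrow> b - t < \<delta> \<longrightarrow> d (\<gamma> t) (\<gamma> b) < e"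
  shows "\<exists>t'. a \<le> t' \<and> t' < b \<and> curve_length d \<gamma> t' b < ennreal e"
proof (cases "curve_length d \<gamma> a b < ennreal e")
  case True then show ?thesis using \<open>a < b\<close> by blast
next
  case False
  obtain l where l: "curve_length d \<gamma> a b = ennreal l" "0 \<le> l"
    using fin by (cases "curve_length d \<gamma> a b") auto
  have le: "e \<le> l" using False l \<open>0 < e\<close> by (simp add: not_less)
  then have "ennreal (l - e / 2) < curve_length d \<gamma> a b"
    unfolding l(1) using \<open>0 < e\<close> by (intro ennreal_lessI) auto
  then obtain n t where t: "t 0 = a" "t n = b" "\<forall>i<n. t i \<le> t (Suc i)"
    and S: "ennreal (l - e / 2) < (\<Sum>i<n. ennreal (d (\<gamma> (t i)) (\<gamma> (t (Suc i)))))"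
    unfolding curve_length_def less_SUP_iff by auto
  obtain \<delta> where \<delta>: "\<delta> > 0" "\<And>t. a \<le> t \<Longrightarrow> t \<le> b \<Longrightarrow> b - t < \<delta> \<Longrightarrow> d (\<gamma> t) (\<gamma> b) < e / 2"
    using cont[of "e / 2"] \<open>0 < e\<close> by auto
  \<comment> \<open>The partition points below \<open>b\<close>; inserting \<open>a\<close> makes
    the set visibly nonempty, so that its maximum exists.\<close>
  define P where "P = insert a {t i | i. i \<le> n \<and> t i < b}"
  have P: "finite P" "P \<noteq> {}" by (auto simp: P_def)
  have "Max P \<in> P" using P by simp
  then have Max: "a \<le> Max P" "Max P < b"
    using Max_ge[OF P(1), of a] \<open>a < b\<close> by (auto simp: P_def)
  define t' where "t' = max (Max P) (b - \<delta> / 2)"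
  have t': "a \<le> t'" "t' < b" "b - t' < \<delta>" using Max \<delta>(1) by (auto simp: t'_def)
  have alt: "t i \<le> t' \<or> t i = b" if "i \<le> n" for i
  proof (cases "t i < b")
    case True
    then have "t i \<le> Max P" using P that by (intro Max_ge) (auto simp: P_def)
    then show ?thesis by (simp add: t'_def le_max_iff_disj)
  next
    case False
    then show ?thesis using partition_mono[OF t(3), of i n] that t(2) by auto
  qed
  \<comment> \<open>The part of the partition beyond \<open>t'\<close>. It takes only the values
    \<open>t'\<close> and \<open>b\<close>, so its polygonal sum collapses to one chord.\<close>
  define w where "w i = max (t i) t'" for i
  have w: "w i = t' \<or> w i = b" if "i \<le> n" for i
    using alt[OF that] t' by (auto simp: w_def)
  have wsum: "(\<Sum>i<k. ennreal (d (\<gamma> (w i)) (\<gamma> (w (Suc i))))) = ennreal (d (\<gamma> (w 0)) (\<gamma> (w k)))"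
    if "k \<le> n" for k
    using that
  proof (induction k)
    case 0
    have "\<gamma> (w 0) \<in> M" using w[of 0] M t' by auto
    then show ?case by simp
  next
    case (Suc k)
    have "w 0 \<le> w k" using partition_mono[OF t(3), of 0 k] Suc by (auto simp: w_def max_def)
    moreover have "w k \<le> w (Suc k)"
      using t(3) Suc(2) unfolding w_def by (intro max.mono) auto
    ultimately have "w k = w (Suc k) \<or> w 0 = w k"
      using w[of 0] w[of k] w[of "Suc k"] t' Suc by auto
    moreover have "\<gamma> (w k) \<in> M" using w[of k] M t' Suc by auto
    ultimately show ?case using Suc by auto
  qed
  have ends: "w 0 = t'" "w n = b" using t t' by (auto simp: w_def)
  have tin: "a \<le> t i" "t i \<le> b" if "i \<le> n" for i
    using partition_mono[OF t(3), of 0 i] partition_mono[OF t(3), of i n] that t by auto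
  have "(\<Sum>i<n. ennreal (d (\<gamma> (t i)) (\<gamma> (t (Suc i))))) \<le>
      (\<Sum>i<n. ennreal (d (\<gamma> (min (t i) t')) (\<gamma> (min (t (Suc i)) t'))) + ennreal (d (\<gamma> (w i)) (\<gamma> (w (Suc i)))))"
  proof (rule sum_mono)
    fix i assume i: "i \<in> {..<n}"
    have "d (\<gamma> (t i)) (\<gamma> (t (Suc i))) \<le>
        d (\<gamma> (min (t i) t')) (\<gamma> (min (t (Suc i)) t')) + d (\<gamma> (w i)) (\<gamma> (w (Suc i)))"
      using i tin[of i] tin[of "Suc i"] t(3) t' M[of "t i"] M[of "t (Suc i)"] M[of t']
        triangle[of "\<gamma> (t i)" "\<gamma> t'" "\<gamma> (t (Suc i))"]
      by (auto simp: w_def min_def max_def)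
    then show "ennreal (d (\<gamma> (t i)) (\<gamma> (t (Suc i)))) \<le>
        ennreal (d (\<gamma> (min (t i) t')) (\<gamma> (min (t (Suc i)) t'))) + ennreal (d (\<gamma> (w i)) (\<gamma> (w (Suc i))))"
      by (simp flip: ennreal_plus)
  qed
  also have "\<dots> = (\<Sum>i<n. ennreal (d (\<gamma> (min (t i) t')) (\<gamma> (min (t (Suc i)) t')))) + ennreal (d (\<gamma> t') (\<gamma> b))"
    by (simp only: sum.distrib wsum[OF order_refl] ends)
  also have "\<dots> \<le> curve_length d \<gamma> a t' + ennreal (d (\<gamma> t') (\<gamma> b))"
    by (intro add_right_mono curve_length_upper[of "\<lambda>i. min (t i) t'"])
      (use t t' in \<open>auto simp: min_def intro: order_trans\<close>)
  finally have 1: "ennreal (l - e / 2) < curve_length d \<gamma> a t' + ennreal (d (\<gamma> t') (\<gamma> b))"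
    using S by simp
  have 2: "ennreal l = curve_length d \<gamma> a t' + curve_length d \<gamma> t' b"
    unfolding l(1)[symmetric] using t' by (intro curve_length_additive M) auto
  obtain A where A: "curve_length d \<gamma> a t' = ennreal A" "0 \<le> A"
    using 2 by (cases "curve_length d \<gamma> a t'") auto
  obtain B where B: "curve_length d \<gamma> t' b = ennreal B" "0 \<le> B"
    using 2 by (cases "curve_length d \<gamma> t' b") auto
  have "l = A + B" using 2 A B l by (simp flip: ennreal_plus)
  moreover have "l - e / 2 < A + d (\<gamma> t') (\<gamma> b)"
    using 1 A le \<open>0 < e\<close> by (simp flip: ennreal_plus add: ennreal_less_iff)
  moreover have "d (\<gamma> t') (\<gamma> b) < e / 2" using \<delta>(2)[of t'] t' by simp
  ultimately have "B < e" by simp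
  then show ?thesis using t' B by (intro exI[of _ t']) (auto simp: ennreal_less_iff)
qed

text \<open>Left continuity is the previous lemma, right continuity is the same for the reversed
  curve. It serves rectifiable curves whose parametrization need not be Lipschitz.\<close>

lemma continuous_on_arc_length:
  assumes M: "\<And>t. t \<in> {0..1} \<Longrightarrow> \<gamma> t \<in> M" and fin: "curve_length d \<gamma> 0 1 < \<infinity>"
    and cont: "\<And>x e. x \<in> {0..1} \<Longrightarrow> 0 < e \<Longrightarrow> \<exists>\<delta>>0. \<forall>t\<in>{0..1}. \<bar>t - x\<bar> < \<delta> \<longrightarrow> d (\<gamma> t) (\<gamma> x) < e"
  shows "continuous_on {0..1} (\<lambda>t. enn2real (curve_length d \<gamma> 0 t))"
  unfolding continuous_on_iff
proof (intro ballI allI impI)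
  fix x e :: real assume x: "x \<in> {0..1}" and e: "0 < e"
  have f: "curve_length d \<gamma> a b < \<infinity>" if "0 \<le> a" "a \<le> b" "b \<le> 1" for a b
    using curve_length_mono_interval[OF that, of d \<gamma>] fin by (rule order.strict_trans1)
  have L: "\<exists>\<delta>>0. \<forall>t. 0 \<le> t \<longrightarrow> t \<le> x \<longrightarrow> x - t < \<delta> \<longrightarrow> curve_length d \<gamma> t x < ennreal e"
  proof (cases "x = 0")
    case True
    have "curve_length d \<gamma> 0 0 \<le> ennreal (0 * (0 - 0))"
    proof (intro curve_length_lipschitz)
      fix u v :: real assume "0 \<le> u" "u \<le> v" "v \<le> 0"
      then have "u = 0" "v = 0" by linarith+
      then show "d (\<gamma> u) (\<gamma> v) \<le> 0 * (v - u)" using M[of 0] by simp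
    qed simp
    then have "curve_length d \<gamma> t x < ennreal e" if "0 \<le> t" "t \<le> x" for t
      using e True that by (metis antisym cancel_comm_monoid_add_class.diff_cancel ennreal_0 ennreal_less_zero_iff le_zero_eq mult_zero_left)
    then show ?thesis by (intro exI[of _ 1]) simp
  next
    case False
    have "\<exists>t'. 0 \<le> t' \<and> t' < x \<and> curve_length d \<gamma> t' x < ennreal e"
    proof (rule curve_length_left_small)
      show "\<exists>\<delta>>0. \<forall>t. 0 \<le> t \<longrightarrow> t \<le> x \<longrightarrow> x - t < \<delta> \<longrightarrow> d (\<gamma> t) (\<gamma> x) < e" if "0 < e" for e
        using cont[OF x that] x by (metis abs_of_nonpos atLeastAtMost_iff diff_le_0_iff_le minus_diff_eq order_trans)
    qed (use M x f e False in auto)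
    then obtain t' where t': "0 \<le> t'" "t' < x" "curve_length d \<gamma> t' x < ennreal e" by auto
    show ?thesis
    proof (intro exI[of _ "x - t'"] conjI allI impI)
      fix t assume "0 \<le> t" "t \<le> x" "x - t < x - t'"
      then show "curve_length d \<gamma> t x < ennreal e"
        using t'(3) curve_length_mono_interval[of t' t x x d \<gamma>] by (auto intro: order.strict_trans1)
    qed (use t' in auto)
  qed
  have R: "\<exists>\<delta>>0. \<forall>t. x \<le> t \<longrightarrow> t \<le> 1 \<longrightarrow> t - x < \<delta> \<longrightarrow> curve_length d \<gamma> x t < ennreal e"
  proof (cases "x = 1")
    case True
    have "curve_length d \<gamma> 1 1 \<le> ennreal (0 * (1 - 1))"
    proof (intro curve_length_lipschitz)
      fix u v :: real assume "1 \<le> u" "u \<le> v" "v \<le> 1"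
      then have "u = 1" "v = 1" by linarith+
      then show "d (\<gamma> u) (\<gamma> v) \<le> 0 * (v - u)" using M[of 1] by simp
    qed simp
    then have "curve_length d \<gamma> x t < ennreal e" if "x \<le> t" "t \<le> 1" for t
      using e True that by (metis antisym cancel_comm_monoid_add_class.diff_cancel ennreal_0 ennreal_less_zero_iff le_zero_eq mult_zero_left)
    then show ?thesis by (intro exI[of _ 1]) simp
  next
    case False
    have rev: "curve_length d (\<lambda>t. \<gamma> (- t)) (- b) (- a) = curve_length d \<gamma> a b" for a b
      using curve_length_reparam_antimono[of "-b" "-a" uminus d \<gamma>]
        curve_length_reparam_antimono[of a b uminus d "\<lambda>t. \<gamma> (- t)"] commute
      by (intro antisym) auto
    have "\<exists>t'. - 1 \<le> t' \<and> t' < - x \<and> curve_length d (\<lambda>t. \<gamma> (- t)) t' (- x) < ennreal e"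
    proof (rule curve_length_left_small)
      fix e :: real assume "0 < e"
      then obtain \<delta> where "\<delta> > 0" "\<And>t. t \<in> {0..1} \<Longrightarrow> \<bar>t - x\<bar> < \<delta> \<Longrightarrow> d (\<gamma> t) (\<gamma> x) < e"
        using cont[OF x] by metis
      then show "\<exists>\<delta>>0. \<forall>t. - 1 \<le> t \<longrightarrow> t \<le> - x \<longrightarrow> - x - t < \<delta> \<longrightarrow> d (\<gamma> (- t)) (\<gamma> (- (- x))) < e"
        using x by (intro exI[of _ \<delta>]) auto
    next
      show "curve_length d (\<lambda>t. \<gamma> (- t)) (- 1) (- x) < \<infinity>" unfolding rev using x by (intro f) auto
    qed (use M x e False in auto)
    then obtain s where s: "- 1 \<le> s" "s < - x" "curve_length d (\<lambda>t. \<gamma> (- t)) s (- x) < ennreal e"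
      by auto
    then have t': "x < - s" "- s \<le> 1" "curve_length d \<gamma> x (- s) < ennreal e"
      using rev[of "- s" x] by auto
    show ?thesis
    proof (intro exI[of _ "- s - x"] conjI allI impI)
      fix t assume "x \<le> t" "t \<le> 1" "t - x < - s - x"
      then show "curve_length d \<gamma> x t < ennreal e"
        using t'(3) curve_length_mono_interval[of x x t "-s" d \<gamma>] by (auto intro: order.strict_trans1)
    qed (use t' in auto)
  qed
  obtain d1 where d1: "d1 > 0" "\<And>t. 0 \<le> t \<Longrightarrow> t \<le> x \<Longrightarrow> x - t < d1 \<Longrightarrow> curve_length d \<gamma> t x < ennreal e"
    using L by auto
  obtain d2 where d2: "d2 > 0" "\<And>t. x \<le> t \<Longrightarrow> t \<le> 1 \<Longrightarrow> t - x < d2 \<Longrightarrow> curve_length d \<gamma> x t < ennreal e"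
    using R by auto
  have "dist (enn2real (curve_length d \<gamma> 0 y)) (enn2real (curve_length d \<gamma> 0 x)) < e"
    if y: "y \<in> {0..1}" "dist y x < min d1 d2" for y
  proof (cases "y \<le> x")
    case True
    then have "curve_length d \<gamma> y x < ennreal e" using d1(2)[of y] y by (auto simp: dist_real_def)
    then have "enn2real (curve_length d \<gamma> y x) < e" using e
      by (metis arc_length_le(3)[OF M fin] True x y(1) atLeastAtMost_iff ennreal_less_iff enn2real_nonneg)
    then show ?thesis
      using arc_length_le(2)[OF M fin, of y x] True x y(1) enn2real_nonneg[of "curve_length d \<gamma> y x"]
      unfolding dist_real_def atLeastAtMost_iff by linarith
  next
    case False
    then have "curve_length d \<gamma> x y < ennreal e" using d2(2)[of y] y by (auto simp: dist_real_def)
    then have "enn2real (curve_length d \<gamma> x y) < e" using e False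
      by (metis arc_length_le(3)[OF M fin] linear x y(1) atLeastAtMost_iff ennreal_less_iff enn2real_nonneg)
    then show ?thesis
      using arc_length_le(2)[OF M fin, of x y] False x y(1) enn2real_nonneg[of "curve_length d \<gamma> x y"]
      unfolding dist_real_def atLeastAtMost_iff by linarith
  qed
  then show "\<exists>\<delta>>0. \<forall>y\<in>{0..1}. dist y x < \<delta> \<longrightarrow>
      dist (enn2real (curve_length d \<gamma> 0 y)) (enn2real (curve_length d \<gamma> 0 x)) < e"
    using d1(1) d2(1) by (intro exI[of _ "min d1 d2"]) auto
qed

end

section \<open>The length metric\<close>

text \<open>Kept in \<open>ennreal\<close>, so that the triangle inequality is available before
  finiteness is known; \<open>enn2real\<close> would turn an infinite distance into 0.\<close>

definition ldist :: "(real \<times> real) set \<Rightarrow> real \<times> real \<Rightarrow> real \<times> real \<Rightarrow> ennreal" where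
  "ldist X p q = (INF \<gamma> \<in> {\<gamma>. path \<gamma> \<and> path_image \<gamma> \<subseteq> X \<and> pathstart \<gamma> = p \<and> pathfinish \<gamma> = q}.
     curve_length dist \<gamma> 0 1)"

lemma length_dist_eq: "length_dist X p q = enn2real (ldist X p q)"
  by (simp add: length_dist_def ldist_def)

lemma ldist_le:
  assumes "path \<gamma>" "path_image \<gamma> \<subseteq> X" "pathstart \<gamma> = p" "pathfinish \<gamma> = q"
  shows "ldist X p q \<le> curve_length dist \<gamma> 0 1"
  unfolding ldist_def by (rule INF_lower) (use assms in auto)

lemma dist_le_ldist: "ennreal (dist p q) \<le> ldist X p q"
  unfolding ldist_def
proof (rule INF_greatest)
  fix \<gamma> assume "\<gamma> \<in> {\<gamma>. path \<gamma> \<and> path_image \<gamma> \<subseteq> X \<and> pathstart \<gamma> = p \<and> pathfinish \<gamma> = q}"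
  then show "ennreal (dist p q) \<le> curve_length dist \<gamma> 0 1"
    using dist_le_curve_length[of 0 1 dist \<gamma>] by (auto simp: pathstart_def pathfinish_def)
qed

lemma ldist_commute: "ldist X p q = ldist X q p"
proof -
  have *: "ldist X p q \<le> ldist X q p" for p q
    unfolding ldist_def[of X q p]
  proof (rule INF_greatest)
    fix \<gamma> assume \<gamma>: "\<gamma> \<in> {\<gamma>. path \<gamma> \<and> path_image \<gamma> \<subseteq> X \<and> pathstart \<gamma> = q \<and> pathfinish \<gamma> = p}"
    have "ldist X p q \<le> curve_length dist (reversepath \<gamma>) 0 1"
      using \<gamma> by (intro ldist_le) auto
    also have "\<dots> \<le> curve_length dist \<gamma> 0 1"
      using curve_length_reparam_antimono[of 0 1 "\<lambda>t. 1 - t" dist \<gamma>]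
      by (simp add: reversepath_def dist_commute)
    finally show "ldist X p q \<le> curve_length dist \<gamma> 0 1" .
  qed
  show ?thesis by (intro antisym *)
qed

lemma ldist_triangle: "ldist X p r \<le> ldist X p q + ldist X q r"
proof -
  let ?A = "\<lambda>p q. {\<gamma>. path \<gamma> \<and> path_image \<gamma> \<subseteq> X \<and> pathstart \<gamma> = p \<and> pathfinish \<gamma> = q}"
  have *: "ldist X p r \<le> curve_length dist \<gamma>1 0 1 + curve_length dist \<gamma>2 0 1"
    if 1: "\<gamma>1 \<in> ?A p q" and 2: "\<gamma>2 \<in> ?A q r" for \<gamma>1 \<gamma>2
  proof -
    have "ldist X p r \<le> curve_length dist (\<gamma>1 +++ \<gamma>2) 0 1"
      using 1 2 by (intro ldist_le) (auto simp: path_image_join)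
    also have "\<dots> \<le> curve_length dist (\<gamma>1 +++ \<gamma>2) 0 (1/2) + curve_length dist (\<gamma>1 +++ \<gamma>2) (1/2) 1"
      by (rule Met_TC.curve_length_subadditive) auto
    also have "curve_length dist (\<gamma>1 +++ \<gamma>2) 0 (1/2) = curve_length dist (\<lambda>t. \<gamma>1 (2 * t)) 0 (1/2)"
      by (rule curve_length_cong) (auto simp: joinpaths_def)
    also have "\<dots> \<le> curve_length dist \<gamma>1 0 1"
      using curve_length_reparam[of 0 "1/2" "\<lambda>t. 2 * t" dist \<gamma>1] by simp
    also have "curve_length dist (\<gamma>1 +++ \<gamma>2) (1/2) 1 = curve_length dist (\<lambda>t. \<gamma>2 (2 * t - 1)) (1/2) 1"
    proof (rule curve_length_cong)
      fix t :: real assume "1 / 2 \<le> t" "t \<le> 1"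
      then consider "t = 1 / 2" | "1 / 2 < t" by linarith
      then show "(\<gamma>1 +++ \<gamma>2) t = \<gamma>2 (2 * t - 1)"
      proof cases
        assume half: "t = 1 / 2"
        show ?thesis unfolding half using 1 2 by (simp add: joinpaths_def pathstart_def pathfinish_def)
      qed (simp add: joinpaths_def)
    qed
    also have "\<dots> \<le> curve_length dist \<gamma>2 0 1"
      using curve_length_reparam[of "1/2" 1 "\<lambda>t. 2 * t - 1" dist \<gamma>2] by simp
    finally show ?thesis by (simp add: add_mono)
  qed
  show ?thesis
  \<comment> \<open>The infima need not be attained, so nearly minimal curves with slack
    \<open>e / 2\<close> each are joined; finiteness, granted by this rule, makes the slack a strict
    inequality.\<close>
  proof (rule ennreal_le_epsilon)
    fix e :: real assume fin: "ldist X p q + ldist X q r < top" and "0 < e"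
    then have e: "0 < ennreal (e / 2)" by simp
    have lt: "x < x + ennreal (e / 2)" if "x < top" for x
      using that \<open>0 < e\<close> by (cases x) (auto simp flip: ennreal_plus simp: ennreal_less_iff)
    have "ldist X p q < top" "ldist X q r < top" using fin by (auto simp: less_top)
    then have "ldist X p q < ldist X p q + ennreal (e / 2)" "ldist X q r < ldist X q r + ennreal (e / 2)"
      using lt by blast+
    then obtain \<gamma>1 \<gamma>2 where \<gamma>: "\<gamma>1 \<in> ?A p q" "curve_length dist \<gamma>1 0 1 < ldist X p q + ennreal (e / 2)"
      "\<gamma>2 \<in> ?A q r" "curve_length dist \<gamma>2 0 1 < ldist X q r + ennreal (e / 2)"
      unfolding ldist_def[of X p q] ldist_def[of X q r] INF_less_iff by blast
    have "ldist X p r \<le> (ldist X p q + ennreal (e / 2)) + (ldist X q r + ennreal (e / 2))"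
      using *[OF \<gamma>(1,3)] add_mono[OF less_imp_le[OF \<gamma>(2)] less_imp_le[OF \<gamma>(4)]] by (rule order_trans)
    also have "\<dots> = ldist X p q + ldist X q r + (ennreal (e / 2) + ennreal (e / 2))"
      by (simp add: ac_simps)
    also have "ennreal (e / 2) + ennreal (e / 2) = ennreal e"
      using \<open>0 < e\<close> by (subst ennreal_plus[symmetric]) auto
    finally show "ldist X p r \<le> ldist X p q + ldist X q r + ennreal e" .
  qed
qed

lemma ldist_lipschitz:
  assumes "0 \<le> K" "a \<le> b"
    and lip: "\<And>x y. a \<le> x \<Longrightarrow> x \<le> y \<Longrightarrow> y \<le> b \<Longrightarrow> dist (\<gamma> x) (\<gamma> y) \<le> K * (y - x)"
    and X: "\<And>x. a \<le> x \<Longrightarrow> x \<le> b \<Longrightarrow> \<gamma> x \<in> X"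
  shows "ldist X (\<gamma> a) (\<gamma> b) \<le> ennreal (K * (b - a))"
proof -
  define \<eta> where "\<eta> t = \<gamma> (a + t * (b - a))" for t
  have r: "a \<le> a + t * (b - a)" "a + t * (b - a) \<le> b" if "0 \<le> t" "t \<le> 1" for t
    using that \<open>a \<le> b\<close> mult_left_le_one_le[of "b - a" t] mult_nonneg_nonneg[of t "b - a"] by linarith+
  have lip\<eta>: "dist (\<eta> x) (\<eta> y) \<le> K * (b - a) * (y - x)" if "0 \<le> x" "x \<le> y" "y \<le> 1" for x y
  proof -
    have "x * (b - a) \<le> y * (b - a)" using that \<open>a \<le> b\<close> by (intro mult_right_mono) auto
    then have "dist (\<eta> x) (\<eta> y) \<le> K * (a + y * (b - a) - (a + x * (b - a)))"
      unfolding \<eta>_def using r[of x] r[of y] that by (intro lip) auto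
    then show ?thesis by (simp add: algebra_simps)
  qed
  have "(K * (b - a))-lipschitz_on {0..1} \<eta>"
  proof (rule lipschitz_onI)
    fix x y :: real assume "x \<in> {0..1}" "y \<in> {0..1}"
    then show "dist (\<eta> x) (\<eta> y) \<le> K * (b - a) * dist x y"
      using lip\<eta>[of x y] lip\<eta>[of y x] by (cases "x \<le> y") (auto simp: dist_real_def dist_commute)
  qed (use assms in auto)
  then have "path \<eta>" unfolding path_def by (rule lipschitz_on_continuous_on)
  moreover have "path_image \<eta> \<subseteq> X" using r X by (auto simp: path_image_def \<eta>_def)
  ultimately have "ldist X (\<gamma> a) (\<gamma> b) \<le> curve_length dist \<eta> 0 1"
    by (intro ldist_le) (auto simp: pathstart_def pathfinish_def \<eta>_def)
  also have "\<dots> \<le> ennreal (K * (b - a) * (1 - 0))"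
    by (rule curve_length_lipschitz) (use lip\<eta> in auto)
  finally show ?thesis by simp
qed

lemma Metric_space_length_dist:
  assumes "\<And>p q. p \<in> X \<Longrightarrow> q \<in> X \<Longrightarrow> ldist X p q < \<infinity>"
  shows "Metric_space X (length_dist X)"
proof
  fix x y z
  show "0 \<le> length_dist X x y" by (simp add: length_dist_eq)
  show "length_dist X x y = length_dist X y x" by (simp add: length_dist_eq ldist_commute)
  show "length_dist X x y = 0 \<longleftrightarrow> x = y" if "x \<in> X" "y \<in> X"
  proof
    assume "length_dist X x y = 0"
    then have "ldist X x y = 0"
      using assms[OF that] by (auto simp: length_dist_eq enn2real_eq_0_iff)
    then show "x = y" using dist_le_ldist[of x y X] by simp
  next
    assume "x = y"
    then show "length_dist X x y = 0"
      using ldist_lipschitz[of 0 0 0 "\<lambda>_. x" X] that by (simp add: length_dist_eq)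
  qed
  show "length_dist X x z \<le> length_dist X x y + length_dist X y z" if "x \<in> X" "y \<in> X" "z \<in> X"
    using ldist_triangle[of X x z y] assms that
    by (simp add: length_dist_eq enn2real_plus[symmetric] enn2real_mono ennreal_add_eq_top less_top)
qed

section \<open>Endpoints of the surviving intervals\<close>

text \<open>The left endpoint of the surviving interval number \<open>N\<close>, counted from 0. Only the last \<open>m\<close>
  binary digits of \<open>N\<close> matter.\<close>

fun left_end :: "real \<Rightarrow> nat \<Rightarrow> nat \<Rightarrow> real" where
  "left_end a 0 N = 0"
| "left_end a (Suc m) N = left_end a m (N div 2) + real (N mod 2) * (1 - a) * a ^ m"

lemma length_cantor_endpoints: "length (cantor_endpoints a m) = 2 ^ m"
  by (induction m) (auto simp: length_concat remove_central_def comp_def case_prod_beta sum_list_triv)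

lemma nth_concat_pairs:
  assumes "\<And>x. x \<in> set xs \<Longrightarrow> length (f x) = 2" "N < 2 * length xs"
  shows "concat (map f xs) ! N = f (xs ! (N div 2)) ! (N mod 2)"
  using assms
proof (induction xs arbitrary: N)
  case (Cons x xs)
  show ?case
  proof (cases "N < 2")
    case True
    then show ?thesis using Cons.prems(1)[of x] by (auto simp: nth_append)
  next
    case False
    then obtain N' where N: "N = N' + 2" by (metis add.commute le_iff_add not_less)
    have "concat (map f (x # xs)) ! N = concat (map f xs) ! N'"
      using Cons.prems(1)[of x] N by (simp add: nth_append)
    also have "\<dots> = f (xs ! (N' div 2)) ! (N' mod 2)"
      using Cons.prems N by (intro Cons.IH) auto
    finally show ?thesis using N by simp
  qed
qed simp

lemma nth_cantor_endpoints:
  "N < 2 ^ m \<Longrightarrow> cantor_endpoints a m ! N = (left_end a m N, left_end a m N + a ^ m)"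
proof (induction m arbitrary: N)
  case (Suc m)
  have "cantor_endpoints a (Suc m) ! N = remove_central a (cantor_endpoints a m ! (N div 2)) ! (N mod 2)"
    unfolding cantor_endpoints.simps
    by (rule nth_concat_pairs) (use Suc.prems in \<open>auto simp: remove_central_def length_cantor_endpoints case_prod_beta\<close>)
  also have "cantor_endpoints a m ! (N div 2) = (left_end a m (N div 2), left_end a m (N div 2) + a ^ m)"
    using Suc.prems by (intro Suc.IH) auto
  finally show ?case
    by (cases "N mod 2 = 0") (auto simp: remove_central_def field_simps not_mod_2_eq_0_eq_1)
qed simp

definition cantor_interval :: "real \<Rightarrow> nat \<Rightarrow> nat \<Rightarrow> real set" where
  "cantor_interval a m N = {left_end a m N .. left_end a m N + a ^ m}"

definition cantor_level :: "real \<Rightarrow> nat \<Rightarrow> real set" where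
  "cantor_level a m = (\<Union>N<2 ^ m. cantor_interval a m N)"

lemma surviving_interval_eq:
  assumes "j \<in> {1..2 ^ m}"
  shows "surviving_interval a m j = cantor_interval a m (j - 1)"
  using nth_cantor_endpoints[of "j - 1" m a] assms
  by (auto simp: surviving_interval_def cantor_interval_def)

lemma cantor_set_eq: "cantor_set a = (\<Inter>m. cantor_level a m)"
proof -
  have "(\<Union>j\<in>{1..2 ^ m}. surviving_interval a m j) = cantor_level a m" for m
  proof -
    have "(\<Union>j\<in>{1..2 ^ m}. surviving_interval a m j) = (\<Union>j\<in>{1..2 ^ m}. cantor_interval a m (j - 1))"
      by (intro SUP_cong refl surviving_interval_eq)
    also have "\<dots> = (\<Union>N\<in>(\<lambda>j. j - 1) ` {1..2 ^ m}. cantor_interval a m N)" by auto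
    also have "(\<lambda>j. j - 1) ` {1..2 ^ m} = {..<(2::nat) ^ m}"
    proof (intro antisym subsetI)
      fix N :: nat assume "N \<in> {..<2 ^ m}"
      then show "N \<in> (\<lambda>j. j - 1) ` {1..2 ^ m}" by (intro image_eqI[of _ _ "Suc N"]) auto
    qed auto
    finally show ?thesis by (simp add: cantor_level_def)
  qed
  then show ?thesis by (simp add: cantor_set_def)
qed

section \<open>Nesting and separation of the surviving intervals\<close>

locale cantor_ratio =
  fixes a :: real
  assumes a_pos: "0 < a" and a_half: "a < 1 / 2"
begin

lemma apow: "0 < a ^ m" "a ^ m \<le> 1"
  using a_pos a_half by (auto intro: power_le_one)

lemma apow_Suc: "a ^ Suc m < a ^ m / 2"
  using mult_strict_right_mono[OF a_half apow(1)[of m]] by simp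

lemma left_end_Suc: "left_end a m (N div 2) \<le> left_end a (Suc m) N"
    "left_end a (Suc m) N + a ^ Suc m \<le> left_end a m (N div 2) + a ^ m"
proof -
  have "N mod 2 = 0 \<or> N mod 2 = 1" by auto
  then show "left_end a m (N div 2) \<le> left_end a (Suc m) N"
    "left_end a (Suc m) N + a ^ Suc m \<le> left_end a m (N div 2) + a ^ m"
    using apow_Suc[of m] apow[of m] a_half by (auto simp: algebra_simps mult_nonneg_nonneg)
qed

text \<open>Dropping the last \<open>j\<close> binary digits of the address leads to the ancestor
  \<open>j\<close> levels up, which contains the interval.\<close>

lemma left_end_add: "left_end a m (N div 2 ^ j) \<le> left_end a (m + j) N \<and>
    left_end a (m + j) N + a ^ (m + j) \<le> left_end a m (N div 2 ^ j) + a ^ m"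
proof (induction j arbitrary: N)
  case (Suc j)
  have *: "N div 2 ^ Suc j = N div 2 div 2 ^ j" by (simp add: div_mult2_eq)
  show ?case
    unfolding * add_Suc_right
    using Suc[of "N div 2"] left_end_Suc[of "m + j" N] by linarith
qed simp

lemma cantor_interval_add: "cantor_interval a (m + j) N \<subseteq> cantor_interval a m (N div 2 ^ j)"
  using left_end_add[of m N j] by (auto simp: cantor_interval_def)

lemma cantor_interval_subset:
  "m \<le> k \<Longrightarrow> cantor_interval a k N \<subseteq> cantor_interval a m (N div 2 ^ (k - m))"
  using cantor_interval_add[of m "k - m" N] by simp

text \<open>Siblings are separated by the central piece removed from their parent, of length
  \<open>(1 - 2 * a)\<close> times that of the parent; other pairs inherit the gap between their
  parents.\<close>

lemma left_end_separated:
  "N < N' \<Longrightarrow> N' < 2 ^ m \<Longrightarrow> left_end a m N + a ^ m + (1 - 2 * a) * a ^ m \<le> left_end a m N'"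
proof (induction m arbitrary: N N')
  case (Suc m)
  have pos: "(1 - 2 * a) * a ^ Suc m \<le> (1 - 2 * a) * a ^ m"
    using a_pos a_half apow[of m] apow_Suc[of m] by (intro mult_left_mono) auto
  show ?case
  proof (cases "N div 2 = N' div 2")
    case True
    then have "N mod 2 = 0" "N' mod 2 = 1" using Suc.prems(1) by presburger+
    then show ?thesis using True pos by (simp add: algebra_simps)
  next
    case False
    then have "N div 2 < N' div 2" using Suc.prems(1) by (simp add: div_le_mono le_neq_implies_less less_imp_le)
    then have "left_end a m (N div 2) + a ^ m + (1 - 2 * a) * a ^ m \<le> left_end a m (N' div 2)"
      using Suc.prems by (intro Suc.IH) auto
    then show ?thesis using left_end_Suc[of m N] left_end_Suc[of m N'] pos by linarith
  qed
qed simp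

lemma cantor_interval_separated:
  assumes "x \<in> cantor_interval a m N" "x' \<in> cantor_interval a m N'" "N < 2 ^ m" "N' < 2 ^ m"
    "\<bar>x - x'\<bar> < (1 - 2 * a) * a ^ m"
  shows "N = N'"
proof (rule ccontr)
  assume "N \<noteq> N'"
  then consider "N < N'" | "N' < N" by linarith
  then show False
    using left_end_separated[of N N' m] left_end_separated[of N' N m] assms
    by cases (auto simp: cantor_interval_def abs_real_def split: if_splits)
qed

lemma cantor_interval_unique:
  assumes "x \<in> cantor_interval a m N" "x \<in> cantor_interval a m N'" "N < 2 ^ m" "N' < 2 ^ m"
  shows "N = N'"
  using cantor_interval_separated[OF assms] apow a_half by simp

lemma div_less_pow: "N < 2 ^ k \<Longrightarrow> m \<le> k \<Longrightarrow> N div 2 ^ (k - m) < (2 :: nat) ^ m"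
  by (metis le_add_diff_inverse2 less_mult_imp_div_less power_add mult.commute)

lemma cantor_level_antimono: "m \<le> k \<Longrightarrow> cantor_level a k \<subseteq> cantor_level a m"
  unfolding cantor_level_def using cantor_interval_subset div_less_pow by fast

lemma closed_cantor_level: "closed (cantor_level a m)"
  unfolding cantor_level_def cantor_interval_def by (intro closed_UN) auto

lemma cantor_level_01: "cantor_level a m \<subseteq> {0..1}"
  using cantor_level_antimono[of 0 m] by (simp add: cantor_level_def cantor_interval_def lessThan_Suc)

text \<open>Removing central pieces keeps endpoints: a left end survives as the left end of child
  \<open>2 * N'\<close>, a right end as the right end of child \<open>2 * N' + 1\<close>.\<close>

lemma endpoint_next:
  assumes "N < 2 ^ m" "e = left_end a m N \<or> e = left_end a m N + a ^ m"
  shows "\<exists>N'<2 ^ (m + j). e = left_end a (m + j) N' \<or> e = left_end a (m + j) N' + a ^ (m + j)"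
proof (induction j)
  case 0 then show ?case using assms by auto
next
  case (Suc j)
  then obtain N' where N': "N' < 2 ^ (m + j)"
    "e = left_end a (m + j) N' \<or> e = left_end a (m + j) N' + a ^ (m + j)" by auto
  from N'(2) show ?case
  proof
    assume "e = left_end a (m + j) N'"
    then show ?thesis using N'(1) by (intro exI[of _ "2 * N'"]) auto
  next
    assume e: "e = left_end a (m + j) N' + a ^ (m + j)"
    have "(2 * N' + 1) div 2 = N'" "(2 * N' + 1) mod 2 = 1" by auto
    then show ?thesis using N'(1) e
      by (intro exI[of _ "2 * N' + 1"]) (auto simp: algebra_simps simp del: add_2_eq_Suc' One_nat_def)
  qed
qed

lemma endpoint_in_cantor_set:
  assumes "N < 2 ^ m" "e = left_end a m N \<or> e = left_end a m N + a ^ m"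
  shows "e \<in> cantor_set a"
  unfolding cantor_set_eq
proof
  fix k
  obtain N' where N': "N' < 2 ^ (m + k)"
    "e = left_end a (m + k) N' \<or> e = left_end a (m + k) N' + a ^ (m + k)"
    using endpoint_next[OF assms] by auto
  then have "e \<in> cantor_level a (m + k)"
    using apow(1)[of "m + k"] by (auto simp: cantor_level_def cantor_interval_def intro!: bexI[of _ N'])
  then show "e \<in> cantor_level a k" using cantor_level_antimono[of k "m + k"] by auto
qed

end

section \<open>A parametrization of the Cantor set\<close>

text \<open>The binary expansion of \<open>\<omega>\<close> is the address of \<open>cantor_point a \<omega>\<close>.\<close>

definition cantor_point :: "real \<Rightarrow> real \<Rightarrow> real" where
  "cantor_point a \<omega> = (SUP m. left_end a m (nat \<lfloor>2 ^ m * \<omega>\<rfloor>))"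

text \<open>Half-open, so that every \<omega> in [0, 1) has exactly one address at each
  level.\<close>

definition dyadic :: "nat \<Rightarrow> nat \<Rightarrow> real set" where
  "dyadic m N = {real N / 2 ^ m ..< (real N + 1) / 2 ^ m}"

lemma dyadic_iff: "0 \<le> \<omega> \<Longrightarrow> \<omega> \<in> dyadic m N \<longleftrightarrow> nat \<lfloor>2 ^ m * \<omega>\<rfloor> = N"
proof -
  assume "0 \<le> \<omega>"
  then have "nat \<lfloor>2 ^ m * \<omega>\<rfloor> = N \<longleftrightarrow> \<lfloor>2 ^ m * \<omega>\<rfloor> = int N"
    by (metis nat_int of_nat_eq_iff int_nat_eq zero_le_floor zero_le_mult_iff zero_le_numeral zero_le_power)
  also have "\<dots> \<longleftrightarrow> real N \<le> 2 ^ m * \<omega> \<and> 2 ^ m * \<omega> < real N + 1"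
    by (simp add: floor_eq_iff)
  finally show ?thesis by (auto simp: dyadic_def field_simps)
qed

lemma dyadic_nonneg: "\<omega> \<in> dyadic m N \<Longrightarrow> 0 \<le> \<omega>"
  unfolding dyadic_def atLeastLessThan_iff
  by (meson divide_nonneg_nonneg of_nat_0_le_iff order_trans zero_le_numeral zero_le_power)

lemma dyadic_less_1:
  assumes "\<omega> \<in> dyadic m N" "N < 2 ^ m"
  shows "\<omega> < 1"
proof -
  have "real N + 1 \<le> 2 ^ m" using assms(2) by (metis Suc_leI of_nat_Suc of_nat_le_iff of_nat_numeral of_nat_power add.commute)
  then have "(real N + 1) / 2 ^ m \<le> 1" by simp
  then show ?thesis using assms(1) unfolding dyadic_def atLeastLessThan_iff by linarith
qed

lemma emeasure_dyadic: "emeasure lborel (dyadic m N) = ennreal (1 / 2 ^ m)"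
  unfolding dyadic_def by (subst emeasure_lborel_Ico) (auto simp: field_simps)

lemma dyadic_sets[measurable]: "dyadic m N \<in> sets borel"
  by (simp add: dyadic_def)

lemma floor_pow_div:
  assumes "0 \<le> \<omega>"
  shows "nat \<lfloor>2 ^ (m + j) * \<omega>\<rfloor> div 2 ^ j = nat \<lfloor>2 ^ m * (\<omega> :: real)\<rfloor>"
proof -
  have "\<lfloor>2 ^ m * \<omega>\<rfloor> = \<lfloor>2 ^ (m + j) * \<omega> / real_of_int (2 ^ j)\<rfloor>"
    by (simp add: power_add)
  also have "\<dots> = \<lfloor>2 ^ (m + j) * \<omega>\<rfloor> div 2 ^ j"
    by (rule floor_divide_real_eq_div) simp
  finally show ?thesis using assms by (simp add: nat_div_distrib nat_power_eq)
qed

context cantor_ratio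
begin

lemma left_end_01: "0 \<le> left_end a m N" "left_end a m N \<le> 1"
  using left_end_add[of 0 N m] apow[of m] by auto

lemma cantor_point_measurable[measurable]: "cantor_point a \<in> borel_measurable borel"
proof -
  have "(\<lambda>\<omega> :: real. left_end a m (nat \<lfloor>2 ^ m * \<omega>\<rfloor>)) \<in> borel_measurable borel" for m
  proof (rule measurable_compose[of "\<lambda>\<omega> :: real. nat \<lfloor>2 ^ m * \<omega>\<rfloor>" borel "count_space UNIV"])
    show "(\<lambda>\<omega> :: real. nat \<lfloor>2 ^ m * \<omega>\<rfloor>) \<in> borel \<rightarrow>\<^sub>M count_space UNIV" by measurable
  qed simp
  then show ?thesis
    unfolding cantor_point_def[abs_def]
    by (intro borel_measurable_cSUP) (auto intro!: bdd_aboveI[of _ 1] left_end_01)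
qed

text \<open>Along one address the left ends increase and the right ends decrease with the level, so
  every left end lies below every right end, whichever level is the finer.\<close>

lemma cantor_point_in:
  assumes "0 \<le> \<omega>"
  shows "cantor_point a \<omega> \<in> cantor_interval a m (nat \<lfloor>2 ^ m * \<omega>\<rfloor>)"
proof -
  let ?N = "\<lambda>m. nat \<lfloor>2 ^ m * \<omega>\<rfloor>"
  have bdd: "bdd_above (range (\<lambda>m. left_end a m (?N m)))"
    by (auto intro!: bdd_aboveI[of _ 1] left_end_01)
  have "left_end a m (?N m) \<le> cantor_point a \<omega>"
    unfolding cantor_point_def by (rule cSUP_upper[OF _ bdd]) auto
  moreover have "cantor_point a \<omega> \<le> left_end a m (?N m) + a ^ m"
    unfolding cantor_point_def
  proof (rule cSUP_least)
    fix k
    show "left_end a k (?N k) \<le> left_end a m (?N m) + a ^ m"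
    proof (cases "m \<le> k")
      case True
      then obtain j where j: "k = m + j" by (metis le_add_diff_inverse)
      show ?thesis
        using left_end_add[of m "?N k" j] floor_pow_div[OF assms, of m j] apow[of k] unfolding j by simp
    next
      case False
      then obtain j where j: "m = k + j" by (metis le_add_diff_inverse nat_le_linear)
      show ?thesis
        using left_end_add[of k "?N m" j] floor_pow_div[OF assms, of k j] apow[of m] unfolding j by simp
    qed
  qed simp
  ultimately show ?thesis by (simp add: cantor_interval_def)
qed

lemma floor_less_pow: "0 \<le> \<omega> \<Longrightarrow> \<omega> < 1 \<Longrightarrow> nat \<lfloor>2 ^ m * \<omega>\<rfloor> < 2 ^ m"
  by (simp add: nat_less_iff floor_less_iff)

lemma cantor_point_in_cantor_set:
  assumes "0 \<le> \<omega>" "\<omega> < 1"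
  shows "cantor_point a \<omega> \<in> cantor_set a"
  unfolding cantor_set_eq cantor_level_def
  using cantor_point_in[OF assms(1)] floor_less_pow[OF assms] by fast

lemma apow_tendsto: "(\<lambda>m. C * a ^ m) \<longlonglongrightarrow> 0"
  using LIMSEQ_power_zero[of a] a_pos a_half by (auto intro!: tendsto_mult_right_zero)

lemma exists_scale:
  assumes "0 < C" "0 < \<delta>" "\<delta> < C"
  shows "\<exists>m. C * a ^ Suc m \<le> \<delta> \<and> \<delta> < C * a ^ m"
proof -
  have ex: "\<exists>m. C * a ^ m \<le> \<delta>"
    using order_tendstoD(2)[OF apow_tendsto assms(2), of C]
    by (auto simp: eventually_sequentially intro: less_imp_le)
  define m where "m = (LEAST m. C * a ^ m \<le> \<delta>)"
  have m: "C * a ^ m \<le> \<delta>" unfolding m_def using ex by (rule LeastI_ex)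
  then have "m \<noteq> 0" using assms by (intro notI) auto
  then obtain k where k: "m = Suc k" by (cases m) auto
  then have "\<not> C * a ^ k \<le> \<delta>" using not_less_Least[of k "\<lambda>m. C * a ^ m \<le> \<delta>"] m_def by simp
  then show ?thesis using m k by (intro exI[of _ k]) auto
qed

text \<open>The uniform measure of the Cantor set is \<open>s\<close>-regular, where \<open>a powr s = 1 / 2\<close>.\<close>

lemma emeasure_cantor_point_near:
  assumes s: "a powr s = 1 / 2" and "0 < \<delta>"
  shows "emeasure lborel {\<omega> \<in> {0..<1}. \<bar>x - cantor_point a \<omega>\<bar> \<le> \<delta>} \<le>
    ennreal (2 * (2 / (1 - 2 * a)) powr s * \<delta> powr s)"
proof -
  have s0: "0 < s" using s a_pos a_half powr_mono'[of s 0 a] by (cases "0 < s") auto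
  have c: "0 < 1 - 2 * a" using a_half by simp
  define E where "E = {\<omega> \<in> {0..<1}. \<bar>x - cantor_point a \<omega>\<bar> \<le> \<delta>}"
  \<comment> \<open>Two points of the Cantor set within \<delta> of \<open>x\<close> are within
    \<open>2 * \<delta>\<close> of each other, and points closer than
    \<open>(1 - 2 * a) * a ^ m\<close> share their address of level \<open>m\<close>;
    \<open>Q < a ^ m\<close> says just that. For \<open>Q \<ge> 1\<close> the total mass 1 is bound
    enough.\<close>
  define Q where "Q = 2 * \<delta> / (1 - 2 * a)"
  have Q: "(2 / (1 - 2 * a)) powr s * \<delta> powr s = Q powr s"
    using c \<open>0 < \<delta>\<close> by (simp add: powr_mult[symmetric] Q_def)
  have E: "emeasure lborel E \<le> ennreal (2 * Q powr s)"
  proof (cases "1 \<le> Q")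
    case True
    have "emeasure lborel E \<le> emeasure lborel {0..<1::real}"
      by (intro emeasure_mono) (auto simp: E_def)
    also have "\<dots> = ennreal 1" by simp
    also have "\<dots> \<le> ennreal (2 * Q powr s)"
      using ge_one_powr_ge_zero[OF True, of s] s0 by (intro ennreal_leI) auto
    finally show ?thesis .
  next
    case False
    then obtain m where m: "1 * a ^ Suc m \<le> Q" "Q < 1 * a ^ m"
      using exists_scale[of 1 Q] c \<open>0 < \<delta>\<close> by (auto simp: Q_def)
    show ?thesis
    proof (cases "E = {}")
      case False
      then obtain \<omega> where \<omega>: "\<omega> \<in> E" by auto
      let ?N = "\<lambda>\<omega>. nat \<lfloor>2 ^ m * \<omega>\<rfloor>"
      have "E \<subseteq> dyadic m (?N \<omega>)"
      proof
        fix \<omega>' assume \<omega>': "\<omega>' \<in> E"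
        have "\<bar>cantor_point a \<omega> - cantor_point a \<omega>'\<bar> \<le> 2 * \<delta>"
          using \<omega> \<omega>' by (auto simp: E_def)
        also have "\<dots> < (1 - 2 * a) * a ^ m" using m(2) c by (simp add: Q_def field_simps)
        finally have lt: "\<bar>cantor_point a \<omega> - cantor_point a \<omega>'\<bar> < (1 - 2 * a) * a ^ m" .
        have "?N \<omega> = ?N \<omega>'"
          by (rule cantor_interval_separated[OF cantor_point_in cantor_point_in floor_less_pow floor_less_pow])
            (use \<omega> \<omega>' lt in \<open>auto simp: E_def\<close>)
        then show "\<omega>' \<in> dyadic m (?N \<omega>)" using \<omega>' by (auto simp: dyadic_iff E_def)
      qed
      then have "emeasure lborel E \<le> emeasure lborel (dyadic m (?N \<omega>))"
        by (intro emeasure_mono) auto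
      also have "\<dots> = ennreal ((1 / 2) ^ m)" by (simp add: emeasure_dyadic power_one_over)
      also have "(1 / 2) ^ m \<le> 2 * Q powr s"
      proof -
        have "(a ^ Suc m) powr s = (a powr real (Suc m)) powr s"
          using a_pos by (simp only: powr_realpow)
        also have "\<dots> = (a powr s) powr real (Suc m)"
          by (simp only: powr_powr mult.commute)
        also have "\<dots> = (1 / 2) ^ Suc m"
          unfolding s by (rule powr_realpow) simp
        finally have "(1 / 2) ^ Suc m = (a ^ Suc m) powr s" ..
        also have "\<dots> \<le> Q powr s" using m(1) apow[of "Suc m"] s0 by (intro powr_mono2) auto
        finally show ?thesis by simp
      qed
      finally show ?thesis by (simp add: ennreal_leI)
    qed simp
  qed
  show ?thesis using E Q by (simp add: E_def mult.assoc)
qed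

end

section \<open>The set D and its gaps\<close>

locale cantor_space =
  fixes l :: real and \<nu> :: nat
  assumes l_pos: "0 < l" and l_half: "l < 1 / 2" and \<nu>: "2 \<le> \<nu>"
begin

definition q :: real where "q = l ^ \<nu>"
text \<open>The dilation that normalizes gaps: the central piece removed from a band of length
  \<open>L * q ^ n\<close> has length \<open>L * (1 - 2 * q) * q ^ n = q ^ n\<close>.\<close>

definition L :: real where "L = 1 / (1 - 2 * q)"

lemma q_pos: "0 < q" using l_pos by (simp add: q_def)

lemma q_quarter: "q < 1 / 4"
proof -
  have "q \<le> l ^ 2" unfolding q_def using \<nu> l_pos l_half by (intro power_decreasing) auto
  also have "l ^ 2 < (1 / 2) ^ 2" using l_pos l_half by (intro power_strict_mono) auto
  finally show ?thesis by (simp add: power2_eq_square)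
qed

sublocale C: cantor_ratio l using l_pos l_half by unfold_locales
sublocale Q: cantor_ratio q using q_pos q_quarter by unfold_locales auto

lemma qpow: "0 < q ^ n" "q ^ n \<le> 1" using Q.apow by auto

lemma qpow_eq: "l ^ (\<nu> * n) = q ^ n" by (simp add: q_def power_mult)

lemma L_bounds: "1 < L" "L < 2" using q_pos q_quarter by (auto simp: L_def field_simps)

lemma L_eq: "L = 1 + 2 * q * L" using q_quarter by (simp add: L_def field_simps)

text \<open>\<open>gap n i\<close> is the closed gap that is removed from the surviving interval \<open>band n i\<close> of the dilated
  Cantor set. As \<open>l ^ (\<nu> * n) = q ^ n\<close>, the cubes over it are the squares based on the intervals of \<open>CC n\<close>.\<close>

definition band_lo :: "nat \<Rightarrow> nat \<Rightarrow> real" where "band_lo n i = L * left_end q n i"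
definition gap_lo :: "nat \<Rightarrow> nat \<Rightarrow> real" where "gap_lo n i = band_lo n i + L * q ^ Suc n"
definition band :: "nat \<Rightarrow> nat \<Rightarrow> real set" where "band n i = {band_lo n i .. band_lo n i + L * q ^ n}"
definition gap :: "nat \<Rightarrow> nat \<Rightarrow> real set" where "gap n i = {gap_lo n i .. gap_lo n i + q ^ n}"
definition open_gap :: "nat \<Rightarrow> nat \<Rightarrow> real set" where "open_gap n i = {gap_lo n i <..< gap_lo n i + q ^ n}"
definition bands :: "nat \<Rightarrow> real set" where "bands n = (\<Union>i<2 ^ n. band n i)"
definition D :: "real set" where "D = dilated_cantor_set l \<nu>"
definition CC :: "nat \<Rightarrow> real set" where "CC n = cantor_level l (\<nu> * n)"

lemma band_iff: "y \<in> band n i \<longleftrightarrow> y / L \<in> cantor_interval q n i"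
  using L_bounds by (auto simp: band_def band_lo_def cantor_interval_def field_simps)

lemma bands_iff: "y \<in> bands n \<longleftrightarrow> y / L \<in> cantor_level q n"
  by (auto simp: bands_def cantor_level_def band_iff)

lemma D_eq: "D = (\<lambda>x. L * x) ` cantor_set q"
  unfolding D_def dilated_cantor_set_def L_def q_def ..

lemma D_iff: "y \<in> D \<longleftrightarrow> y / L \<in> cantor_set q"
proof
  assume "y / L \<in> cantor_set q"
  then have "L * (y / L) \<in> D" unfolding D_eq by (rule imageI)
  then show "y \<in> D" using L_bounds by simp
qed (use L_bounds in \<open>auto simp: D_eq\<close>)

lemma D_iff_bands: "y \<in> D \<longleftrightarrow> (\<forall>n. y \<in> bands n)"
  by (auto simp: D_iff bands_iff cantor_set_eq)

lemma bands_antimono: "m \<le> n \<Longrightarrow> bands n \<subseteq> bands m"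
  using Q.cantor_level_antimono[of m n] by (auto simp: bands_iff)

lemma closed_bands: "closed (bands n)"
  unfolding bands_def band_def by (intro closed_UN) auto

lemma closed_D: "closed D"
proof -
  have "D = (\<Inter>n. bands n)" using D_iff_bands by auto
  then show ?thesis using closed_bands by auto
qed

lemma D_sets[measurable]: "D \<in> sets borel" using closed_D by simp

lemma bands_0: "bands 0 = {0..L}"
  by (auto simp: bands_def band_def band_lo_def lessThan_Suc)

lemma D_subset: "D \<subseteq> {0..L}" using D_iff_bands bands_0 by auto

lemma band_subset: "m \<le> n \<Longrightarrow> band n i \<subseteq> band m (i div 2 ^ (n - m))"
  using Q.cantor_interval_subset[of m n i] by (auto simp: band_iff)

lemma band_unique: "y \<in> band n i \<Longrightarrow> y \<in> band n i' \<Longrightarrow> i < 2 ^ n \<Longrightarrow> i' < 2 ^ n \<Longrightarrow> i = i'"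
  unfolding band_iff by (rule Q.cantor_interval_unique)

lemma band_separated:
  assumes "i < i'" "i' < 2 ^ n"
  shows "band_lo n i + L * q ^ n + q ^ n \<le> band_lo n i'"
proof -
  have "L * (left_end q n i + q ^ n + (1 - 2 * q) * q ^ n) \<le> L * left_end q n i'"
    using Q.left_end_separated[OF assms] L_bounds by (intro mult_left_mono) auto
  moreover have "L * ((1 - 2 * q) * q ^ n) = q ^ n"
    using q_quarter by (simp add: L_def)
  ultimately show ?thesis by (simp add: band_lo_def algebra_simps)
qed

lemma gap_hi: "gap_lo n i + q ^ n + L * q ^ Suc n = band_lo n i + L * q ^ n"
proof -
  have "L * q ^ n = (1 + 2 * q * L) * q ^ n" by (rule arg_cong[OF L_eq])
  then show ?thesis by (simp add: gap_lo_def algebra_simps)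
qed

lemma gap_subset_band: "gap n i \<subseteq> band n i"
proof -
  have "0 \<le> L * q ^ Suc n" using L_bounds qpow[of "Suc n"] by (intro mult_nonneg_nonneg) auto
  then have "band_lo n i \<le> gap_lo n i" "gap_lo n i + q ^ n \<le> band_lo n i + L * q ^ n"
    using gap_hi[of n i] unfolding gap_lo_def by linarith+
  then show ?thesis by (auto simp: gap_def band_def)
qed

lemma open_gap_subset: "open_gap n i \<subseteq> gap n i" by (auto simp: open_gap_def gap_def)

lemma band_children: "band_lo (Suc n) (2 * i) = band_lo n i" "band_lo (Suc n) (2 * i + 1) = gap_lo n i + q ^ n"
proof -
  show "band_lo (Suc n) (2 * i) = band_lo n i" by (simp add: band_lo_def)
  have "(2 * i + 1) div 2 = i" "(2 * i + 1) mod 2 = 1" by auto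
  then have "band_lo (Suc n) (2 * i + 1) = band_lo n i + L * q ^ n - L * q ^ Suc n"
    by (simp add: band_lo_def algebra_simps del: One_nat_def)
  then show "band_lo (Suc n) (2 * i + 1) = gap_lo n i + q ^ n" using gap_hi[of n i] by simp
qed

lemma open_gap_not_bands:
  assumes y: "y \<in> open_gap n i" and i: "i < 2 ^ n"
  shows "y \<notin> bands (Suc n)"
proof
  assume "y \<in> bands (Suc n)"
  then obtain i' where i': "i' < 2 ^ Suc n" "y \<in> band (Suc n) i'" by (auto simp: bands_def)
  then have "y \<in> band n (i' div 2)" using band_subset[of n "Suc n" i'] by auto
  moreover have "y \<in> band n i" using y open_gap_subset gap_subset_band by blast
  ultimately have "i' div 2 = i" using band_unique i i' by auto
  then consider "i' = 2 * i" | "i' = 2 * i + 1" by linarith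
  then show False
  proof cases
    case 1
    then have "y \<le> band_lo n i + L * q ^ Suc n"
      using i'(2) band_children[of n i] by (simp add: band_def)
    then show ?thesis using y by (simp add: open_gap_def gap_lo_def)
  next
    case 2
    then have "gap_lo n i + q ^ n \<le> y"
      using i'(2) band_children[of n i] by (simp add: band_def)
    then show ?thesis using y by (simp add: open_gap_def)
  qed
qed

lemma open_gap_disjoint_D: "y \<in> open_gap n i \<Longrightarrow> i < 2 ^ n \<Longrightarrow> y \<notin> D"
  using open_gap_not_bands D_iff_bands by blast

lemma open_gap_disjoint_band:
  assumes y: "y \<in> open_gap k i" and "i < 2 ^ k" "k \<le> k'" "i' < 2 ^ k'" "(k', i') \<noteq> (k, i)"
  shows "y \<notin> band k' i'"
proof
  assume b: "y \<in> band k' i'"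
  show False
  proof (cases "k' = k")
    case True
    then show False using b band_unique[of y k i i'] assms open_gap_subset gap_subset_band by blast
  next
    case False
    then have "y \<in> bands (Suc k)"
      using b assms bands_antimono[of "Suc k" k'] by (auto simp: bands_def)
    then show False using open_gap_not_bands assms by blast
  qed
qed

lemma gap_ends_in_D:
  assumes "i < 2 ^ n"
  shows "gap_lo n i \<in> D" "gap_lo n i + q ^ n \<in> D" "band_lo n i \<in> D" "band_lo n i + L * q ^ n \<in> D"
proof -
  have ends: "band_lo k j \<in> D \<and> band_lo k j + L * q ^ k \<in> D" if "j < 2 ^ k" for k j
  proof -
    have "left_end q k j \<in> cantor_set q" "left_end q k j + q ^ k \<in> cantor_set q"
      using Q.endpoint_in_cantor_set[OF that] by auto
    moreover have "band_lo k j / L = left_end q k j" "(band_lo k j + L * q ^ k) / L = left_end q k j + q ^ k"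
      using L_bounds by (auto simp: band_lo_def field_simps)
    ultimately show ?thesis by (simp add: D_iff)
  qed
  show "band_lo n i \<in> D" "band_lo n i + L * q ^ n \<in> D" using ends[OF assms] by auto
  show "gap_lo n i \<in> D" using ends[of "2 * i" "Suc n"] assms band_children(1)[of n i] by (simp add: gap_lo_def)
  show "gap_lo n i + q ^ n \<in> D"
    using ends[of "2 * i + 1" "Suc n"] assms band_children(2)[of n i] by simp
qed

lemma in_band_cases:
  assumes "y \<in> band n i"
  shows "y \<in> gap n i \<or> y \<in> band (Suc n) (2 * i) \<or> y \<in> band (Suc n) (2 * i + 1)"
  using assms band_children[of n i] gap_hi[of n i]
  by (auto simp: band_def gap_def gap_lo_def simp del: power_Suc)

text \<open>At the first level \<open>Suc k\<close> whose bands miss \<open>y\<close>, the point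
  lies in a band of level \<open>k\<close> but in neither child, hence in the gap between them; it
  is no end of the gap, as these belong to \<open>D\<close>.\<close>

lemma exists_open_gap:
  assumes "y \<in> {0..L}" "y \<notin> D"
  shows "\<exists>k i. i < 2 ^ k \<and> y \<in> open_gap k i"
proof -
  obtain n where n: "y \<notin> bands n" using assms D_iff_bands by auto
  define n0 where "n0 = (LEAST n. y \<notin> bands n)"
  have n0: "y \<notin> bands n0" unfolding n0_def using n by (rule LeastI)
  then have "n0 \<noteq> 0" using assms bands_0 by (intro notI) simp
  then obtain k where k: "n0 = Suc k" by (cases n0) auto
  then have "y \<in> bands k" using not_less_Least[of k "\<lambda>n. y \<notin> bands n"] n0_def by simp
  then obtain i where i: "i < 2 ^ k" "y \<in> band k i" by (auto simp: bands_def)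
  then have "y \<in> gap k i"
    using in_band_cases[OF i(2)] n0 k by (auto simp: bands_def)
  moreover have "y \<noteq> gap_lo k i" "y \<noteq> gap_lo k i + q ^ k" using gap_ends_in_D[OF i(1)] assms by auto
  ultimately have "y \<in> open_gap k i" by (auto simp: gap_def open_gap_def)
  then show ?thesis using i by blast
qed

lemma gap_subset_0L: "i < 2 ^ n \<Longrightarrow> gap n i \<subseteq> {0..L}"
  using gap_subset_band[of n i] bands_antimono[of 0 n] bands_0 by (auto simp: bands_def)

lemma closed_gaps_D: "closed_gaps D = {gap k i | k i. i < 2 ^ k}"
proof -
  have "0 \<in> D" "L \<in> D" using gap_ends_in_D(3,4)[of 0 0] by (auto simp: band_lo_def)
  then have "Inf D = 0" "Sup D = L" using D_subset by (auto intro!: cInf_eq_minimum cSup_eq_maximum)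
  then have eq: "closed_gaps D = closure ` components ({0..L} - D)" by (simp add: closed_gaps_def)
  \<comment> \<open>The ends of the gap are in \<open>D\<close>, so a connected set that avoids
    \<open>D\<close> and meets the open gap cannot leave it.\<close>
  have comp: "connected_component_set ({0..L} - D) y = open_gap k i"
    if y: "y \<in> open_gap k i" and i: "i < 2 ^ k" for y k i
  proof (rule connected_component_unique)
    show "open_gap k i \<subseteq> {0..L} - D"
      using gap_subset_0L[OF i] open_gap_subset[of k i] open_gap_disjoint_D[OF _ i] by blast
    show "connected (open_gap k i)" unfolding open_gap_def by simp
    fix T assume T: "y \<in> T" "T \<subseteq> {0..L} - D" "connected T"
    show "T \<subseteq> open_gap k i"
    proof
      fix z assume z: "z \<in> T"
      have "{y..z} \<subseteq> T" "{z..y} \<subseteq> T" using T z connected_contains_Icc by blast+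
      then have "gap_lo k i \<notin> {z..y}" "gap_lo k i + q ^ k \<notin> {y..z}" using T gap_ends_in_D[OF i] by blast+
      then show "z \<in> open_gap k i" using y by (auto simp: open_gap_def)
    qed
  qed (use y in auto)
  have "components ({0..L} - D) = {open_gap k i | k i. i < 2 ^ k}"
  proof (intro antisym subsetI)
    fix S assume "S \<in> components ({0..L} - D)"
    then obtain y where y: "y \<in> {0..L} - D" "S = connected_component_set ({0..L} - D) y"
      by (auto simp: components_iff)
    then obtain k i where "i < 2 ^ k" "y \<in> open_gap k i" using exists_open_gap by blast
    then show "S \<in> {open_gap k i | k i. i < 2 ^ k}" using comp y by auto
  next
    fix S assume "S \<in> {open_gap k i | k i. i < 2 ^ k}"
    then obtain k i where i: "i < 2 ^ k" "S = open_gap k i" by auto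
    have mid: "gap_lo k i + q ^ k / 2 \<in> open_gap k i" using qpow[of k] by (auto simp: open_gap_def)
    then have "gap_lo k i + q ^ k / 2 \<in> {0..L} - D"
      using gap_subset_0L[OF i(1)] open_gap_subset[of k i] open_gap_disjoint_D[OF _ i(1)] by blast
    then show "S \<in> components ({0..L} - D)" using comp[OF mid i(1)] i by (auto simp: components_iff)
  qed
  moreover have "closure (open_gap k i) = gap k i" for k i
    using qpow[of k] by (simp add: open_gap_def gap_def)
  ultimately have "closed_gaps D = closure ` {open_gap k i | k i. i < 2 ^ k}" and
    clo: "\<And>k i. closure (open_gap k i) = gap k i"
    unfolding eq by simp_all
  moreover have "closure ` {open_gap k i | k i. i < 2 ^ k} = {closure (open_gap k i) | k i. i < 2 ^ k}"
    by blast
  ultimately show ?thesis by simp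
qed

section \<open>The space X\<close>

definition X :: "(real \<times> real) set" where "X = X_space l \<nu>"

text \<open>A gap of level \<open>k\<close> has length \<open>q ^ k = l ^ (\<nu> * k)\<close>, and
  powers of \<open>l\<close> are injective in the exponent, so the base intervals have level exactly
  \<open>\<nu> * k\<close>.\<close>

lemma cubes_eq: "cubes l \<nu> = {cantor_interval l (\<nu> * k) N \<times> gap k i | k i N. i < 2 ^ k \<and> N < 2 ^ (\<nu> * k)}"
proof -
  have m: "measure lborel (gap k i) = l ^ m \<longleftrightarrow> m = \<nu> * k" for k i m
  proof -
    have "measure lborel (gap k i) = l ^ (\<nu> * k)" using qpow[of k] by (simp add: gap_def qpow_eq)
    then show ?thesis using power_inject_exp'[of l "\<nu> * k" m] l_pos l_half by auto
  qed
  show ?thesis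
  proof (intro antisym subsetI)
    fix S assume "S \<in> cubes l \<nu>"
    then obtain m j k i where "S = surviving_interval l m j \<times> gap k i" "i < 2 ^ k"
      "measure lborel (gap k i) = l ^ m" "j \<in> {1..2 ^ m}"
      unfolding cubes_def closed_gaps_D[unfolded D_def] by auto
    then show "S \<in> {cantor_interval l (\<nu> * k) N \<times> gap k i | k i N. i < 2 ^ k \<and> N < 2 ^ (\<nu> * k)}"
    proof -
      have "m = \<nu> * k" using \<open>measure lborel (gap k i) = l ^ m\<close> m by simp
      then have "S = cantor_interval l (\<nu> * k) (j - 1) \<times> gap k i" "j - 1 < 2 ^ (\<nu> * k)"
        using surviving_interval_eq[of j m l] \<open>S = _\<close> \<open>j \<in> _\<close> by auto
      then show ?thesis using \<open>i < 2 ^ k\<close> by blast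
    qed
  next
    fix S assume "S \<in> {cantor_interval l (\<nu> * k) N \<times> gap k i | k i N. i < 2 ^ k \<and> N < 2 ^ (\<nu> * k)}"
    then obtain k i N where S: "S = cantor_interval l (\<nu> * k) N \<times> gap k i" "i < 2 ^ k" "N < 2 ^ (\<nu> * k)"
      by auto
    then have "S = surviving_interval l (\<nu> * k) (Suc N) \<times> gap k i" "Suc N \<in> {1..2 ^ (\<nu> * k)}"
      using surviving_interval_eq[of "Suc N" "\<nu> * k" l] by auto
    then show "S \<in> cubes l \<nu>"
      unfolding cubes_def closed_gaps_D[unfolded D_def] using m[of k i "\<nu> * k"] S(2) by blast
  qed
qed

lemma CC_antimono: "m \<le> n \<Longrightarrow> CC n \<subseteq> CC m"
  unfolding CC_def by (rule C.cantor_level_antimono) simp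

lemma cantor_set_subset_CC: "cantor_set l \<subseteq> CC n" by (auto simp: CC_def cantor_set_eq)

lemma cantor_set_iff_CC: "x \<in> cantor_set l \<longleftrightarrow> (\<forall>n. x \<in> CC n)"
proof
  assume all: "\<forall>n. x \<in> CC n"
  show "x \<in> cantor_set l"
    unfolding cantor_set_eq
  proof
    fix m
    have "x \<in> CC m" using all by simp
    then show "x \<in> cantor_level l m"
      unfolding CC_def using C.cantor_level_antimono[of m "\<nu> * m"] \<nu> by auto
  qed
qed (use cantor_set_subset_CC in auto)

text \<open>The closure adds only \<open>cantor_set l \<times> D\<close>: each closed set
  \<open>Xn n\<close>, made of the cubes of level below \<open>n\<close> and of
  \<open>CC n \<times> bands n\<close>, contains all cubes, and a point of all \<open>Xn n\<close>
  that lies in no cube lies in every \<open>CC n \<times> bands n\<close>.\<close>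

lemma X_iff: "(x, y) \<in> X \<longleftrightarrow>
    (\<exists>k i. i < 2 ^ k \<and> x \<in> CC k \<and> y \<in> gap k i) \<or> (x \<in> cantor_set l \<and> y \<in> D)"
    (is "_ \<longleftrightarrow> ?R")
proof -
  have union: "\<Union>(cubes l \<nu>) = {(x, y). \<exists>k i. i < 2 ^ k \<and> x \<in> CC k \<and> y \<in> gap k i}"
    unfolding cubes_eq CC_def cantor_level_def by auto
  define Xn where "Xn n = (\<Union>k<n. \<Union>i<2 ^ k. CC k \<times> gap k i) \<union> CC n \<times> bands n" for n
  have "closed (Xn n)" for n
    unfolding Xn_def using closed_bands
    by (auto intro!: closed_Un closed_UN closed_Times simp: gap_def CC_def C.closed_cantor_level)
  moreover have "\<Union>(cubes l \<nu>) \<subseteq> Xn n" for n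
  proof
    fix z assume "z \<in> \<Union>(cubes l \<nu>)"
    then obtain x y k i where z: "z = (x, y)" "i < 2 ^ k" "x \<in> CC k" "y \<in> gap k i" using union by auto
    show "z \<in> Xn n"
    proof (cases "k < n")
      case True then show ?thesis using z by (auto simp: Xn_def)
    next
      case False
      then have "x \<in> CC n" "y \<in> bands n"
      proof -
        show "x \<in> CC n" using z False CC_antimono[of n k] by auto
        have "y \<in> bands k" using z gap_subset_band[of k i] unfolding bands_def by blast
        then show "y \<in> bands n" using False bands_antimono[of n k] by auto
      qed
      then show ?thesis using z by (simp add: Xn_def)
    qed
  qed
  ultimately have "X \<subseteq> Xn n" for n unfolding X_def X_space_def by (intro closure_minimal)
  then have "?R" if "(x, y) \<in> X"
  proof (cases "\<exists>k i. i < 2 ^ k \<and> x \<in> CC k \<and> y \<in> gap k i")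
    case False
    have "x \<in> CC n \<and> y \<in> bands n" for n
    proof -
      have "(x, y) \<notin> (\<Union>k<n. \<Union>i<2 ^ k. CC k \<times> gap k i)" using False by blast
      moreover have "(x, y) \<in> Xn n" using \<open>\<And>n. X \<subseteq> Xn n\<close> that by blast
      ultimately show ?thesis unfolding Xn_def by blast
    qed
    then show ?thesis by (simp add: cantor_set_iff_CC D_iff_bands)
  qed blast
  moreover have "(x, y) \<in> X" if ?R
    using that
  proof
    assume "\<exists>k i. i < 2 ^ k \<and> x \<in> CC k \<and> y \<in> gap k i"
    then have "(x, y) \<in> \<Union>(cubes l \<nu>)" unfolding union by blast
    then show ?thesis unfolding X_def X_space_def by (rule subsetD[OF closure_subset])
  next
    assume xy: "x \<in> cantor_set l \<and> y \<in> D"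
    show ?thesis
      unfolding X_def X_space_def closure_approachable
    proof (intro allI impI)
      fix e :: real assume "0 < e"
      then obtain n where n: "2 * q ^ n < e"
        using order_tendstoD(2)[OF Q.apow_tendsto, of e 2] by (auto simp: eventually_sequentially)
      have "y \<in> bands n" using xy D_iff_bands by blast
      then obtain i where i: "i < 2 ^ n" "y \<in> band n i" unfolding bands_def by blast
      \<comment> \<open>As \<open>x\<close> lies in every \<open>CC n\<close>, only the height has
        to move, to the gap of level \<open>n\<close> in the band around \<open>y\<close>.\<close>
      have "gap_lo n i \<in> band n i" "gap_lo n i \<in> gap n i"
        using gap_subset_band[of n i] qpow[of n] by (auto simp: gap_def)
      then have "\<bar>gap_lo n i - y\<bar> \<le> L * q ^ n" using i by (auto simp: band_def)
      also have "\<dots> \<le> 2 * q ^ n" using L_bounds qpow[of n] by (intro mult_right_mono) auto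
      finally have "dist (x, gap_lo n i) (x, y) < e" using n by (simp add: dist_Pair_Pair dist_real_def)
      moreover have "(x, gap_lo n i) \<in> \<Union>(cubes l \<nu>)"
        unfolding union using i xy cantor_set_subset_CC \<open>gap_lo n i \<in> gap n i\<close> by blast
      ultimately show "\<exists>z\<in>\<Union>(cubes l \<nu>). dist z (x, y) < e" by blast
    qed
  qed
  ultimately show ?thesis by blast
qed

lemma closed_X: "closed X" by (simp add: X_def X_space_def)

end

section \<open>The local geometry of X\<close>

lemma ldist_segment:
  assumes "closed_segment p q \<subseteq> X"
  shows "ldist X p q \<le> ennreal (dist p q)"
proof -
  have "ldist X (linepath p q 0) (linepath p q 1) \<le> ennreal (dist p q * (1 - 0))"
  proof (rule ldist_lipschitz)
    fix x y :: real assume "0 \<le> x" "x \<le> y" "y \<le> 1"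
    have "linepath p q x - linepath p q y = (x - y) *\<^sub>R (q - p)"
      by (simp add: linepath_def algebra_simps)
    then show "dist (linepath p q x) (linepath p q y) \<le> dist p q * (y - x)"
      using \<open>x \<le> y\<close> by (simp add: dist_norm norm_minus_commute mult.commute)
  next
    fix x :: real assume "0 \<le> x" "x \<le> 1"
    then show "linepath p q x \<in> X" using assms linepath_in_path[of x p q] by auto
  qed auto
  then show ?thesis by (simp add: linepath_def)
qed

lemma dist_Pair_le: "dist (x, y) (x', y') \<le> \<bar>x - x'\<bar> + \<bar>y - y'\<bar>" for x y x' y' :: real
  unfolding dist_Pair_Pair dist_real_def using sqrt_sum_squares_le_sum_abs[of "x - x'" "y - y'"] by simp

lemma closed_segment_Times_subset:
  assumes "p \<in> A \<times> B" "p' \<in> A \<times> B" "convex A" "convex B" "A \<times> B \<subseteq> S"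
  shows "closed_segment p p' \<subseteq> S"
  using closed_segment_subset[OF assms(1,2) convex_Times[OF assms(3,4)]] assms(5) by blast

context cantor_space
begin

lemma convex_cantor_interval: "convex (cantor_interval a m N)"
  by (simp add: cantor_interval_def)

lemma convex_gap: "convex (gap k i)" by (simp add: gap_def)

lemma cube_subset_X:
  assumes "i < 2 ^ k" "N < 2 ^ (\<nu> * k)"
  shows "cantor_interval l (\<nu> * k) N \<times> gap k i \<subseteq> X"
proof
  fix z assume "z \<in> cantor_interval l (\<nu> * k) N \<times> gap k i"
  then obtain x y where z: "z = (x, y)" "x \<in> cantor_interval l (\<nu> * k) N" "y \<in> gap k i" by auto
  then have "x \<in> CC k" unfolding CC_def cantor_level_def using assms by blast
  then show "z \<in> X" unfolding z X_iff using z assms by blast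
qed

lemma line_subset_X:
  assumes "x \<in> cantor_set l"
  shows "{x} \<times> {0..L} \<subseteq> X"
proof
  fix z assume "z \<in> {x} \<times> {0..L}"
  then obtain y where z: "z = (x, y)" "y \<in> {0..L}" by auto
  show "z \<in> X"
  proof (cases "y \<in> D")
    case True then show ?thesis unfolding z X_iff using assms by blast
  next
    case False
    then obtain k i where "i < 2 ^ k" "y \<in> open_gap k i" using exists_open_gap z by blast
    then show ?thesis unfolding z X_iff using assms cantor_set_subset_CC open_gap_subset by blast
  qed
qed

lemma X_snd: "(x, y) \<in> X \<Longrightarrow> y \<in> {0..L}"
  unfolding X_iff using gap_subset_0L D_subset by blast

lemma X_fst:
  assumes "(x, y) \<in> X"
  shows "x \<in> {0..1}"
proof -
  obtain k where "x \<in> CC k" using assms cantor_set_subset_CC unfolding X_iff by blast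
  then show ?thesis unfolding CC_def using C.cantor_level_01 by blast
qed

section \<open>Towers: the pieces of X at scale \<open>q ^ n\<close>\<close>

definition margin :: real where "margin = (1 - 2 * l) / 2"

lemma margin: "0 < margin" "margin \<le> 1 / 2" "2 * margin = 1 - 2 * l"
  using l_pos l_half by (auto simp: margin_def)

text \<open>Base intervals of this level are at least \<open>2 * margin * q ^ n\<close> apart, so
  the enlarged interval meets no other one.\<close>

definition window :: "nat \<Rightarrow> nat \<Rightarrow> real set" where
  "window n N = {left_end l (\<nu> * n) N - margin * q ^ n .. left_end l (\<nu> * n) N + q ^ n + margin * q ^ n}"

text \<open>Bands of level \<open>n\<close> are at least \<open>q ^ n\<close> apart
  (\<open>band_separated\<close>); half of that on either side keeps this band the nearest
  one.\<close>

definition span :: "nat \<Rightarrow> nat \<Rightarrow> real set" where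
  "span n i = {band_lo n i - q ^ n / 2 .. band_lo n i + L * q ^ n + q ^ n / 2}"

text \<open>The shape of a small ball that is not contained in one large cube. Besides the cubes
  inside the band, a tower reaches into the larger cubes above and below it, which is the purpose of
  the enlargements.\<close>

definition tower :: "nat \<Rightarrow> nat \<Rightarrow> nat \<Rightarrow> (real \<times> real) set" where
  "tower n N i = X \<inter> (window n N \<times> span n i)"

text \<open>A point of the window is within \<open>margin * q ^ n\<close> of the base interval, less
  than the separation at the coarser of the two levels; hence the two addresses agree there.\<close>

lemma window_interval:
  assumes x: "x \<in> window n N" "x \<in> cantor_interval l (\<nu> * m) N'" and N: "N < 2 ^ (\<nu> * n)" "N' < 2 ^ (\<nu> * m)"
  shows "n \<le> m \<Longrightarrow> N' div 2 ^ (\<nu> * m - \<nu> * n) = N" "m < n \<Longrightarrow> N' = N div 2 ^ (\<nu> * n - \<nu> * m)"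
proof -
  \<comment> \<open>The point of the base interval nearest to \<open>x\<close>.\<close>
  define x0 where "x0 = max (left_end l (\<nu> * n) N) (min x (left_end l (\<nu> * n) N + q ^ n))"
  have x0: "x0 \<in> cantor_interval l (\<nu> * n) N" "\<bar>x - x0\<bar> \<le> margin * q ^ n"
    using x(1) qpow[of n] mult_pos_pos[OF margin(1) qpow(1)[of n]]
    by (auto simp: x0_def cantor_interval_def qpow_eq window_def max_def min_def)
  show "N' div 2 ^ (\<nu> * m - \<nu> * n) = N" if "n \<le> m"
  proof (rule C.cantor_interval_separated[OF _ x0(1) _ N(1)])
    show "x \<in> cantor_interval l (\<nu> * n) (N' div 2 ^ (\<nu> * m - \<nu> * n))"
      using C.cantor_interval_subset[of "\<nu> * n" "\<nu> * m" N'] x(2) that by auto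
    show "N' div 2 ^ (\<nu> * m - \<nu> * n) < 2 ^ (\<nu> * n)"
      using C.div_less_pow[OF N(2)] that by simp
    have "margin * q ^ n < 2 * margin * q ^ n" using margin(1) qpow[of n] by simp
    then show "\<bar>x - x0\<bar> < (1 - 2 * l) * l ^ (\<nu> * n)"
      unfolding margin(3)[symmetric] qpow_eq using x0(2) by linarith
  qed
  show "N' = N div 2 ^ (\<nu> * n - \<nu> * m)" if "m < n"
  proof (rule C.cantor_interval_separated[OF x(2) _ N(2)])
    show "x0 \<in> cantor_interval l (\<nu> * m) (N div 2 ^ (\<nu> * n - \<nu> * m))"
      using C.cantor_interval_subset[of "\<nu> * m" "\<nu> * n" N] x0(1) that by auto
    show "N div 2 ^ (\<nu> * n - \<nu> * m) < 2 ^ (\<nu> * m)"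
      using C.div_less_pow[OF N(1)] that by simp
    have "margin * q ^ n \<le> margin * q ^ m"
      using margin(1) q_pos q_quarter that by (intro mult_left_mono power_decreasing) auto
    also have "\<dots> < 2 * margin * q ^ m" using margin(1) qpow[of m] by simp
    finally show "\<bar>x - x0\<bar> < (1 - 2 * l) * l ^ (\<nu> * m)"
      unfolding margin(3)[symmetric] qpow_eq using x0(2) by linarith
  qed
qed

text \<open>Different cubes communicate only through lines over the Cantor set, so each point is
  first moved horizontally to such a line: inside a cube of level at least \<open>n\<close> to the
  left end of its own base, inside a larger cube to the left end of the base interval of the
  tower.\<close>

lemma tower_connect:
  assumes z: "(x, y) \<in> tower n N i" and N: "N < 2 ^ (\<nu> * n)"
  shows "\<exists>\<xi>. \<xi> \<in> cantor_set l \<and> \<xi> \<in> cantor_interval l (\<nu> * n) N \<and> closed_segment (x, y) (\<xi>, y) \<subseteq> X"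
proof -
  have w: "x \<in> window n N" using z by (simp add: tower_def)
  have "(x, y) \<in> X" using z by (simp add: tower_def)
  then consider (D) "x \<in> cantor_set l" "y \<in> D" | (gap) k j where "j < 2 ^ k" "x \<in> CC k" "y \<in> gap k j"
    unfolding X_iff by blast
  then show ?thesis
  proof cases
    case D
    then have "x \<in> CC n" using cantor_set_subset_CC by blast
    then obtain N' where N': "N' < 2 ^ (\<nu> * n)" "x \<in> cantor_interval l (\<nu> * n) N'"
      by (auto simp: CC_def cantor_level_def)
    then have "N' = N" using window_interval(1)[OF w N'(2) N N'(1)] by simp
    then show ?thesis using D N' \<open>(x, y) \<in> X\<close> by (intro exI[of _ x]) simp
  next
    case (gap k j)
    then obtain N' where N': "N' < 2 ^ (\<nu> * k)" "x \<in> cantor_interval l (\<nu> * k) N'"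
      by (auto simp: CC_def cantor_level_def)
    have seg: "closed_segment (x, y) (\<xi>, y) \<subseteq> X" if "\<xi> \<in> cantor_interval l (\<nu> * k) N'" for \<xi>
      by (rule closed_segment_Times_subset[OF _ _ convex_cantor_interval convex_gap cube_subset_X[OF gap(1) N'(1)]])
        (use N' gap that in auto)
    have end_in: "left_end l m M \<in> cantor_interval l m M" for m M
      using C.apow[of m] by (simp add: cantor_interval_def)
    show ?thesis
    proof (cases "n \<le> k")
      case True
      have "left_end l (\<nu> * k) N' \<in> cantor_interval l (\<nu> * n) (N' div 2 ^ (\<nu> * k - \<nu> * n))"
        using C.cantor_interval_subset[of "\<nu> * n" "\<nu> * k" N'] True end_in by auto
      then have "left_end l (\<nu> * k) N' \<in> cantor_interval l (\<nu> * n) N"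
        using window_interval(1)[OF w N'(2) N N'(1)] True by simp
      then show ?thesis
        using C.endpoint_in_cantor_set[OF N'(1)] seg[OF end_in] by blast
    next
      case False
      have "left_end l (\<nu> * n) N \<in> cantor_interval l (\<nu> * k) (N div 2 ^ (\<nu> * n - \<nu> * k))"
        using C.cantor_interval_subset[of "\<nu> * k" "\<nu> * n" N] False end_in by auto
      then have "left_end l (\<nu> * n) N \<in> cantor_interval l (\<nu> * k) N'"
        using window_interval(2)[OF w N'(2) N N'(1)] False by simp
      then show ?thesis
        using C.endpoint_in_cantor_set[OF N] seg end_in by blast
    qed
  qed
qed

text \<open>Each point goes horizontally to a line (at most \<open>2 * q ^ n\<close>) and vertically
  to the bottom of the gap \<open>gap n i\<close> (at most \<open>3 * q ^ n\<close>); the cube over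
  that gap joins the two lines (at most \<open>q ^ n\<close>). The total is 5 + 1 + 5.\<close>

lemma ldist_tower:
  assumes z: "z \<in> tower n N i" "z' \<in> tower n N i" and N: "N < 2 ^ (\<nu> * n)" and i: "i < 2 ^ n"
  shows "ldist X z z' \<le> ennreal (11 * q ^ n)"
proof -
  let ?m = "gap_lo n i"
  have m: "?m \<in> gap n i" using qpow[of n] by (simp add: gap_def)
  then have m0: "?m \<in> {0..L}" using gap_subset_0L[OF i] by blast
  have m1: "?m \<in> band n i" using m gap_subset_band by blast
  have half: "\<exists>\<xi>. \<xi> \<in> cantor_interval l (\<nu> * n) N \<and> ldist X (x, y) (\<xi>, ?m) \<le> ennreal (5 * q ^ n)"
    if xy: "(x, y) \<in> tower n N i" for x y
  proof -
    obtain \<xi> where \<xi>: "\<xi> \<in> cantor_set l" "\<xi> \<in> cantor_interval l (\<nu> * n) N" "closed_segment (x, y) (\<xi>, y) \<subseteq> X"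
      using tower_connect[OF xy N] by blast
    have "\<bar>x - \<xi>\<bar> \<le> q ^ n + margin * q ^ n"
      using xy \<xi>(2) mult_pos_pos[OF margin(1) qpow(1)[of n]]
      by (auto simp: tower_def window_def cantor_interval_def qpow_eq)
    also have "margin * q ^ n \<le> 1 / 2 * q ^ n" using margin qpow[of n] by (intro mult_right_mono) auto
    finally have x: "\<bar>x - \<xi>\<bar> \<le> 2 * q ^ n" using qpow[of n] by simp
    have "L * q ^ n \<le> 2 * q ^ n" using L_bounds qpow[of n] by (intro mult_right_mono) auto
    then have y: "\<bar>y - ?m\<bar> \<le> 3 * q ^ n"
      using xy m1 qpow(1)[of n] unfolding tower_def span_def band_def mem_Sigma_iff Int_iff atLeastAtMost_iff
      by linarith
    have "y \<in> {0..L}" using xy X_snd by (auto simp: tower_def)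
    then have "closed_segment (\<xi>, y) (\<xi>, ?m) \<subseteq> X"
      by (intro closed_segment_Times_subset[OF _ _ _ _ line_subset_X[OF \<xi>(1)]]) (use m0 in auto)
    then have "ldist X (\<xi>, y) (\<xi>, ?m) \<le> ennreal (dist (\<xi>, y) (\<xi>, ?m))" by (rule ldist_segment)
    also have "\<dots> \<le> ennreal (3 * q ^ n)"
      using dist_Pair_le[of \<xi> y \<xi> ?m] y by (intro ennreal_leI) simp
    finally have 1: "ldist X (\<xi>, y) (\<xi>, ?m) \<le> ennreal (3 * q ^ n)" .
    have "ldist X (x, y) (\<xi>, y) \<le> ennreal (dist (x, y) (\<xi>, y))" by (rule ldist_segment[OF \<xi>(3)])
    also have "\<dots> \<le> ennreal (2 * q ^ n)"
      using dist_Pair_le[of x y \<xi> y] x by (intro ennreal_leI) simp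
    finally have "ldist X (x, y) (\<xi>, y) \<le> ennreal (2 * q ^ n)" .
    then have "ldist X (x, y) (\<xi>, ?m) \<le> ennreal (2 * q ^ n) + ennreal (3 * q ^ n)"
      using ldist_triangle[of X "(x, y)" "(\<xi>, ?m)" "(\<xi>, y)"] 1 by (meson add_mono order_trans)
    also have "\<dots> = ennreal (5 * q ^ n)" using qpow[of n] by (subst ennreal_plus[symmetric]) auto
    finally show ?thesis using \<xi>(2) by blast
  qed
  obtain \<xi> where \<xi>: "\<xi> \<in> cantor_interval l (\<nu> * n) N" "ldist X z (\<xi>, ?m) \<le> ennreal (5 * q ^ n)"
    using half[of "fst z" "snd z"] z by auto
  obtain \<xi>' where \<xi>': "\<xi>' \<in> cantor_interval l (\<nu> * n) N" "ldist X z' (\<xi>', ?m) \<le> ennreal (5 * q ^ n)"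
    using half[of "fst z'" "snd z'"] z by auto
  have "closed_segment (\<xi>, ?m) (\<xi>', ?m) \<subseteq> X"
    by (rule closed_segment_Times_subset[OF _ _ convex_cantor_interval convex_gap cube_subset_X[OF i N]])
      (use \<xi> \<xi>' m in auto)
  then have "ldist X (\<xi>, ?m) (\<xi>', ?m) \<le> ennreal (dist (\<xi>, ?m) (\<xi>', ?m))" by (rule ldist_segment)
  also have "\<dots> \<le> ennreal (q ^ n)"
    using dist_Pair_le[of \<xi> ?m \<xi>' ?m] \<xi> \<xi>' by (intro ennreal_leI) (auto simp: cantor_interval_def qpow_eq)
  finally have mid: "ldist X (\<xi>, ?m) (\<xi>', ?m) \<le> ennreal (q ^ n)" .
  have "ldist X z z' \<le> ldist X z (\<xi>, ?m) + (ldist X (\<xi>, ?m) (\<xi>', ?m) + ldist X (\<xi>', ?m) z')"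
    using ldist_triangle[of X z z' "(\<xi>, ?m)"] ldist_triangle[of X "(\<xi>, ?m)" z' "(\<xi>', ?m)"]
    by (meson add_left_mono order_trans)
  also have "\<dots> \<le> ennreal (5 * q ^ n) + (ennreal (q ^ n) + ennreal (5 * q ^ n))"
    using \<xi> \<xi>' mid by (intro add_mono) (auto simp: ldist_commute)
  also have "\<dots> = ennreal (11 * q ^ n)" using qpow[of n] by (subst ennreal_plus[symmetric], simp, simp)+ simp
  finally show ?thesis .
qed

lemma X_subset_tower: "X \<subseteq> tower 0 0 0"
proof
  fix z assume z: "z \<in> X"
  then have "fst z \<in> {0..1}" "snd z \<in> {0..L}" using X_fst[of "fst z" "snd z"] X_snd[of "fst z" "snd z"] by auto
  then show "z \<in> tower 0 0 0"
    using z margin(1) by (cases z) (auto simp: tower_def window_def span_def band_lo_def)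
qed

lemma ldist_finite:
  assumes "p \<in> X" "p' \<in> X"
  shows "ldist X p p' < \<infinity>"
proof -
  have "ldist X p p' \<le> ennreal (11 * q ^ 0)"
    using assms X_subset_tower by (intro ldist_tower) auto
  also have "\<dots> < \<infinity>" by simp
  finally show ?thesis .
qed

sublocale MX: Metric_space X "length_dist X"
  by (rule Metric_space_length_dist) (rule ldist_finite)

lemma length_dist_le: "ldist X p p' \<le> ennreal c \<Longrightarrow> 0 \<le> c \<Longrightarrow> length_dist X p p' \<le> c"
  by (simp add: length_dist_eq enn2real_leI)

lemma dist_le_length_dist: "p \<in> X \<Longrightarrow> p' \<in> X \<Longrightarrow> dist p p' \<le> length_dist X p p'"
  using dist_le_ldist[of p p' X] ldist_finite[of p p']
  by (cases "ldist X p p'") (auto simp: length_dist_eq)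

text \<open>For \<open>k \<le> k'\<close> the band around the gap of level \<open>k'\<close> misses
  the open gap of level \<open>k\<close>, hence lies on one side of it. Inside that band the gap is
  padded on both sides by a child band of length \<open>L * q ^ Suc k'\<close>, and this is at least
  \<open>L * q ^ n\<close>.\<close>

lemma gap_separated:
  assumes "(k, j) \<noteq> (k', j')" "k < n" "k' < n" "j < 2 ^ k" "j' < 2 ^ k'" "y \<in> gap k j" "y' \<in> gap k' j'"
  shows "L * q ^ n \<le> \<bar>y - y'\<bar>"
proof -
  have *: "L * q ^ n \<le> \<bar>y - y'\<bar>"
    if "(k, j) \<noteq> (k', j')" "k \<le> k'" "k' < n" "j < 2 ^ k" "j' < 2 ^ k'" "y \<in> gap k j" "y' \<in> gap k' j'"
    for k j k' j' y y'
  proof -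
    let ?A = "gap_lo k j" and ?B = "gap_lo k j + q ^ k"
    let ?e = "band_lo k' j'" and ?f = "band_lo k' j' + L * q ^ k'"
    have AB: "?A < ?B" using qpow[of k] by simp
    have ef: "?e \<le> ?f" using L_bounds qpow[of k'] by simp
    have disj: "t \<notin> {?e..?f}" if "?A < t" "t < ?B" for t
      using open_gap_disjoint_band[of t k j k' j'] that \<open>(k, j) \<noteq> (k', j')\<close> \<open>k \<le> k'\<close> \<open>j < 2 ^ k\<close> \<open>j' < 2 ^ k'\<close>
      by (auto simp: open_gap_def band_def)
    have "?B \<le> ?e \<or> ?f \<le> ?A"
    proof (rule ccontr)
      assume "\<not> (?B \<le> ?e \<or> ?f \<le> ?A)"
      then have lt: "?e < ?B" "?A < ?f" by auto
      show False
      proof (cases "?A < ?e")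
        case True
        then show False using disj[of ?e] lt ef by simp
      next
        case False
        have m: "?A < (?A + ?B) / 2" "(?A + ?B) / 2 < ?B" using AB by auto
        show False
        proof (cases "?f \<le> (?A + ?B) / 2")
          case True
          then show False using disj[of ?f] lt ef m unfolding atLeastAtMost_iff by linarith
        next
          case f: False
          show False using disj[of "(?A + ?B) / 2"] f False m unfolding atLeastAtMost_iff by linarith
        qed
      qed
    qed
    moreover have "L * q ^ n \<le> L * q ^ Suc k'"
      using L_bounds q_pos q_quarter \<open>k' < n\<close> by (intro mult_left_mono power_decreasing) auto
    ultimately show ?thesis
      using \<open>y \<in> gap k j\<close> \<open>y' \<in> gap k' j'\<close> gap_hi[of k' j']
      by (auto simp: gap_def gap_lo_def[of k' j'] simp del: power_Suc)
  qed
  show ?thesis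
    using *[of k j k' j' y y'] *[of k' j' k j y' y] assms by (cases "k \<le> k'") (auto simp: abs_minus_commute)
qed

section \<open>Small balls, the topology and the size of balls\<close>

lemma X_band_or_cube:
  assumes "(x, y) \<in> X"
  shows "(\<exists>N i. N < 2 ^ (\<nu> * n) \<and> i < 2 ^ n \<and> x \<in> cantor_interval l (\<nu> * n) N \<and> y \<in> band n i) \<or>
    (\<exists>k j N. k < n \<and> j < 2 ^ k \<and> N < 2 ^ (\<nu> * k) \<and> x \<in> cantor_interval l (\<nu> * k) N \<and> y \<in> gap k j)"
proof -
  have band: ?thesis if "x \<in> CC n" "y \<in> bands n"
    using that unfolding CC_def cantor_level_def bands_def by blast
  consider (D) "x \<in> cantor_set l" "y \<in> D" | (gap) k j where "j < 2 ^ k" "x \<in> CC k" "y \<in> gap k j"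
    using assms unfolding X_iff by blast
  then show ?thesis
  proof cases
    case D
    then show ?thesis using band cantor_set_subset_CC D_iff_bands by blast
  next
    case (gap k j)
    show ?thesis
    proof (cases "k < n")
      case True
      then show ?thesis using gap unfolding CC_def cantor_level_def by blast
    next
      case False
      have "y \<in> bands k" using gap gap_subset_band unfolding bands_def by blast
      then show ?thesis using band gap False CC_antimono[of n k] bands_antimono[of n k] by auto
    qed
  qed
qed

text \<open>If some point of the ball lies over a band and a base interval of level
  \<open>n\<close>, the enlargements capture the whole ball in that tower. Otherwise all its points
  lie in cubes of level below \<open>n\<close>, and two different ones are farther apart than the
  diameter of the ball.\<close>

lemma ball_cases:
  assumes z: "z \<in> X" and \<rho>: "0 < \<rho>" "2 * \<rho> \<le> margin * q ^ n"
  shows "(\<exists>N i. N < 2 ^ (\<nu> * n) \<and> i < 2 ^ n \<and> X \<inter> ball z \<rho> \<subseteq> tower n N i) \<or>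
    (\<exists>k j N. k < n \<and> j < 2 ^ k \<and> N < 2 ^ (\<nu> * k) \<and> X \<inter> ball z \<rho> \<subseteq> cantor_interval l (\<nu> * k) N \<times> gap k j)"
proof -
  have near: "\<bar>fst p - fst p'\<bar> < margin * q ^ n" "\<bar>snd p - snd p'\<bar> < margin * q ^ n"
    if "p \<in> ball z \<rho>" "p' \<in> ball z \<rho>" for p p'
  proof -
    have "dist p p' < 2 * \<rho>" using that dist_triangle2[of p p' z] by (auto simp: dist_commute)
    then show "\<bar>fst p - fst p'\<bar> < margin * q ^ n" "\<bar>snd p - snd p'\<bar> < margin * q ^ n"
      using dist_fst_le[of p p'] dist_snd_le[of p p'] \<rho> unfolding dist_real_def by linarith+
  qed
  have mq: "margin * q ^ n \<le> 1 / 2 * q ^ n" using margin qpow[of n] by (intro mult_right_mono) auto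
  show ?thesis
  proof (cases "\<exists>p N i. p \<in> X \<inter> ball z \<rho> \<and> N < 2 ^ (\<nu> * n) \<and> i < 2 ^ n \<and>
      fst p \<in> cantor_interval l (\<nu> * n) N \<and> snd p \<in> band n i")
    case True
    then obtain p N i where p: "p \<in> X \<inter> ball z \<rho>" "N < 2 ^ (\<nu> * n)" "i < 2 ^ n"
      "fst p \<in> cantor_interval l (\<nu> * n) N" "snd p \<in> band n i" by blast
    have "X \<inter> ball z \<rho> \<subseteq> tower n N i"
    proof
      fix p' assume p': "p' \<in> X \<inter> ball z \<rho>"
      then have "fst p' \<in> window n N" "snd p' \<in> span n i"
        using near[of p p'] p mq by (auto simp: window_def span_def cantor_interval_def band_def qpow_eq)
      then show "p' \<in> tower n N i" using p' by (cases p') (auto simp: tower_def)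
    qed
    then show ?thesis using p by blast
  next
    case False
    have cube: "\<exists>k j N. k < n \<and> j < 2 ^ k \<and> N < 2 ^ (\<nu> * k) \<and> fst p \<in> cantor_interval l (\<nu> * k) N \<and> snd p \<in> gap k j"
      if "p \<in> X \<inter> ball z \<rho>" for p
      using X_band_or_cube[of "fst p" "snd p" n] False that unfolding prod.collapse Int_iff by blast
    have zz: "z \<in> X \<inter> ball z \<rho>" using z \<rho> by simp
    obtain k j N where k: "k < n" "j < 2 ^ k" "N < 2 ^ (\<nu> * k)" "fst z \<in> cantor_interval l (\<nu> * k) N" "snd z \<in> gap k j"
      using cube[OF zz] by blast
    have "X \<inter> ball z \<rho> \<subseteq> cantor_interval l (\<nu> * k) N \<times> gap k j"
    proof
      fix p assume p: "p \<in> X \<inter> ball z \<rho>"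
      obtain k' j' N' where k': "k' < n" "j' < 2 ^ k'" "N' < 2 ^ (\<nu> * k')"
        "fst p \<in> cantor_interval l (\<nu> * k') N'" "snd p \<in> gap k' j'"
        using cube[OF p] by blast
      have "(k, j) = (k', j')"
      proof (rule ccontr)
        assume "(k, j) \<noteq> (k', j')"
        then have "L * q ^ n \<le> \<bar>snd z - snd p\<bar>" using k k' by (intro gap_separated) auto
        moreover have "1 * q ^ n \<le> L * q ^ n" using L_bounds qpow[of n] by (intro mult_right_mono) auto
        moreover have "\<bar>snd z - snd p\<bar> < margin * q ^ n" using near(2)[of z p] zz p by blast
        ultimately show False using mq qpow(1)[of n] by linarith
      qed
      moreover have "N' = N"
      proof (rule C.cantor_interval_separated)
        have "margin * q ^ n \<le> margin * q ^ k"
          using margin(1) q_pos q_quarter k(1) by (intro mult_left_mono power_decreasing) auto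
        also have "\<dots> < 2 * margin * q ^ k" using margin(1) qpow[of k] by simp
        finally show "\<bar>fst p - fst z\<bar> < (1 - 2 * l) * l ^ (\<nu> * k)"
          unfolding margin(3)[symmetric] qpow_eq using near(1)[of p z] zz p by auto
      qed (use k k' calculation in auto)
      ultimately show "p \<in> cantor_interval l (\<nu> * k) N \<times> gap k j" using k' by (cases p) auto
    qed
    then show ?thesis using k by blast
  qed
qed

text \<open>In a tower \<open>ldist_tower\<close> applies, and in a cube the segment is available.
  With \<open>dist_le_length_dist\<close> this identifies the topology of the length metric with the
  Euclidean one, so continuity and Borel sets are the usual ones.\<close>

lemma length_dist_le_near:
  assumes z: "z \<in> X" "z' \<in> X" and d: "2 * dist z z' < margin * q ^ n"
  shows "length_dist X z z' \<le> 12 * q ^ n"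
proof (cases "z = z'")
  case True then show ?thesis using z qpow[of n] by simp
next
  case False
  define \<rho> where "\<rho> = margin * q ^ n / 2"
  have \<rho>: "0 < \<rho>" "2 * \<rho> \<le> margin * q ^ n" using margin(1) qpow[of n] by (auto simp: \<rho>_def)
  have zz: "z \<in> X \<inter> ball z \<rho>" "z' \<in> X \<inter> ball z \<rho>" using z d \<rho> by (auto simp: \<rho>_def)
  from ball_cases[OF z(1) \<rho>] show ?thesis
  proof (elim disjE exE conjE)
    fix N i assume "N < 2 ^ (\<nu> * n)" "i < 2 ^ n" "X \<inter> ball z \<rho> \<subseteq> tower n N i"
    then have "ldist X z z' \<le> ennreal (11 * q ^ n)" using zz by (intro ldist_tower) auto
    then have "length_dist X z z' \<le> 11 * q ^ n" using qpow[of n] by (intro length_dist_le) auto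
    then show ?thesis using qpow[of n] by simp
  next
    fix k j N assume k: "k < n" "j < 2 ^ k" "N < 2 ^ (\<nu> * k)"
      "X \<inter> ball z \<rho> \<subseteq> cantor_interval l (\<nu> * k) N \<times> gap k j"
    have "closed_segment z z' \<subseteq> X"
      by (rule closed_segment_Times_subset[OF _ _ convex_cantor_interval convex_gap cube_subset_X[OF k(2,3)]])
        (use k(4) zz in auto)
    then have "length_dist X z z' \<le> dist z z'" using ldist_segment[of z z'] by (intro length_dist_le) auto
    also have "\<dots> \<le> margin * q ^ n" using d zero_le_dist[of z z'] by linarith
    also have "\<dots> \<le> 12 * q ^ n" using margin qpow[of n] by (intro mult_right_mono) auto
    finally show ?thesis .
  qed
qed

lemma mtopology_X: "MX.mtopology = top_of_set X"
  unfolding topology_eq MX.openin_mtopology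
proof (intro allI iffI)
  fix U assume U: "U \<subseteq> X \<and> (\<forall>x. x \<in> U \<longrightarrow> (\<exists>r>0. MX.mball x r \<subseteq> U))"
  show "openin (top_of_set X) U"
    unfolding openin_contains_ball
  proof (intro conjI ballI)
    fix x assume x: "x \<in> U"
    then have xX: "x \<in> X" using U by blast
    obtain r where r: "r > 0" "MX.mball x r \<subseteq> U" using U x by blast
    obtain n where n: "12 * q ^ n < r"
      using order_tendstoD(2)[OF Q.apow_tendsto r(1), of 12] by (auto simp: eventually_sequentially)
    have "ball x (margin * q ^ n / 2) \<inter> X \<subseteq> U"
    proof
      fix y assume y: "y \<in> ball x (margin * q ^ n / 2) \<inter> X"
      then have "length_dist X x y \<le> 12 * q ^ n" using xX by (intro length_dist_le_near) auto
      then have "y \<in> MX.mball x r" using n xX y by simp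
      then show "y \<in> U" using r(2) by blast
    qed
    then show "\<exists>e>0. ball x e \<inter> X \<subseteq> U"
      using margin(1) qpow[of n] by (intro exI[of _ "margin * q ^ n / 2"]) auto
  qed (use U in auto)
next
  fix U assume U: "openin (top_of_set X) U"
  show "U \<subseteq> X \<and> (\<forall>x. x \<in> U \<longrightarrow> (\<exists>r>0. MX.mball x r \<subseteq> U))"
  proof (intro conjI allI impI)
    fix x assume x: "x \<in> U"
    then obtain e where e: "e > 0" "ball x e \<inter> X \<subseteq> U" using U unfolding openin_contains_ball by blast
    have "MX.mball x e \<subseteq> U"
    proof
      fix y assume "y \<in> MX.mball x e"
      then show "y \<in> U" using e(2) dist_le_length_dist[of x y] by auto
    qed
    then show "\<exists>r>0. MX.mball x r \<subseteq> U" using e by blast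
  qed (use openin_imp_subset[OF U] in auto)
qed

text \<open>At a level with \<open>12 * q ^ n \<le> \<rho>\<close> the ball swallows the tower
  around its centre, which contains the cube over \<open>gap n i\<close>; if the centre lies in a
  larger cube instead, a subsquare through the centre will do.\<close>

lemma ball_contains_square:
  assumes z: "z \<in> X" and \<rho>: "0 < \<rho>" "\<rho> \<le> 1"
  shows "\<exists>a b. {a..a + q * \<rho> / 24} \<times> {b..b + q * \<rho> / 24} \<subseteq> MX.mball z \<rho>"
proof -
  obtain m where m: "12 * q ^ Suc m \<le> \<rho>" "\<rho> < 12 * q ^ m"
    using Q.exists_scale[of 12 \<rho>] \<rho> by auto
  define n where "n = Suc m"
  have n: "12 * q ^ n \<le> \<rho>" using m by (simp add: n_def)
  have "q * \<rho> \<le> q * (12 * q ^ m)" using m(2) q_pos by (intro mult_left_mono) auto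
  then have s: "q * \<rho> / 24 \<le> q ^ n / 2" by (simp add: n_def algebra_simps)
  define s where "s = q * \<rho> / 24"
  have s': "0 < s" "s \<le> q ^ n / 2" using s \<rho> q_pos by (auto simp: s_def)
  have "(fst z, snd z) \<in> X" using z by simp
  from X_band_or_cube[OF this, of n]
  have "\<exists>a b. {a..a + s} \<times> {b..b + s} \<subseteq> MX.mball z \<rho>"
  proof (elim disjE exE conjE)
    fix N i assume N: "N < 2 ^ (\<nu> * n)" "i < 2 ^ n" "fst z \<in> cantor_interval l (\<nu> * n) N" "snd z \<in> band n i"
    have sub: "cantor_interval l (\<nu> * n) N \<subseteq> window n N" "band n i \<subseteq> span n i"
      using margin(1) qpow[of n] mult_pos_pos[OF margin(1) qpow(1)[of n]]
      by (auto simp: cantor_interval_def window_def band_def span_def qpow_eq)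
    have zt: "z \<in> tower n N i" using N z sub by (cases z) (auto simp: tower_def)
    have "{left_end l (\<nu> * n) N..left_end l (\<nu> * n) N + s} \<times> {gap_lo n i..gap_lo n i + s} \<subseteq>
        cantor_interval l (\<nu> * n) N \<times> gap n i"
      using s' qpow[of n] by (auto simp: cantor_interval_def gap_def qpow_eq)
    also have "\<dots> \<subseteq> MX.mball z \<rho>"
    proof
      fix p assume p: "p \<in> cantor_interval l (\<nu> * n) N \<times> gap n i"
      have pX: "p \<in> X" using cube_subset_X[OF N(2,1)] p by blast
      have "p \<in> tower n N i" using p pX sub gap_subset_band[of n i] by (cases p) (auto simp: tower_def)
      then have "length_dist X z p \<le> 11 * q ^ n"
        using ldist_tower[OF zt _ N(1,2)] qpow[of n] by (intro length_dist_le) auto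
      then show "p \<in> MX.mball z \<rho>" using pX z n qpow[of n] by simp
    qed
    finally show ?thesis by blast
  next
    fix k j N assume k: "k < n" "j < 2 ^ k" "N < 2 ^ (\<nu> * k)"
      "fst z \<in> cantor_interval l (\<nu> * k) N" "snd z \<in> gap k j"
    have qk: "q ^ n \<le> q ^ k" using k(1) q_pos q_quarter by (intro power_decreasing) auto
    \<comment> \<open>From the left half of the interval the piece of length \<open>s\<close>
      extends to the right, from the right half to the left; it fits because
      \<open>s \<le> q ^ k / 2\<close>.\<close>
    have sq: "\<exists>b. t \<in> {b..b + s} \<and> {b..b + s} \<subseteq> {u..u + q ^ k}" if "t \<in> {u..u + q ^ k}" for t u
      using that s' qk by (intro exI[of _ "if t \<le> u + q ^ k / 2 then t else t - s"]) auto
    obtain a where a: "fst z \<in> {a..a + s}" "{a..a + s} \<subseteq> cantor_interval l (\<nu> * k) N"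
      using sq[of "fst z" "left_end l (\<nu> * k) N"] k(4) unfolding cantor_interval_def qpow_eq by blast
    obtain b where b: "snd z \<in> {b..b + s}" "{b..b + s} \<subseteq> gap k j"
      using sq[of "snd z" "gap_lo k j"] k(5) unfolding gap_def by blast
    have "{a..a + s} \<times> {b..b + s} \<subseteq> MX.mball z \<rho>"
    proof
      fix p assume p: "p \<in> {a..a + s} \<times> {b..b + s}"
      then have pc: "p \<in> cantor_interval l (\<nu> * k) N \<times> gap k j" using a b by blast
      then have pX: "p \<in> X" using cube_subset_X[OF k(2,3)] by blast
      have zc: "z \<in> cantor_interval l (\<nu> * k) N \<times> gap k j" using k by (cases z) auto
      have "closed_segment z p \<subseteq> X"
        by (rule closed_segment_Times_subset[OF zc pc convex_cantor_interval convex_gap cube_subset_X[OF k(2,3)]])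
      then have "length_dist X z p \<le> dist z p" using ldist_segment[of z p] by (intro length_dist_le) auto
      also have "\<dots> \<le> \<bar>fst z - fst p\<bar> + \<bar>snd z - snd p\<bar>"
        using dist_Pair_le[of "fst z" "snd z" "fst p" "snd p"] by simp
      also have "\<dots> \<le> s + s" using p a(1) b(1) by (cases p) auto
      also have "\<dots> < \<rho>" using s' n qpow[of n] by simp
      finally show "p \<in> MX.mball z \<rho>" using pX z by simp
    qed
    then show ?thesis by blast
  qed
  then show ?thesis by (simp add: s_def)
qed

end

section \<open>Gradients along Lipschitz curves\<close>

text \<open>What remains of an upper gradient when it is tested on Euclidean Lipschitz curves: arc
  length is replaced by the Lipschitz constant times an integral over the parameter. The positive
  half works with this notion alone.\<close>

definition lip_gradient ::
    "(real \<times> real) set \<Rightarrow> (real \<times> real \<Rightarrow> real) \<Rightarrow> (real \<times> real \<Rightarrow> ennreal) \<Rightarrow> bool" where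
  "lip_gradient U u g \<longleftrightarrow>
     (\<forall>\<gamma> K. 0 \<le> K \<longrightarrow> (\<forall>t\<in>{0..1}. \<gamma> t \<in> U) \<longrightarrow>
       (\<forall>s t. 0 \<le> s \<longrightarrow> s \<le> t \<longrightarrow> t \<le> 1 \<longrightarrow> dist (\<gamma> s) (\<gamma> t) \<le> K * (t - s)) \<longrightarrow>
       ennreal \<bar>u (\<gamma> 0) - u (\<gamma> 1)\<bar> \<le> ennreal K * (\<integral>\<^sup>+ t\<in>{0..1}. g (\<gamma> t) \<partial>lborel))"

lemma lip_gradient_subset: "lip_gradient U u g \<Longrightarrow> V \<subseteq> U \<Longrightarrow> lip_gradient V u g"
  unfolding lip_gradient_def by blast

lemma lip_gradient_affine:
  fixes f h :: "real \<Rightarrow> real"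
  assumes grad: "lip_gradient U u g" and ab: "a \<le> b" and K: "0 \<le> K"
    and lip: "\<And>s t. a \<le> s \<Longrightarrow> s \<le> t \<Longrightarrow> t \<le> b \<Longrightarrow> dist (\<gamma> s) (\<gamma> t) \<le> K * (t - s)"
    and U: "\<And>t. a \<le> t \<Longrightarrow> t \<le> b \<Longrightarrow> \<gamma> t \<in> U"
    and meas: "(\<lambda>t. g (\<gamma> t) * indicator {a..b} t) \<in> borel_measurable borel"
  shows "ennreal \<bar>u (\<gamma> a) - u (\<gamma> b)\<bar> \<le> ennreal K * (\<integral>\<^sup>+ t\<in>{a..b}. g (\<gamma> t) \<partial>lborel)"
proof (cases "a = b")
  case False
  then have lt: "a < b" using ab by simp
  define \<eta> where "\<eta> t = \<gamma> (a + (b - a) * t)" for t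
  have r: "a \<le> a + (b - a) * t" "a + (b - a) * t \<le> b" if "0 \<le> t" "t \<le> 1" for t
    using that ab mult_left_le[of t "b - a"] mult_nonneg_nonneg[of "b - a" t] by linarith+
  have "ennreal \<bar>u (\<eta> 0) - u (\<eta> 1)\<bar> \<le> ennreal (K * (b - a)) * (\<integral>\<^sup>+ t\<in>{0..1}. g (\<eta> t) \<partial>lborel)"
  proof (rule grad[unfolded lip_gradient_def, rule_format])
    fix s t :: real assume st: "0 \<le> s" "s \<le> t" "t \<le> 1"
    have "(b - a) * s \<le> (b - a) * t" using st ab by (intro mult_left_mono) auto
    then have "dist (\<eta> s) (\<eta> t) \<le> K * (a + (b - a) * t - (a + (b - a) * s))"
      unfolding \<eta>_def using r[of s] r[of t] st by (intro lip) auto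
    then show "dist (\<eta> s) (\<eta> t) \<le> K * (b - a) * (t - s)" by (simp add: algebra_simps)
  next
    fix t :: real assume "t \<in> {0..1}"
    then show "\<eta> t \<in> U" unfolding \<eta>_def using r[of t] by (intro U) auto
  qed (use K ab in auto)
  also have "(\<integral>\<^sup>+ t\<in>{0..1}. g (\<eta> t) \<partial>lborel) =
      (\<integral>\<^sup>+ t. g (\<gamma> (a + (b - a) * t)) * indicator {a..b} (a + (b - a) * t) \<partial>lborel)"
  proof (intro nn_integral_cong)
    fix t :: real
    have "a + (b - a) * t \<in> {a..b} \<longleftrightarrow> t \<in> {0..1}"
    proof
      assume *: "a + (b - a) * t \<in> {a..b}"
      then have "0 \<le> (b - a) * t" "(b - a) * t \<le> (b - a) * 1" by auto
      then show "t \<in> {0..1}" using lt by (simp only: zero_le_mult_iff mult_le_cancel_left_pos atLeastAtMost_iff) auto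
    qed (use r in auto)
    then show "g (\<eta> t) * indicator {0..1} t = g (\<gamma> (a + (b - a) * t)) * indicator {a..b} (a + (b - a) * t)"
      by (simp add: \<eta>_def indicator_def)
  qed
  also have "ennreal (K * (b - a)) * \<dots> = ennreal K * (\<integral>\<^sup>+ t\<in>{a..b}. g (\<gamma> t) \<partial>lborel)"
    using nn_integral_real_affine[OF meas, of "b - a" a] lt K by (simp add: ennreal_mult mult.assoc)
  finally show ?thesis by (simp add: \<eta>_def)
qed simp

text \<open>The graph map of a 1-Lipschitz function has Lipschitz constant at most 1 + 1.\<close>

lemma lip_gradient_graph:
  fixes f :: "real \<Rightarrow> real"
  assumes "lip_gradient U u g" "a \<le> b"
    and lip: "\<And>s t. a \<le> s \<Longrightarrow> s \<le> t \<Longrightarrow> t \<le> b \<Longrightarrow> \<bar>f s - f t\<bar> \<le> t - s"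
    and "\<And>t. a \<le> t \<Longrightarrow> t \<le> b \<Longrightarrow> (f t, t) \<in> U"
    and [measurable]: "f \<in> borel_measurable borel" "g \<in> borel_measurable borel"
  shows "ennreal \<bar>u (f a, a) - u (f b, b)\<bar> \<le> 2 * (\<integral>\<^sup>+ t\<in>{a..b}. g (f t, t) \<partial>lborel)"
proof -
  have "ennreal \<bar>u (f a, a) - u (f b, b)\<bar> \<le> ennreal 2 * (\<integral>\<^sup>+ t\<in>{a..b}. g (f t, t) \<partial>lborel)"
  proof (rule lip_gradient_affine[OF assms(1,2), where \<gamma> = "\<lambda>t. (f t, t)"])
    fix s t assume st: "a \<le> s" "s \<le> t" "t \<le> b"
    show "dist (f s, s) (f t, t) \<le> 2 * (t - s)"
      using dist_Pair_le[of "f s" s "f t" t] lip[OF st] st by simp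
  qed (use assms(4) in auto)
  then show ?thesis by simp
qed

lemma lip_gradient_horizontal:
  assumes "lip_gradient U u g" "x \<in> A" "x' \<in> A" "convex A" "A \<times> {y} \<subseteq> U"
    and [measurable]: "g \<in> borel_measurable borel" "A \<in> sets borel"
  shows "ennreal \<bar>u (x, y) - u (x', y)\<bar> \<le> (\<integral>\<^sup>+ t\<in>A. g (t, y) \<partial>lborel)"
proof -
  have *: "ennreal \<bar>u (x, y) - u (x', y)\<bar> \<le> (\<integral>\<^sup>+ t\<in>A. g (t, y) \<partial>lborel)"
    if "x \<le> x'" "x \<in> A" "x' \<in> A" for x x'
  proof -
    have sub: "{x..x'} \<subseteq> A"
      using that \<open>convex A\<close> by (metis closed_segment_eq_real_ivl closed_segment_subset)
    have "ennreal \<bar>u (x, y) - u (x', y)\<bar> \<le> ennreal 1 * (\<integral>\<^sup>+ t\<in>{x..x'}. g (t, y) \<partial>lborel)"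
    proof (rule lip_gradient_affine[OF assms(1) \<open>x \<le> x'\<close>, where \<gamma> = "\<lambda>t. (t, y)"])
      fix s t assume "x \<le> s" "s \<le> t" "t \<le> x'"
      then show "dist (s, y) (t, y) \<le> 1 * (t - s)" using dist_Pair_le[of s y t y] by simp
    next
      fix t assume "x \<le> t" "t \<le> x'"
      then show "(t, y) \<in> U" using sub assms(5) by (auto simp: subset_iff)
    qed auto
    also have "\<dots> \<le> (\<integral>\<^sup>+ t\<in>A. g (t, y) \<partial>lborel)"
      using sub by (auto intro!: nn_integral_mono split: split_indicator)
    finally show ?thesis .
  qed
  show ?thesis using *[of x x'] *[of x' x] assms by (cases "x \<le> x'") (auto simp: abs_minus_commute)
qed

text \<open>On each piece \<open>K i\<close> the oscillation of \<open>f\<close> is at most the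
  integral of \<open>G\<close>, so \<open>f x\<close> may be exchanged for the values of
  \<open>f\<close> at the points \<open>X \<omega> \<tau>\<close> in the same piece, and then
  averaged over the parameters. In use, the pieces are the components of a horizontal slice and
  \<open>\<Omega> i\<close> holds the addresses of the curves through them; \<open>A / B\<close> is
  length per unit of parameter mass.\<close>

lemma family_average:
  fixes f :: "real \<Rightarrow> real" and X :: "real \<Rightarrow> real \<Rightarrow> real" and G :: "real \<Rightarrow> ennreal"
  assumes fin: "finite I" and K[measurable]: "\<And>i. i \<in> I \<Longrightarrow> K i \<in> sets borel" and "0 \<le> A" "0 < B"
    and disj: "disjoint_family_on K I" "disjoint_family_on \<Omega> I"
    and A: "\<And>i. i \<in> I \<Longrightarrow> emeasure lborel (K i) \<le> ennreal A"
    and \<Omega>[measurable]: "\<And>i. i \<in> I \<Longrightarrow> \<Omega> i \<in> sets borel"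
    and B: "\<And>i. i \<in> I \<Longrightarrow> emeasure lborel (\<Omega> i) = ennreal B"
    and [measurable]: "f \<in> borel_measurable borel" "G \<in> borel_measurable borel"
      "(\<lambda>z. X (fst z) (snd z)) \<in> borel_measurable (borel \<Otimes>\<^sub>M borel)"
    and osc: "\<And>i x x'. i \<in> I \<Longrightarrow> x \<in> K i \<Longrightarrow> x' \<in> K i \<Longrightarrow> ennreal \<bar>f x - f x'\<bar> \<le> (\<integral>\<^sup>+ t\<in>K i. G t \<partial>lborel)"
    and X: "\<And>i \<omega> \<tau>. i \<in> I \<Longrightarrow> \<omega> \<in> \<Omega> i \<Longrightarrow> \<tau> \<in> {0..1} \<Longrightarrow> X \<omega> \<tau> \<in> K i"
  shows "(\<integral>\<^sup>+ x\<in>(\<Union>i\<in>I. K i). ennreal \<bar>f x - c\<bar> \<partial>lborel) \<le>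
    ennreal A * (\<integral>\<^sup>+ x\<in>(\<Union>i\<in>I. K i). G x \<partial>lborel) +
    ennreal (A / B) * (\<integral>\<^sup>+ \<omega>\<in>(\<Union>i\<in>I. \<Omega> i). (\<integral>\<^sup>+ \<tau>\<in>{0..1}. ennreal \<bar>f (X \<omega> \<tau>) - c\<bar> \<partial>lborel) \<partial>lborel)"
proof -
  define H where "H \<omega> = (\<integral>\<^sup>+ \<tau>\<in>{0..1}. ennreal \<bar>f (X \<omega> \<tau>) - c\<bar> \<partial>lborel)" for \<omega>
  have X2[measurable]: "(\<lambda>z. X (fst z) (snd z)) \<in> borel_measurable (lborel \<Otimes>\<^sub>M lborel)"
    using assms(12) by (simp cong: measurable_cong_sets sets_pair_measure_cong)
  have X1[measurable]: "X \<omega> \<in> borel_measurable borel" for \<omega>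
    using measurable_compose[OF measurable_Pair1'[of \<omega> borel borel] assms(12)] by simp
  have H[measurable]: "H \<in> borel_measurable borel"
    unfolding H_def by measurable
  have one: "(\<integral>\<^sup>+ x\<in>K i. ennreal \<bar>f x - c\<bar> \<partial>lborel) \<le>
      ennreal A * (\<integral>\<^sup>+ x\<in>K i. G x \<partial>lborel) + ennreal (A / B) * (\<integral>\<^sup>+ \<omega>\<in>\<Omega> i. H \<omega> \<partial>lborel)" if i: "i \<in> I" for i
  proof -
    note [measurable] = K[OF i] \<Omega>[OF i]
    let ?G = "\<integral>\<^sup>+ x\<in>K i. G x \<partial>lborel"
    have pt: "ennreal \<bar>f x - c\<bar> \<le> ?G + ennreal (1 / B) * (\<integral>\<^sup>+ \<omega>\<in>\<Omega> i. H \<omega> \<partial>lborel)" if x: "x \<in> K i" for x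
    proof -
      have "ennreal \<bar>f x - c\<bar> \<le> ?G + H \<omega>" if \<omega>: "\<omega> \<in> \<Omega> i" for \<omega>
      proof -
        have "ennreal \<bar>f x - c\<bar> = (\<integral>\<^sup>+ (\<tau>::real)\<in>{0..1}. ennreal \<bar>f x - c\<bar> \<partial>lborel)"
          by (simp add: nn_integral_cmult_indicator)
        also have "\<dots> \<le> (\<integral>\<^sup>+ \<tau>. ?G * indicator {0..1} \<tau> + ennreal \<bar>f (X \<omega> \<tau>) - c\<bar> * indicator {0..1} \<tau> \<partial>lborel)"
        proof (intro nn_integral_mono)
          fix \<tau> :: real
          show "ennreal \<bar>f x - c\<bar> * indicator {0..1} \<tau> \<le>
              ?G * indicator {0..1} \<tau> + ennreal \<bar>f (X \<omega> \<tau>) - c\<bar> * indicator {0..1} \<tau>"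
          proof (cases "\<tau> \<in> {0..1}")
            case True
            have "ennreal \<bar>f x - c\<bar> \<le> ennreal (\<bar>f x - f (X \<omega> \<tau>)\<bar> + \<bar>f (X \<omega> \<tau>) - c\<bar>)"
              by (intro ennreal_leI) simp
            also have "\<dots> = ennreal \<bar>f x - f (X \<omega> \<tau>)\<bar> + ennreal \<bar>f (X \<omega> \<tau>) - c\<bar>"
              by (rule ennreal_plus) auto
            also have "\<dots> \<le> ?G + ennreal \<bar>f (X \<omega> \<tau>) - c\<bar>"
              by (intro add_right_mono osc[OF i x] X[OF i \<omega> True])
            finally show ?thesis using True by simp
          qed simp
        qed
        also have "\<dots> = ?G + H \<omega>"
          by (subst nn_integral_add) (auto simp: nn_integral_cmult_indicator H_def)
        finally show ?thesis .
      qed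
      then have "(\<integral>\<^sup>+ \<omega>\<in>\<Omega> i. ennreal \<bar>f x - c\<bar> \<partial>lborel) \<le>
          (\<integral>\<^sup>+ \<omega>. ?G * indicator (\<Omega> i) \<omega> + H \<omega> * indicator (\<Omega> i) \<omega> \<partial>lborel)"
        by (intro nn_integral_mono) (auto split: split_indicator)
      also have "\<dots> = ?G * ennreal B + (\<integral>\<^sup>+ \<omega>\<in>\<Omega> i. H \<omega> \<partial>lborel)"
        by (subst nn_integral_add) (auto simp: nn_integral_cmult_indicator B[OF i])
      finally have "ennreal (1 / B) * (ennreal \<bar>f x - c\<bar> * ennreal B) \<le>
          ennreal (1 / B) * (?G * ennreal B + (\<integral>\<^sup>+ \<omega>\<in>\<Omega> i. H \<omega> \<partial>lborel))"
        by (intro mult_left_mono) (auto simp: nn_integral_cmult_indicator B[OF i])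
      moreover have "ennreal (1 / B) * (t * ennreal B) = t" for t
      proof -
        have "ennreal (1 / B) * ennreal B = 1" using \<open>0 < B\<close> by (simp flip: ennreal_mult)
        then show ?thesis by (metis mult.left_commute mult.right_neutral)
      qed
      ultimately show ?thesis by (simp add: distrib_left)
    qed
    then have "(\<integral>\<^sup>+ x\<in>K i. ennreal \<bar>f x - c\<bar> \<partial>lborel) \<le>
        (\<integral>\<^sup>+ x. (?G + ennreal (1 / B) * (\<integral>\<^sup>+ \<omega>\<in>\<Omega> i. H \<omega> \<partial>lborel)) * indicator (K i) x \<partial>lborel)"
      by (intro nn_integral_mono) (auto split: split_indicator)
    also have "\<dots> = (?G + ennreal (1 / B) * (\<integral>\<^sup>+ \<omega>\<in>\<Omega> i. H \<omega> \<partial>lborel)) * emeasure lborel (K i)"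
      by (simp add: nn_integral_cmult_indicator)
    also have "\<dots> \<le> (?G + ennreal (1 / B) * (\<integral>\<^sup>+ \<omega>\<in>\<Omega> i. H \<omega> \<partial>lborel)) * ennreal A"
      by (intro mult_left_mono A[OF i]) auto
    also have "\<dots> = ennreal A * ?G + (ennreal A * ennreal (1 / B)) * (\<integral>\<^sup>+ \<omega>\<in>\<Omega> i. H \<omega> \<partial>lborel)"
      by (simp only: distrib_right distrib_left mult_ac)
    also have "ennreal A * ennreal (1 / B) = ennreal (A / B)"
      using \<open>0 \<le> A\<close> \<open>0 < B\<close> by (simp flip: ennreal_mult)
    finally show ?thesis .
  qed
  have union: "(\<integral>\<^sup>+ x\<in>(\<Union>i\<in>I. V i). h x \<partial>lborel) = (\<Sum>i\<in>I. \<integral>\<^sup>+ x\<in>V i. h x \<partial>lborel)"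
    if "disjoint_family_on V I" "h \<in> borel_measurable borel" "\<And>i. i \<in> I \<Longrightarrow> V i \<in> sets borel"
    for V and h :: "real \<Rightarrow> ennreal"
  proof -
    have "(\<integral>\<^sup>+ x\<in>(\<Union>i\<in>I. V i). h x \<partial>lborel) = (\<integral>\<^sup>+ x. (\<Sum>i\<in>I. h x * indicator (V i) x) \<partial>lborel)"
      by (simp add: indicator_UN_disjoint[OF fin that(1)] sum_distrib_left)
    also have "\<dots> = (\<Sum>i\<in>I. \<integral>\<^sup>+ x\<in>V i. h x \<partial>lborel)"
      using that by (intro nn_integral_sum) auto
    finally show ?thesis .
  qed
  have "(\<integral>\<^sup>+ x\<in>(\<Union>i\<in>I. K i). ennreal \<bar>f x - c\<bar> \<partial>lborel) \<le>
      (\<Sum>i\<in>I. ennreal A * (\<integral>\<^sup>+ x\<in>K i. G x \<partial>lborel) + ennreal (A / B) * (\<integral>\<^sup>+ \<omega>\<in>\<Omega> i. H \<omega> \<partial>lborel))"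
    by (subst union[OF disj(1)]) (auto intro!: sum_mono one)
  also have "\<dots> = ennreal A * (\<integral>\<^sup>+ x\<in>(\<Union>i\<in>I. K i). G x \<partial>lborel) +
      ennreal (A / B) * (\<integral>\<^sup>+ \<omega>\<in>(\<Union>i\<in>I. \<Omega> i). H \<omega> \<partial>lborel)"
    by (simp add: union[OF disj(1)] union[OF disj(2)] sum.distrib sum_distrib_left)
  finally show ?thesis unfolding H_def .
qed

section \<open>A pencil of curves through a tower\<close>

lemma exists_le_average:
  fixes \<Phi> :: "real \<Rightarrow> ennreal"
  assumes [measurable]: "\<Phi> \<in> borel_measurable borel" and "0 < r"
  shows "\<exists>y\<in>{a..a + r}. ennreal r * \<Phi> y \<le> (\<integral>\<^sup>+ y\<in>{a..a + r}. \<Phi> y \<partial>lborel)"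
proof (rule ccontr)
  let ?S = "\<integral>\<^sup>+ y\<in>{a..a + r}. \<Phi> y \<partial>lborel"
  assume "\<not> ?thesis"
  then have lt: "?S < ennreal r * \<Phi> y" if "y \<in> {a..a + r}" for y using that by (auto simp: not_le)
  \<comment> \<open>\<open>lt\<close> puts the integral strictly below some value, hence below
    infinity, which the strict comparison of integrals requires.\<close>
  have S: "?S \<noteq> \<infinity>" using lt[of a] \<open>0 < r\<close> by auto
  have const: "(\<integral>\<^sup>+ y\<in>{a..a + r}. ?S \<partial>lborel) = ?S * ennreal r"
    using \<open>0 < r\<close> by (simp add: nn_integral_cmult_indicator)
  have "(\<integral>\<^sup>+ y\<in>{a..a + r}. ?S \<partial>lborel) < (\<integral>\<^sup>+ y\<in>{a..a + r}. ennreal r * \<Phi> y \<partial>lborel)"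
  proof (rule nn_integral_less)
    show "(\<integral>\<^sup>+ y\<in>{a..a + r}. ?S \<partial>lborel) \<noteq> \<infinity>"
      unfolding const using S by (simp add: ennreal_mult_eq_top_iff)
    show "AE y in lborel. ?S * indicator {a..a + r} y \<le> ennreal r * \<Phi> y * indicator {a..a + r} y"
      using lt by (auto intro!: AE_I2 intro: less_imp_le split: split_indicator)
    show "\<not> (AE y in lborel. ennreal r * \<Phi> y * indicator {a..a + r} y \<le> ?S * indicator {a..a + r} y)"
    proof
      assume "AE y in lborel. ennreal r * \<Phi> y * indicator {a..a + r} y \<le> ?S * indicator {a..a + r} y"
      then have "AE y in lborel. y \<notin> {a..a + r}"
        by (rule AE_mp) (use lt in \<open>auto intro!: AE_I2 simp: not_le[symmetric] split: split_indicator_asm\<close>)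
      then have "emeasure lborel {a..a + r} = 0"
        by (subst (asm) AE_iff_measurable[of "{a..a + r}"]) auto
      then show False using \<open>0 < r\<close> by simp
    qed
  qed auto
  also have "\<dots> = ennreal r * ?S"
    by (simp add: nn_integral_cmult mult.assoc)
  finally show False unfolding const by (simp add: mult.commute)
qed

section \<open>The curves of the pencil\<close>

context cantor_space
begin

text \<open>The level of the gap around \<open>y\<close>. On \<open>D\<close> the predicate holds
  nowhere and the value is unspecified; this is harmless, because \<open>height\<close> vanishes
  there and the curve sits at the Cantor point.\<close>

definition lev :: "real \<Rightarrow> nat" where "lev y = (LEAST k. y \<notin> bands (Suc k))"

lemma lev_eq:
  assumes "y \<in> open_gap k i" "i < 2 ^ k"
  shows "lev y = k"
  unfolding lev_def
proof (rule Least_equality)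
  show "y \<notin> bands (Suc k)" using open_gap_not_bands[OF assms] .
  fix m assume m: "y \<notin> bands (Suc m)"
  have "y \<in> band k i" using assms(1) open_gap_subset[of k i] gap_subset_band[of k i] by auto
  then have "y \<in> bands k" unfolding bands_def using assms(2) by auto
  then show "k \<le> m" using m bands_antimono[of "Suc m" k] by (cases "k \<le> m") auto
qed

lemma lev_measurable[measurable]: "lev \<in> borel \<rightarrow>\<^sub>M count_space UNIV"
proof -
  have [measurable]: "bands k \<in> sets borel" for k using closed_bands by simp
  show ?thesis unfolding lev_def[abs_def] by measurable
qed

definition prefix :: "nat \<Rightarrow> real \<Rightarrow> nat" where "prefix m \<omega> = nat \<lfloor>2 ^ m * \<omega>\<rfloor>"
text \<open>In a cube larger than the tower (\<open>lev y < n\<close>) the curves have to stay over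
  the base interval of the tower; this explains \<open>max\<close> here and the cap
  \<open>q ^ n / 2\<close> in \<open>height\<close>, which together give
  \<open>height n y \<le> l ^ depth n y\<close>.\<close>

definition depth :: "nat \<Rightarrow> real \<Rightarrow> nat" where "depth n y = \<nu> * max (lev y) n"
definition height :: "nat \<Rightarrow> real \<Rightarrow> real" where "height n y = min (infdist y D) (q ^ n / 2)"

text \<open>For a height \<open>y\<close> outside \<open>D\<close>, the points \<open>spread n \<omega> \<tau> y\<close> with \<open>\<tau> \<in> [0, 1]\<close> fill a segment of
  length \<open>height n y\<close> in the side of the cube around \<open>cantor_point l \<omega>\<close>.\<close>

definition spread :: "nat \<Rightarrow> real \<Rightarrow> real \<Rightarrow> real \<Rightarrow> real" where
  "spread n \<omega> \<tau> y = cantor_point l \<omega> + height n y / l ^ depth n y *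
     (left_end l (depth n y) (prefix (depth n y) \<omega>) + \<tau> * l ^ depth n y - cantor_point l \<omega>)"

lemma height_measurable[measurable]: "height n \<in> borel_measurable borel"
proof -
  have "(\<lambda>y. infdist y D) \<in> borel_measurable borel"
    by (intro borel_measurable_continuous_onI continuous_intros)
  then show ?thesis unfolding height_def[abs_def] by measurable
qed

lemma spread_measurable[measurable (raw)]:
  assumes [measurable]: "f \<in> borel_measurable M" "g \<in> borel_measurable M" "h \<in> borel_measurable M"
  shows "(\<lambda>x. spread n (f x) (g x) (h x)) \<in> borel_measurable M"
proof -
  have dep: "(\<lambda>x. depth n (h x)) \<in> M \<rightarrow>\<^sub>M count_space UNIV"
    unfolding depth_def by (rule measurable_compose[of _ _ "borel"]) measurable
  have 1: "(\<lambda>x. left_end l m (prefix m (f x))) \<in> borel_measurable M" for m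
  proof (rule measurable_compose[of "\<lambda>x. prefix m (f x)" M "count_space UNIV"])
    show "(\<lambda>x. prefix m (f x)) \<in> M \<rightarrow>\<^sub>M count_space UNIV" unfolding prefix_def by measurable
  qed simp
  have [measurable]: "(\<lambda>x. left_end l (depth n (h x)) (prefix (depth n (h x)) (f x))) \<in> borel_measurable M"
    by (rule measurable_compose_countable[OF 1 dep])
  have [measurable]: "(\<lambda>x. l ^ depth n (h x)) \<in> borel_measurable M"
    by (rule measurable_compose[OF dep]) simp
  show ?thesis unfolding spread_def by measurable
qed

lemma infdist_open_gap:
  assumes "y \<in> open_gap k i" "i < 2 ^ k"
  shows "infdist y D \<le> q ^ k / 2"
proof -
  have "infdist y D \<le> y - gap_lo k i" "infdist y D \<le> gap_lo k i + q ^ k - y"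
    using infdist_le[OF gap_ends_in_D(1)[OF assms(2)], of y] infdist_le[OF gap_ends_in_D(2)[OF assms(2)], of y] assms
    by (auto simp: dist_real_def open_gap_def)
  then show ?thesis by simp
qed

lemma height_D: "y \<in> D \<Longrightarrow> height n y = 0"
  using qpow[of n] by (simp add: height_def)

lemma D_nonempty: "D \<noteq> {}" using gap_ends_in_D[of 0 0] by auto

lemma height_nonneg: "0 \<le> height n y" using qpow[of n] by (simp add: height_def infdist_nonneg)

lemma height_pos:
  assumes "y \<notin> D"
  shows "0 < height n y"
proof -
  have "infdist y D \<noteq> 0" using in_closed_iff_infdist_zero[OF closed_D D_nonempty, of y] assms by blast
  then have "0 < infdist y D" using infdist_nonneg[of y D] by linarith
  then show ?thesis using qpow[of n] by (simp add: height_def)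
qed

lemma height_le:
  assumes "y \<in> {0..L}"
  shows "height n y \<le> l ^ depth n y"
proof (cases "y \<in> D")
  case True then show ?thesis using C.apow[of "depth n y"] by (simp add: height_D)
next
  case False
  then obtain k i where k: "i < 2 ^ k" "y \<in> open_gap k i" using exists_open_gap assms by blast
  have "height n y \<le> q ^ k" "height n y \<le> q ^ n"
    using infdist_open_gap[OF k(2,1)] qpow(1)[of k] qpow(1)[of n] unfolding height_def by linarith+
  then have "height n y \<le> q ^ max k n" by (simp add: max_def)
  then show ?thesis by (simp add: depth_def lev_eq[OF k(2,1)] qpow_eq)
qed

lemma height_lipschitz: "\<bar>height n y - height n y'\<bar> \<le> \<bar>y - y'\<bar>"
proof -
  have "\<bar>min a c - min b c\<bar> \<le> \<bar>a - b\<bar>" for a b c :: real by (simp add: min_def)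
  then show ?thesis
    using infdist_triangle_abs[of y D y'] unfolding height_def dist_real_def by (rule order_trans)
qed

lemma cantor_point_prefix: "0 \<le> \<omega> \<Longrightarrow> cantor_point l \<omega> \<in> cantor_interval l m (prefix m \<omega>)"
  unfolding prefix_def by (rule C.cantor_point_in)

lemma spread_factor:
  assumes "0 \<le> \<omega>" "\<tau> \<in> {0..1}"
  shows "\<bar>left_end l m (prefix m \<omega>) + \<tau> * l ^ m - cantor_point l \<omega>\<bar> \<le> l ^ m"
proof -
  have "0 \<le> \<tau> * l ^ m" using assms C.apow(1)[of m] by simp
  moreover have "\<tau> * l ^ m \<le> 1 * l ^ m" using assms C.apow(1)[of m] by (intro mult_right_mono) auto
  ultimately have "0 \<le> \<tau> * l ^ m" "\<tau> * l ^ m \<le> l ^ m" by auto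
  then show ?thesis
    using cantor_point_prefix[OF assms(1), of m] unfolding cantor_interval_def atLeastAtMost_iff abs_le_iff by linarith
qed

lemma spread_close:
  assumes "0 \<le> \<omega>" "\<tau> \<in> {0..1}"
  shows "\<bar>spread n \<omega> \<tau> y - cantor_point l \<omega>\<bar> \<le> height n y"
proof -
  let ?m = "depth n y"
  have "\<bar>spread n \<omega> \<tau> y - cantor_point l \<omega>\<bar> =
      height n y / l ^ ?m * \<bar>left_end l ?m (prefix ?m \<omega>) + \<tau> * l ^ ?m - cantor_point l \<omega>\<bar>"
    using height_nonneg[of n y] C.apow[of ?m] by (simp add: spread_def abs_mult)
  also have "\<dots> \<le> height n y / l ^ ?m * l ^ ?m"
    using height_nonneg[of n y] C.apow[of ?m] by (intro mult_left_mono spread_factor assms) auto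
  finally show ?thesis using l_pos by simp
qed

lemma spread_in:
  assumes "0 \<le> \<omega>" "\<tau> \<in> {0..1}" "y \<in> {0..L}"
  shows "spread n \<omega> \<tau> y \<in> cantor_interval l (depth n y) (prefix (depth n y) \<omega>)"
proof -
  let ?m = "depth n y" and ?\<xi> = "cantor_point l \<omega>"
  let ?I = "cantor_interval l ?m (prefix ?m \<omega>)" and ?A = "left_end l ?m (prefix ?m \<omega>)"
  let ?h = "height n y / l ^ ?m"
  have h: "0 \<le> ?h" "?h \<le> 1" using height_nonneg[of n y] height_le[OF assms(3), of n] C.apow[of ?m] by auto
  have "0 \<le> \<tau> * l ^ ?m" using assms C.apow(1)[of ?m] by simp
  moreover have "\<tau> * l ^ ?m \<le> 1 * l ^ ?m" using assms C.apow(1)[of ?m] by (intro mult_right_mono) auto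
  ultimately have e: "?A + \<tau> * l ^ ?m \<in> ?I" by (simp add: cantor_interval_def)
  have "(1 - ?h) *\<^sub>R ?\<xi> + ?h *\<^sub>R (?A + \<tau> * l ^ ?m) \<in> ?I"
    by (rule convexD[OF convex_cantor_interval cantor_point_prefix[OF assms(1)] e]) (use h in auto)
  then show ?thesis by (simp add: spread_def algebra_simps)
qed

lemma spread_in_X:
  assumes "0 \<le> \<omega>" "\<omega> < 1" "\<tau> \<in> {0..1}" "y \<in> {0..L}"
  shows "(spread n \<omega> \<tau> y, y) \<in> X"
proof (cases "y \<in> D")
  case True
  then have "spread n \<omega> \<tau> y = cantor_point l \<omega>" using spread_close[OF assms(1,3), of n y] by (simp add: height_D)
  then show ?thesis using C.cantor_point_in_cantor_set[OF assms(1,2)] True by (simp add: X_iff)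
next
  case False
  then obtain k i where k: "i < 2 ^ k" "y \<in> open_gap k i" using exists_open_gap assms by blast
  have "spread n \<omega> \<tau> y \<in> cantor_level l (depth n y)"
    using spread_in[OF assms(1,3,4), of n] C.floor_less_pow[OF assms(1,2)] unfolding cantor_level_def prefix_def by blast
  then have "spread n \<omega> \<tau> y \<in> CC k"
    unfolding CC_def depth_def lev_eq[OF k(2,1)]
    using C.cantor_level_antimono[of "\<nu> * k" "\<nu> * max k n"] by auto
  then show ?thesis unfolding X_iff using k open_gap_subset by blast
qed

text \<open>If a point \<open>e\<close> of \<open>D\<close> lies between the two heights, each curve
  point is as close to the Cantor point as its height is to \<open>e\<close>, and these distances
  add up to at most \<open>y' - y\<close>. Otherwise both heights lie in one gap, the depth is
  constant, and the curve is an affine function of \<open>height\<close> with slope at most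
  1.\<close>

lemma spread_lipschitz:
  assumes \<omega>: "0 \<le> \<omega>" "\<tau> \<in> {0..1}" and y: "0 \<le> y" "y \<le> y'" "y' \<le> L"
  shows "\<bar>spread n \<omega> \<tau> y - spread n \<omega> \<tau> y'\<bar> \<le> y' - y"
proof (cases "\<exists>e\<in>D. y \<le> e \<and> e \<le> y'")
  case True
  then obtain e where e: "e \<in> D" "y \<le> e" "e \<le> y'" by blast
  have "height n y \<le> e - y" "height n y' \<le> y' - e"
    using infdist_le[OF e(1), of y] infdist_le[OF e(1), of y'] e by (auto simp: height_def dist_real_def)
  then show ?thesis using spread_close[OF \<omega>, of n y] spread_close[OF \<omega>, of n y'] by linarith
next
  case False
  then have "y \<notin> D" using y by auto
  then obtain k i where k: "i < 2 ^ k" "y \<in> open_gap k i" using exists_open_gap y by force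
  have "y' \<in> open_gap k i"
    using False gap_ends_in_D(2)[OF k(1)] k(2) y unfolding open_gap_def greaterThanLessThan_iff
    by (metis less_le_trans less_imp_le not_le)
  then have "depth n y' = depth n y" using lev_eq[of _ k i] k by (simp add: depth_def)
  then have "spread n \<omega> \<tau> y - spread n \<omega> \<tau> y' = (height n y - height n y') / l ^ depth n y *
      (left_end l (depth n y) (prefix (depth n y) \<omega>) + \<tau> * l ^ depth n y - cantor_point l \<omega>)"
    by (simp add: spread_def algebra_simps diff_divide_distrib)
  then have "\<bar>spread n \<omega> \<tau> y - spread n \<omega> \<tau> y'\<bar> = \<bar>height n y - height n y'\<bar> / l ^ depth n y *
      \<bar>left_end l (depth n y) (prefix (depth n y) \<omega>) + \<tau> * l ^ depth n y - cantor_point l \<omega>\<bar>"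
    using C.apow[of "depth n y"] by (simp add: abs_mult)
  also have "\<dots> \<le> \<bar>height n y - height n y'\<bar> / l ^ depth n y * l ^ depth n y"
    using C.apow[of "depth n y"] by (intro mult_left_mono spread_factor \<omega>) auto
  also have "\<dots> = \<bar>height n y - height n y'\<bar>" using l_pos by simp
  also have "\<dots> \<le> y' - y" using height_lipschitz[of n y y'] y by simp
  finally show ?thesis .
qed

lemma spread_in_base:
  assumes "\<omega> \<in> dyadic (\<nu> * n) N" "\<tau> \<in> {0..1}" "y \<in> {0..L}"
  shows "spread n \<omega> \<tau> y \<in> cantor_interval l (\<nu> * n) N"
proof -
  have \<omega>: "0 \<le> \<omega>" using dyadic_nonneg assms by blast
  obtain j where j: "depth n y = \<nu> * n + j"
    by (metis depth_def le_add_diff_inverse max.cobounded2 mult_le_mono2)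
  have "spread n \<omega> \<tau> y \<in> cantor_interval l (\<nu> * n) (prefix (\<nu> * n + j) \<omega> div 2 ^ j)"
    using spread_in[OF \<omega> assms(2,3), of n] C.cantor_interval_add[of "\<nu> * n" j] unfolding j by blast
  then show ?thesis using floor_pow_div[OF \<omega>] dyadic_iff[OF \<omega>] assms(1) unfolding prefix_def by metis
qed

lemma base_subset_window: "cantor_interval l (\<nu> * n) N \<subseteq> window n N"
  using mult_pos_pos[OF margin(1) qpow(1)[of n]] by (auto simp: cantor_interval_def window_def qpow_eq)

lemma spread_in_tower:
  assumes "\<omega> \<in> dyadic (\<nu> * n) N" "N < 2 ^ (\<nu> * n)" "\<tau> \<in> {0..1}" "y \<in> {0..L}" "y \<in> span n i"
  shows "(spread n \<omega> \<tau> y, y) \<in> tower n N i"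
  using spread_in_base[OF assms(1,3,4)] base_subset_window[of n N] assms
    spread_in_X[OF dyadic_nonneg dyadic_less_1] by (auto simp: tower_def)

lemma tower_sets[measurable]: "tower n N i \<in> sets borel"
proof -
  have "closed (tower n N i)"
    unfolding tower_def window_def span_def by (intro closed_Int closed_X closed_Times) auto
  then show ?thesis by simp
qed

lemma emeasure_D: "emeasure lborel D = 0"
proof -
  have "emeasure lborel D \<le> ennreal (L * (2 * q) ^ n)" for n
  proof -
    have "D \<subseteq> (\<Union>i<2 ^ n. band n i)" using D_iff_bands unfolding bands_def by auto
    then have "emeasure lborel D \<le> emeasure lborel (\<Union>i<2 ^ n. band n i)"
      by (intro emeasure_mono) (auto simp: band_def)
    also have "\<dots> \<le> (\<Sum>i<2 ^ n. emeasure lborel (band n i))"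
      by (intro emeasure_subadditive_finite) (auto simp: band_def)
    also have "\<dots> = (\<Sum>i<(2::nat) ^ n. ennreal (L * q ^ n))"
      using L_bounds qpow[of n] by (intro sum.cong) (auto simp: band_def)
    also have "\<dots> = ennreal (L * (2 * q) ^ n)"
      using L_bounds qpow[of n]
      by (simp add: ennreal_of_nat_eq_real_of_nat power_mult_distrib mult_ac flip: ennreal_mult)
    finally show ?thesis .
  qed
  moreover have "(\<lambda>n. ennreal (L * (2 * q) ^ n)) \<longlonglongrightarrow> ennreal 0"
    using q_pos q_quarter by (intro tendsto_ennrealI tendsto_mult_right_zero LIMSEQ_power_zero) auto
  ultimately have "emeasure lborel D \<le> ennreal 0"
    by (intro LIMSEQ_le_const) auto
  then show ?thesis by simp
qed

lemma AE_not_D: "AE y in lborel. y \<notin> D"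
  using emeasure_D by (intro AE_I[of _ _ D]) auto

section \<open>Oscillation in a tower in terms of the pencil\<close>

definition heights :: "nat \<Rightarrow> nat \<Rightarrow> real set" where "heights n i = span n i \<inter> {0..L}"

lemma heights_sets[measurable]: "heights n i \<in> sets borel" by (simp add: heights_def span_def)

lemma emeasure_heights: "emeasure lborel (heights n i) \<le> ennreal (3 * q ^ n)"
proof -
  have "emeasure lborel (heights n i) \<le> emeasure lborel (span n i)"
    by (intro emeasure_mono) (auto simp: heights_def span_def)
  also have "\<dots> = ennreal (L * q ^ n + q ^ n)" using L_bounds qpow[of n] by (simp add: span_def)
  also have "\<dots> \<le> ennreal (3 * q ^ n)"
    using mult_right_mono[of L 2 "q ^ n"] L_bounds qpow[of n] by (intro ennreal_leI) simp
  finally show ?thesis .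
qed

lemma heights_Icc:
  assumes "y \<in> heights n i" "y' \<in> heights n i"
  shows "{y..y'} \<subseteq> heights n i"
  using assms by (auto simp: heights_def span_def)

lemma gap_subset_heights: "i < 2 ^ n \<Longrightarrow> gap n i \<subseteq> heights n i"
  using gap_subset_0L[of i n] gap_subset_band[of n i] qpow[of n]
  by (auto simp: heights_def span_def band_def subset_iff)

lemma spread_oscillation:
  assumes grad: "lip_gradient (tower n N i) u g" and N: "N < 2 ^ (\<nu> * n)"
    and \<omega>: "\<omega> \<in> dyadic (\<nu> * n) N" "\<tau> \<in> {0..1}"
    and y: "y \<in> heights n i" "y' \<in> heights n i"
    and [measurable]: "g \<in> borel_measurable borel"
  shows "ennreal \<bar>u (spread n \<omega> \<tau> y, y) - u (spread n \<omega> \<tau> y', y')\<bar> \<le>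
    2 * (\<integral>\<^sup>+ t\<in>heights n i. g (spread n \<omega> \<tau> t, t) \<partial>lborel)"
proof -
  have *: "ennreal \<bar>u (spread n \<omega> \<tau> y, y) - u (spread n \<omega> \<tau> y', y')\<bar> \<le>
      2 * (\<integral>\<^sup>+ t\<in>heights n i. g (spread n \<omega> \<tau> t, t) \<partial>lborel)"
    if y: "y \<le> y'" "y \<in> heights n i" "y' \<in> heights n i" for y y'
  proof -
    have sub: "{y..y'} \<subseteq> heights n i" using heights_Icc y by blast
    have "ennreal \<bar>u (spread n \<omega> \<tau> y, y) - u (spread n \<omega> \<tau> y', y')\<bar> \<le>
        2 * (\<integral>\<^sup>+ t\<in>{y..y'}. g (spread n \<omega> \<tau> t, t) \<partial>lborel)"
    proof (rule lip_gradient_graph[OF grad y(1)])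
      fix s t assume st: "y \<le> s" "s \<le> t" "t \<le> y'"
      then show "\<bar>spread n \<omega> \<tau> s - spread n \<omega> \<tau> t\<bar> \<le> t - s"
        using y dyadic_nonneg[OF \<omega>(1)] by (intro spread_lipschitz \<omega>) (auto simp: heights_def)
    next
      fix t assume "y \<le> t" "t \<le> y'"
      then have "t \<in> heights n i" using sub by auto
      then show "(spread n \<omega> \<tau> t, t) \<in> tower n N i"
        by (intro spread_in_tower N \<omega>) (auto simp: heights_def)
    qed measurable
    also have "\<dots> \<le> 2 * (\<integral>\<^sup>+ t\<in>heights n i. g (spread n \<omega> \<tau> t, t) \<partial>lborel)"
      using sub by (intro mult_left_mono nn_integral_mono) (auto split: split_indicator)
    finally show ?thesis .
  qed
  show ?thesis using *[of y y'] *[of y' y] y by (cases "y \<le> y'") (auto simp: abs_minus_commute)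
qed

definition slice :: "nat \<Rightarrow> nat \<Rightarrow> nat \<Rightarrow> real \<Rightarrow> real set" where
  "slice n N i y = {x. (x, y) \<in> tower n N i}"

lemma slice_sets[measurable]: "slice n N i y \<in> sets borel"
proof -
  have "(\<lambda>x. (x, y)) -` tower n N i \<inter> space borel \<in> sets borel"
    by (rule measurable_sets[of _ _ borel]) measurable
  then show ?thesis by (simp add: slice_def vimage_def)
qed

lemma slice_iff:
  assumes "y \<in> heights n i" "y \<in> open_gap k j" "j < 2 ^ k"
  shows "x \<in> slice n N i y \<longleftrightarrow> x \<in> CC k \<and> x \<in> window n N"
proof -
  have yD: "y \<notin> D" using open_gap_disjoint_D assms by blast
  have uniq: "k' = k" if "j' < 2 ^ k'" "y \<in> gap k' j'" for k' j'
  proof -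
    have "y \<in> open_gap k' j'"
      using that yD gap_ends_in_D(1,2)[OF that(1)] unfolding gap_def open_gap_def
      by (metis atLeastAtMost_iff greaterThanLessThan_iff order_less_le)
    then show ?thesis using lev_eq[of y k' j'] lev_eq[of y k j] that assms by simp
  qed
  have "(x, y) \<in> X \<longleftrightarrow> x \<in> CC k"
    unfolding X_iff using uniq yD assms open_gap_subset by blast
  then show ?thesis using assms by (auto simp: slice_def tower_def heights_def)
qed

text \<open>A slice through cubes of level \<open>k \<ge> n\<close> is a disjoint union of base
  intervals, one for each address extending \<open>N\<close>, and the curves with that address pass
  through that interval. For \<open>k < n\<close> the slice is a single interval inside one large
  cube.\<close>

lemma slice_average:
  assumes grad: "lip_gradient (tower n N i) u g" and N: "N < 2 ^ (\<nu> * n)" and i: "i < 2 ^ n"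
    and y: "y \<in> heights n i" "y \<notin> D"
    and [measurable]: "u \<in> borel_measurable borel" "g \<in> borel_measurable borel"
  shows "(\<integral>\<^sup>+ x\<in>slice n N i y. ennreal \<bar>u (x, y) - c\<bar> \<partial>lborel) \<le>
    ennreal (2 * q ^ n) * (\<integral>\<^sup>+ x\<in>slice n N i y. g (x, y) \<partial>lborel) +
    ennreal (2 * 2 ^ (\<nu> * n) * q ^ n) * (\<integral>\<^sup>+ \<omega>\<in>dyadic (\<nu> * n) N. (\<integral>\<^sup>+ \<tau>\<in>{0..1}.
      ennreal \<bar>u (spread n \<omega> \<tau> y, y) - c\<bar> \<partial>lborel) \<partial>lborel)"
proof -
  obtain k j where k: "j < 2 ^ k" "y \<in> open_gap k j"
    using exists_open_gap[of y] y unfolding heights_def by blast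
  have y0: "y \<in> {0..L}" using y by (simp add: heights_def)
  have dep: "depth n y = \<nu> * max k n" using lev_eq[OF k(2,1)] by (simp add: depth_def)
  have slice: "x \<in> slice n N i y \<longleftrightarrow> x \<in> CC k \<and> x \<in> window n N" for x
    using slice_iff[OF y(1) k(2,1)] .
  have sub: "A \<times> {y} \<subseteq> tower n N i" if "A \<subseteq> slice n N i y" for A
    using that by (auto simp: slice_def)
  have ci_sets[measurable]: "cantor_interval l m M \<in> sets borel" for m M by (simp add: cantor_interval_def)
  have win_sets[measurable]: "window n N \<in> sets borel" by (simp add: window_def)
  have pow: "\<nu> * n \<le> \<nu> * k" if "n \<le> k" using that by simp
  show ?thesis
  proof (cases "n \<le> k")
    case True
    define I where "I = {N'. N' < 2 ^ (\<nu> * k) \<and> N' div 2 ^ (\<nu> * k - \<nu> * n) = N}"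
    have S: "slice n N i y = (\<Union>N'\<in>I. cantor_interval l (\<nu> * k) N')"
    proof (intro antisym subsetI)
      fix x assume "x \<in> slice n N i y"
      then have x: "x \<in> CC k" "x \<in> window n N" using slice by auto
      then obtain N' where N': "N' < 2 ^ (\<nu> * k)" "x \<in> cantor_interval l (\<nu> * k) N'"
        by (auto simp: CC_def cantor_level_def)
      then have "N' \<in> I" using window_interval(1)[OF x(2) N'(2) N N'(1) True] by (simp add: I_def)
      then show "x \<in> (\<Union>N'\<in>I. cantor_interval l (\<nu> * k) N')" using N' by blast
    next
      fix x assume "x \<in> (\<Union>N'\<in>I. cantor_interval l (\<nu> * k) N')"
      then obtain N' where N': "N' \<in> I" "x \<in> cantor_interval l (\<nu> * k) N'" by blast
      then have "x \<in> CC k" by (auto simp: I_def CC_def cantor_level_def)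
      moreover have "x \<in> cantor_interval l (\<nu> * n) N"
        using C.cantor_interval_subset[OF pow[OF True], of N'] N' by (auto simp: I_def)
      ultimately show "x \<in> slice n N i y" using slice base_subset_window by blast
    qed
    have pre: "prefix (\<nu> * k) \<omega> div 2 ^ (\<nu> * k - \<nu> * n) = prefix (\<nu> * n) \<omega>" if "0 \<le> \<omega>" for \<omega>
      using floor_pow_div[OF that, of "\<nu> * n" "\<nu> * k - \<nu> * n"] pow[OF True] by (simp add: prefix_def)
    have O: "dyadic (\<nu> * n) N = (\<Union>N'\<in>I. dyadic (\<nu> * k) N')"
    proof (intro antisym subsetI)
      fix \<omega> assume \<omega>: "\<omega> \<in> dyadic (\<nu> * n) N"
      have nn: "0 \<le> \<omega>" "\<omega> < 1" using dyadic_nonneg dyadic_less_1[OF \<omega> N] \<omega> by auto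
      have "prefix (\<nu> * n) \<omega> = N" using dyadic_iff[OF nn(1)] \<omega> by (simp add: prefix_def)
      then have "prefix (\<nu> * k) \<omega> \<in> I"
        using pre[OF nn(1)] C.floor_less_pow[OF nn] by (simp add: I_def prefix_def)
      then show "\<omega> \<in> (\<Union>N'\<in>I. dyadic (\<nu> * k) N')" using dyadic_iff[OF nn(1)] by (auto simp: prefix_def)
    next
      fix \<omega> assume "\<omega> \<in> (\<Union>N'\<in>I. dyadic (\<nu> * k) N')"
      then obtain N' where N': "N' \<in> I" "\<omega> \<in> dyadic (\<nu> * k) N'" by blast
      then have nn: "0 \<le> \<omega>" using dyadic_nonneg by blast
      then show "\<omega> \<in> dyadic (\<nu> * n) N"
        using N' pre[OF nn] dyadic_iff[OF nn] by (auto simp: I_def prefix_def)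
    qed
    have "(\<integral>\<^sup>+ x\<in>(\<Union>N'\<in>I. cantor_interval l (\<nu> * k) N'). ennreal \<bar>u (x, y) - c\<bar> \<partial>lborel) \<le>
        ennreal (q ^ k) * (\<integral>\<^sup>+ x\<in>(\<Union>N'\<in>I. cantor_interval l (\<nu> * k) N'). g (x, y) \<partial>lborel) +
        ennreal (q ^ k / (1 / 2 ^ (\<nu> * k))) * (\<integral>\<^sup>+ \<omega>\<in>(\<Union>N'\<in>I. dyadic (\<nu> * k) N').
          (\<integral>\<^sup>+ \<tau>\<in>{0..1}. ennreal \<bar>u (spread n \<omega> \<tau> y, y) - c\<bar> \<partial>lborel) \<partial>lborel)"
    proof (rule family_average)
      show "finite I" by (simp add: I_def)
      show "disjoint_family_on (cantor_interval l (\<nu> * k)) I"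
        unfolding disjoint_family_on_def I_def using C.cantor_interval_unique by blast
      show "disjoint_family_on (dyadic (\<nu> * k)) I"
      proof -
        have "M = M'" if "\<omega> \<in> dyadic m M" "\<omega> \<in> dyadic m M'" for \<omega> m M M'
          using that dyadic_iff[OF dyadic_nonneg[OF that(1)]] by simp
        then show ?thesis unfolding disjoint_family_on_def by blast
      qed
      show "emeasure lborel (cantor_interval l (\<nu> * k) N') \<le> ennreal (q ^ k)" for N'
        using qpow[of k] by (simp add: cantor_interval_def qpow_eq)
      show "emeasure lborel (dyadic (\<nu> * k) N') = ennreal (1 / 2 ^ (\<nu> * k))" for N'
        by (rule emeasure_dyadic)
      fix N' assume N': "N' \<in> I"
      show "ennreal \<bar>u (x, y) - u (x', y)\<bar> \<le> (\<integral>\<^sup>+ t\<in>cantor_interval l (\<nu> * k) N'. g (t, y) \<partial>lborel)"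
        if "x \<in> cantor_interval l (\<nu> * k) N'" "x' \<in> cantor_interval l (\<nu> * k) N'" for x x'
        by (rule lip_gradient_horizontal[OF grad that convex_cantor_interval sub]) (use N' S in auto)
      show "spread n \<omega> \<tau> y \<in> cantor_interval l (\<nu> * k) N'" if "\<omega> \<in> dyadic (\<nu> * k) N'" "\<tau> \<in> {0..1}" for \<omega> \<tau>
        using spread_in[OF dyadic_nonneg[OF that(1)] that(2) y0, of n] True
          dyadic_iff[OF dyadic_nonneg[OF that(1)], of "\<nu> * k" N'] that(1) dep
        by (simp add: max_def prefix_def)
    qed (use qpow[of k] in auto)
    also have "\<dots> \<le> ennreal (2 * q ^ n) * (\<integral>\<^sup>+ x\<in>(\<Union>N'\<in>I. cantor_interval l (\<nu> * k) N'). g (x, y) \<partial>lborel) +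
        ennreal (2 * 2 ^ (\<nu> * n) * q ^ n) * (\<integral>\<^sup>+ \<omega>\<in>(\<Union>N'\<in>I. dyadic (\<nu> * k) N').
          (\<integral>\<^sup>+ \<tau>\<in>{0..1}. ennreal \<bar>u (spread n \<omega> \<tau> y, y) - c\<bar> \<partial>lborel) \<partial>lborel)"
    proof (intro add_mono mult_right_mono ennreal_leI)
      have "q ^ k \<le> q ^ n" using q_pos q_quarter True by (intro power_decreasing) auto
      then show "q ^ k \<le> 2 * q ^ n" using qpow[of n] by simp
      \<comment> \<open>Length of an interval over mass of its addresses is
        \<open>q ^ k * 2 ^ (\<nu> * k) = (2 * l) ^ (\<nu> * k)\<close>, which decreases in
        \<open>k\<close>, so the value at \<open>n\<close> bounds it for all finer levels.\<close>
      have "(2 * l) ^ (\<nu> * k) \<le> (2 * l) ^ (\<nu> * n)"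
        using l_pos l_half pow[OF True] by (intro power_decreasing) auto
      then have "2 ^ (\<nu> * k) * q ^ k \<le> 2 ^ (\<nu> * n) * q ^ n" by (simp add: power_mult_distrib qpow_eq)
      moreover have "0 \<le> (2::real) ^ (\<nu> * n) * q ^ n" using qpow[of n] by simp
      ultimately show "q ^ k / (1 / 2 ^ (\<nu> * k)) \<le> 2 * 2 ^ (\<nu> * n) * q ^ n" by (simp add: mult.commute)
    qed auto
    finally show ?thesis unfolding S O .
  next
    case False
    define N'' where "N'' = N div 2 ^ (\<nu> * n - \<nu> * k)"
    have N'': "N'' < 2 ^ (\<nu> * k)" using C.div_less_pow[OF N] False by (simp add: N''_def)
    have S: "slice n N i y = cantor_interval l (\<nu> * k) N'' \<inter> window n N"
    proof (intro antisym subsetI)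
      fix x assume "x \<in> slice n N i y"
      then have x: "x \<in> CC k" "x \<in> window n N" using slice by auto
      then obtain N' where N': "N' < 2 ^ (\<nu> * k)" "x \<in> cantor_interval l (\<nu> * k) N'"
        by (auto simp: CC_def cantor_level_def)
      then have "N' = N''" using window_interval(2)[OF x(2) N'(2) N N'(1)] False by (simp add: N''_def)
      then show "x \<in> cantor_interval l (\<nu> * k) N'' \<inter> window n N" using x N' by simp
    next
      fix x assume "x \<in> cantor_interval l (\<nu> * k) N'' \<inter> window n N"
      then show "x \<in> slice n N i y" using slice N'' by (auto simp: CC_def cantor_level_def)
    qed
    have conv: "convex (slice n N i y)"
      unfolding S window_def by (intro convex_Int convex_cantor_interval) simp
    have base: "cantor_interval l (\<nu> * n) N \<subseteq> slice n N i y"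
      unfolding S using base_subset_window C.cantor_interval_subset[of "\<nu> * k" "\<nu> * n" N] False
      by (auto simp: N''_def)
    \<comment> \<open>The family with one member.\<close>
    have "(\<integral>\<^sup>+ x\<in>(\<Union>_\<in>{0::nat}. slice n N i y). ennreal \<bar>u (x, y) - c\<bar> \<partial>lborel) \<le>
        ennreal (2 * q ^ n) * (\<integral>\<^sup>+ x\<in>(\<Union>_\<in>{0::nat}. slice n N i y). g (x, y) \<partial>lborel) +
        ennreal (2 * q ^ n / (1 / 2 ^ (\<nu> * n))) * (\<integral>\<^sup>+ \<omega>\<in>(\<Union>_\<in>{0::nat}. dyadic (\<nu> * n) N).
          (\<integral>\<^sup>+ \<tau>\<in>{0..1}. ennreal \<bar>u (spread n \<omega> \<tau> y, y) - c\<bar> \<partial>lborel) \<partial>lborel)"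
    proof (rule family_average)
      have "emeasure lborel (slice n N i y) \<le> emeasure lborel (window n N)"
        unfolding S by (intro emeasure_mono) auto
      also have "\<dots> = ennreal (q ^ n + 2 * margin * q ^ n)"
        using mult_pos_pos[OF margin(1) qpow(1)[of n]] qpow[of n] by (simp add: window_def)
      also have "\<dots> \<le> ennreal (2 * q ^ n)"
        using margin(2) qpow[of n] mult_right_mono[of "2 * margin" 1 "q ^ n"] by (intro ennreal_leI) simp
      finally show "emeasure lborel (slice n N i y) \<le> ennreal (2 * q ^ n)" .
      show "emeasure lborel (dyadic (\<nu> * n) N) = ennreal (1 / 2 ^ (\<nu> * n))" by (rule emeasure_dyadic)
      show "ennreal \<bar>u (x, y) - u (x', y)\<bar> \<le> (\<integral>\<^sup>+ t\<in>slice n N i y. g (t, y) \<partial>lborel)"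
        if "x \<in> slice n N i y" "x' \<in> slice n N i y" for x x'
        by (rule lip_gradient_horizontal[OF grad that conv sub]) auto
      show "spread n \<omega> \<tau> y \<in> slice n N i y" if "\<omega> \<in> dyadic (\<nu> * n) N" "\<tau> \<in> {0..1}" for \<omega> \<tau>
        using spread_in_base[OF that y0] base by blast
    qed (use qpow[of n] in \<open>auto simp: disjoint_family_on_def\<close>)
    also have "2 * q ^ n / (1 / 2 ^ (\<nu> * n)) = 2 * 2 ^ (\<nu> * n) * q ^ n" by simp
    finally show ?thesis by simp
  qed
qed

lemma tower_nn_integral:
  assumes [measurable]: "h \<in> borel_measurable borel"
  shows "(\<integral>\<^sup>+ z\<in>tower n N i. h z \<partial>lborel) =
    (\<integral>\<^sup>+ y\<in>heights n i. (\<integral>\<^sup>+ x\<in>slice n N i y. h (x, y) \<partial>lborel) \<partial>lborel)"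
proof -
  have "(\<integral>\<^sup>+ z\<in>tower n N i. h z \<partial>lborel) = integral\<^sup>N (lborel \<Otimes>\<^sub>M lborel) (\<lambda>z. h z * indicator (tower n N i) z)"
    by (simp add: lborel_prod)
  also have "\<dots> = (\<integral>\<^sup>+ y. (\<integral>\<^sup>+ x. h (x, y) * indicator (tower n N i) (x, y) \<partial>lborel) \<partial>lborel)"
    by (rule lborel_pair.nn_integral_snd[symmetric]) (simp add: lborel_prod)
  also have "\<dots> = (\<integral>\<^sup>+ y\<in>heights n i. (\<integral>\<^sup>+ x\<in>slice n N i y. h (x, y) \<partial>lborel) \<partial>lborel)"
  proof (rule nn_integral_cong)
    fix y
    have "indicator (tower n N i) (x, y) = (indicator (slice n N i y) x * indicator (heights n i) y :: ennreal)" for x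
      using X_snd[of x y] by (auto simp: slice_def tower_def heights_def indicator_def)
    then have "(\<integral>\<^sup>+ x. h (x, y) * indicator (tower n N i) (x, y) \<partial>lborel) =
        (\<integral>\<^sup>+ x. (h (x, y) * indicator (slice n N i y) x) * indicator (heights n i) y \<partial>lborel)"
      by (simp add: mult.assoc)
    also have "\<dots> = (\<integral>\<^sup>+ x\<in>slice n N i y. h (x, y) \<partial>lborel) * indicator (heights n i) y"
      by (rule nn_integral_multc) measurable
    finally show "(\<integral>\<^sup>+ x. h (x, y) * indicator (tower n N i) (x, y) \<partial>lborel) = \<dots>" .
  qed
  finally show ?thesis .
qed

text \<open>Not normalized: the parameters have total mass \<open>1 / 2 ^ (\<nu> * n)\<close>, which
  the factor \<open>2 ^ (\<nu> * n)\<close> in the next lemma compensates.\<close>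

definition flux :: "nat \<Rightarrow> nat \<Rightarrow> nat \<Rightarrow> (real \<times> real \<Rightarrow> ennreal) \<Rightarrow> ennreal" where
  "flux n N i h = (\<integral>\<^sup>+ \<omega>\<in>dyadic (\<nu> * n) N. (\<integral>\<^sup>+ \<tau>\<in>{0..1}. (\<integral>\<^sup>+ t\<in>heights n i.
     h (spread n \<omega> \<tau> t, t) \<partial>lborel) \<partial>lborel) \<partial>lborel)"

text \<open>A point of the tower is moved horizontally to the curves, along them to a height
  \<open>y0\<close> inside the gap of level \<open>n\<close>, and horizontally to one reference
  point there. The first move costs the integral of \<open>g\<close> over the slice, the second the
  flux, and the third is cheap because \<open>y0\<close> is chosen well.\<close>

lemma tower_oscillation:
  assumes grad: "lip_gradient (tower n N i) u g" and N: "N < 2 ^ (\<nu> * n)" and i: "i < 2 ^ n"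
    and [measurable]: "u \<in> borel_measurable borel" "g \<in> borel_measurable borel"
  shows "\<exists>c. (\<integral>\<^sup>+ z\<in>tower n N i. ennreal \<bar>u z - c\<bar> \<partial>lborel) \<le>
    ennreal (8 * q ^ n) * (\<integral>\<^sup>+ z\<in>tower n N i. g z \<partial>lborel) +
    ennreal (12 * 2 ^ (\<nu> * n) * (q ^ n)\<^sup>2) * flux n N i g"
proof -
  let ?r = "q ^ n" and ?I = "cantor_interval l (\<nu> * n) N" and ?\<alpha> = "left_end l (\<nu> * n) N"
  have [measurable]: "?I \<in> sets borel" by (simp add: cantor_interval_def)
  define \<Phi> where "\<Phi> y = (\<integral>\<^sup>+ x\<in>?I. g (x, y) \<partial>lborel)" for y
  have [measurable]: "\<Phi> \<in> borel_measurable borel" unfolding \<Phi>_def by measurable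
  \<comment> \<open>A height where the horizontal integral of \<open>g\<close> is at most its
    average over the gap.\<close>
  obtain y0 where y0: "y0 \<in> gap n i" "ennreal ?r * \<Phi> y0 \<le> (\<integral>\<^sup>+ y\<in>gap n i. \<Phi> y \<partial>lborel)"
    using exists_le_average[of \<Phi> ?r "gap_lo n i"] qpow[of n] unfolding gap_def by auto
  have Isub: "?I \<subseteq> slice n N i y" if "y \<in> gap n i" for y
    using cube_subset_X[OF i N] base_subset_window gap_subset_heights[OF i] that
    by (auto simp: slice_def tower_def heights_def)
  have \<Phi>int: "(\<integral>\<^sup>+ y\<in>gap n i. \<Phi> y \<partial>lborel) \<le> (\<integral>\<^sup>+ z\<in>tower n N i. g z \<partial>lborel)"
    unfolding tower_nn_integral[OF assms(5)]
  proof (rule nn_integral_mono)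
    fix y
    show "\<Phi> y * indicator (gap n i) y \<le>
        (\<integral>\<^sup>+ x\<in>slice n N i y. g (x, y) \<partial>lborel) * indicator (heights n i) y"
    proof (cases "y \<in> gap n i")
      case True
      then have "\<Phi> y \<le> (\<integral>\<^sup>+ x\<in>slice n N i y. g (x, y) \<partial>lborel)"
        unfolding \<Phi>_def using Isub[OF True] by (intro nn_integral_mono) (auto split: split_indicator)
      then show ?thesis using True gap_subset_heights[OF i] by auto
    qed simp
  qed
  define c where "c = u (?\<alpha>, y0)"
  define F where "F \<omega> \<tau> = (\<integral>\<^sup>+ t\<in>heights n i. g (spread n \<omega> \<tau> t, t) \<partial>lborel)" for \<omega> \<tau>
  have pt: "ennreal \<bar>u (spread n \<omega> \<tau> y, y) - c\<bar> \<le> 2 * F \<omega> \<tau> + \<Phi> y0"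
    if \<omega>: "\<omega> \<in> dyadic (\<nu> * n) N" "\<tau> \<in> {0..1}" and y: "y \<in> heights n i" for \<omega> \<tau> y
  proof -
    have yy0: "y0 \<in> heights n i" using y0 gap_subset_heights[OF i] by blast
    have "ennreal \<bar>u (spread n \<omega> \<tau> y, y) - c\<bar> \<le>
        ennreal (\<bar>u (spread n \<omega> \<tau> y, y) - u (spread n \<omega> \<tau> y0, y0)\<bar> + \<bar>u (spread n \<omega> \<tau> y0, y0) - c\<bar>)"
      by (intro ennreal_leI) simp
    also have "\<dots> = ennreal \<bar>u (spread n \<omega> \<tau> y, y) - u (spread n \<omega> \<tau> y0, y0)\<bar> + ennreal \<bar>u (spread n \<omega> \<tau> y0, y0) - c\<bar>"
      by (rule ennreal_plus) auto
    also have "\<dots> \<le> 2 * F \<omega> \<tau> + \<Phi> y0"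
    proof (intro add_mono)
      show "ennreal \<bar>u (spread n \<omega> \<tau> y, y) - u (spread n \<omega> \<tau> y0, y0)\<bar> \<le> 2 * F \<omega> \<tau>"
        unfolding F_def by (rule spread_oscillation[OF grad N \<omega> y yy0]) measurable
      show "ennreal \<bar>u (spread n \<omega> \<tau> y0, y0) - c\<bar> \<le> \<Phi> y0"
        unfolding \<Phi>_def c_def
      proof (rule lip_gradient_horizontal[OF grad _ _ convex_cantor_interval])
        show "spread n \<omega> \<tau> y0 \<in> ?I" using yy0 by (intro spread_in_base \<omega>) (simp add: heights_def)
        show "?\<alpha> \<in> ?I" using C.apow[of "\<nu> * n"] by (simp add: cantor_interval_def)
        show "?I \<times> {y0} \<subseteq> tower n N i" using Isub[OF y0(1)] by (auto simp: slice_def)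
      qed auto
    qed
    finally show ?thesis .
  qed
  have Fm: "(\<lambda>\<tau>. F \<omega> \<tau>) \<in> borel_measurable borel" for \<omega> unfolding F_def by measurable
  have Fm2[measurable]: "(\<lambda>z. F (fst z) (snd z)) \<in> borel_measurable (lborel \<Otimes>\<^sub>M lborel)"
    unfolding F_def by measurable
  have flux: "flux n N i g = (\<integral>\<^sup>+ \<omega>\<in>dyadic (\<nu> * n) N. (\<integral>\<^sup>+ \<tau>\<in>{0..1}. F \<omega> \<tau> \<partial>lborel) \<partial>lborel)"
    by (simp add: flux_def F_def)
  define b :: real where "b = (1 / 2) ^ (\<nu> * n)"
  have avg: "(\<integral>\<^sup>+ \<omega>\<in>dyadic (\<nu> * n) N. (\<integral>\<^sup>+ \<tau>\<in>{0..1}. ennreal \<bar>u (spread n \<omega> \<tau> y, y) - c\<bar> \<partial>lborel) \<partial>lborel) \<le>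
      2 * flux n N i g + ennreal b * \<Phi> y0" if y: "y \<in> heights n i" for y
  proof -
    have inner: "(\<integral>\<^sup>+ \<tau>\<in>{0..1}. ennreal \<bar>u (spread n \<omega> \<tau> y, y) - c\<bar> \<partial>lborel) \<le> 2 * (\<integral>\<^sup>+ \<tau>\<in>{0..1}. F \<omega> \<tau> \<partial>lborel) + \<Phi> y0"
      if \<omega>: "\<omega> \<in> dyadic (\<nu> * n) N" for \<omega>
    proof -
      have "(\<integral>\<^sup>+ \<tau>\<in>{0..1}. ennreal \<bar>u (spread n \<omega> \<tau> y, y) - c\<bar> \<partial>lborel) \<le>
          (\<integral>\<^sup>+ \<tau>. 2 * (F \<omega> \<tau> * indicator {0..1} \<tau>) + \<Phi> y0 * indicator {0..1} \<tau> \<partial>lborel)"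
        using pt[OF \<omega> _ y] by (intro nn_integral_mono) (auto split: split_indicator)
      also have "\<dots> = 2 * (\<integral>\<^sup>+ \<tau>\<in>{0..1}. F \<omega> \<tau> \<partial>lborel) + \<Phi> y0"
        using Fm[of \<omega>] by (subst nn_integral_add) (auto simp: nn_integral_cmult nn_integral_cmult_indicator)
      finally show ?thesis .
    qed
    have "(\<integral>\<^sup>+ \<omega>\<in>dyadic (\<nu> * n) N. (\<integral>\<^sup>+ \<tau>\<in>{0..1}. ennreal \<bar>u (spread n \<omega> \<tau> y, y) - c\<bar> \<partial>lborel) \<partial>lborel) \<le>
        (\<integral>\<^sup>+ \<omega>. 2 * ((\<integral>\<^sup>+ \<tau>\<in>{0..1}. F \<omega> \<tau> \<partial>lborel) * indicator (dyadic (\<nu> * n) N) \<omega>) +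
          \<Phi> y0 * indicator (dyadic (\<nu> * n) N) \<omega> \<partial>lborel)"
      using inner by (intro nn_integral_mono) (auto split: split_indicator)
    also have "\<dots> = 2 * flux n N i g + ennreal b * \<Phi> y0"
      unfolding flux
      by (subst nn_integral_add)
        (auto simp: nn_integral_cmult nn_integral_cmult_indicator emeasure_dyadic b_def power_one_over mult.commute)
    finally show ?thesis .
  qed
  let ?B = "ennreal (2 * 2 ^ (\<nu> * n) * ?r) * (2 * flux n N i g + ennreal b * \<Phi> y0)"
  have "(\<integral>\<^sup>+ z\<in>tower n N i. ennreal \<bar>u z - c\<bar> \<partial>lborel) =
      (\<integral>\<^sup>+ y\<in>heights n i. (\<integral>\<^sup>+ x\<in>slice n N i y. ennreal \<bar>u (x, y) - c\<bar> \<partial>lborel) \<partial>lborel)"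
    by (rule tower_nn_integral) measurable
  also have "\<dots> \<le> (\<integral>\<^sup>+ y. ennreal (2 * ?r) * ((\<integral>\<^sup>+ x\<in>slice n N i y. g (x, y) \<partial>lborel) * indicator (heights n i) y) +
      ?B * indicator (heights n i) y \<partial>lborel)"
  proof (rule nn_integral_mono_AE, rule AE_mp[OF AE_not_D], rule AE_I2, rule impI)
    fix y assume yD: "y \<notin> D"
    show "(\<integral>\<^sup>+ x\<in>slice n N i y. ennreal \<bar>u (x, y) - c\<bar> \<partial>lborel) * indicator (heights n i) y \<le>
        ennreal (2 * ?r) * ((\<integral>\<^sup>+ x\<in>slice n N i y. g (x, y) \<partial>lborel) * indicator (heights n i) y) +
        ?B * indicator (heights n i) y"
    proof (cases "y \<in> heights n i")
      case True
      have "(\<integral>\<^sup>+ x\<in>slice n N i y. ennreal \<bar>u (x, y) - c\<bar> \<partial>lborel) \<le>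
          ennreal (2 * ?r) * (\<integral>\<^sup>+ x\<in>slice n N i y. g (x, y) \<partial>lborel) +
          ennreal (2 * 2 ^ (\<nu> * n) * ?r) * (\<integral>\<^sup>+ \<omega>\<in>dyadic (\<nu> * n) N. (\<integral>\<^sup>+ \<tau>\<in>{0..1}.
            ennreal \<bar>u (spread n \<omega> \<tau> y, y) - c\<bar> \<partial>lborel) \<partial>lborel)"
        by (rule slice_average[OF grad N i True yD]) measurable
      also have "\<dots> \<le> ennreal (2 * ?r) * (\<integral>\<^sup>+ x\<in>slice n N i y. g (x, y) \<partial>lborel) + ?B"
        by (intro add_left_mono mult_left_mono avg[OF True]) auto
      finally show ?thesis using True by simp
    qed simp
  qed
  also have "\<dots> = ennreal (2 * ?r) * (\<integral>\<^sup>+ z\<in>tower n N i. g z \<partial>lborel) + ?B * emeasure lborel (heights n i)"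
  proof -
    have [measurable]: "(\<lambda>y. (\<integral>\<^sup>+ x\<in>slice n N i y. g (x, y) \<partial>lborel) * indicator (heights n i) y) \<in> borel_measurable borel"
    proof -
      have "indicator (slice n N i y) x = (indicator (tower n N i) (x, y) :: ennreal)" for x y
        by (simp add: slice_def indicator_def)
      then show ?thesis by simp
    qed
    show ?thesis
      by (subst nn_integral_add)
        (auto simp: nn_integral_cmult nn_integral_cmult_indicator tower_nn_integral[OF assms(5)])
  qed
  also have "\<dots> \<le> ennreal (2 * ?r) * (\<integral>\<^sup>+ z\<in>tower n N i. g z \<partial>lborel) + ?B * ennreal (3 * ?r)"
    by (intro add_left_mono mult_left_mono emeasure_heights) auto
  \<comment> \<open>12 = 2 * 2 * 3: from \<open>slice_average\<close>, from the Lipschitz constant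
    of the curves, and from the length of \<open>heights n i\<close>. The horizontal move at
    \<open>y0\<close> lacks the second factor, hence 6.\<close>
  also have "?B * ennreal (3 * ?r) = ennreal (12 * 2 ^ (\<nu> * n) * ?r\<^sup>2) * flux n N i g + ennreal (6 * ?r) * (ennreal ?r * \<Phi> y0)"
  proof -
    have b: "2 ^ (\<nu> * n) * b = 1" by (simp add: b_def power_one_over)
    have "?B * ennreal (3 * ?r) = (ennreal (2 * 2 ^ (\<nu> * n) * ?r) * 2 * ennreal (3 * ?r)) * flux n N i g +
        (ennreal (2 * 2 ^ (\<nu> * n) * ?r) * ennreal b * ennreal (3 * ?r)) * \<Phi> y0"
      by (simp only: distrib_left distrib_right mult_ac)
    also have "ennreal (2 * 2 ^ (\<nu> * n) * ?r) * 2 * ennreal (3 * ?r) = ennreal ((2 * 2 ^ (\<nu> * n) * ?r) * 2 * (3 * ?r))"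
    proof -
      have "ennreal x * 2 * ennreal y = ennreal (x * 2 * y)" if "0 \<le> x" "0 \<le> y" for x y
        using that by (simp add: ennreal_mult)
      then show ?thesis using qpow[of n] by simp
    qed
    also have "(2 * 2 ^ (\<nu> * n) * ?r) * 2 * (3 * ?r) = 12 * 2 ^ (\<nu> * n) * ?r\<^sup>2" by (simp add: power2_eq_square)
    also have "ennreal (2 * 2 ^ (\<nu> * n) * ?r) * ennreal b * ennreal (3 * ?r) = ennreal ((2 * 2 ^ (\<nu> * n) * ?r) * b * (3 * ?r))"
    proof -
      have "ennreal x * ennreal y * ennreal z = ennreal (x * y * z)" if "0 \<le> x" "0 \<le> y" "0 \<le> z" for x y z
        using that by (simp add: ennreal_mult)
      then show ?thesis using qpow[of n] by (simp add: b_def)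
    qed
    also have "(2 * 2 ^ (\<nu> * n) * ?r) * b * (3 * ?r) = 6 * ?r * ?r * (2 ^ (\<nu> * n) * b)" by simp
    also have "\<dots> = 6 * ?r * ?r" unfolding b by simp
    also have "ennreal (6 * ?r * ?r) = ennreal (6 * ?r) * ennreal ?r" using qpow[of n] by (intro ennreal_mult) auto
    finally show ?thesis by (simp only: mult.assoc)
  qed
  also have "ennreal (2 * ?r) * (\<integral>\<^sup>+ z\<in>tower n N i. g z \<partial>lborel) +
      (ennreal (12 * 2 ^ (\<nu> * n) * ?r\<^sup>2) * flux n N i g + ennreal (6 * ?r) * (ennreal ?r * \<Phi> y0)) \<le>
      ennreal (2 * ?r) * (\<integral>\<^sup>+ z\<in>tower n N i. g z \<partial>lborel) +
      (ennreal (12 * 2 ^ (\<nu> * n) * ?r\<^sup>2) * flux n N i g + ennreal (6 * ?r) * (\<integral>\<^sup>+ z\<in>tower n N i. g z \<partial>lborel))"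
    by (intro add_left_mono mult_left_mono order_trans[OF y0(2) \<Phi>int]) auto
  also have "\<dots> = (ennreal (2 * ?r) + ennreal (6 * ?r)) * (\<integral>\<^sup>+ z\<in>tower n N i. g z \<partial>lborel) +
      ennreal (12 * 2 ^ (\<nu> * n) * ?r\<^sup>2) * flux n N i g"
    by (simp only: distrib_right add_ac)
  also have "ennreal (2 * ?r) + ennreal (6 * ?r) = ennreal (8 * ?r)"
    using qpow[of n] by (subst ennreal_plus[symmetric]) auto
  finally show ?thesis by blast
qed

end

section \<open>Integrals of powers\<close>

lemma nn_integral_powr_0:
  assumes "a < 1" "0 \<le> r"
  shows "(\<integral>\<^sup>+ x\<in>{0..r}. ennreal (x powr (- a)) \<partial>lborel) = ennreal (r powr (1 - a) / (1 - a))"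
proof -
  have "((\<lambda>x. x powr (- a)) has_integral (r powr (- a + 1) / (- a + 1))) {0..r}"
    using assms by (intro has_integral_powr_from_0) auto
  then have "((\<lambda>x. if x \<in> {0..r} then x powr (- a) else 0) has_integral (r powr (- a + 1) / (- a + 1))) UNIV"
    by (subst has_integral_restrict_UNIV)
  then have "integral\<^sup>N lborel (\<lambda>x. ennreal (if x \<in> {0..r} then x powr (- a) else 0)) =
      ennreal (r powr (- a + 1) / (- a + 1))"
    by (intro nn_integral_has_integral_lborel) auto
  also have "(\<lambda>x. ennreal (if x \<in> {0..r} then x powr (- a) else 0)) = (\<lambda>x. ennreal (x powr (- a)) * indicator {0..r} x)"
    by (auto simp: fun_eq_iff indicator_def)
  finally show ?thesis by (simp add: add.commute)
qed

lemma nn_integral_powr_shift: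
  assumes "a < 1" "0 \<le> r"
  shows "(\<integral>\<^sup>+ x\<in>{c..c + r}. ennreal ((x - c) powr (- a)) \<partial>lborel) = ennreal (r powr (1 - a) / (1 - a))"
    and "(\<integral>\<^sup>+ x\<in>{c - r..c}. ennreal ((c - x) powr (- a)) \<partial>lborel) = ennreal (r powr (1 - a) / (1 - a))"
proof -
  have "(\<integral>\<^sup>+ x\<in>{c..c + r}. ennreal ((x - c) powr (- a)) \<partial>lborel) =
      ennreal \<bar>1\<bar> * (\<integral>\<^sup>+ x. ennreal ((c + 1 * x - c) powr (- a)) * indicator {c..c + r} (c + 1 * x) \<partial>lborel)"
    by (rule nn_integral_real_affine) auto
  also have "\<dots> = (\<integral>\<^sup>+ x\<in>{0..r}. ennreal (x powr (- a)) \<partial>lborel)"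
    by (simp add: indicator_def)
  finally show "(\<integral>\<^sup>+ x\<in>{c..c + r}. ennreal ((x - c) powr (- a)) \<partial>lborel) = ennreal (r powr (1 - a) / (1 - a))"
    by (simp add: nn_integral_powr_0[OF assms])
  have "(\<integral>\<^sup>+ x\<in>{c - r..c}. ennreal ((c - x) powr (- a)) \<partial>lborel) =
      ennreal \<bar>-1\<bar> * (\<integral>\<^sup>+ x. ennreal ((c - (c + (-1) * x)) powr (- a)) * indicator {c - r..c} (c + (-1) * x) \<partial>lborel)"
    by (rule nn_integral_real_affine) auto
  also have "\<dots> = (\<integral>\<^sup>+ x\<in>{0..r}. ennreal (x powr (- a)) \<partial>lborel)"
    by (auto simp: indicator_def intro!: nn_integral_cong)
  finally show "(\<integral>\<^sup>+ x\<in>{c - r..c}. ennreal ((c - x) powr (- a)) \<partial>lborel) = ennreal (r powr (1 - a) / (1 - a))"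
    by (simp add: nn_integral_powr_0[OF assms])
qed

lemma ennreal_powr_measurable[measurable (raw)]:
  assumes [measurable]: "f \<in> borel_measurable M"
  shows "(\<lambda>x. ennreal_powr (f x) p) \<in> borel_measurable M"
  unfolding ennreal_powr_def by measurable

text \<open>A crude form of Young's inequality: below the threshold
  \<open>b powr (- 1 / (p - 1))\<close> the last term suffices, and above it
  \<open>b * t powr (p - 1) \<ge> 1\<close>, so the first one does.\<close>

lemma le_weighted_powr:
  assumes "1 < p" "0 < b"
  shows "x \<le> ennreal b * ennreal_powr x p + ennreal (b powr (- 1 / (p - 1)))"
proof (cases x)
  case top
  then show ?thesis using \<open>0 < b\<close> by (simp add: ennreal_powr_def ennreal_mult_eq_top_iff)
next
  case (real t)
  show ?thesis
  proof (cases "t \<le> b powr (- 1 / (p - 1))")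
    case True
    then have "x \<le> ennreal (b powr (- 1 / (p - 1)))" using real by (simp add: ennreal_leI)
    then show ?thesis by (simp add: add_increasing)
  next
    case False
    have t: "0 < t" using False by (smt (verit) powr_ge_zero)
    have "b powr -1 = (b powr (- 1 / (p - 1))) powr (p - 1)" using assms by (simp add: powr_powr)
    also have "\<dots> \<le> t powr (p - 1)" using False assms by (intro powr_mono2) auto
    finally have "1 \<le> b * t powr (p - 1)" using \<open>0 < b\<close> by (simp add: powr_minus_divide field_simps)
    then have "1 * t \<le> b * t powr (p - 1) * t" using t by (intro mult_right_mono) auto
    also have "t powr (p - 1) * t = t powr p" using t by (metis add.commute diff_add_cancel powr_mult_base mult.commute less_imp_le)
    then have "b * t powr (p - 1) * t = b * t powr p" by (simp add: mult.assoc)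
    finally have "x \<le> ennreal (b * t powr p)" using real by (simp add: ennreal_leI)
    also have "\<dots> = ennreal b * ennreal_powr x p" using real \<open>0 < b\<close> by (simp add: ennreal_powr_def ennreal_mult)
    finally show ?thesis by (rule add_increasing2[rotated]) simp
  qed
qed

text \<open>\<open>s\<close> is the dimension of \<open>cantor_set l\<close>. In the Young inequality for the flux, the density of the
  pencil costs a factor \<open>h powr (s - 1)\<close> at distance \<open>h\<close> from \<open>D\<close>, which leaves \<open>h powr (- a)\<close> to be integrated;
  \<open>crit\<close> is the condition for the integral to be finite.\<close>

locale supercritical = cantor_space +
  fixes s p a :: real
  assumes s: "l powr s = 1 / 2" and p: "1 < p" and a: "a = (1 - s) / (p - 1)" and crit: "2 * q powr (1 - a) < 1"
begin

lemma s_bounds: "0 < s" "s < 1"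
proof -
  show "0 < s" using s l_pos l_half powr_mono'[of s 0 l] by (cases "0 < s") auto
  show "s < 1" using s l_pos l_half powr_mono'[of 1 s l] by (cases "s < 1") auto
qed

lemma a_bounds: "0 < a" "a < 1"
proof -
  show "0 < a" using s_bounds p by (simp add: a)
  show "a < 1"
  proof (rule ccontr)
    assume "\<not> a < 1"
    then have "q powr 0 \<le> q powr (1 - a)" using q_pos q_quarter by (intro powr_mono') auto
    then show False using crit q_pos by simp
  qed
qed

text \<open>\<open>B0\<close> accounts for the two ends of a gap, with \<open>1 / (1 - a)\<close>
  each. \<open>M0\<close> is the fixed point of \<open>M = B0 + 2 * q powr (1 - a) * M\<close>: a
  band consists of one gap and two bands smaller by the factor q. \<open>crit\<close> makes it
  positive.\<close>

definition B0 :: real where "B0 = 2 / (1 - a)"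
definition M0 :: real where "M0 = B0 / (1 - 2 * q powr (1 - a))"

lemma M0: "0 < B0" "0 < M0" "B0 + M0 * (2 * q powr (1 - a)) = M0"
proof -
  define \<theta> where "\<theta> = 2 * q powr (1 - a)"
  have \<theta>: "\<theta> < 1" "M0 = B0 / (1 - \<theta>)" using crit by (auto simp: \<theta>_def M0_def)
  show "0 < B0" using a_bounds by (simp add: B0_def)
  then show "0 < M0" using \<theta> by simp
  have "B0 + M0 * \<theta> = M0" unfolding \<theta>(2) using \<theta>(1) by (simp add: field_simps)
  then show "B0 + M0 * (2 * q powr (1 - a)) = M0" by (simp add: \<theta>_def)
qed

section \<open>Integrals of powers of the distance to D\<close>

lemma infdist_D_ge: "(\<And>e. e \<in> D \<Longrightarrow> m \<le> \<bar>t - e\<bar>) \<Longrightarrow> m \<le> infdist t D"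
  using D_nonempty by (auto simp: infdist_def dist_real_def intro!: cINF_greatest)

text \<open>Since \<open>0 powr x = 0\<close>, it vanishes on \<open>D\<close> instead of being
  infinite there, so the monotone limit over the levels in \<open>dist_powr_band\<close> is exact at
  every point.\<close>

definition dist_powr :: "real \<Rightarrow> ennreal" where "dist_powr t = ennreal (infdist t D powr (- a))"

lemma dist_powr_measurable[measurable]: "dist_powr \<in> borel_measurable borel"
proof -
  have [measurable]: "(\<lambda>y. infdist y D) \<in> borel_measurable borel"
    by (intro borel_measurable_continuous_onI continuous_intros)
  show ?thesis unfolding dist_powr_def[abs_def] by measurable
qed

lemma dist_powr_le: "(\<And>e. e \<in> D \<Longrightarrow> m \<le> \<bar>t - e\<bar>) \<Longrightarrow> 0 < m \<Longrightarrow> dist_powr t \<le> ennreal (m powr (- a))"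
  unfolding dist_powr_def using infdist_D_ge[of m t] a_bounds by (intro ennreal_leI powr_mono2') auto

lemma dist_powr_D: "t \<in> D \<Longrightarrow> dist_powr t = 0" by (simp add: dist_powr_def)

lemma dist_powr_gap:
  assumes i: "i < 2 ^ k"
  shows "(\<integral>\<^sup>+ t\<in>gap k i. dist_powr t \<partial>lborel) \<le> ennreal (B0 * (q ^ k) powr (1 - a))"
proof -
  let ?lo = "gap_lo k i" and ?r = "q ^ k"
  have pt: "dist_powr t * indicator (gap k i) t \<le> ennreal ((t - ?lo) powr (- a)) * indicator {?lo..?lo + ?r} t +
      ennreal ((?lo + ?r - t) powr (- a)) * indicator {?lo + ?r - ?r..?lo + ?r} t" for t
  proof (cases "t \<in> open_gap k i")
    case True
    let ?m = "min (t - ?lo) (?lo + ?r - t)"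
    have m: "0 < ?m" using True by (auto simp: open_gap_def)
    have "dist_powr t \<le> ennreal (?m powr (- a))"
    proof (rule dist_powr_le[OF _ m])
      fix e assume "e \<in> D"
      then have "e \<notin> open_gap k i" using open_gap_disjoint_D i by blast
      then show "?m \<le> \<bar>t - e\<bar>" by (auto simp: open_gap_def)
    qed
    also have "\<dots> \<le> ennreal ((t - ?lo) powr (- a) + (?lo + ?r - t) powr (- a))"
      by (intro ennreal_leI) (simp add: min_def)
    also have "\<dots> = ennreal ((t - ?lo) powr (- a)) + ennreal ((?lo + ?r - t) powr (- a))"
      by (rule ennreal_plus) auto
    finally show ?thesis using True by (simp add: open_gap_def gap_def indicator_def)
  next
    case False
    show ?thesis
    proof (cases "t \<in> gap k i")
      case True
      then have "t = ?lo \<or> t = ?lo + ?r" using False by (auto simp: gap_def open_gap_def)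
      then have "t \<in> D" using gap_ends_in_D[OF i] by auto
      then show ?thesis by (simp add: dist_powr_D)
    qed simp
  qed
  have "(\<integral>\<^sup>+ t\<in>gap k i. dist_powr t \<partial>lborel) \<le> (\<integral>\<^sup>+ t. ennreal ((t - ?lo) powr (- a)) * indicator {?lo..?lo + ?r} t +
      ennreal ((?lo + ?r - t) powr (- a)) * indicator {?lo + ?r - ?r..?lo + ?r} t \<partial>lborel)"
    by (intro nn_integral_mono pt)
  also have "\<dots> = ennreal (?r powr (1 - a) / (1 - a)) + ennreal (?r powr (1 - a) / (1 - a))"
    using qpow[of k] a_bounds
    by (subst nn_integral_add) (simp_all only: nn_integral_powr_shift[OF a_bounds(2) less_imp_le[OF qpow(1)[of k]]], measurable)
  also have "\<dots> = ennreal (B0 * ?r powr (1 - a))"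
    using a_bounds by (simp add: B0_def flip: ennreal_plus)
  finally show ?thesis .
qed

text \<open>Leaving out the bands of level \<open>K\<close> makes the self-similar recursion start
  from 0 at \<open>n = K\<close>; going down one level adds one gap and doubles the children, which
  is the equation for \<open>M0\<close>.\<close>

lemma dist_powr_band_level:
  assumes "n \<le> K" "i < 2 ^ n"
  shows "(\<integral>\<^sup>+ t\<in>band n i. dist_powr t * indicator (- bands K) t \<partial>lborel) \<le> ennreal (M0 * (q ^ n) powr (1 - a))"
  using assms
proof (induction "K - n" arbitrary: n i)
  case 0
  then have "n = K" by simp
  then have "band n i \<subseteq> bands K" using 0 by (auto simp: bands_def)
  then have "(\<integral>\<^sup>+ t\<in>band n i. dist_powr t * indicator (- bands K) t \<partial>lborel) = (\<integral>\<^sup>+ t. 0 \<partial>(lborel :: real measure))"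
    by (intro nn_integral_cong) (auto simp: indicator_def)
  then show ?case by simp
next
  case (Suc d)
  have [measurable]: "bands K \<in> sets borel" using closed_bands by simp
  have [measurable]: "band m j \<in> sets borel" "gap m j \<in> sets borel" for m j by (auto simp: band_def gap_def)
  let ?f = "\<lambda>t. dist_powr t * indicator (- bands K) t"
  have IH: "(\<integral>\<^sup>+ t\<in>band (Suc n) j. ?f t \<partial>lborel) \<le> ennreal (M0 * (q ^ Suc n) powr (1 - a))" if "j < 2 ^ Suc n" for j
    by (rule Suc(1)) (use Suc that in auto)
  have "(\<integral>\<^sup>+ t\<in>band n i. ?f t \<partial>lborel) \<le>
      (\<integral>\<^sup>+ t. dist_powr t * indicator (gap n i) t + (?f t * indicator (band (Suc n) (2 * i)) t +
        ?f t * indicator (band (Suc n) (2 * i + 1)) t) \<partial>lborel)"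
    using in_band_cases[of _ n i] by (intro nn_integral_mono) (auto simp: indicator_def)
  also have "\<dots> = (\<integral>\<^sup>+ t\<in>gap n i. dist_powr t \<partial>lborel) + ((\<integral>\<^sup>+ t\<in>band (Suc n) (2 * i). ?f t \<partial>lborel) +
      (\<integral>\<^sup>+ t\<in>band (Suc n) (2 * i + 1). ?f t \<partial>lborel))"
    by (subst nn_integral_add; (subst nn_integral_add)?; measurable)
  also have "\<dots> \<le> ennreal (B0 * (q ^ n) powr (1 - a)) + (ennreal (M0 * (q ^ Suc n) powr (1 - a)) +
      ennreal (M0 * (q ^ Suc n) powr (1 - a)))"
    using Suc by (intro add_mono dist_powr_gap IH) auto
  also have "\<dots> = ennreal (B0 * (q ^ n) powr (1 - a) + (M0 * (q ^ Suc n) powr (1 - a) + M0 * (q ^ Suc n) powr (1 - a)))"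
    using M0 by (simp flip: ennreal_plus)
  also have "B0 * (q ^ n) powr (1 - a) + (M0 * (q ^ Suc n) powr (1 - a) + M0 * (q ^ Suc n) powr (1 - a)) =
      (B0 + M0 * (2 * q powr (1 - a))) * (q ^ n) powr (1 - a)"
    using q_pos by (simp add: powr_mult algebra_simps)
  finally show ?case unfolding M0(3) .
qed

lemma dist_powr_band:
  assumes "i < 2 ^ n"
  shows "(\<integral>\<^sup>+ t\<in>band n i. dist_powr t \<partial>lborel) \<le> ennreal (M0 * (q ^ n) powr (1 - a))"
proof -
  have [measurable]: "bands K \<in> sets borel" for K using closed_bands by simp
  have [measurable]: "band m j \<in> sets borel" for m j by (simp add: band_def)
  let ?f = "\<lambda>K t. dist_powr t * indicator (- bands (n + K)) t * indicator (band n i) t"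
  have "incseq ?f"
  proof (rule incseq_SucI, rule le_funI)
    fix K t
    show "?f K t \<le> ?f (Suc K) t"
      using bands_antimono[of "n + K" "n + Suc K"] by (auto simp: indicator_def)
  qed
  have sup: "dist_powr t * indicator (band n i) t = (SUP K. ?f K t)" for t
  proof (cases "t \<in> D")
    case True then show ?thesis by (simp add: dist_powr_D)
  next
    case False
    then obtain m where "t \<notin> bands m" using D_iff_bands by blast
    then have "t \<notin> bands (n + m)" using bands_antimono[of m "n + m"] by auto
    then have "?f m t = dist_powr t * indicator (band n i) t" by simp
    moreover have "?f K t \<le> dist_powr t * indicator (band n i) t" for K by (auto simp: indicator_def)
    ultimately show ?thesis by (intro antisym SUP_upper2[of m] SUP_least) auto
  qed
  have "(\<integral>\<^sup>+ t\<in>band n i. dist_powr t \<partial>lborel) = (\<integral>\<^sup>+ t. (SUP K. ?f K t) \<partial>lborel)"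
    by (simp only: sup)
  also have "\<dots> = (SUP K. \<integral>\<^sup>+ t. ?f K t \<partial>lborel)"
    by (rule nn_integral_monotone_convergence_SUP[OF \<open>incseq ?f\<close>]) measurable
  also have "\<dots> \<le> ennreal (M0 * (q ^ n) powr (1 - a))"
    by (intro SUP_least dist_powr_band_level) (use assms in auto)
  finally show ?thesis .
qed

lemma dist_powr_heights:
  assumes i: "i < 2 ^ n"
  shows "(\<integral>\<^sup>+ t\<in>heights n i. dist_powr t \<partial>lborel) \<le> ennreal ((B0 + M0) * (q ^ n) powr (1 - a))"
proof -
  have [measurable]: "band m j \<in> sets borel" for m j by (simp add: band_def)
  let ?r = "q ^ n" let ?lo = "band_lo n i" let ?hi = "band_lo n i + L * q ^ n"
  \<comment> \<open>Points of \<open>D\<close> outside the band lie in other bands, at distance at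
    least \<open>q ^ n\<close>. Within \<open>q ^ n / 2\<close> of the band the nearest point of
    \<open>D\<close> is therefore an end of the band.\<close>
  have De: "e \<le> ?lo - ?r \<or> (?lo \<le> e \<and> e \<le> ?hi) \<or> ?hi + ?r \<le> e" if "e \<in> D" for e
  proof -
    have "e \<in> bands n" using that D_iff_bands by blast
    then obtain j where j: "j < 2 ^ n" "e \<in> band n j" unfolding bands_def by auto
    then consider "j < i" | "j = i" | "i < j" by linarith
    then show ?thesis
      using band_separated[of j i n] band_separated[of i j n] i j by cases (auto simp: band_def)
  qed
  have lohi: "?lo \<le> ?hi" using L_bounds qpow[of n] by simp
  have lower: "dist_powr t \<le> ennreal ((?lo - t) powr (- a))" if t: "?lo - ?r / 2 \<le> t" "t < ?lo" for t
  proof (rule dist_powr_le)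
    fix e assume "e \<in> D"
    then show "?lo - t \<le> \<bar>t - e\<bar>" using De[of e] t lohi by linarith
  qed (use t in simp)
  have upper: "dist_powr t \<le> ennreal ((t - ?hi) powr (- a))" if t: "?hi < t" "t \<le> ?hi + ?r / 2" for t
  proof (rule dist_powr_le)
    fix e assume "e \<in> D"
    then show "t - ?hi \<le> \<bar>t - e\<bar>" using De[of e] t lohi by linarith
  qed (use t in simp)
  have pt: "dist_powr t * indicator (heights n i) t \<le> dist_powr t * indicator (band n i) t +
      (ennreal ((?lo - t) powr (- a)) * indicator {?lo - ?r / 2..?lo} t +
       ennreal ((t - ?hi) powr (- a)) * indicator {?hi..?hi + ?r / 2} t)" for t
  proof (cases "t \<in> heights n i")
    case True
    then consider "t \<in> band n i" | "?lo - ?r / 2 \<le> t" "t < ?lo" | "?hi < t" "t \<le> ?hi + ?r / 2"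
      unfolding heights_def span_def band_def Int_iff atLeastAtMost_iff by linarith
    then show ?thesis
    proof cases
      case 2 then show ?thesis using lower[OF 2] True by (simp add: indicator_def add_increasing add_increasing2)
    next
      case 3 then show ?thesis using upper[OF 3] True by (simp add: indicator_def add_increasing add_increasing2)
    qed (simp add: True)
  qed simp
  have "(\<integral>\<^sup>+ t\<in>heights n i. dist_powr t \<partial>lborel) \<le> (\<integral>\<^sup>+ t. dist_powr t * indicator (band n i) t +
      (ennreal ((?lo - t) powr (- a)) * indicator {?lo - ?r / 2..?lo} t +
       ennreal ((t - ?hi) powr (- a)) * indicator {?hi..?hi + ?r / 2} t) \<partial>lborel)"
    by (intro nn_integral_mono pt)
  also have "\<dots> = (\<integral>\<^sup>+ t\<in>band n i. dist_powr t \<partial>lborel) +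
      ((\<integral>\<^sup>+ t\<in>{?lo - ?r / 2..?lo}. ennreal ((?lo - t) powr (- a)) \<partial>lborel) +
       (\<integral>\<^sup>+ t\<in>{?hi..?hi + ?r / 2}. ennreal ((t - ?hi) powr (- a)) \<partial>lborel))"
    by (subst nn_integral_add; (subst nn_integral_add)?; measurable)
  also have "\<dots> \<le> ennreal (M0 * ?r powr (1 - a)) +
      (ennreal ((?r / 2) powr (1 - a) / (1 - a)) + ennreal ((?r / 2) powr (1 - a) / (1 - a)))"
    using nn_integral_powr_shift[OF a_bounds(2), of "?r / 2"] qpow[of n]
    by (intro add_mono dist_powr_band i) auto
  also have "\<dots> = ennreal (M0 * ?r powr (1 - a) + ((?r / 2) powr (1 - a) / (1 - a) + (?r / 2) powr (1 - a) / (1 - a)))"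
    using M0 a_bounds by (simp flip: ennreal_plus)
  also have "\<dots> \<le> ennreal ((B0 + M0) * ?r powr (1 - a))"
  proof (rule ennreal_leI)
    have "(?r / 2) powr (1 - a) / (1 - a) \<le> ?r powr (1 - a) / (1 - a)"
      using qpow[of n] a_bounds by (intro divide_right_mono powr_mono2) auto
    then show "M0 * ?r powr (1 - a) + ((?r / 2) powr (1 - a) / (1 - a) + (?r / 2) powr (1 - a) / (1 - a)) \<le>
        (B0 + M0) * ?r powr (1 - a)"
      by (simp add: B0_def distrib_right)
  qed
  finally show ?thesis .
qed

text \<open>\<open>B0 + M0\<close> comes from \<open>dist_powr_heights\<close>; the last term covers
  the heights where \<open>height\<close> is capped at \<open>q ^ n / 2\<close>, on a set of length
  at most \<open>3 * q ^ n\<close>.\<close>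

definition C2 :: real where "C2 = B0 + M0 + 3 * 2 powr a"

lemma height_integral:
  assumes i: "i < 2 ^ n"
  shows "(\<integral>\<^sup>+ t\<in>heights n i. ennreal ((height n t / q ^ n) powr (- a)) \<partial>lborel) \<le> ennreal (C2 * q ^ n)"
proof -
  let ?r = "q ^ n"
  have pt: "ennreal ((height n t / ?r) powr (- a)) \<le> ennreal (?r powr a) * dist_powr t + ennreal (2 powr a)" for t
  proof -
    have "(height n t / ?r) powr (- a) \<le> ?r powr a * infdist t D powr (- a) + 2 powr a"
    proof (cases "infdist t D \<le> ?r / 2")
      case True
      have "(height n t / ?r) powr (- a) = ?r powr a * infdist t D powr (- a)"
        using True qpow[of n] infdist_nonneg[of t D] by (simp add: height_def powr_divide powr_minus field_simps)
      then show ?thesis by simp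
    next
      case False
      have "(height n t / ?r) powr (- a) = (1 / 2) powr (- a)" using False q_pos by (simp add: height_def)
      also have "\<dots> = 2 powr a" by (simp add: powr_minus powr_divide)
      finally show ?thesis by simp
    qed
    then show ?thesis unfolding dist_powr_def by (simp add: ennreal_leI flip: ennreal_mult ennreal_plus)
  qed
  have "(\<integral>\<^sup>+ t\<in>heights n i. ennreal ((height n t / ?r) powr (- a)) \<partial>lborel) \<le>
      (\<integral>\<^sup>+ t. ennreal (?r powr a) * (dist_powr t * indicator (heights n i) t) + ennreal (2 powr a) * indicator (heights n i) t \<partial>lborel)"
    using pt by (intro nn_integral_mono) (auto split: split_indicator)
  also have "\<dots> = ennreal (?r powr a) * (\<integral>\<^sup>+ t\<in>heights n i. dist_powr t \<partial>lborel) + ennreal (2 powr a) * emeasure lborel (heights n i)"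
    by (subst nn_integral_add) (auto simp: nn_integral_cmult nn_integral_cmult_indicator)
  also have "\<dots> \<le> ennreal (?r powr a) * ennreal ((B0 + M0) * ?r powr (1 - a)) + ennreal (2 powr a) * ennreal (3 * ?r)"
    by (intro add_mono mult_left_mono dist_powr_heights[OF i] emeasure_heights) auto
  also have "\<dots> = ennreal (?r powr a * ((B0 + M0) * ?r powr (1 - a)) + 2 powr a * (3 * ?r))"
    using M0 qpow[of n] by (simp flip: ennreal_mult ennreal_plus)
  also have "?r powr a * ((B0 + M0) * ?r powr (1 - a)) = (B0 + M0) * (?r powr a * ?r powr (1 - a))" by simp
  also have "?r powr a * ?r powr (1 - a) = ?r" using qpow[of n] by (simp flip: powr_add)
  also have "(B0 + M0) * ?r + 2 powr a * (3 * ?r) = C2 * ?r" by (simp add: C2_def algebra_simps)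
  finally show ?thesis .
qed

section \<open>The density of the pencil\<close>

definition C1 :: real where "C1 = 2 * (2 / (1 - 2 * l)) powr s"

lemma C12_pos: "0 < C1" "0 < C2"
  using l_half M0 by (auto simp: C1_def C2_def intro!: add_pos_nonneg)

text \<open>For fixed \<omega> the point moves with speed \<open>height n t\<close> in \<tau>, which
  gives density \<open>1 / height n t\<close> on a segment close to the Cantor point. After
  exchanging the integrals, the mass of those \<omega> whose Cantor point is within
  \<open>height n t\<close> of \<open>x\<close> is at most
  \<open>C1 * height n t powr s\<close>.\<close>

lemma spread_density:
  assumes N: "N < 2 ^ (\<nu> * n)" and t: "t \<in> heights n i" "t \<notin> D" and [measurable]: "h \<in> borel_measurable borel"
  shows "(\<integral>\<^sup>+ \<omega>\<in>dyadic (\<nu> * n) N. (\<integral>\<^sup>+ \<tau>\<in>{0..1}. h (spread n \<omega> \<tau> t) \<partial>lborel) \<partial>lborel) \<le>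
    ennreal (C1 * height n t powr (s - 1)) * (\<integral>\<^sup>+ x\<in>slice n N i t. h x \<partial>lborel)"
proof -
  let ?\<delta> = "height n t" and ?\<xi> = "cantor_point l"
  have \<delta>: "0 < ?\<delta>" using height_pos[OF t(2)] .
  have t0: "t \<in> {0..L}" using t by (simp add: heights_def)
  \<comment> \<open>Instead of the exact segment for \<omega> only its distance from the Cantor
    point is recorded; this condition is what the regularity of the Cantor measure controls once
    \<omega> becomes the inner variable.\<close>
  define f where "f \<omega> x = h x * indicator (slice n N i t) x * indicator {x. \<bar>x - ?\<xi> \<omega>\<bar> \<le> ?\<delta>} x" for \<omega> x
  have fm[measurable]: "(\<lambda>z. f (fst z) (snd z)) \<in> borel_measurable (lborel \<Otimes>\<^sub>M lborel)"
  proof -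
    have "(\<lambda>z. f (fst z) (snd z)) = (\<lambda>z. h (snd z) * indicator (slice n N i t) (snd z) *
        indicator {z. \<bar>snd z - ?\<xi> (fst z)\<bar> \<le> ?\<delta>} z)"
      by (auto simp: f_def indicator_def fun_eq_iff)
    also have "\<dots> \<in> borel_measurable (lborel \<Otimes>\<^sub>M lborel)" by measurable
    finally show ?thesis .
  qed
  have inner: "(\<integral>\<^sup>+ \<tau>\<in>{0..1}. h (spread n \<omega> \<tau> t) \<partial>lborel) \<le> ennreal (1 / ?\<delta>) * (\<integral>\<^sup>+ x. f \<omega> x \<partial>lborel)"
    if \<omega>: "\<omega> \<in> dyadic (\<nu> * n) N" for \<omega>
  proof -
    let ?m = "depth n t"
    define e where "e = ?\<xi> \<omega> + ?\<delta> / l ^ ?m * (left_end l ?m (prefix ?m \<omega>) - ?\<xi> \<omega>)"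
    have spread: "spread n \<omega> \<tau> t = e + ?\<delta> * \<tau>" for \<tau>
      using C.apow[of ?m] l_pos by (simp add: spread_def e_def field_simps)
    have "(\<integral>\<^sup>+ \<tau>\<in>{0..1}. h (spread n \<omega> \<tau> t) \<partial>lborel) \<le> (\<integral>\<^sup>+ \<tau>. f \<omega> (e + ?\<delta> * \<tau>) \<partial>lborel)"
    proof (rule nn_integral_mono)
      fix \<tau> :: real
      show "h (spread n \<omega> \<tau> t) * indicator {0..1} \<tau> \<le> f \<omega> (e + ?\<delta> * \<tau>)"
      proof (cases "\<tau> \<in> {0..1}")
        case True
        have "spread n \<omega> \<tau> t \<in> slice n N i t"
          using spread_in_tower[OF \<omega> N True t0] t by (simp add: slice_def heights_def)
        moreover have "\<bar>spread n \<omega> \<tau> t - ?\<xi> \<omega>\<bar> \<le> ?\<delta>"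
          using spread_close[OF dyadic_nonneg[OF \<omega>] True] .
        ultimately show ?thesis unfolding spread[symmetric] f_def using True by simp
      qed simp
    qed
    also have "\<dots> = ennreal (1 / ?\<delta>) * (ennreal \<bar>?\<delta>\<bar> * (\<integral>\<^sup>+ \<tau>. f \<omega> (e + ?\<delta> * \<tau>) \<partial>lborel))"
    proof -
      have "ennreal (1 / ?\<delta>) * ennreal \<bar>?\<delta>\<bar> = 1" using \<delta> by (simp flip: ennreal_mult)
      then show ?thesis by (simp flip: mult.assoc)
    qed
    also have "ennreal \<bar>?\<delta>\<bar> * (\<integral>\<^sup>+ \<tau>. f \<omega> (e + ?\<delta> * \<tau>) \<partial>lborel) = (\<integral>\<^sup>+ x. f \<omega> x \<partial>lborel)"
      using \<delta> by (intro nn_integral_real_affine[symmetric]) (auto simp: f_def)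
    finally show ?thesis .
  qed
  have fm1: "(\<lambda>\<omega>. \<integral>\<^sup>+ x. f \<omega> x \<partial>lborel) \<in> borel_measurable borel" by measurable
  have "(\<integral>\<^sup>+ \<omega>\<in>dyadic (\<nu> * n) N. (\<integral>\<^sup>+ \<tau>\<in>{0..1}. h (spread n \<omega> \<tau> t) \<partial>lborel) \<partial>lborel) \<le>
      (\<integral>\<^sup>+ \<omega>. ennreal (1 / ?\<delta>) * ((\<integral>\<^sup>+ x. f \<omega> x \<partial>lborel) * indicator {0..<1} \<omega>) \<partial>lborel)"
  proof (rule nn_integral_mono)
    fix \<omega> :: real
    show "(\<integral>\<^sup>+ \<tau>\<in>{0..1}. h (spread n \<omega> \<tau> t) \<partial>lborel) * indicator (dyadic (\<nu> * n) N) \<omega> \<le>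
        ennreal (1 / ?\<delta>) * ((\<integral>\<^sup>+ x. f \<omega> x \<partial>lborel) * indicator {0..<1} \<omega>)"
    proof (cases "\<omega> \<in> dyadic (\<nu> * n) N")
      case True
      then have "\<omega> \<in> {0..<1}" using dyadic_nonneg dyadic_less_1[OF True N] by auto
      then show ?thesis using inner[OF True] True by simp
    qed simp
  qed
  also have "\<dots> = ennreal (1 / ?\<delta>) * (\<integral>\<^sup>+ \<omega>. (\<integral>\<^sup>+ x. f \<omega> x * indicator {0..<1} \<omega> \<partial>lborel) \<partial>lborel)"
  proof -
    have fx: "f \<omega> \<in> borel_measurable borel" for \<omega>
      using measurable_compose[OF measurable_Pair1'[of \<omega> lborel lborel] fm] by simp
    have "(\<integral>\<^sup>+ x. f \<omega> x * indicator {0..<1} \<omega> \<partial>lborel) = (\<integral>\<^sup>+ x. f \<omega> x \<partial>lborel) * indicator {0..<1} \<omega>" for \<omega>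
      by (rule nn_integral_multc) (simp add: fx)
    then show ?thesis using fm1 by (simp add: nn_integral_cmult)
  qed
  also have "(\<integral>\<^sup>+ \<omega>. (\<integral>\<^sup>+ x. f \<omega> x * indicator {0..<1} \<omega> \<partial>lborel) \<partial>lborel) =
      (\<integral>\<^sup>+ x. (\<integral>\<^sup>+ \<omega>. f \<omega> x * indicator {0..<1} \<omega> \<partial>lborel) \<partial>lborel)"
  proof -
    have "(\<lambda>(x, \<omega>). f \<omega> x * indicator {0..<1::real} \<omega>) \<in> borel_measurable (lborel \<Otimes>\<^sub>M lborel)"
      using measurable_compose[OF measurable_pair_swap', of _ lborel lborel, OF fm]
      by (simp add: case_prod_beta)
    then show ?thesis by (rule lborel_pair.Fubini')
  qed
  also have "\<dots> \<le> (\<integral>\<^sup>+ x. ennreal (C1 * ?\<delta> powr s) * (h x * indicator (slice n N i t) x) \<partial>lborel)"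
  proof (rule nn_integral_mono)
    fix x
    have "(\<integral>\<^sup>+ \<omega>. f \<omega> x * indicator {0..<1} \<omega> \<partial>lborel) =
        (\<integral>\<^sup>+ \<omega>. (h x * indicator (slice n N i t) x) * indicator {\<omega> \<in> {0..<1}. \<bar>x - ?\<xi> \<omega>\<bar> \<le> ?\<delta>} \<omega> \<partial>lborel)"
      by (intro nn_integral_cong) (auto simp: f_def indicator_def)
    also have "\<dots> = (h x * indicator (slice n N i t) x) * emeasure lborel {\<omega> \<in> {0..<1}. \<bar>x - ?\<xi> \<omega>\<bar> \<le> ?\<delta>}"
      by (rule nn_integral_cmult_indicator) measurable
    also have "\<dots> \<le> (h x * indicator (slice n N i t) x) * ennreal (C1 * ?\<delta> powr s)"
      unfolding C1_def by (intro mult_left_mono C.emeasure_cantor_point_near s \<delta>) auto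
    finally show "(\<integral>\<^sup>+ \<omega>. f \<omega> x * indicator {0..<1} \<omega> \<partial>lborel) \<le>
        ennreal (C1 * ?\<delta> powr s) * (h x * indicator (slice n N i t) x)"
      by (simp add: mult.commute)
  qed
  also have "\<dots> = ennreal (C1 * ?\<delta> powr s) * (\<integral>\<^sup>+ x\<in>slice n N i t. h x \<partial>lborel)"
    by (rule nn_integral_cmult) measurable
  also have "ennreal (1 / ?\<delta>) * (ennreal (C1 * ?\<delta> powr s) * (\<integral>\<^sup>+ x\<in>slice n N i t. h x \<partial>lborel)) =
      ennreal (1 / ?\<delta> * (C1 * ?\<delta> powr s)) * (\<integral>\<^sup>+ x\<in>slice n N i t. h x \<partial>lborel)"
    using \<delta> C12_pos by (subst ennreal_mult) (auto simp: mult.assoc)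
  also have "1 / ?\<delta> * (C1 * ?\<delta> powr s) = C1 * ?\<delta> powr (s - 1)"
    using \<delta> by (simp add: powr_diff)
  finally show ?thesis by (simp add: mult_left_mono)
qed

lemma flux_swap:
  assumes [measurable]: "h \<in> borel_measurable borel"
  shows "flux n N i h = (\<integral>\<^sup>+ t\<in>heights n i. (\<integral>\<^sup>+ \<omega>\<in>dyadic (\<nu> * n) N. (\<integral>\<^sup>+ \<tau>\<in>{0..1}.
    h (spread n \<omega> \<tau> t, t) \<partial>lborel) \<partial>lborel) \<partial>lborel)"
proof -
  \<comment> \<open>All three domains become indicators in one integrand, so that two applications
    of Fubini suffice.\<close>
  define k where "k \<omega> \<tau> t = h (spread n \<omega> \<tau> t, t) * indicator {0..1} \<tau> * indicator (dyadic (\<nu> * n) N) \<omega> *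
    indicator (heights n i) t" for \<omega> \<tau> t
  have km: "(\<lambda>z. k (f z) (g z) (h z)) \<in> borel_measurable M"
    if [measurable]: "f \<in> borel_measurable M" "g \<in> borel_measurable M" "h \<in> borel_measurable M" for f g h and M :: "'b measure"
    unfolding k_def by measurable
  have 1: "(\<integral>\<^sup>+ \<tau>. (\<integral>\<^sup>+ t. k \<omega> \<tau> t \<partial>lborel) \<partial>lborel) =
      (\<integral>\<^sup>+ \<tau>\<in>{0..1}. (\<integral>\<^sup>+ t\<in>heights n i. h (spread n \<omega> \<tau> t, t) \<partial>lborel) \<partial>lborel) * indicator (dyadic (\<nu> * n) N) \<omega>" for \<omega>
  proof -
    have "(\<integral>\<^sup>+ t. k \<omega> \<tau> t \<partial>lborel) = (\<integral>\<^sup>+ t. h (spread n \<omega> \<tau> t, t) * indicator (heights n i) t *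
        (indicator {0..1} \<tau> * indicator (dyadic (\<nu> * n) N) \<omega>) \<partial>lborel)" for \<tau>
      by (intro nn_integral_cong) (simp add: k_def mult_ac)
    also have "\<dots> \<tau> = (\<integral>\<^sup>+ t\<in>heights n i. h (spread n \<omega> \<tau> t, t) \<partial>lborel) * (indicator {0..1} \<tau> * indicator (dyadic (\<nu> * n) N) \<omega>)" for \<tau>
      by (rule nn_integral_multc) measurable
    finally have "(\<integral>\<^sup>+ \<tau>. (\<integral>\<^sup>+ t. k \<omega> \<tau> t \<partial>lborel) \<partial>lborel) =
        (\<integral>\<^sup>+ \<tau>. (\<integral>\<^sup>+ t\<in>heights n i. h (spread n \<omega> \<tau> t, t) \<partial>lborel) * indicator {0..1} \<tau> * indicator (dyadic (\<nu> * n) N) \<omega> \<partial>lborel)"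
      by (simp add: mult.assoc)
    also have "\<dots> = (\<integral>\<^sup>+ \<tau>\<in>{0..1}. (\<integral>\<^sup>+ t\<in>heights n i. h (spread n \<omega> \<tau> t, t) \<partial>lborel) \<partial>lborel) * indicator (dyadic (\<nu> * n) N) \<omega>"
      by (rule nn_integral_multc) measurable
    finally show ?thesis .
  qed
  have 2: "(\<integral>\<^sup>+ \<omega>. (\<integral>\<^sup>+ \<tau>. k \<omega> \<tau> t \<partial>lborel) \<partial>lborel) =
      (\<integral>\<^sup>+ \<omega>\<in>dyadic (\<nu> * n) N. (\<integral>\<^sup>+ \<tau>\<in>{0..1}. h (spread n \<omega> \<tau> t, t) \<partial>lborel) \<partial>lborel) * indicator (heights n i) t" for t
  proof -
    have "(\<integral>\<^sup>+ \<tau>. k \<omega> \<tau> t \<partial>lborel) = (\<integral>\<^sup>+ \<tau>. h (spread n \<omega> \<tau> t, t) * indicator {0..1} \<tau> *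
        (indicator (dyadic (\<nu> * n) N) \<omega> * indicator (heights n i) t) \<partial>lborel)" for \<omega>
      by (intro nn_integral_cong) (simp add: k_def mult_ac)
    also have "\<dots> \<omega> = (\<integral>\<^sup>+ \<tau>\<in>{0..1}. h (spread n \<omega> \<tau> t, t) \<partial>lborel) * (indicator (dyadic (\<nu> * n) N) \<omega> * indicator (heights n i) t)" for \<omega>
      by (rule nn_integral_multc) measurable
    finally have "(\<integral>\<^sup>+ \<omega>. (\<integral>\<^sup>+ \<tau>. k \<omega> \<tau> t \<partial>lborel) \<partial>lborel) =
        (\<integral>\<^sup>+ \<omega>. (\<integral>\<^sup>+ \<tau>\<in>{0..1}. h (spread n \<omega> \<tau> t, t) \<partial>lborel) * indicator (dyadic (\<nu> * n) N) \<omega> * indicator (heights n i) t \<partial>lborel)"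
      by (simp add: mult.assoc)
    also have "\<dots> = (\<integral>\<^sup>+ \<omega>\<in>dyadic (\<nu> * n) N. (\<integral>\<^sup>+ \<tau>\<in>{0..1}. h (spread n \<omega> \<tau> t, t) \<partial>lborel) \<partial>lborel) * indicator (heights n i) t"
      by (rule nn_integral_multc) measurable
    finally show ?thesis .
  qed
  have "flux n N i h = (\<integral>\<^sup>+ \<omega>. (\<integral>\<^sup>+ \<tau>. (\<integral>\<^sup>+ t. k \<omega> \<tau> t \<partial>lborel) \<partial>lborel) \<partial>lborel)"
    unfolding flux_def 1 ..
  also have "\<dots> = (\<integral>\<^sup>+ \<omega>. (\<integral>\<^sup>+ t. (\<integral>\<^sup>+ \<tau>. k \<omega> \<tau> t \<partial>lborel) \<partial>lborel) \<partial>lborel)"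
  proof -
    have "(\<integral>\<^sup>+ \<tau>. (\<integral>\<^sup>+ t. k \<omega> \<tau> t \<partial>lborel) \<partial>lborel) = (\<integral>\<^sup>+ t. (\<integral>\<^sup>+ \<tau>. k \<omega> \<tau> t \<partial>lborel) \<partial>lborel)" for \<omega>
    proof (rule lborel_pair.Fubini'[of "\<lambda>t \<tau>. k \<omega> \<tau> t"])
      show "(\<lambda>(t, \<tau>). k \<omega> \<tau> t) \<in> borel_measurable (lborel \<Otimes>\<^sub>M lborel)"
        unfolding case_prod_beta by (intro km) measurable
    qed
    then show ?thesis by simp
  qed
  also have "\<dots> = (\<integral>\<^sup>+ t. (\<integral>\<^sup>+ \<omega>. (\<integral>\<^sup>+ \<tau>. k \<omega> \<tau> t \<partial>lborel) \<partial>lborel) \<partial>lborel)"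
  proof (rule lborel_pair.Fubini'[of "\<lambda>t \<omega>. \<integral>\<^sup>+ \<tau>. k \<omega> \<tau> t \<partial>lborel"])
    have "(\<lambda>(z, \<tau>). k (snd z) \<tau> (fst z)) \<in> borel_measurable ((lborel \<Otimes>\<^sub>M lborel) \<Otimes>\<^sub>M lborel)"
      unfolding case_prod_beta by (intro km) measurable
    then have "(\<lambda>z. \<integral>\<^sup>+ \<tau>. k (snd z) \<tau> (fst z) \<partial>lborel) \<in> borel_measurable (lborel \<Otimes>\<^sub>M lborel)"
      by (rule lborel.borel_measurable_nn_integral)
    then show "(\<lambda>(t, \<omega>). \<integral>\<^sup>+ \<tau>. k \<omega> \<tau> t \<partial>lborel) \<in> borel_measurable (lborel \<Otimes>\<^sub>M lborel)"
      by (simp add: case_prod_beta)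
  qed
  also have "\<dots> = (\<integral>\<^sup>+ t\<in>heights n i. (\<integral>\<^sup>+ \<omega>\<in>dyadic (\<nu> * n) N. (\<integral>\<^sup>+ \<tau>\<in>{0..1}.
      h (spread n \<omega> \<tau> t, t) \<partial>lborel) \<partial>lborel) \<partial>lborel)"
    unfolding 2 ..
  finally show ?thesis .
qed

end

section \<open>Oscillation on towers, rectangles and balls\<close>

lemma nn_integral_Times:
  fixes h :: "real \<times> real \<Rightarrow> ennreal"
  assumes [measurable]: "h \<in> borel_measurable borel" "A \<in> sets borel" "B \<in> sets borel"
  shows "(\<integral>\<^sup>+ z\<in>A \<times> B. h z \<partial>lborel) = (\<integral>\<^sup>+ y\<in>B. (\<integral>\<^sup>+ x\<in>A. h (x, y) \<partial>lborel) \<partial>lborel)"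
    and "(\<integral>\<^sup>+ z\<in>A \<times> B. h z \<partial>lborel) = (\<integral>\<^sup>+ x\<in>A. (\<integral>\<^sup>+ y\<in>B. h (x, y) \<partial>lborel) \<partial>lborel)"
proof -
  have [measurable]: "A \<times> B \<in> sets (borel :: (real \<times> real) measure)" by (intro borel_Times) auto
  have ind: "indicator (A \<times> B) (x, y) = (indicator A x * indicator B y :: ennreal)" for x y
    by (simp add: indicator_def)
  have int: "(\<integral>\<^sup>+ z\<in>A \<times> B. h z \<partial>lborel) = integral\<^sup>N (lborel \<Otimes>\<^sub>M lborel) (\<lambda>z. h z * indicator (A \<times> B) z)"
    by (simp add: lborel_prod)
  have m: "(\<lambda>z. h z * indicator (A \<times> B) z) \<in> borel_measurable (lborel \<Otimes>\<^sub>M lborel)"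
    by (simp add: lborel_prod)
  have "integral\<^sup>N (lborel \<Otimes>\<^sub>M lborel) (\<lambda>z. h z * indicator (A \<times> B) z) =
      (\<integral>\<^sup>+ y. (\<integral>\<^sup>+ x. h (x, y) * indicator (A \<times> B) (x, y) \<partial>lborel) \<partial>lborel)"
    by (rule lborel_pair.nn_integral_snd[OF m, symmetric])
  also have "\<dots> = (\<integral>\<^sup>+ y. (\<integral>\<^sup>+ x. h (x, y) * indicator A x * indicator B y \<partial>lborel) \<partial>lborel)"
    by (simp add: ind mult.assoc)
  also have "\<dots> = (\<integral>\<^sup>+ y\<in>B. (\<integral>\<^sup>+ x\<in>A. h (x, y) \<partial>lborel) \<partial>lborel)"
    by (intro nn_integral_cong nn_integral_multc) measurable
  finally show "(\<integral>\<^sup>+ z\<in>A \<times> B. h z \<partial>lborel) = (\<integral>\<^sup>+ y\<in>B. (\<integral>\<^sup>+ x\<in>A. h (x, y) \<partial>lborel) \<partial>lborel)"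
    unfolding int .
  have "integral\<^sup>N (lborel \<Otimes>\<^sub>M lborel) (\<lambda>z. h z * indicator (A \<times> B) z) =
      (\<integral>\<^sup>+ x. (\<integral>\<^sup>+ y. h (x, y) * indicator (A \<times> B) (x, y) \<partial>lborel) \<partial>lborel)"
    by (rule lborel.nn_integral_fst[OF m, symmetric])
  also have "\<dots> = (\<integral>\<^sup>+ x. (\<integral>\<^sup>+ y. h (x, y) * indicator B y * indicator A x \<partial>lborel) \<partial>lborel)"
    by (simp add: ind mult_ac)
  also have "\<dots> = (\<integral>\<^sup>+ x\<in>A. (\<integral>\<^sup>+ y\<in>B. h (x, y) \<partial>lborel) \<partial>lborel)"
    by (intro nn_integral_cong nn_integral_multc) measurable
  finally show "(\<integral>\<^sup>+ z\<in>A \<times> B. h z \<partial>lborel) = (\<integral>\<^sup>+ x\<in>A. (\<integral>\<^sup>+ y\<in>B. h (x, y) \<partial>lborel) \<partial>lborel)"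
    unfolding int .
qed

lemma emeasure_lborel_rect:
  assumes "a \<le> b" "c \<le> d"
  shows "emeasure lborel ({a..b} \<times> {c..d} :: (real \<times> real) set) = ennreal ((b - a) * (d - c))"
proof -
  have "emeasure (lborel \<Otimes>\<^sub>M lborel) ({a..b} \<times> {c..d}) = emeasure lborel {a..b} * emeasure lborel {c..d}"
    by (rule lborel.emeasure_pair_measure_Times) auto
  then show ?thesis using assms by (simp add: lborel_prod ennreal_mult)
qed

lemma nn_integral_le_powr:
  fixes g :: "'a \<Rightarrow> ennreal"
  assumes "1 < p" "0 < e" and [measurable]: "g \<in> borel_measurable M" "S \<in> sets M"
  shows "(\<integral>\<^sup>+ z\<in>S. g z \<partial>M) \<le> ennreal e * (\<integral>\<^sup>+ z\<in>S. ennreal_powr (g z) p \<partial>M) +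
    ennreal (e powr (- 1 / (p - 1))) * emeasure M S"
proof -
  have "(\<integral>\<^sup>+ z\<in>S. g z \<partial>M) \<le> (\<integral>\<^sup>+ z. ennreal e * (ennreal_powr (g z) p * indicator S z) +
      ennreal (e powr (- 1 / (p - 1))) * indicator S z \<partial>M)"
    using le_weighted_powr[OF assms(1,2)] by (intro nn_integral_mono) (auto split: split_indicator)
  also have "\<dots> = ennreal e * (\<integral>\<^sup>+ z\<in>S. ennreal_powr (g z) p \<partial>M) + ennreal (e powr (- 1 / (p - 1))) * emeasure M S"
    by (subst nn_integral_add) (auto simp: nn_integral_cmult nn_integral_cmult_indicator)
  finally show ?thesis .
qed

text \<open>The pencil argument for a full rectangle, where vertical segments replace the curves and
  the reference height is again chosen by averaging.\<close>

lemma rect_oscillation: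
  assumes grad: "lip_gradient ({x0..x0 + w} \<times> {y0..y0 + h}) u g" and wh: "0 < w" "0 < h"
    and [measurable]: "u \<in> borel_measurable borel" "g \<in> borel_measurable borel"
  shows "\<exists>c. (\<integral>\<^sup>+ z\<in>{x0..x0 + w} \<times> {y0..y0 + h}. ennreal \<bar>u z - c\<bar> \<partial>lborel) \<le>
    ennreal (w + 2 * h) * (\<integral>\<^sup>+ z\<in>{x0..x0 + w} \<times> {y0..y0 + h}. g z \<partial>lborel)"
proof -
  let ?A = "{x0..x0 + w}" and ?B = "{y0..y0 + h}"
  let ?I = "\<integral>\<^sup>+ z\<in>?A \<times> ?B. g z \<partial>lborel"
  define \<Phi> where "\<Phi> y = (\<integral>\<^sup>+ x\<in>?A. g (x, y) \<partial>lborel)" for y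
  define V where "V x = (\<integral>\<^sup>+ y\<in>?B. g (x, y) \<partial>lborel)" for x
  have [measurable]: "\<Phi> \<in> borel_measurable borel" unfolding \<Phi>_def by measurable
  have [measurable]: "V \<in> borel_measurable borel" unfolding V_def by measurable
  obtain y1 where y1: "y1 \<in> ?B" "ennreal h * \<Phi> y1 \<le> (\<integral>\<^sup>+ y\<in>?B. \<Phi> y \<partial>lborel)"
    using exists_le_average[of \<Phi> h y0] wh by auto
  then have y1I: "ennreal h * \<Phi> y1 \<le> ?I" by (simp add: nn_integral_Times(1) \<Phi>_def)
  have VI: "(\<integral>\<^sup>+ x\<in>?A. V x \<partial>lborel) = ?I" by (simp add: nn_integral_Times(2) V_def)
  define c where "c = u (x0, y1)"
  have pt: "ennreal \<bar>u (x, y) - c\<bar> \<le> 2 * V x + \<Phi> y1" if x: "x \<in> ?A" and y: "y \<in> ?B" for x y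
  proof -
    have vert: "ennreal \<bar>u (x, y) - u (x, y')\<bar> \<le> 2 * V x" if "y \<le> y'" "y \<in> ?B" "y' \<in> ?B" for y y'
    proof -
      have "ennreal \<bar>u (x, y) - u (x, y')\<bar> \<le> 2 * (\<integral>\<^sup>+ t\<in>{y..y'}. g (x, t) \<partial>lborel)"
        by (rule lip_gradient_graph[OF grad \<open>y \<le> y'\<close>, of "\<lambda>_. x"]) (use x that in auto)
      also have "\<dots> \<le> 2 * V x"
        unfolding V_def using that by (intro mult_left_mono nn_integral_mono) (auto split: split_indicator)
      finally show ?thesis .
    qed
    have "ennreal \<bar>u (x, y) - c\<bar> \<le> ennreal (\<bar>u (x, y) - u (x, y1)\<bar> + \<bar>u (x, y1) - c\<bar>)"
      by (intro ennreal_leI) simp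
    also have "\<dots> = ennreal \<bar>u (x, y) - u (x, y1)\<bar> + ennreal \<bar>u (x, y1) - c\<bar>"
      by (rule ennreal_plus) auto
    also have "\<dots> \<le> 2 * V x + \<Phi> y1"
    proof (rule add_mono)
      show "ennreal \<bar>u (x, y) - u (x, y1)\<bar> \<le> 2 * V x"
        using vert[of y y1] vert[of y1 y] y y1(1) by (cases "y \<le> y1") (auto simp: abs_minus_commute)
      show "ennreal \<bar>u (x, y1) - c\<bar> \<le> \<Phi> y1"
        unfolding c_def \<Phi>_def by (rule lip_gradient_horizontal[OF grad]) (use x y1 wh in auto)
    qed
    finally show ?thesis .
  qed
  have "(\<integral>\<^sup>+ z\<in>?A \<times> ?B. ennreal \<bar>u z - c\<bar> \<partial>lborel) = (\<integral>\<^sup>+ x\<in>?A. (\<integral>\<^sup>+ y\<in>?B. ennreal \<bar>u (x, y) - c\<bar> \<partial>lborel) \<partial>lborel)"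
    by (rule nn_integral_Times(2)) measurable
  also have "\<dots> \<le> (\<integral>\<^sup>+ x. (2 * V x + \<Phi> y1) * ennreal h * indicator ?A x \<partial>lborel)"
  proof (rule nn_integral_mono)
    fix x
    show "(\<integral>\<^sup>+ y\<in>?B. ennreal \<bar>u (x, y) - c\<bar> \<partial>lborel) * indicator ?A x \<le> (2 * V x + \<Phi> y1) * ennreal h * indicator ?A x"
    proof (cases "x \<in> ?A")
      case True
      have "(\<integral>\<^sup>+ y\<in>?B. ennreal \<bar>u (x, y) - c\<bar> \<partial>lborel) \<le> (\<integral>\<^sup>+ y. (2 * V x + \<Phi> y1) * indicator ?B y \<partial>lborel)"
        using pt[OF True] by (intro nn_integral_mono) (auto split: split_indicator)
      also have "\<dots> = (2 * V x + \<Phi> y1) * ennreal h"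
        using wh by (subst nn_integral_cmult_indicator) auto
      finally show ?thesis using True by simp
    qed simp
  qed
  also have "\<dots> = (\<integral>\<^sup>+ x. 2 * ennreal h * (V x * indicator ?A x) + ennreal h * \<Phi> y1 * indicator ?A x \<partial>lborel)"
    by (intro nn_integral_cong) (simp add: distrib_left distrib_right mult_ac)
  also have "\<dots> = 2 * ennreal h * ?I + ennreal h * \<Phi> y1 * ennreal w"
    using wh VI by (subst nn_integral_add) (auto simp: nn_integral_cmult nn_integral_cmult_indicator)
  also have "\<dots> \<le> 2 * ennreal h * ?I + ?I * ennreal w"
    by (intro add_left_mono mult_right_mono y1I) auto
  also have "\<dots> = (2 * ennreal h + ennreal w) * ?I" by (simp add: distrib_right mult.commute)
  also have "2 * ennreal h + ennreal w = ennreal (w + 2 * h)"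
    using wh by (simp add: ennreal_mult add.commute)
  finally show ?thesis by blast
qed

section \<open>Young's inequality on towers and rectangles\<close>

context supercritical
begin

lemma qpow_powr_s: "(q ^ n) powr s = (1 / 2) ^ (\<nu> * n)"
proof -
  have "(q ^ n) powr s = (l powr real (\<nu> * n)) powr s"
    using l_pos by (simp only: qpow_eq[symmetric] powr_realpow)
  also have "\<dots> = (l powr s) powr real (\<nu> * n)" by (simp only: powr_powr mult.commute)
  also have "\<dots> = (1 / 2) ^ (\<nu> * n)" unfolding s by (rule powr_realpow) simp
  finally show ?thesis .
qed

lemma emeasure_tower: "emeasure lborel (tower n N i) \<le> ennreal (6 * (q ^ n)\<^sup>2)"
proof -
  let ?r = "q ^ n"
  have "emeasure lborel (tower n N i) \<le> emeasure lborel (window n N \<times> span n i)"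
    unfolding tower_def window_def span_def by (intro emeasure_mono) (auto intro!: borel_Times)
  also have "\<dots> = ennreal ((?r + 2 * margin * ?r) * (L * ?r + ?r))"
    unfolding window_def span_def using margin(1) qpow[of n] L_bounds mult_pos_pos[OF margin(1) qpow(1)[of n]]
    by (subst emeasure_lborel_rect) (auto simp: algebra_simps)
  also have "\<dots> \<le> ennreal ((2 * ?r) * (3 * ?r))"
    using margin qpow[of n] L_bounds mult_right_mono[of "2 * margin" 1 ?r] mult_right_mono[of L 2 ?r]
    by (intro ennreal_leI mult_mono) auto
  finally show ?thesis by (simp add: power2_eq_square)
qed

definition young :: "real \<Rightarrow> real" where "young e = e powr (- 1 / (p - 1))"

lemma flux_bound:
  assumes N: "N < 2 ^ (\<nu> * n)" and i: "i < 2 ^ n" and e: "0 < e"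
    and [measurable]: "g \<in> borel_measurable borel"
  shows "flux n N i g \<le> ennreal (e * (q ^ n) powr (s - 1) * C1) * (\<integral>\<^sup>+ z\<in>tower n N i. ennreal_powr (g z) p \<partial>lborel) +
    ennreal ((1 / 2) ^ (\<nu> * n) * young e * (C2 * q ^ n))"
proof -
  let ?r = "q ^ n" let ?b = "(1 / 2 :: real) ^ (\<nu> * n)"
  define S where "S t = (\<integral>\<^sup>+ x\<in>slice n N i t. ennreal_powr (g (x, t)) p \<partial>lborel)" for t
  have Sm[measurable]: "S \<in> borel_measurable borel"
  proof -
    have "indicator (slice n N i t) x = (indicator (tower n N i) (x, t) :: ennreal)" for x t
      by (simp add: slice_def indicator_def)
    then show ?thesis unfolding S_def by simp
  qed
  have pt: "(\<integral>\<^sup>+ \<omega>\<in>dyadic (\<nu> * n) N. (\<integral>\<^sup>+ \<tau>\<in>{0..1}. g (spread n \<omega> \<tau> t, t) \<partial>lborel) \<partial>lborel) \<le>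
      ennreal (e * ?r powr (s - 1) * C1) * S t + ennreal (?b * young e) * ennreal ((height n t / ?r) powr (- a))"
    if t: "t \<in> heights n i" "t \<notin> D" for t
  proof -
    have \<delta>: "0 < height n t" using height_pos t by blast
    \<comment> \<open>The Young factor depends on the height so as to cancel the density:
      \<open>et * height n t powr (s - 1)\<close> is constant in \<open>t\<close>. The price is the
      factor \<open>(height n t / ?r) powr (- a)\<close> in the other term, which
      \<open>height_integral\<close> can integrate.\<close>
    define et where "et = e * (height n t / ?r) powr (1 - s)"
    have et: "0 < et" using e \<delta> qpow[of n] q_pos by (simp add: et_def)
    have et': "et powr (- 1 / (p - 1)) = young e * (height n t / ?r) powr (- a)"
      using e \<delta> qpow[of n] q_pos p by (simp add: et_def young_def powr_mult powr_powr a)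
    let ?h = "\<lambda>x. ennreal_powr (g (x, t)) p"
    let ?k = "ennreal (et powr (- 1 / (p - 1)))"
    have inner: "(\<integral>\<^sup>+ \<tau>\<in>{0..1}. g (spread n \<omega> \<tau> t, t) \<partial>lborel) \<le>
        ennreal et * (\<integral>\<^sup>+ \<tau>\<in>{0..1}. ?h (spread n \<omega> \<tau> t) \<partial>lborel) + ?k" for \<omega>
      using nn_integral_le_powr[OF p et, of "\<lambda>\<tau>. g (spread n \<omega> \<tau> t, t)" lborel "{0..1}"] by simp
    have "(\<integral>\<^sup>+ \<omega>\<in>dyadic (\<nu> * n) N. (\<integral>\<^sup>+ \<tau>\<in>{0..1}. g (spread n \<omega> \<tau> t, t) \<partial>lborel) \<partial>lborel) \<le>
        (\<integral>\<^sup>+ \<omega>. ennreal et * ((\<integral>\<^sup>+ \<tau>\<in>{0..1}. ?h (spread n \<omega> \<tau> t) \<partial>lborel) * indicator (dyadic (\<nu> * n) N) \<omega>) +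
          ?k * indicator (dyadic (\<nu> * n) N) \<omega> \<partial>lborel)"
      using inner by (intro nn_integral_mono) (auto split: split_indicator)
    also have "\<dots> = ennreal et * (\<integral>\<^sup>+ \<omega>\<in>dyadic (\<nu> * n) N. (\<integral>\<^sup>+ \<tau>\<in>{0..1}. ?h (spread n \<omega> \<tau> t) \<partial>lborel) \<partial>lborel) + ?k * ennreal ?b"
      by (subst nn_integral_add) (auto simp: nn_integral_cmult nn_integral_cmult_indicator emeasure_dyadic power_one_over)
    also have "\<dots> \<le> ennreal et * (ennreal (C1 * height n t powr (s - 1)) * S t) + ?k * ennreal ?b"
      unfolding S_def by (intro add_right_mono mult_left_mono spread_density N t) auto
    also have "\<dots> = ennreal (et * (C1 * height n t powr (s - 1))) * S t + ennreal (?b * young e) * ennreal ((height n t / ?r) powr (- a))"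
    proof -
      have "?k * ennreal ?b = ennreal (?b * young e) * ennreal ((height n t / ?r) powr (- a))"
        unfolding et' by (simp add: young_def mult_ac flip: ennreal_mult)
      then show ?thesis using et C12_pos by (simp add: ennreal_mult mult.assoc)
    qed
    also have "et * (C1 * height n t powr (s - 1)) = e * ?r powr (s - 1) * C1"
    proof -
      have "(height n t / ?r) powr (1 - s) * height n t powr (s - 1) = ?r powr (s - 1)"
        using \<delta> qpow[of n] q_pos by (simp add: powr_divide powr_diff field_simps)
      then show ?thesis by (simp add: et_def mult_ac)
    qed
    finally show ?thesis .
  qed
  have "flux n N i g = (\<integral>\<^sup>+ t\<in>heights n i. (\<integral>\<^sup>+ \<omega>\<in>dyadic (\<nu> * n) N. (\<integral>\<^sup>+ \<tau>\<in>{0..1}.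
      g (spread n \<omega> \<tau> t, t) \<partial>lborel) \<partial>lborel) \<partial>lborel)"
    by (rule flux_swap) measurable
  also have "\<dots> \<le> (\<integral>\<^sup>+ t. ennreal (e * ?r powr (s - 1) * C1) * (S t * indicator (heights n i) t) +
      ennreal (?b * young e) * (ennreal ((height n t / ?r) powr (- a)) * indicator (heights n i) t) \<partial>lborel)"
    by (rule nn_integral_mono_AE, rule AE_mp[OF AE_not_D], rule AE_I2) (use pt in \<open>auto split: split_indicator\<close>)
  also have "\<dots> = ennreal (e * ?r powr (s - 1) * C1) * (\<integral>\<^sup>+ t\<in>heights n i. S t \<partial>lborel) +
      ennreal (?b * young e) * (\<integral>\<^sup>+ t\<in>heights n i. ennreal ((height n t / ?r) powr (- a)) \<partial>lborel)"
    by (subst nn_integral_add) (auto simp: nn_integral_cmult)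
  also have "(\<integral>\<^sup>+ t\<in>heights n i. S t \<partial>lborel) = (\<integral>\<^sup>+ z\<in>tower n N i. ennreal_powr (g z) p \<partial>lborel)"
    unfolding S_def by (rule tower_nn_integral[symmetric]) measurable
  also have "ennreal (?b * young e) * (\<integral>\<^sup>+ t\<in>heights n i. ennreal ((height n t / ?r) powr (- a)) \<partial>lborel) \<le>
      ennreal (?b * young e) * ennreal (C2 * ?r)"
    by (intro mult_left_mono height_integral i) auto
  also have "\<dots> = ennreal (?b * young e * (C2 * ?r))"
    using C12_pos qpow[of n] by (intro ennreal_mult[symmetric]) (auto simp: young_def)
  finally show ?thesis by (simp add: add_left_mono)
qed

text \<open>Combines \<open>tower_oscillation\<close>, Young's inequality on the tower (48 = 8 * 6,
  with 6 from its area) and \<open>flux_bound\<close>. The constants are the same at all levels;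
  only powers of the scale \<open>q ^ n\<close> remain.\<close>

lemma tower_young:
  assumes grad: "lip_gradient (tower n N i) u g" and N: "N < 2 ^ (\<nu> * n)" and i: "i < 2 ^ n" and e: "0 < e"
    and [measurable]: "u \<in> borel_measurable borel" "g \<in> borel_measurable borel"
  shows "\<exists>c. (\<integral>\<^sup>+ z\<in>tower n N i. ennreal \<bar>u z - c\<bar> \<partial>lborel) \<le>
    ennreal ((8 + 12 * C1) * e * q ^ n) * (\<integral>\<^sup>+ z\<in>tower n N i. ennreal_powr (g z) p \<partial>lborel) +
    ennreal ((48 + 12 * C2) * young e * (q ^ n) ^ 3)"
proof -
  let ?r = "q ^ n" let ?b = "(1 / 2 :: real) ^ (\<nu> * n)" let ?E = "\<integral>\<^sup>+ z\<in>tower n N i. ennreal_powr (g z) p \<partial>lborel"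
  obtain c where c: "(\<integral>\<^sup>+ z\<in>tower n N i. ennreal \<bar>u z - c\<bar> \<partial>lborel) \<le>
      ennreal (8 * ?r) * (\<integral>\<^sup>+ z\<in>tower n N i. g z \<partial>lborel) + ennreal (12 * 2 ^ (\<nu> * n) * ?r\<^sup>2) * flux n N i g"
    using tower_oscillation[OF grad N i] by auto
  have "(\<integral>\<^sup>+ z\<in>tower n N i. g z \<partial>lborel) \<le> ennreal e * ?E + ennreal (young e) * emeasure lborel (tower n N i)"
    unfolding young_def by (rule nn_integral_le_powr[OF p e]) auto
  also have "\<dots> \<le> ennreal e * ?E + ennreal (young e) * ennreal (6 * ?r\<^sup>2)"
    by (intro add_left_mono mult_left_mono emeasure_tower) auto
  also have "ennreal (young e) * ennreal (6 * ?r\<^sup>2) = ennreal (young e * (6 * ?r\<^sup>2))"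
    by (intro ennreal_mult[symmetric]) (auto simp: young_def)
  finally have g: "(\<integral>\<^sup>+ z\<in>tower n N i. g z \<partial>lborel) \<le> ennreal e * ?E + ennreal (young e * (6 * ?r\<^sup>2))" .
  have comb: "ennreal k * (ennreal x * ?E + ennreal y) = ennreal (k * x) * ?E + ennreal (k * y)"
    if "0 \<le> k" "0 \<le> x" "0 \<le> y" for k x y
    using that by (simp add: distrib_left ennreal_mult mult.assoc)
  have "ennreal (8 * ?r) * (\<integral>\<^sup>+ z\<in>tower n N i. g z \<partial>lborel) \<le>
      ennreal (8 * ?r) * (ennreal e * ?E + ennreal (young e * (6 * ?r\<^sup>2)))"
    by (intro mult_left_mono g) auto
  also have "\<dots> = ennreal (8 * ?r * e) * ?E + ennreal (8 * ?r * (young e * (6 * ?r\<^sup>2)))"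
    using qpow[of n] e by (intro comb) (auto simp: young_def)
  also have "8 * ?r * e = 8 * e * ?r" by simp
  also have "8 * ?r * (young e * (6 * ?r\<^sup>2)) = 48 * young e * ?r ^ 3" by (simp add: power2_eq_square power3_eq_cube)
  finally have 1: "ennreal (8 * ?r) * (\<integral>\<^sup>+ z\<in>tower n N i. g z \<partial>lborel) \<le>
      ennreal (8 * e * ?r) * ?E + ennreal (48 * young e * ?r ^ 3)" .
  have pb: "2 ^ (\<nu> * n) * ?b = 1" by (simp add: power_one_over)
  \<comment> \<open>\<open>(q ^ n) powr s\<close> is the Cantor mass of a base interval; it cancels
    the factor \<open>2 ^ (\<nu> * n)\<close> in front of the flux.\<close>
  have rr: "?r powr (s - 1) * ?r = ?b" using q_pos qpow_powr_s[of n] by (simp add: powr_diff)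
  have "ennreal (12 * 2 ^ (\<nu> * n) * ?r\<^sup>2) * flux n N i g \<le> ennreal (12 * 2 ^ (\<nu> * n) * ?r\<^sup>2) *
      (ennreal (e * ?r powr (s - 1) * C1) * ?E + ennreal (?b * young e * (C2 * ?r)))"
    by (intro mult_left_mono flux_bound N i e) auto
  also have "\<dots> = ennreal (12 * 2 ^ (\<nu> * n) * ?r\<^sup>2 * (e * ?r powr (s - 1) * C1)) * ?E +
      ennreal (12 * 2 ^ (\<nu> * n) * ?r\<^sup>2 * (?b * young e * (C2 * ?r)))"
    using e C12_pos qpow[of n] by (intro comb) (auto simp: young_def)
  also have "12 * 2 ^ (\<nu> * n) * ?r\<^sup>2 * (e * ?r powr (s - 1) * C1) = 12 * (2 ^ (\<nu> * n) * (?r powr (s - 1) * ?r)) * C1 * e * ?r"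
    by (simp add: power2_eq_square mult_ac)
  also have "\<dots> = 12 * C1 * e * ?r" unfolding rr pb by simp
  also have "12 * 2 ^ (\<nu> * n) * ?r\<^sup>2 * (?b * young e * (C2 * ?r)) = 12 * (2 ^ (\<nu> * n) * ?b) * C2 * young e * ?r ^ 3"
    by (simp only: power2_eq_square power3_eq_cube mult_ac)
  also have "\<dots> = 12 * C2 * young e * ?r ^ 3" unfolding pb by simp
  finally have 2: "ennreal (12 * 2 ^ (\<nu> * n) * ?r\<^sup>2) * flux n N i g \<le>
      ennreal (12 * C1 * e * ?r) * ?E + ennreal (12 * C2 * young e * ?r ^ 3)" .
  have "(\<integral>\<^sup>+ z\<in>tower n N i. ennreal \<bar>u z - c\<bar> \<partial>lborel) \<le>
      (ennreal (8 * e * ?r) * ?E + ennreal (48 * young e * ?r ^ 3)) + (ennreal (12 * C1 * e * ?r) * ?E + ennreal (12 * C2 * young e * ?r ^ 3))"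
    using c add_mono[OF 1 2] by (rule order_trans)
  also have "\<dots> = (ennreal (8 * e * ?r) + ennreal (12 * C1 * e * ?r)) * ?E + (ennreal (48 * young e * ?r ^ 3) + ennreal (12 * C2 * young e * ?r ^ 3))"
    by (simp only: distrib_right add_ac)
  also have "ennreal (8 * e * ?r) + ennreal (12 * C1 * e * ?r) = ennreal ((8 + 12 * C1) * e * ?r)"
    using e C12_pos qpow[of n] by (subst ennreal_plus[symmetric]) (auto simp: distrib_right)
  also have "ennreal (48 * young e * ?r ^ 3) + ennreal (12 * C2 * young e * ?r ^ 3) = ennreal ((48 + 12 * C2) * young e * ?r ^ 3)"
    using e C12_pos qpow[of n] by (subst ennreal_plus[symmetric]) (auto simp: distrib_right young_def)
  finally show ?thesis by blast
qed

lemma rect_young: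
  assumes grad: "lip_gradient ({x0..x0 + w} \<times> {y0..y0 + h}) u g" and wh: "0 < w" "0 < h" "w \<le> 2 * \<rho>" "h \<le> 2 * \<rho>"
    and e: "0 < e" and [measurable]: "u \<in> borel_measurable borel" "g \<in> borel_measurable borel"
  shows "\<exists>c. (\<integral>\<^sup>+ z\<in>{x0..x0 + w} \<times> {y0..y0 + h}. ennreal \<bar>u z - c\<bar> \<partial>lborel) \<le>
    ennreal (6 * e * \<rho>) * (\<integral>\<^sup>+ z\<in>{x0..x0 + w} \<times> {y0..y0 + h}. ennreal_powr (g z) p \<partial>lborel) +
    ennreal (24 * young e * \<rho> ^ 3)"
proof -
  let ?S = "{x0..x0 + w} \<times> {y0..y0 + h}" let ?E = "\<integral>\<^sup>+ z\<in>?S. ennreal_powr (g z) p \<partial>lborel"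
  have [measurable]: "?S \<in> sets borel" by (intro borel_Times) auto
  have \<rho>: "0 < \<rho>" using wh by linarith
  obtain c where c: "(\<integral>\<^sup>+ z\<in>?S. ennreal \<bar>u z - c\<bar> \<partial>lborel) \<le> ennreal (w + 2 * h) * (\<integral>\<^sup>+ z\<in>?S. g z \<partial>lborel)"
    using rect_oscillation[OF grad wh(1,2)] by auto
  also have "\<dots> \<le> ennreal (6 * \<rho>) * (ennreal e * ?E + ennreal (young e) * emeasure lborel ?S)"
    unfolding young_def using wh by (intro mult_mono ennreal_leI nn_integral_le_powr[OF p e]) auto
  also have "emeasure lborel ?S = ennreal (w * h)" using wh by (subst emeasure_lborel_rect) auto
  also have "ennreal (w * h) \<le> ennreal ((2 * \<rho>) * (2 * \<rho>))" using wh by (intro ennreal_leI mult_mono) auto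
  also have "ennreal (6 * \<rho>) * (ennreal e * ?E + ennreal (young e) * ennreal (2 * \<rho> * (2 * \<rho>))) =
      ennreal (6 * \<rho> * e) * ?E + ennreal (6 * \<rho> * (young e * (2 * \<rho> * (2 * \<rho>))))"
  proof -
    have "ennreal (young e) * ennreal (2 * \<rho> * (2 * \<rho>)) = ennreal (young e * (2 * \<rho> * (2 * \<rho>)))"
      using \<rho> by (intro ennreal_mult[symmetric]) (auto simp: young_def)
    moreover have "ennreal k * (ennreal x * ?E + ennreal y) = ennreal (k * x) * ?E + ennreal (k * y)"
      if "0 \<le> k" "0 \<le> x" "0 \<le> y" for k x y
      using that by (simp add: distrib_left ennreal_mult mult.assoc)
    ultimately show ?thesis using \<rho> e by (simp add: young_def)
  qed
  also have "6 * \<rho> * (young e * (2 * \<rho> * (2 * \<rho>))) = 24 * young e * \<rho> ^ 3" by (simp add: power3_eq_cube)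
  finally have "(\<integral>\<^sup>+ z\<in>?S. ennreal \<bar>u z - c\<bar> \<partial>lborel) \<le> ennreal (6 * \<rho> * e) * ?E + ennreal (24 * young e * \<rho> ^ 3)"
    by (auto simp: mult_left_mono add_left_mono)
  then show ?thesis by (auto simp: mult_ac)
qed

end

section \<open>Poincare inequalities above the critical exponent\<close>

lemma lip_gradient_cong:
  assumes "lip_gradient U u g" "\<And>z. z \<in> U \<Longrightarrow> u' z = u z" "\<And>z. z \<in> U \<Longrightarrow> g' z = g z"
  shows "lip_gradient U u' g'"
  unfolding lip_gradient_def
proof (intro allI impI)
  fix \<gamma> K
  assume K: "0 \<le> K" and U: "\<forall>t\<in>{0..1}. \<gamma> t \<in> U"
    and lip: "\<forall>s t. 0 \<le> s \<longrightarrow> s \<le> t \<longrightarrow> t \<le> 1 \<longrightarrow> dist (\<gamma> s) (\<gamma> t) \<le> K * (t - s)"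
  have "(\<integral>\<^sup>+ t\<in>{0..1}. g' (\<gamma> t) \<partial>lborel) = (\<integral>\<^sup>+ t\<in>{0..1}. g (\<gamma> t) \<partial>lborel)"
    using U assms(3) by (intro nn_integral_cong) (auto split: split_indicator)
  moreover have "u' (\<gamma> 0) = u (\<gamma> 0)" "u' (\<gamma> 1) = u (\<gamma> 1)" using U assms(2) by auto
  ultimately show "ennreal \<bar>u' (\<gamma> 0) - u' (\<gamma> 1)\<bar> \<le> ennreal K * (\<integral>\<^sup>+ t\<in>{0..1}. g' (\<gamma> t) \<partial>lborel)"
    using assms(1) K U lip unfolding lip_gradient_def by simp
qed

text \<open>The mean differs from \<open>c\<close> by at most the mean of
  \<open>\<bar>f - c\<bar>\<close>, so replacing \<open>c\<close> by the mean costs a factor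
  2.\<close>

lemma mean_oscillation_le:
  fixes f :: "'a \<Rightarrow> real"
  assumes B[measurable]: "B \<in> sets M" and fin: "emeasure M B < \<infinity>" and pos: "0 < measure M B"
    and [measurable]: "f \<in> borel_measurable M" and bdd: "\<And>x. x \<in> B \<Longrightarrow> \<bar>f x\<bar> \<le> b"
  shows "ennreal (1 / measure M B * (LINT x:B|M. \<bar>f x - 1 / measure M B * (LINT x:B|M. f x)\<bar>)) \<le>
    ennreal (2 / measure M B) * (\<integral>\<^sup>+ x\<in>B. ennreal \<bar>f x - c\<bar> \<partial>M)"
proof -
  let ?m = "measure M B"
  have const: "set_integrable M B (\<lambda>x. k)" for k :: real
    unfolding set_integrable_def using fin by simp
  have int: "set_integrable M B f"
    unfolding set_integrable_def
    by (rule Bochner_Integration.integrable_bound[OF const[of b, unfolded set_integrable_def]])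
      (use bdd in \<open>auto split: split_indicator intro: order_trans[OF _ abs_ge_self]\<close>)
  define k where "k = 1 / ?m * (LINT x:B|M. f x)"
  have intc: "set_integrable M B (\<lambda>x. \<bar>f x - t\<bar>)" for t
    by (intro set_integrable_abs set_integral_diff(1) int const)
  have cst: "(LINT x:B|M. t) = ?m * t" for t :: real
    using fin by (simp add: set_lebesgue_integral_def less_top)
  define I where "I = (LINT x:B|M. \<bar>f x - c\<bar>)"
  have "\<bar>(LINT x:B|M. f x) - ?m * c\<bar> \<le> I"
  proof -
    have "(LINT x:B|M. f x) - ?m * c = (LINT x:B|M. f x - c)"
      using int const by (simp add: set_integral_diff(2) cst)
    also have "\<bar>\<dots>\<bar> \<le> I"
      unfolding I_def set_lebesgue_integral_def real_scaleR_def
      by (rule order_trans[OF integral_abs_bound]) (simp add: abs_mult)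
    finally show ?thesis .
  qed
  then have kc: "?m * \<bar>c - k\<bar> \<le> I"
  proof -
    have "?m * \<bar>c - k\<bar> = \<bar>?m * (c - k)\<bar>" using pos by (simp add: abs_mult)
    also have "?m * (c - k) = ?m * c - (LINT x:B|M. f x)" using pos by (simp add: k_def right_diff_distrib)
    finally show ?thesis using \<open>\<bar>_\<bar> \<le> I\<close> by (simp add: abs_minus_commute)
  qed
  have "(LINT x:B|M. \<bar>f x - k\<bar>) \<le> (LINT x:B|M. \<bar>f x - c\<bar> + \<bar>c - k\<bar>)"
    by (rule set_integral_mono[OF intc set_integral_add(1)[OF intc const]]) simp
  also have "\<dots> = I + ?m * \<bar>c - k\<bar>"
    by (simp add: set_integral_add(2)[OF intc const] cst I_def)
  also have "\<dots> \<le> 2 * I" using kc by simp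
  finally have "1 / ?m * (LINT x:B|M. \<bar>f x - k\<bar>) \<le> 1 / ?m * (2 * I)"
    using pos by (intro mult_left_mono) auto
  then have "ennreal (1 / ?m * (LINT x:B|M. \<bar>f x - k\<bar>)) \<le> ennreal (2 / ?m * I)"
    by (intro ennreal_leI) simp
  also have "\<dots> = ennreal (2 / ?m) * ennreal I"
    using pos by (intro ennreal_mult) (auto simp: I_def set_lebesgue_integral_def)
  also have "ennreal I = (\<integral>\<^sup>+ x. ennreal (indicator B x *\<^sub>R \<bar>f x - c\<bar>) \<partial>M)"
    unfolding I_def set_lebesgue_integral_def
    by (rule nn_integral_eq_integral[symmetric]) (use intc[unfolded set_integrable_def] in auto)
  also have "\<dots> = (\<integral>\<^sup>+ x\<in>B. ennreal \<bar>f x - c\<bar> \<partial>M)"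
    by (intro nn_integral_cong) (auto split: split_indicator)
  finally show ?thesis unfolding k_def .
qed

text \<open>With \<open>w = e / \<rho> ^ 2\<close> the choice
  \<open>\<epsilon> = w powr (- (p - 1) / p)\<close> balances the terms: both become
  \<open>w powr (1 / p) * \<rho>\<close>.\<close>

lemma optimize_young:
  fixes p e \<rho> A t :: real
  assumes p: "1 < p" and pos: "0 < \<rho>" "0 < A" "0 \<le> e"
    and le: "\<And>\<epsilon>. 0 < \<epsilon> \<Longrightarrow> t \<le> A * (\<epsilon> * e / \<rho> + \<epsilon> powr (- 1 / (p - 1)) * \<rho>)"
  shows "t \<le> 2 * A * \<rho> * (e / \<rho>\<^sup>2) powr (1 / p)"
proof (cases "e = 0")
  case True
  have "t \<le> 0"
  proof (rule ccontr)
    assume "\<not> t \<le> 0"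
    then have t: "0 < t" by simp
    \<comment> \<open>Without energy, \<epsilon> may be taken so large that the remaining term is
      only \<open>t / 2\<close>.\<close>
    define \<epsilon> where "\<epsilon> = (t / (2 * A * \<rho>)) powr (- (p - 1))"
    have "t \<le> A * (\<epsilon> powr (- 1 / (p - 1)) * \<rho>)" using le[of \<epsilon>] t pos True by (simp add: \<epsilon>_def)
    also have "\<epsilon> powr (- 1 / (p - 1)) = t / (2 * A * \<rho>)"
    proof -
      have "- (p - 1) * (- 1 / (p - 1)) = 1" using p by (simp add: field_simps)
      then have "\<epsilon> powr (- 1 / (p - 1)) = (t / (2 * A * \<rho>)) powr 1" unfolding \<epsilon>_def powr_powr by (simp only:)
      then show ?thesis using t pos by simp
    qed
    also have "A * (t / (2 * A * \<rho>) * \<rho>) = t / 2" using pos by (simp add: field_simps)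
    finally show False using t by simp
  qed
  then show ?thesis using True by simp
next
  case False
  define w where "w = e / \<rho>\<^sup>2"
  have w: "0 < w" "e = w * \<rho>\<^sup>2" using False pos by (auto simp: w_def)
  define \<epsilon> where "\<epsilon> = w powr (- (p - 1) / p)"
  have \<epsilon>: "0 < \<epsilon>" using w by (simp add: \<epsilon>_def)
  have k: "- k / p * (- 1 / k) = 1 / p" if "k \<noteq> 0" for k using that p by simp
  have "- (p - 1) / p * (- 1 / (p - 1)) = 1 / p" by (rule k) (use p in simp)
  then have 1: "\<epsilon> powr (- 1 / (p - 1)) = w powr (1 / p)" unfolding \<epsilon>_def powr_powr by (simp only:)
  have "\<epsilon> * w = w powr (- (p - 1) / p) * w powr 1" using w by (simp add: \<epsilon>_def)
  also have "\<dots> = w powr (- (p - 1) / p + 1)" by (simp only: powr_add)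
  also have "- (p - 1) / p + 1 = 1 / p" using p by (simp add: field_simps)
  finally have "\<epsilon> * e / \<rho> = w powr (1 / p) * \<rho>" using pos w(2) by (simp add: power2_eq_square)
  then show ?thesis using le[OF \<epsilon>] unfolding 1 w_def[symmetric] by simp
qed

section \<open>From upper gradients in the length metric to Lipschitz curves\<close>

context cantor_space
begin

text \<open>A Euclidean Lipschitz curve in X is Lipschitz for the length metric with the same
  constant, since its own arcs compete in the infimum.\<close>

lemma upper_gradient_lip_gradient:
  assumes ug: "MX.upper_gradient_on U u g" and U: "U \<subseteq> X"
  shows "lip_gradient U u g"
  unfolding lip_gradient_def
proof (intro allI impI)
  fix \<gamma> K
  assume K: "0 \<le> K" and \<gamma>: "\<forall>t\<in>{0..1}. \<gamma> t \<in> U"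
    and lip: "\<forall>s t. 0 \<le> s \<longrightarrow> s \<le> t \<longrightarrow> t \<le> 1 \<longrightarrow> dist (\<gamma> s) (\<gamma> t) \<le> K * (t - s)"
  have lipX: "length_dist X (\<gamma> x) (\<gamma> y) \<le> K * (y - x)" if "0 \<le> x" "x \<le> y" "y \<le> 1" for x y
  proof (rule length_dist_le)
    show "ldist X (\<gamma> x) (\<gamma> y) \<le> ennreal (K * (y - x))"
    proof (rule ldist_lipschitz[OF K that(2)])
      fix t assume "x \<le> t" "t \<le> y"
      then have "t \<in> {0..1}" using that by simp
      then show "\<gamma> t \<in> X" using \<gamma> U by blast
    qed (use lip that in simp)
  qed (use K that in auto)
  have g: "MX.borel_function_on U g" using ug by (simp add: MX.upper_gradient_on_def)
  have \<gamma>UX: "\<gamma> t \<in> X" "\<gamma> t \<in> U" if "t \<in> {0..1}" for t using \<gamma> U that by auto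
  have "MX.rectifiable_curve_in U \<gamma>" and le: "curve_integral (length_dist X) \<gamma> g \<le> ennreal K * (\<integral>\<^sup>+ t\<in>{0..1}. g (\<gamma> t) \<partial>lborel)"
    using MX.curve_integral_lipschitz_le[OF \<gamma>UX(1) K lipX \<gamma>UX(2) g] by auto
  then have "ennreal \<bar>u (\<gamma> 0) - u (\<gamma> 1)\<bar> \<le> curve_integral (length_dist X) \<gamma> g"
    using ug \<gamma> unfolding MX.upper_gradient_on_def by simp
  then show "ennreal \<bar>u (\<gamma> 0) - u (\<gamma> 1)\<bar> \<le> ennreal K * (\<integral>\<^sup>+ t\<in>{0..1}. g (\<gamma> t) \<partial>lborel)"
    using le by (rule order_trans)
qed

lemma mball_sets[measurable]: "MX.mball z r \<in> sets borel"
proof -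
  have "openin (top_of_set X) (MX.mball z r)" using MX.openin_mball unfolding mtopology_X .
  then obtain T where "open T" "MX.mball z r = X \<inter> T" by (auto simp: openin_open)
  then show ?thesis using closed_X by auto
qed

lemma subtopology_X: "U \<subseteq> X \<Longrightarrow> subtopology MX.mtopology U = top_of_set U"
  by (simp add: mtopology_X subtopology_subtopology Int_absorb1)

lemma borel_function_extend:
  assumes g: "MX.borel_function_on U g" and U: "U \<subseteq> X" "U \<in> sets borel"
  shows "(\<lambda>z. g z * indicator U z) \<in> borel_measurable borel"
proof -
  have "sets (sigma U {V. openin (top_of_set U) V}) \<subseteq> sets (restrict_space borel U)"
  proof -
    have "{V. openin (top_of_set U) V} \<subseteq> Pow U" by (auto dest: openin_imp_subset)
    then have "sets (sigma U {V. openin (top_of_set U) V}) = sigma_sets U {V. openin (top_of_set U) V}"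
      by (rule sets_measure_of)
    also have "\<dots> \<subseteq> sets (restrict_space borel U)"
    proof (rule sigma_algebra.sigma_sets_subset)
      show "sigma_algebra U (sets (restrict_space borel U))"
        using sets.sigma_algebra_axioms[of "restrict_space borel U"] by (simp add: space_restrict_space)
      show "{V. openin (top_of_set U) V} \<subseteq> sets (restrict_space borel U)"
      proof
        fix V assume "V \<in> {V. openin (top_of_set U) V}"
        then obtain T where "open T" "V = U \<inter> T" by (auto simp: openin_open)
        then show "V \<in> sets (restrict_space borel U)" by (simp add: sets_restrict_space)
      qed
    qed
    finally show ?thesis .
  qed
  moreover have sp: "space (sigma U {V. openin (top_of_set U) V}) = U"
    by (rule space_measure_of) (auto dest: openin_imp_subset)
  moreover have "g \<in> borel_measurable (sigma U {V. openin (top_of_set U) V})"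
    using g unfolding MX.borel_function_on_def subtopology_X[OF U(1)] .
  ultimately have "g -` A \<inter> U \<in> sets (restrict_space borel U)" if "A \<in> sets borel" for A
    using measurable_sets[of g _ borel A] that by fastforce
  then have "g \<in> borel_measurable (restrict_space borel U)"
    by (intro measurableI) (simp_all add: space_restrict_space)
  then show ?thesis using U(2) by (subst (asm) borel_measurable_restrict_space_iff_ennreal) auto
qed

end

section \<open>Balls, and the Poincare inequality\<close>

context supercritical
begin

text \<open>A ball of radius r lies in a tower with \<open>q ^ n\<close> at most
  \<open>2 / (margin * q) * r\<close>, whose diameter is at most \<open>11 * q ^ n\<close>; the 3
  covers rectangles inside a large cube, which stay within \<open>2 * r\<close> of the
  centre.\<close>

definition ball_dilation :: real where "ball_dilation = 22 / (margin * q) + 3"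
definition ball_const :: real where "ball_const = (56 + 12 * C1 + 12 * C2) * (2 / (margin * q)) ^ 3"

lemma scale_const: "1 \<le> 2 / (margin * q)"
proof -
  have "margin * q \<le> 1 * 1" using margin q_pos q_quarter by (intro mult_mono) auto
  then show ?thesis using margin q_pos by (simp add: field_simps)
qed

text \<open>By \<open>ball_cases\<close> the ball lies in a tower, or its part of a large cube in a
  rectangle, and both fit into the dilated ball. \<open>min r 1\<close> replaces the radius because
  X is bounded: large balls are no worse than unit balls.\<close>

lemma ball_young:
  assumes z: "z \<in> X" and r: "0 < r" and e: "0 < e"
    and grad: "lip_gradient (MX.mball z (ball_dilation * r)) u g"
    and [measurable]: "u \<in> borel_measurable borel" "g \<in> borel_measurable borel"
  shows "\<exists>c. (\<integral>\<^sup>+ y\<in>MX.mball z r. ennreal \<bar>u y - c\<bar> \<partial>lborel) \<le>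
    ennreal (ball_const * e * min r 1) * (\<integral>\<^sup>+ y\<in>MX.mball z (ball_dilation * r). ennreal_powr (g y) p \<partial>lborel) +
    ennreal (ball_const * young e * (min r 1) ^ 3)"
proof -
  let ?K0 = "2 / (margin * q)" let ?\<rho> = "min r 1"
  let ?B = "MX.mball z r" let ?V = "MX.mball z (ball_dilation * r)"
  have K0: "1 \<le> ?K0" by (rule scale_const)
  have \<rho>: "0 < ?\<rho>" using r by simp
  have y0: "0 \<le> young e" by (simp add: young_def)
  have K0_3: "?K0 \<le> ?K0 ^ 3" using K0 by (intro self_le_power) auto
  have K13: "1 \<le> ?K0 ^ 3" using K0 K0_3 by simp
  define c0 where "c0 = 56 + 12 * C1 + 12 * C2"
  have c0: "56 \<le> c0" "8 + 12 * C1 \<le> c0" "48 + 12 * C2 \<le> c0" using C12_pos by (auto simp: c0_def)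
  have ball_const: "ball_const = c0 * ?K0 ^ 3" by (simp add: ball_const_def c0_def)
  have ball_dilation: "ball_dilation = 11 * ?K0 + 3" by (simp add: ball_dilation_def)
  have Bball: "?B \<subseteq> X \<inter> ball z r"
  proof
    fix y assume y: "y \<in> ?B"
    then have "dist z y \<le> length_dist X z y" using dist_le_length_dist[OF z, of y] MX.in_mball by blast
    then show "y \<in> X \<inter> ball z r" using y by simp
  qed
  have finish: "\<exists>c. (\<integral>\<^sup>+ y\<in>?B. ennreal \<bar>u y - c\<bar> \<partial>lborel) \<le>
      ennreal (ball_const * e * ?\<rho>) * (\<integral>\<^sup>+ y\<in>?V. ennreal_powr (g y) p \<partial>lborel) + ennreal (ball_const * young e * ?\<rho> ^ 3)"
    if S: "?B \<subseteq> S" "S \<subseteq> ?V" and ex: "\<exists>c. (\<integral>\<^sup>+ y\<in>S. ennreal \<bar>u y - c\<bar> \<partial>lborel) \<le>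
        ennreal k1 * (\<integral>\<^sup>+ y\<in>S. ennreal_powr (g y) p \<partial>lborel) + ennreal k2"
      and k: "k1 \<le> ball_const * e * ?\<rho>" "k2 \<le> ball_const * young e * ?\<rho> ^ 3" for S k1 k2
  proof -
    obtain c where c: "(\<integral>\<^sup>+ y\<in>S. ennreal \<bar>u y - c\<bar> \<partial>lborel) \<le>
        ennreal k1 * (\<integral>\<^sup>+ y\<in>S. ennreal_powr (g y) p \<partial>lborel) + ennreal k2" using ex by blast
    have "(\<integral>\<^sup>+ y\<in>?B. ennreal \<bar>u y - c\<bar> \<partial>lborel) \<le> (\<integral>\<^sup>+ y\<in>S. ennreal \<bar>u y - c\<bar> \<partial>lborel)"
      using S(1) by (intro nn_integral_mono) (auto split: split_indicator)
    also note c
    also have "ennreal k1 * (\<integral>\<^sup>+ y\<in>S. ennreal_powr (g y) p \<partial>lborel) + ennreal k2 \<le>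
        ennreal (ball_const * e * ?\<rho>) * (\<integral>\<^sup>+ y\<in>?V. ennreal_powr (g y) p \<partial>lborel) + ennreal (ball_const * young e * ?\<rho> ^ 3)"
      using S(2) k by (intro add_mono mult_mono ennreal_leI nn_integral_mono) (auto split: split_indicator)
    finally show ?thesis by blast
  qed
  have tower: ?thesis
    if n: "q ^ n \<le> ?K0 * ?\<rho>" and N: "N < 2 ^ (\<nu> * n)" "i < 2 ^ n" and sub: "?B \<subseteq> tower n N i" for n N i
  proof (rule finish[OF sub])
    have zt: "z \<in> tower n N i" using sub z r by auto
    show TV: "tower n N i \<subseteq> ?V"
    proof
      fix y assume y: "y \<in> tower n N i"
      then have "length_dist X z y \<le> 11 * q ^ n"
        using ldist_tower[OF zt y N] qpow[of n] by (intro length_dist_le) auto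
      also have "\<dots> \<le> 11 * (?K0 * ?\<rho>)" using n by simp
      also have "\<dots> \<le> 11 * (?K0 * r)" using margin(1) q_pos by (intro mult_left_mono) auto
      also have "\<dots> < ball_dilation * r" unfolding ball_dilation using r by (simp add: distrib_right)
      finally show "y \<in> ?V" using z y by (auto simp: tower_def)
    qed
    show "\<exists>c. (\<integral>\<^sup>+ y\<in>tower n N i. ennreal \<bar>u y - c\<bar> \<partial>lborel) \<le>
        ennreal ((8 + 12 * C1) * e * q ^ n) * (\<integral>\<^sup>+ y\<in>tower n N i. ennreal_powr (g y) p \<partial>lborel) +
        ennreal ((48 + 12 * C2) * young e * (q ^ n) ^ 3)"
      by (rule tower_young[OF lip_gradient_subset[OF grad TV] N e]) auto
    have "(8 + 12 * C1) * e * q ^ n \<le> c0 * e * (?K0 * ?\<rho>)"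
      using c0 e n qpow[of n] by (intro mult_mono) auto
    also have "\<dots> \<le> c0 * e * (?K0 ^ 3 * ?\<rho>)"
      using c0 e K0_3 \<rho> by (intro mult_left_mono mult_right_mono) auto
    finally show "(8 + 12 * C1) * e * q ^ n \<le> ball_const * e * ?\<rho>" unfolding ball_const by (simp add: mult_ac)
    have "(48 + 12 * C2) * young e * (q ^ n) ^ 3 \<le> c0 * young e * (?K0 * ?\<rho>) ^ 3"
      using c0 y0 n qpow[of n] by (intro mult_mono power_mono) auto
    then show "(48 + 12 * C2) * young e * (q ^ n) ^ 3 \<le> ball_const * young e * ?\<rho> ^ 3"
      unfolding ball_const power_mult_distrib by (simp add: mult_ac)
  qed
  show ?thesis
  proof (cases "r < margin / 2")
    case False
    \<comment> \<open>For such radii the tower of level 0, which is all of X, is comparable in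
      size.\<close>
    have "q ^ 0 \<le> ?K0 * ?\<rho>"
    proof -
      have "margin * q \<le> margin * 1" using margin q_quarter by (intro mult_left_mono) auto
      moreover have "margin / 2 \<le> ?\<rho>" using False margin by simp
      ultimately have "margin * q \<le> 2 * ?\<rho>" by linarith
      then show ?thesis using margin q_pos by (simp add: field_simps)
    qed
    then show ?thesis
      by (rule tower[of 0 0 0]) (use X_subset_tower MX.mball_subset_mspace[of z r] in auto)
  next
    case True
    then have \<rho>r: "?\<rho> = r" using margin by simp
    obtain n where n: "margin / 2 * q ^ Suc n \<le> r" "r < margin / 2 * q ^ n"
      using Q.exists_scale[of "margin / 2" r] r True margin by auto
    have qn: "q ^ n \<le> ?K0 * ?\<rho>" using n(1) margin q_pos unfolding \<rho>r by (simp add: field_simps)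
    have r2: "2 * r \<le> margin * q ^ n" using n(2) by simp
    from ball_cases[OF z r r2] show ?thesis
    proof (elim disjE exE conjE)
      fix N i assume "N < 2 ^ (\<nu> * n)" "i < 2 ^ n" "X \<inter> ball z r \<subseteq> tower n N i"
      then show ?thesis using tower[OF qn, of N i] Bball by blast
    next
      fix k j N assume k: "k < n" "j < 2 ^ k" "N < 2 ^ (\<nu> * k)"
        and sub: "X \<inter> ball z r \<subseteq> cantor_interval l (\<nu> * k) N \<times> gap k j"
      let ?x = "left_end l (\<nu> * k) N" and ?y = "gap_lo k j"
      \<comment> \<open>The ball sits in one cube; cutting the cube by the square of half-width
        \<open>r\<close> around \<open>z\<close> gives a rectangle \<open>S\<close> between the ball
        and its dilation.\<close>
      have zc: "z \<in> cantor_interval l (\<nu> * k) N \<times> gap k j" using sub z r by auto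
      define xa where "xa = max ?x (fst z - r)"
      define xb where "xb = min (?x + q ^ k) (fst z + r)"
      define ya where "ya = max ?y (snd z - r)"
      define yb where "yb = min (?y + q ^ k) (snd z + r)"
      have xy: "xa < xb" "ya < yb" "xb - xa \<le> 2 * r" "yb - ya \<le> 2 * r"
        using zc r qpow[of k] by (auto simp: xa_def xb_def ya_def yb_def cantor_interval_def gap_def qpow_eq)
      define S where "S = {xa..xa + (xb - xa)} \<times> {ya..ya + (yb - ya)}"
      have Scube: "S \<subseteq> cantor_interval l (\<nu> * k) N \<times> gap k j"
        by (auto simp: S_def xa_def xb_def ya_def yb_def cantor_interval_def gap_def qpow_eq)
      have BS: "?B \<subseteq> S"
      proof
        fix y assume "y \<in> ?B"
        then have y: "y \<in> X \<inter> ball z r" using Bball by blast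
        then have "\<bar>fst z - fst y\<bar> \<le> r" "\<bar>snd z - snd y\<bar> \<le> r"
          using dist_fst_le[of z y] dist_snd_le[of z y] by (auto simp: dist_real_def)
        moreover have "y \<in> cantor_interval l (\<nu> * k) N \<times> gap k j" using y sub by blast
        ultimately show "y \<in> S"
          by (cases y) (auto simp: S_def xa_def xb_def ya_def yb_def cantor_interval_def gap_def qpow_eq)
      qed
      have SV: "S \<subseteq> ?V"
      proof
        fix y assume y: "y \<in> S"
        have yc: "y \<in> cantor_interval l (\<nu> * k) N \<times> gap k j" using Scube y by blast
        have "closed_segment z y \<subseteq> X"
          by (rule closed_segment_Times_subset[OF zc yc convex_cantor_interval convex_gap cube_subset_X[OF k(2,3)]])
        then have "length_dist X z y \<le> dist z y" using ldist_segment[of z y] by (intro length_dist_le) auto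
        also have "\<dots> \<le> \<bar>fst z - fst y\<bar> + \<bar>snd z - snd y\<bar>"
          using dist_Pair_le[of "fst z" "snd z" "fst y" "snd y"] by simp
        also have "\<dots> \<le> r + r"
          using y by (intro add_mono) (auto simp: S_def xa_def xb_def ya_def yb_def)
        also have "\<dots> < ball_dilation * r"
        proof -
          have "3 * r \<le> ball_dilation * r" unfolding ball_dilation using margin(1) q_pos r by (intro mult_right_mono) auto
          then show ?thesis using r by linarith
        qed
        finally show "y \<in> ?V" using z yc cube_subset_X[OF k(2,3)] by auto
      qed
      show ?thesis
      proof (rule finish[OF BS SV])
        show "\<exists>c. (\<integral>\<^sup>+ y\<in>S. ennreal \<bar>u y - c\<bar> \<partial>lborel) \<le>
            ennreal (6 * e * r) * (\<integral>\<^sup>+ y\<in>S. ennreal_powr (g y) p \<partial>lborel) + ennreal (24 * young e * r ^ 3)"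
          unfolding S_def
          by (rule rect_young[OF lip_gradient_subset[OF grad SV[unfolded S_def]]]) (use xy e in auto)
        have "6 \<le> c0 * ?K0 ^ 3" using mult_mono[of 6 c0 1 "?K0 ^ 3"] c0 K13 by simp
        then have "6 * (e * r) \<le> c0 * ?K0 ^ 3 * (e * r)" using e r by (intro mult_right_mono) auto
        then show "6 * e * r \<le> ball_const * e * ?\<rho>" unfolding ball_const \<rho>r by (simp add: mult_ac)
        have "24 \<le> c0 * ?K0 ^ 3" using mult_mono[of 24 c0 1 "?K0 ^ 3"] c0 K13 by simp
        then have "24 * (young e * r ^ 3) \<le> c0 * ?K0 ^ 3 * (young e * r ^ 3)"
          using y0 r by (intro mult_right_mono) auto
        then show "24 * young e * r ^ 3 \<le> ball_const * young e * ?\<rho> ^ 3" unfolding ball_const \<rho>r by (simp add: mult_ac)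
      qed
    qed
  qed
qed

text \<open>The square of \<open>ball_contains_square\<close> bounds area and diameter from below.
  From above the area is bounded by a Euclidean square if \<open>r \<le> 1\<close> and by the tower
  of level 0 otherwise.\<close>

lemma ball_size:
  assumes z: "z \<in> X" and r: "0 < r"
  shows "ennreal ((q * min r 1 / 24)\<^sup>2) \<le> emeasure lborel (MX.mball z r)"
    and "q * min r 1 / 24 \<le> MX.mdiam (MX.mball z r)"
    and "0 < k \<Longrightarrow> emeasure lborel (MX.mball z (k * r)) \<le> ennreal ((4 * k\<^sup>2 + 6) * (min r 1)\<^sup>2)"
proof -
  let ?s = "q * min r 1 / 24"
  have s: "0 < ?s" using r q_pos by simp
  obtain a b where "{a..a + ?s} \<times> {b..b + ?s} \<subseteq> MX.mball z (min r 1)"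
    using ball_contains_square[OF z, of "min r 1"] r by auto
  then have sq: "{a..a + ?s} \<times> {b..b + ?s} \<subseteq> MX.mball z r"
    using MX.mball_subset_concentric[of "min r 1" r z] by auto
  have "ennreal (?s\<^sup>2) = emeasure lborel ({a..a + ?s} \<times> {b..b + ?s})"
    using s by (subst emeasure_lborel_rect) (auto simp: power2_eq_square)
  also have "\<dots> \<le> emeasure lborel (MX.mball z r)" using sq by (intro emeasure_mono) auto
  finally show "ennreal (?s\<^sup>2) \<le> emeasure lborel (MX.mball z r)" .
  have in1: "(a, b) \<in> MX.mball z r" "(a + ?s, b) \<in> MX.mball z r"
    using s by (auto intro!: subsetD[OF sq] simp del: MX.in_mball)
  have "?s = dist (a, b) (a + ?s, b)" using s by (simp add: dist_Pair_Pair dist_real_def)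
  also have "\<dots> \<le> length_dist X (a, b) (a + ?s, b)"
    using in1 by (intro dist_le_length_dist) auto
  also have "\<dots> \<le> MX.mdiam (MX.mball z r)"
  proof -
    \<comment> \<open>\<open>mdiam\<close> is a supremum of reals, so an upper bound has to be
      exhibited before a single distance can be compared with it.\<close>
    have "length_dist X x y \<le> 2 * r" if "x \<in> MX.mball z r" "y \<in> MX.mball z r" for x y
      using MX.triangle'[of x z y] MX.commute that by auto
    then have "bdd_above ((\<lambda>(x, y). length_dist X x y) ` (MX.mball z r \<times> MX.mball z r))"
      by (intro bdd_aboveI[of _ "2 * r"]) auto
    then have "(\<lambda>(x, y). length_dist X x y) ((a, b), (a + ?s, b)) \<le> MX.mdiam (MX.mball z r)"
      unfolding MX.mdiam_def by (intro cSUP_upper) (use in1 in auto)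
    then show ?thesis by simp
  qed
  finally show "?s \<le> MX.mdiam (MX.mball z r)" .
  show "emeasure lborel (MX.mball z (k * r)) \<le> ennreal ((4 * k\<^sup>2 + 6) * (min r 1)\<^sup>2)" if k: "0 < k"
  proof (cases "r \<le> 1")
    case True
    have "MX.mball z (k * r) \<subseteq> {fst z - k * r..fst z + k * r} \<times> {snd z - k * r..snd z + k * r}"
    proof
      fix y assume y: "y \<in> MX.mball z (k * r)"
      then have "dist z y \<le> k * r" using dist_le_length_dist[OF z, of y] by auto
      then have "\<bar>fst z - fst y\<bar> \<le> k * r" "\<bar>snd z - snd y\<bar> \<le> k * r"
        using dist_fst_le[of z y] dist_snd_le[of z y] by (auto simp: dist_real_def)
      then show "y \<in> {fst z - k * r..fst z + k * r} \<times> {snd z - k * r..snd z + k * r}" by (cases y) auto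
    qed
    then have "emeasure lborel (MX.mball z (k * r)) \<le>
        emeasure lborel ({fst z - k * r..fst z + k * r} \<times> {snd z - k * r..snd z + k * r})"
      by (intro emeasure_mono) (auto intro!: borel_Times)
    also have "\<dots> = ennreal (4 * k\<^sup>2 * r\<^sup>2)"
      using k r by (subst emeasure_lborel_rect) (auto simp: power2_eq_square)
    also have "\<dots> \<le> ennreal ((4 * k\<^sup>2 + 6) * (min r 1)\<^sup>2)"
      using True by (intro ennreal_leI) (simp add: mult_right_mono)
    finally show ?thesis .
  next
    case False
    have "emeasure lborel (MX.mball z (k * r)) \<le> emeasure lborel (tower 0 0 0)"
      using X_subset_tower MX.mball_subset_mspace by (intro emeasure_mono) auto
    also have "\<dots> \<le> ennreal 6" using emeasure_tower[of 0 0 0] by simp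
    also have "\<dots> \<le> ennreal ((4 * k\<^sup>2 + 6) * (min r 1)\<^sup>2)" using False by (intro ennreal_leI) simp
    finally show ?thesis .
  qed
qed

theorem supports_Poincare_supercritical: "MX.supports_Poincare (restrict_space lborel X) p"
proof -
  let ?\<mu> = "restrict_space lborel X"
  have Xs: "X \<inter> space lborel \<in> sets lborel" using closed_X by simp
  \<comment> \<open>\<open>A2\<close> bounds the area of the dilated ball relative to
    \<open>?\<rho> ^ 2\<close>. The number 24 / q comes from the square of side
    \<open>q * ?\<rho> / 24\<close> in the ball, squared in \<open>A\<close> for the area and once
    in \<open>C\<close> for the diameter. The 2 in \<open>A\<close> is that of
    \<open>mean_oscillation_le\<close>, the 2 in \<open>C\<close> that of
    \<open>optimize_young\<close>.\<close>
  define A2 where "A2 = 4 * ball_dilation\<^sup>2 + 6"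
  define A where "A = 2 * ball_const * (24 / q)\<^sup>2"
  define C where "C = 2 * A * (24 / q) * A2 powr (1 / p)"
  have ball_dilation: "1 \<le> ball_dilation" using margin q_pos by (simp add: ball_dilation_def)
  have ball_const: "0 < ball_const" using C12_pos margin q_pos by (simp add: ball_const_def)
  have A2: "0 < A2" by (simp add: A2_def add_nonneg_pos)
  have A: "0 < A" using ball_const q_pos by (simp add: A_def)
  have C: "0 < C" using A A2 q_pos by (simp add: C_def)
  have main: "ennreal (MX.mean_value ?\<mu> (MX.mball x r) (\<lambda>y. \<bar>u y - MX.mean_value ?\<mu> (MX.mball x r) u\<bar>)) \<le>
      ennreal (C * MX.mdiam (MX.mball x r)) * ennreal_powr
        ((\<integral>\<^sup>+ y\<in>MX.mball x (ball_dilation * r). ennreal_powr (g y) p \<partial>?\<mu>) / emeasure ?\<mu> (MX.mball x (ball_dilation * r))) (1 / p)"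
    if x: "x \<in> X" and r: "0 < r"
      and cont: "continuous_map (subtopology MX.mtopology (MX.mball x (ball_dilation * r))) euclideanreal u"
      and bdd: "bounded (u ` MX.mball x (ball_dilation * r))"
      and ug: "MX.upper_gradient_on (MX.mball x (ball_dilation * r)) u g" for x r u g
  proof -
    let ?B = "MX.mball x r" and ?V = "MX.mball x (ball_dilation * r)"
    let ?\<rho> = "min r 1"
    have \<rho>: "0 < ?\<rho>" using r by simp
    have VX: "?V \<subseteq> X" and BX: "?B \<subseteq> X" by (rule MX.mball_subset_mspace)+
    have BV: "?B \<subseteq> ?V" using ball_dilation r by (intro MX.mball_subset_concentric) simp
    \<comment> \<open>Nothing is known about \<open>u\<close> and \<open>g\<close> outside the
      dilated ball; extended by 0 they are Borel functions on the plane, as the integral estimates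
      require.\<close>
    define u0 where "u0 z = u z * indicator ?V z" for z
    define g0 where "g0 z = g z * indicator ?V z" for z
    have u0m[measurable]: "u0 \<in> borel_measurable borel"
    proof -
      have "continuous_on ?V u" using cont by (simp add: subtopology_X[OF VX])
      then have "(\<lambda>z. indicator ?V z *\<^sub>R u z) \<in> borel_measurable borel"
        by (rule borel_measurable_continuous_on_indicator[OF mball_sets])
      then show ?thesis by (simp add: u0_def[abs_def] mult.commute)
    qed
    have g0m[measurable]: "g0 \<in> borel_measurable borel"
      unfolding g0_def[abs_def] using ug by (intro borel_function_extend VX mball_sets) (simp add: MX.upper_gradient_on_def)
    have grad: "lip_gradient ?V u0 g0"
      by (rule lip_gradient_cong[OF upper_gradient_lip_gradient[OF ug VX]]) (auto simp: u0_def g0_def simp del: MX.in_mball)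
    obtain b where "\<forall>t\<in>u ` ?V. norm t \<le> b" using bdd unfolding bounded_iff by blast
    then have b: "\<bar>u z\<bar> \<le> b" if "z \<in> ?V" for z using that by (metis image_eqI real_norm_def)
    have Bfin: "emeasure lborel ?B < \<infinity>"
      using ball_size(3)[OF x r, of 1] by (auto intro: order.strict_trans1)
    let ?m = "measure lborel ?B"
    have mB: "emeasure lborel ?B = ennreal ?m" using Bfin by (simp add: emeasure_eq_ennreal_measure)
    let ?s = "q * ?\<rho> / 24"
    have s: "0 < ?s" using \<rho> q_pos by simp
    have m: "?s\<^sup>2 \<le> ?m" using ball_size(1)[OF x r] unfolding mB by simp
    have m0: "0 < ?m" using m s by (smt (verit) zero_less_power)
    have mean: "MX.mean_value ?\<mu> ?B f = 1 / ?m * (LINT y:?B|lborel. f y)" for f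
    proof -
      have "measure ?\<mu> ?B = ?m" by (rule measure_restrict_space[OF Xs BX])
      moreover have "(LINT y:?B|?\<mu>. f y) = (LINT y:?B|lborel. f y)"
        unfolding set_lebesgue_integral_def integral_restrict_space[OF Xs]
        by (intro Bochner_Integration.integral_cong) (use BX in \<open>auto simp: indicator_def simp del: MX.in_mball\<close>)
      ultimately show ?thesis by (simp add: MX.mean_value_def)
    qed
    have cong: "(LINT y:?B|lborel. F (u y)) = (LINT y:?B|lborel. F (u0 y))" for F :: "real \<Rightarrow> real"
      unfolding set_lebesgue_integral_def
      by (intro Bochner_Integration.integral_cong) (use BV in \<open>auto simp: indicator_def u0_def simp del: MX.in_mball\<close>)
    define T where "T = 1 / ?m * (LINT y:?B|lborel. \<bar>u0 y - 1 / ?m * (LINT y:?B|lborel. u0 y)\<bar>)"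
    have T: "MX.mean_value ?\<mu> ?B (\<lambda>y. \<bar>u y - MX.mean_value ?\<mu> ?B u\<bar>) = T"
      unfolding mean T_def using cong[of "\<lambda>t. t"] cong[of "\<lambda>t. \<bar>t - 1 / ?m * (LINT y:?B|lborel. u0 y)\<bar>"] by simp
    have T0: "0 \<le> T" using m0 by (simp add: T_def set_lebesgue_integral_def)
    let ?E = "\<integral>\<^sup>+ y\<in>?V. ennreal_powr (g0 y) p \<partial>lborel"
    have E: "(\<integral>\<^sup>+ y\<in>?V. ennreal_powr (g y) p \<partial>?\<mu>) = ?E"
      unfolding nn_integral_restrict_space[OF Xs]
      by (intro nn_integral_cong) (use VX in \<open>auto simp: indicator_def g0_def simp del: MX.in_mball\<close>)
    let ?M = "emeasure lborel ?V"
    have M: "emeasure ?\<mu> ?V = ?M" by (rule emeasure_restrict_space[OF Xs VX])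
    have M1: "?M \<le> ennreal (A2 * ?\<rho>\<^sup>2)" unfolding A2_def using ball_dilation by (intro ball_size(3) x r) simp
    have M2: "ennreal (?s\<^sup>2) \<le> ?M"
      using ball_size(1)[OF x r] emeasure_mono[OF BV, of lborel] by (auto intro: order_trans)
    obtain m' where m': "?M = ennreal m'" "0 \<le> m'"
    proof -
      have "?M < \<infinity>" using M1 by (rule order.strict_trans1) simp
      then show ?thesis using that by (cases ?M) auto
    qed
    have m'le: "m' \<le> A2 * ?\<rho>\<^sup>2" using M1 m' A2 by simp
    have m'pos: "0 < m'"
    proof -
      have "?s\<^sup>2 \<le> m'" using M2 m' by simp
      then show ?thesis using s by (smt (verit) zero_less_power)
    qed
    have diam: "?s \<le> MX.mdiam ?B" by (rule ball_size(2)[OF x r])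
    have young: "ennreal T \<le> ennreal (2 / ?m) *
        (ennreal (ball_const * \<epsilon> * ?\<rho>) * ?E + ennreal (ball_const * young \<epsilon> * ?\<rho> ^ 3))" if \<epsilon>: "0 < \<epsilon>" for \<epsilon>
    proof -
      obtain c where c: "(\<integral>\<^sup>+ y\<in>?B. ennreal \<bar>u0 y - c\<bar> \<partial>lborel) \<le>
          ennreal (ball_const * \<epsilon> * ?\<rho>) * ?E + ennreal (ball_const * young \<epsilon> * ?\<rho> ^ 3)"
        using ball_young[OF x r \<epsilon> grad u0m g0m] by blast
      have "ennreal T \<le> ennreal (2 / ?m) * (\<integral>\<^sup>+ y\<in>?B. ennreal \<bar>u0 y - c\<bar> \<partial>lborel)"
        unfolding T_def
      proof (rule mean_oscillation_le)
        show "\<bar>u0 z\<bar> \<le> b" if "z \<in> ?B" for z using b[of z] BV that by (auto simp: u0_def simp del: MX.in_mball)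
      qed (use Bfin m0 in auto)
      also have "\<dots> \<le> ennreal (2 / ?m) * (ennreal (ball_const * \<epsilon> * ?\<rho>) * ?E + ennreal (ball_const * young \<epsilon> * ?\<rho> ^ 3))"
        by (intro mult_left_mono c) auto
      finally show ?thesis .
    qed
    show ?thesis
    proof (cases ?E)
      \<comment> \<open>With infinite energy the right-hand side is infinite, since the diameter and
        the constant are positive and the area is finite.\<close>
      case top
      have "?E / ?M = \<infinity>" using top m' by (simp add: ennreal_top_divide)
      then have powr: "ennreal_powr (?E / ?M) (1 / p) = \<infinity>" by (simp add: ennreal_powr_def)
      have k: "ennreal k * \<infinity> = \<infinity>" if "0 < k" for k using that by (simp add: ennreal_mult_top)
      have "ennreal (C * MX.mdiam ?B) * \<infinity> = \<infinity>" by (rule k) (use C diam s in simp)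
      then show ?thesis unfolding E M powr by simp
    next
      case (real e)
      have Tle: "T \<le> A * (\<epsilon> * e / ?\<rho> + \<epsilon> powr (- 1 / (p - 1)) * ?\<rho>)" if \<epsilon>: "0 < \<epsilon>" for \<epsilon>
      proof -
        have "ennreal T \<le> ennreal (2 / ?m * (ball_const * \<epsilon> * ?\<rho> * e + ball_const * young \<epsilon> * ?\<rho> ^ 3))"
          using young[OF \<epsilon>] real \<epsilon> ball_const \<rho> m0 by (simp add: young_def flip: ennreal_mult ennreal_plus)
        then have "T \<le> 2 / ?m * (ball_const * \<epsilon> * ?\<rho> * e + ball_const * young \<epsilon> * ?\<rho> ^ 3)"
          by (rule ennreal_le_iff[THEN iffD1, rotated]) (use real \<epsilon> ball_const \<rho> m0 in \<open>simp add: young_def\<close>)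
        also have "\<dots> \<le> 2 / ?s\<^sup>2 * (ball_const * \<epsilon> * ?\<rho> * e + ball_const * young \<epsilon> * ?\<rho> ^ 3)"
        proof (rule mult_right_mono)
          have "0 < ?m * ?s\<^sup>2" using m0 s by (intro mult_pos_pos zero_less_power)
          then show "2 / ?m \<le> 2 / ?s\<^sup>2" by (intro divide_left_mono[OF m]) auto
        qed (use real \<epsilon> ball_const \<rho> in \<open>simp add: young_def\<close>)
        also have "\<dots> = A * (\<epsilon> * e / ?\<rho> + young \<epsilon> * ?\<rho>)"
          using \<rho> q_pos unfolding A_def by (simp add: field_simps power2_eq_square power3_eq_cube)
        finally show ?thesis by (simp add: young_def)
      qed
      have opt: "T \<le> 2 * A * ?\<rho> * (e / ?\<rho>\<^sup>2) powr (1 / p)"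
        by (rule optimize_young[OF p \<rho> A]) (use real Tle in auto)
      have "e / (A2 * ?\<rho>\<^sup>2) \<le> e / m'" using real m'le m'pos A2 \<rho> by (intro divide_left_mono) auto
      then have "(e / (A2 * ?\<rho>\<^sup>2)) powr (1 / p) \<le> (e / m') powr (1 / p)"
        using real A2 \<rho> p by (intro powr_mono2) auto
      moreover have "(e / ?\<rho>\<^sup>2) powr (1 / p) = A2 powr (1 / p) * (e / (A2 * ?\<rho>\<^sup>2)) powr (1 / p)"
        using A2 real \<rho> by (subst powr_mult[symmetric]) auto
      ultimately have "(e / ?\<rho>\<^sup>2) powr (1 / p) \<le> A2 powr (1 / p) * (e / m') powr (1 / p)"
        by (simp add: mult_left_mono)
      then have "2 * A * ?\<rho> * (e / ?\<rho>\<^sup>2) powr (1 / p) \<le> 2 * A * ?\<rho> * (A2 powr (1 / p) * (e / m') powr (1 / p))"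
        using A \<rho> by (intro mult_left_mono) auto
      also have "\<dots> = C * ?s * (e / m') powr (1 / p)" using q_pos by (simp add: C_def)
      also have "\<dots> \<le> C * MX.mdiam ?B * (e / m') powr (1 / p)"
        using C diam by (intro mult_right_mono mult_left_mono) auto
      finally have "T \<le> C * MX.mdiam ?B * (e / m') powr (1 / p)" using opt by simp
      then have "ennreal T \<le> ennreal (C * MX.mdiam ?B) * ennreal ((e / m') powr (1 / p))"
        using C diam s by (simp flip: ennreal_mult add: ennreal_leI)
      also have "ennreal ((e / m') powr (1 / p)) = ennreal_powr (?E / ?M) (1 / p)"
        unfolding real(2) m'(1) divide_ennreal[OF real(1) m'pos]
        using real(1) m'pos by (simp add: ennreal_powr_def)
      finally show ?thesis unfolding T E M .
    qed
  qed
  show ?thesis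
    unfolding MX.supports_Poincare_def
    by (intro exI[of _ ball_dilation] exI[of _ C] conjI ballI allI impI ball_dilation C) (use main in blast)
qed

end

section \<open>Failure below the critical exponent\<close>

context Metric_space
begin

text \<open>Continuity of arc length makes every \<open>s\<close> up to the total length a value of
  it; only then does the choice in \<open>arc_length_param\<close> pick a point of the curve with
  the right length.\<close>

lemma arc_length_param_lipschitz:
  assumes rect: "rectifiable_curve_in U \<gamma>"
  shows "0 \<le> s \<Longrightarrow> s \<le> enn2real (curve_length d \<gamma> 0 1) \<Longrightarrow> arc_length_param d \<gamma> s \<in> U \<inter> M"
    and "0 \<le> s \<Longrightarrow> s \<le> t \<Longrightarrow> t \<le> enn2real (curve_length d \<gamma> 0 1) \<Longrightarrow>
      d (arc_length_param d \<gamma> s) (arc_length_param d \<gamma> t) \<le> t - s"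
    and "arc_length_param d \<gamma> 0 = \<gamma> 0"
    and "arc_length_param d \<gamma> (enn2real (curve_length d \<gamma> 0 1)) = \<gamma> 1"
proof -
  have fin: "curve_length d \<gamma> 0 1 < \<infinity>" and
    pth: "continuous_map (top_of_set {0..1}) (subtopology mtopology U) \<gamma>"
    using rect by (auto simp: rectifiable_curve_in_def pathin_def)
  then have cm: "continuous_map (top_of_set {0..1}) mtopology \<gamma>"
    by (simp add: continuous_map_in_subtopology)
  have MU: "\<gamma> t \<in> U \<inter> M" if "t \<in> {0..1}" for t
    using continuous_map_image_subset_topspace[OF pth] that by auto
  then have M: "\<gamma> t \<in> M" if "t \<in> {0..1}" for t using that by blast
  define \<sigma> where "\<sigma> t = enn2real (curve_length d \<gamma> 0 t)" for t
  have cont: "continuous_on {0..1} \<sigma>"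
    unfolding \<sigma>_def
  proof (rule continuous_on_arc_length[OF M fin])
    fix x e :: real assume x: "x \<in> {0..1}" and e: "0 < e"
    have "\<exists>W. openin (top_of_set {0..1}) W \<and> x \<in> W \<and> (\<forall>y\<in>W. \<gamma> y \<in> mball (\<gamma> x) e)"
      using cm[unfolded continuous_map_to_metric, rule_format, OF _ e, of x] x by simp
    then obtain W where W: "openin (top_of_set {0..1}) W" "x \<in> W" "\<forall>y\<in>W. \<gamma> y \<in> mball (\<gamma> x) e"
      by blast
    from W(1,2) obtain \<delta> where "\<delta> > 0" "ball x \<delta> \<inter> {0..1} \<subseteq> W" unfolding openin_contains_ball by blast
    then show "\<exists>\<delta>>0. \<forall>t\<in>{0..1}. \<bar>t - x\<bar> < \<delta> \<longrightarrow> d (\<gamma> t) (\<gamma> x) < e"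
      using W(3) by (intro exI[of _ \<delta>]) (auto simp: subset_iff dist_real_def abs_minus_commute commute)
  qed
  have "curve_length d \<gamma> 0 0 \<le> ennreal (0 * (0 - 0))"
  proof (rule curve_length_lipschitz)
    fix x y :: real assume "0 \<le> x" "x \<le> y" "y \<le> 0"
    then have "x = 0" "y = 0" by auto
    then show "d (\<gamma> x) (\<gamma> y) \<le> 0 * (y - x)" using M[of 0] by simp
  qed simp
  then have \<sigma>0: "\<sigma> 0 = 0" by (simp add: \<sigma>_def)
  have surj: "\<exists>t\<in>{0..1}. \<sigma> t = s" if "0 \<le> s" "s \<le> \<sigma> 1" for s
    using IVT'[of \<sigma> 0 s 1] cont that \<sigma>0 by auto
  have \<alpha>: "arc_length_param d \<gamma> (\<sigma> t) = \<gamma> t" if "t \<in> {0..1}" for t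
    unfolding \<sigma>_def by (rule arc_length_param_eq[OF M fin that refl])
  show "arc_length_param d \<gamma> 0 = \<gamma> 0" using \<alpha>[of 0] \<sigma>0 by simp
  show "arc_length_param d \<gamma> (enn2real (curve_length d \<gamma> 0 1)) = \<gamma> 1" using \<alpha>[of 1] by (simp add: \<sigma>_def)
  show "arc_length_param d \<gamma> s \<in> U \<inter> M" if "0 \<le> s" "s \<le> enn2real (curve_length d \<gamma> 0 1)"
    using surj[of s] that \<alpha> MU unfolding \<sigma>_def by metis
  show "d (arc_length_param d \<gamma> s) (arc_length_param d \<gamma> t) \<le> t - s"
    if st: "0 \<le> s" "s \<le> t" "t \<le> enn2real (curve_length d \<gamma> 0 1)"
  proof -
    obtain x where x: "x \<in> {0..1}" "\<sigma> x = s" using surj[of s] st by (auto simp: \<sigma>_def)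
    obtain y where y: "y \<in> {0..1}" "\<sigma> y = t" using surj[of t] st by (auto simp: \<sigma>_def)
    have "d (\<gamma> x) (\<gamma> y) \<le> t - s"
    proof (cases "x \<le> y")
      case True
      then show ?thesis using arc_length_le(4)[OF M fin, of x y] x y by (auto simp: \<sigma>_def)
    next
      case False
      then have "\<sigma> y + d (\<gamma> y) (\<gamma> x) \<le> \<sigma> x" using arc_length_le(4)[OF M fin, of y x] x y by (auto simp: \<sigma>_def)
      then show ?thesis using x y st commute[of "\<gamma> x" "\<gamma> y"] nonneg[of "\<gamma> x" "\<gamma> y"] by linarith
    qed
    then show ?thesis using \<alpha>[OF x(1)] \<alpha>[OF y(1)] x y by simp
  qed
qed

end

section \<open>Crossing an interval, and lower bounds for mean oscillation\<close>

definition clamp :: "real \<Rightarrow> real \<Rightarrow> real \<Rightarrow> real" where "clamp lo hi y = max lo (min hi y)"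

text \<open>A 1-Lipschitz function needs time \<open>?d - ?c\<close> to climb from \<open>?c\<close>
  to \<open>?d\<close>; between its last visit below \<open>?c\<close> and the next visit above
  \<open>?d\<close> it stays inside the interval.\<close>

lemma clamp_crossing:
  assumes lip: "\<And>s t. 0 \<le> s \<Longrightarrow> s \<le> t \<Longrightarrow> t \<le> b \<Longrightarrow> \<bar>h s - h t\<bar> \<le> t - s" and "lo \<le> hi" "0 \<le> b"
  shows "ennreal \<bar>clamp lo hi (h 0) - clamp lo hi (h b)\<bar> \<le> emeasure lborel {s \<in> {0..b}. h s \<in> {lo..hi}}"
proof -
  have *: "ennreal (clamp lo hi (h b) - clamp lo hi (h 0)) \<le> emeasure lborel {s \<in> {0..b}. h s \<in> {lo..hi}}"
    if lip: "\<And>s t. 0 \<le> s \<Longrightarrow> s \<le> t \<Longrightarrow> t \<le> b \<Longrightarrow> \<bar>h s - h t\<bar> \<le> t - s" and "lo \<le> hi"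
      and lt: "clamp lo hi (h 0) < clamp lo hi (h b)" for h :: "real \<Rightarrow> real" and lo hi
  proof -
    let ?c = "clamp lo hi (h 0)" and ?d = "clamp lo hi (h b)"
    have cd: "lo \<le> ?c" "?d \<le> hi" "h 0 \<le> ?c" "?d \<le> h b"
      using lt \<open>lo \<le> hi\<close> by (auto simp: clamp_def max_def min_def split: if_splits)
    have "1-lipschitz_on {0..b} h"
    proof (rule lipschitz_onI)
      fix x y assume "x \<in> {0..b}" "y \<in> {0..b}"
      then show "dist (h x) (h y) \<le> 1 * dist x y"
        using lip[of x y] lip[of y x] by (cases "x \<le> y") (auto simp: dist_real_def abs_minus_commute)
    qed simp
    then have cont: "continuous_on {0..b} h" by (rule lipschitz_on_continuous_on)
    define S1 where "S1 = {s \<in> {0..b}. h s \<le> ?c}"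
    have "S1 = {0..b} \<inter> h -` {..?c}" by (auto simp: S1_def)
    then have "closed S1" using continuous_closed_preimage[OF cont] by auto
    moreover have S1ne: "0 \<in> S1" using cd \<open>0 \<le> b\<close> by (simp add: S1_def)
    moreover have bdd1: "bdd_above S1" by (auto simp: S1_def intro!: bdd_aboveI[of _ b])
    ultimately have s1: "Sup S1 \<in> S1" by (intro closed_contains_Sup) auto
    \<comment> \<open>Restricted to times after the last visit below \<open>?c\<close>, so that its
      infimum ends a crossing that never falls back.\<close>
    define S2 where "S2 = {s \<in> {Sup S1..b}. ?d \<le> h s}"
    have s1b: "0 \<le> Sup S1" "Sup S1 \<le> b" "h (Sup S1) \<le> ?c" using s1 by (auto simp: S1_def)
    have "S2 = {Sup S1..b} \<inter> h -` {?d..}" by (auto simp: S2_def)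
    moreover have "continuous_on {Sup S1..b} h" using cont by (rule continuous_on_subset) (use s1b in auto)
    ultimately have "closed S2" using continuous_closed_preimage by auto
    moreover have "b \<in> S2" using cd s1b by (simp add: S2_def)
    moreover have bdd2: "bdd_below S2" by (auto simp: S2_def intro!: bdd_belowI[of _ "Sup S1"])
    ultimately have s2: "Inf S2 \<in> S2" by (intro closed_contains_Inf) auto
    then have s2b: "Sup S1 \<le> Inf S2" "Inf S2 \<le> b" "?d \<le> h (Inf S2)" by (auto simp: S2_def)
    have sub: "{Sup S1<..<Inf S2} \<subseteq> {s \<in> {0..b}. h s \<in> {lo..hi}}"
    proof
      fix s assume s: "s \<in> {Sup S1<..<Inf S2}"
      then have "s \<notin> S1" using cSup_upper[OF _ bdd1, of s] by auto
      then have 1: "?c < h s" using s s1b s2b by (auto simp: S1_def)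
      have "s \<notin> S2" using cInf_lower[OF _ bdd2, of s] s by auto
      then have "h s < ?d" using s s1b s2b by (auto simp: S2_def)
      then show "s \<in> {s \<in> {0..b}. h s \<in> {lo..hi}}" using 1 cd s s1b s2b by auto
    qed
    have meas: "{s \<in> {0..b}. h s \<in> {lo..hi}} \<in> sets borel"
    proof -
      have "closed ({0..b} \<inter> h -` {lo..hi})"
        by (rule continuous_closed_preimage[OF cont]) auto
      moreover have "{s \<in> {0..b}. h s \<in> {lo..hi}} = {0..b} \<inter> h -` {lo..hi}" by auto
      ultimately show ?thesis by simp
    qed
    have "?d - ?c \<le> Inf S2 - Sup S1" using lip[of "Sup S1" "Inf S2"] s1b s2b by auto
    then have "ennreal (?d - ?c) \<le> ennreal (Inf S2 - Sup S1)" by (rule ennreal_leI)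
    also have "\<dots> = emeasure lborel {Sup S1<..<Inf S2}" using s2b by simp
    also have "\<dots> \<le> emeasure lborel {s \<in> {0..b}. h s \<in> {lo..hi}}"
      using sub meas by (intro emeasure_mono) auto
    finally show ?thesis .
  qed
  consider "clamp lo hi (h 0) < clamp lo hi (h b)" | "clamp lo hi (h 0) = clamp lo hi (h b)"
    | "clamp lo hi (h b) < clamp lo hi (h 0)" by linarith
  then show ?thesis
  proof cases
    case 1 then show ?thesis using *[of h lo hi] lip \<open>lo \<le> hi\<close> by simp
  next
    case 2 then show ?thesis by simp
  next
    case 3
    \<comment> \<open>A descent of \<open>h\<close> is an ascent of \<open>- h\<close> through the
      reflected interval.\<close>
    have neg: "clamp (- hi) (- lo) (- y) = - clamp lo hi y" for y
      using \<open>lo \<le> hi\<close> by (auto simp: clamp_def max_def min_def)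
    have "ennreal (clamp (- hi) (- lo) (- h b) - clamp (- hi) (- lo) (- h 0)) \<le>
        emeasure lborel {s \<in> {0..b}. - h s \<in> {- hi..- lo}}"
      using 3 \<open>lo \<le> hi\<close> lip by (intro *) (auto simp: neg abs_minus_commute)
    also have "{s \<in> {0..b}. - h s \<in> {- hi..- lo}} = {s \<in> {0..b}. h s \<in> {lo..hi}}" by auto
    finally show ?thesis using 3 by (simp add: neg)
  qed
qed

text \<open>No constant \<open>c\<close> is close to both \<alpha> and \<beta>: the distances add up
  to at least \<open>\<bar>\<alpha> - \<beta>\<bar>\<close>, and each is taken on a set of measure
  at least \<open>a\<close>.\<close>

lemma mean_oscillation_ge:
  fixes f :: "'a \<Rightarrow> real"
  assumes [measurable]: "A1 \<in> sets M" "A2 \<in> sets M" "B \<in> sets M" and sub: "A1 \<subseteq> B" "A2 \<subseteq> B" and disj: "A1 \<inter> A2 = {}"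
    and fin: "emeasure M B < \<infinity>" and size: "a \<le> measure M A1" "a \<le> measure M A2" "0 \<le> a"
    and [measurable]: "f \<in> borel_measurable M" and bdd: "\<And>x. x \<in> B \<Longrightarrow> \<bar>f x\<bar> \<le> b"
    and val: "\<And>x. x \<in> A1 \<Longrightarrow> f x = \<alpha>" "\<And>x. x \<in> A2 \<Longrightarrow> f x = \<beta>"
  shows "a * \<bar>\<alpha> - \<beta>\<bar> \<le> (LINT x:B|M. \<bar>f x - c\<bar>)"
proof -
  have fin': "emeasure M A1 < \<infinity>" "emeasure M A2 < \<infinity>"
    using emeasure_mono[OF sub(1), of M] emeasure_mono[OF sub(2), of M] fin by (auto intro: order.strict_trans1)
  have "a * \<bar>\<alpha> - \<beta>\<bar> \<le> a * (\<bar>\<alpha> - c\<bar> + \<bar>\<beta> - c\<bar>)" using size by (intro mult_left_mono) auto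
  also have "\<dots> \<le> measure M A1 * \<bar>\<alpha> - c\<bar> + measure M A2 * \<bar>\<beta> - c\<bar>"
    unfolding distrib_left using size by (intro add_mono mult_right_mono) auto
  also have "\<dots> = (\<integral>x. indicator A1 x *\<^sub>R \<bar>\<alpha> - c\<bar> + indicator A2 x *\<^sub>R \<bar>\<beta> - c\<bar> \<partial>M)"
    using fin' by (subst Bochner_Integration.integral_add) (auto simp: less_top)
  also have "\<dots> \<le> (LINT x:B|M. \<bar>f x - c\<bar>)"
    unfolding set_lebesgue_integral_def
  proof (rule integral_mono)
    show "integrable M (\<lambda>x. indicator A1 x *\<^sub>R \<bar>\<alpha> - c\<bar> + indicator A2 x *\<^sub>R \<bar>\<beta> - c\<bar>)"
      using fin' by (intro Bochner_Integration.integrable_add) auto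
    have "integrable M (\<lambda>x. indicator B x *\<^sub>R (b + \<bar>c\<bar>))" using fin by simp
    then show "integrable M (\<lambda>x. indicator B x *\<^sub>R \<bar>f x - c\<bar>)"
    proof (rule Bochner_Integration.integrable_bound)
      have "norm (indicator B x *\<^sub>R \<bar>f x - c\<bar>) \<le> norm (indicator B x *\<^sub>R (b + \<bar>c\<bar>))" for x
        using bdd[of x] by (cases "x \<in> B") auto
      then show "AE x in M. norm (indicator B x *\<^sub>R \<bar>f x - c\<bar>) \<le> norm (indicator B x *\<^sub>R (b + \<bar>c\<bar>))" by simp
    qed measurable
    show "indicator A1 x *\<^sub>R \<bar>\<alpha> - c\<bar> + indicator A2 x *\<^sub>R \<bar>\<beta> - c\<bar> \<le> indicator B x *\<^sub>R \<bar>f x - c\<bar>" for x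
    proof (cases "x \<in> A1")
      case True then show ?thesis using disj sub val(1) by (auto simp: indicator_def)
    next
      case False then show ?thesis using sub val(2)[of x] by (cases "x \<in> A2") (auto simp: indicator_def)
    qed
  qed
  finally show ?thesis .
qed

lemma ennreal_powr_ennreal: "0 \<le> x \<Longrightarrow> ennreal_powr (ennreal x) a = ennreal (x powr a)"
  by (simp add: ennreal_powr_def)

lemma ennreal_powr_mono: "0 \<le> a \<Longrightarrow> x \<le> y \<Longrightarrow> ennreal_powr x a \<le> ennreal_powr y a"
proof -
  assume a: "0 \<le> a" and le: "x \<le> y"
  show ?thesis
  proof (cases "y = \<infinity>")
    case False
    then have "x \<noteq> \<infinity>" "enn2real x \<le> enn2real y" using le by (auto simp: less_top intro!: enn2real_mono)
    then show ?thesis using a False by (simp add: ennreal_powr_def ennreal_leI powr_mono2)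
  qed (simp add: ennreal_powr_def)
qed

section \<open>The test functions and their energy\<close>

context cantor_space
begin

text \<open>The gaps of levels \<open>2, \<dots>, m + 1\<close> between the gap of level 0 and the lower gap of level 1.\<close>

definition gaps :: "nat \<Rightarrow> (nat \<times> nat) set" where
  "gaps m = {(k, i). 2 \<le> k \<and> k < m + 2 \<and> i < 2 ^ k \<and> i div 2 ^ (k - 2) = 1}"

text \<open>With these weights every level contributes the same share of the increase of \<open>cantor_step m\<close>.\<close>

definition weight :: "nat \<Rightarrow> real" where "weight k = 1 / (2 * q) ^ k"

definition cantor_step :: "nat \<Rightarrow> real \<Rightarrow> real" where
  "cantor_step m y = (\<Sum>(k, i)\<in>gaps m. weight k * (clamp (gap_lo k i) (gap_lo k i + q ^ k) y - gap_lo k i))"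

definition step_gradient :: "nat \<Rightarrow> real \<Rightarrow> ennreal" where
  "step_gradient m y = (\<Sum>(k, i)\<in>gaps m. ennreal (weight k) * indicator (gap k i) y)"

text \<open>\<open>i div 2 ^ (k - 2) = 1\<close> puts \<open>gap k i\<close> into
  \<open>band 2 1\<close>; these indices form a block of \<open>2 ^ (k - 2)\<close> consecutive
  numbers, which is all that the sums over gaps need.\<close>

lemma gaps_Sigma: "gaps m = (SIGMA k:{2..<m + 2}. {2 ^ (k - 2)..<2 * 2 ^ (k - 2)})"
proof -
  have "i < 2 ^ k \<and> i div 2 ^ (k - 2) = 1 \<longleftrightarrow> i \<in> {2 ^ (k - 2)..<2 * 2 ^ (k - 2)}" if "2 \<le> k" for i k :: nat
  proof
    assume "i < 2 ^ k \<and> i div 2 ^ (k - 2) = 1"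
    then have i: "i div 2 ^ (k - 2) = 1" by simp
    have "2 ^ (k - 2) * 1 \<le> i" using i by (metis mult.commute div_times_less_eq_dividend)
    moreover have "i < 2 ^ (k - 2) * 2" using i dividend_less_times_div[of "2 ^ (k - 2)" i] by simp
    ultimately show "i \<in> {2 ^ (k - 2)..<2 * 2 ^ (k - 2)}" by simp
  next
    assume i: "i \<in> {2 ^ (k - 2)..<2 * 2 ^ (k - 2)}"
    define j where "j = k - 2"
    have j: "k = j + 2" using that by (simp add: j_def)
    have i': "2 ^ j \<le> i" "i < 2 * 2 ^ j" using i by (simp_all add: j_def)
    have "i div 2 ^ j = 1" using i' by (intro div_nat_eqI) simp_all
    moreover have "i < 2 ^ k" using i' by (simp add: j)
    ultimately show "i < 2 ^ k \<and> i div 2 ^ (k - 2) = 1" by (simp add: j_def)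
  qed
  note * = this
  have "(k, i) \<in> gaps m \<longleftrightarrow> (k, i) \<in> (SIGMA k:{2..<m + 2}. {2 ^ (k - 2)..<2 * 2 ^ (k - 2)})" for k i
    unfolding gaps_def using *[of k i] by (simp only: mem_Sigma_iff mem_Collect_eq case_prod_conv atLeastLessThan_iff) blast
  then show ?thesis by (intro set_eqI) (simp only: split_paired_all)
qed

lemma finite_gaps: "finite (gaps m)" unfolding gaps_Sigma by auto

lemma sum_gaps: "(\<Sum>(k, i)\<in>gaps m. f k) = (\<Sum>k\<in>{2..<m + 2}. 2 ^ (k - 2) * f k)" for f :: "nat \<Rightarrow> real"
  unfolding gaps_Sigma by (subst sum.Sigma[symmetric]) auto

lemma weight_pos: "0 < weight k" using q_pos by (simp add: weight_def)

lemma gaps_in_band: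
  assumes "(k, i) \<in> gaps m"
  shows "i < 2 ^ k" "gap k i \<subseteq> band 2 1"
  using assms gap_subset_band[of k i] band_subset[of 2 k i] by (auto simp: gaps_def)

text \<open>The band in which \<open>cantor_step m\<close> grows lies between two gaps; on these the
  function is constant, with values 0 and m / 4.\<close>

lemma band_2_1: "gap_lo 1 0 + q \<le> band_lo 2 1" "band_lo 2 1 + L * q ^ 2 \<le> gap_lo 0 0"
proof -
  have "band_lo 2 1 = gap_lo 1 0 + q" using band_children(2)[of 1 0] by (simp add: numeral_2_eq_2)
  then show "gap_lo 1 0 + q \<le> band_lo 2 1" "band_lo 2 1 + L * q ^ 2 \<le> gap_lo 0 0"
    using gap_hi[of 1 0] by (auto simp: gap_lo_def band_lo_def numeral_2_eq_2)
qed

lemma cantor_step_low: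
  assumes "y \<in> gap 1 0"
  shows "cantor_step m y = 0"
  unfolding cantor_step_def
proof (intro sum.neutral ballI)
  fix x assume x: "x \<in> gaps m"
  obtain k i where ki: "x = (k, i)" by (cases x)
  have "gap_lo k i \<in> band 2 1" using gaps_in_band[of k i m] x ki qpow[of k] by (auto simp: gap_def)
  then have "y \<le> gap_lo k i" using assms band_2_1 by (auto simp: gap_def band_def)
  then show "(case x of (k, i) \<Rightarrow> weight k * (clamp (gap_lo k i) (gap_lo k i + q ^ k) y - gap_lo k i)) = 0"
    using qpow[of k] by (simp add: ki clamp_def)
qed

lemma cantor_step_high:
  assumes "y \<in> gap 0 0"
  shows "cantor_step m y = real m / 4"
proof -
  have "cantor_step m y = (\<Sum>(k, i)\<in>gaps m. weight k * q ^ k)"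
    unfolding cantor_step_def
  proof (intro sum.cong refl)
    fix x assume x: "x \<in> gaps m"
    obtain k i where ki: "x = (k, i)" by (cases x)
    have "gap_lo k i + q ^ k \<in> band 2 1" using gaps_in_band[of k i m] x ki qpow[of k] by (auto simp: gap_def)
    then have "gap_lo k i + q ^ k \<le> y" using assms band_2_1 by (auto simp: gap_def band_def)
    then show "(case x of (k, i) \<Rightarrow> weight k * (clamp (gap_lo k i) (gap_lo k i + q ^ k) y - gap_lo k i)) =
        (case x of (k, i) \<Rightarrow> weight k * q ^ k)"
      using qpow[of k] by (simp add: ki clamp_def)
  qed
  also have "\<dots> = (\<Sum>k\<in>{2..<m + 2}. 2 ^ (k - 2) * (weight k * q ^ k))" by (rule sum_gaps)
  also have "\<dots> = (\<Sum>k\<in>{2..<m + 2}. 1 / 4)"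
  proof (intro sum.cong refl)
    fix k assume "k \<in> {2..<m + 2}"
    then obtain j where "k = j + 2" by (metis add.commute atLeastLessThan_iff le_add_diff_inverse)
    then show "2 ^ (k - 2) * (weight k * q ^ k) = 1 / 4"
      using q_pos by (simp add: weight_def power_mult_distrib power_add)
  qed
  also have "\<dots> = real m / 4" by simp
  finally show ?thesis .
qed

lemma continuous_cantor_step: "continuous_on UNIV (cantor_step m)"
  unfolding cantor_step_def clamp_def case_prod_beta by (intro continuous_intros)

lemma cantor_step_bounds: "0 \<le> cantor_step m y" "cantor_step m y \<le> (\<Sum>(k, i)\<in>gaps m. weight k * q ^ k)"
proof -
  have *: "0 \<le> clamp (gap_lo k i) (gap_lo k i + q ^ k) y - gap_lo k i"
    "clamp (gap_lo k i) (gap_lo k i + q ^ k) y - gap_lo k i \<le> q ^ k" for k i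
    using qpow(1)[of k] unfolding clamp_def max_def min_def by auto
  show "0 \<le> cantor_step m y" "cantor_step m y \<le> (\<Sum>(k, i)\<in>gaps m. weight k * q ^ k)"
    unfolding cantor_step_def case_prod_beta
    by (intro sum_nonneg sum_mono mult_nonneg_nonneg mult_left_mono * less_imp_le[OF weight_pos])+
qed

lemma gap_sets[measurable]: "gap k i \<in> sets borel" by (simp add: gap_def)

lemma step_gradient_measurable[measurable]: "step_gradient m \<in> borel_measurable borel"
  unfolding step_gradient_def[abs_def] case_prod_beta by measurable

text \<open>In arc length the second coordinate of a curve is 1-Lipschitz, so
  \<open>clamp_crossing\<close> bounds the change of each summand by its weight times the time the
  curve spends over that gap, which is the integral of the corresponding summand of the
  gradient.\<close>

lemma step_upper_gradient: "MX.upper_gradient_on X (\<lambda>z. cantor_step m (snd z)) (\<lambda>z. step_gradient m (snd z))"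
  unfolding MX.upper_gradient_on_def
proof (intro conjI ballI allI impI)
  show "MX.borel_function_on X (\<lambda>z. step_gradient m (snd z))"
    unfolding MX.borel_function_on_def subtopology_X[OF order_refl]
  proof (rule measurable_compose[OF _ step_gradient_measurable])
    have sub: "{V. openin (top_of_set X) V} \<subseteq> Pow X" by (auto dest: openin_imp_subset)
    show "snd \<in> borel_measurable (sigma X {V. openin (top_of_set X) V})"
    proof (rule borel_measurableI)
      fix S :: "real set" assume "open S"
      have "openin (top_of_set X) (X \<inter> snd -` S)"
        by (rule continuous_openin_preimage_gen[OF _ \<open>open S\<close>]) (intro continuous_intros)
      then show "snd -` S \<inter> space (sigma X {V. openin (top_of_set X) V}) \<in> sets (sigma X {V. openin (top_of_set X) V})"
        using sub by (simp add: space_measure_of sets_measure_of Int_commute sigma_sets.Basic)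
    qed
  qed
  fix x y \<gamma> assume "x \<in> X" "y \<in> X" and \<gamma>: "MX.rectifiable_curve_in X \<gamma> \<and> \<gamma> 0 = x \<and> \<gamma> 1 = y"
  let ?b = "enn2real (curve_length (length_dist X) \<gamma> 0 1)"
  let ?\<alpha> = "arc_length_param (length_dist X) \<gamma>"
  define h where "h s = snd (?\<alpha> s)" for s
  have rect: "MX.rectifiable_curve_in X \<gamma>" using \<gamma> by simp
  note al = MX.arc_length_param_lipschitz[OF rect]
  have h: "\<bar>h s - h t\<bar> \<le> t - s" if "0 \<le> s" "s \<le> t" "t \<le> ?b" for s t
  proof -
    have "\<bar>h s - h t\<bar> \<le> dist (?\<alpha> s) (?\<alpha> t)" using dist_snd_le[of "?\<alpha> s" "?\<alpha> t"] by (simp add: h_def dist_real_def)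
    also have "\<dots> \<le> length_dist X (?\<alpha> s) (?\<alpha> t)" using al(1)[of s] al(1)[of t] that by (intro dist_le_length_dist) auto
    also have "\<dots> \<le> t - s" using al(2) that by simp
    finally show ?thesis .
  qed
  have h0: "h 0 = snd x" "h ?b = snd y" using al(3,4) \<gamma> by (auto simp: h_def)
  have b: "0 \<le> ?b" by simp
  have meas: "{s \<in> {0..?b}. h s \<in> gap k i} \<in> sets borel" for k i
  proof -
    have "1-lipschitz_on {0..?b} h"
    proof (rule lipschitz_onI)
      fix x y assume "x \<in> {0..?b}" "y \<in> {0..?b}"
      then show "dist (h x) (h y) \<le> 1 * dist x y"
        using h[of x y] h[of y x] by (cases "x \<le> y") (auto simp: dist_real_def abs_minus_commute)
    qed simp
    then have "closed ({0..?b} \<inter> h -` gap k i)"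
      by (intro continuous_closed_preimage lipschitz_on_continuous_on) (auto simp: gap_def)
    moreover have "{s \<in> {0..?b}. h s \<in> gap k i} = {0..?b} \<inter> h -` gap k i" by auto
    ultimately show ?thesis by simp
  qed
  have "\<bar>cantor_step m (snd x) - cantor_step m (snd y)\<bar> \<le> (\<Sum>(k, i)\<in>gaps m. weight k *
      \<bar>clamp (gap_lo k i) (gap_lo k i + q ^ k) (h 0) - clamp (gap_lo k i) (gap_lo k i + q ^ k) (h ?b)\<bar>)"
    unfolding cantor_step_def h0 sum_subtractf[symmetric]
    by (rule order_trans[OF sum_abs]) (auto intro!: sum_mono simp: abs_mult abs_of_pos[OF weight_pos] simp flip: right_diff_distrib)
  then have "ennreal \<bar>cantor_step m (snd x) - cantor_step m (snd y)\<bar> \<le> (\<Sum>(k, i)\<in>gaps m. ennreal (weight k *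
      \<bar>clamp (gap_lo k i) (gap_lo k i + q ^ k) (h 0) - clamp (gap_lo k i) (gap_lo k i + q ^ k) (h ?b)\<bar>))"
    unfolding case_prod_beta
    by (subst sum_ennreal) (auto intro!: ennreal_leI mult_nonneg_nonneg less_imp_le[OF weight_pos])
  also have "\<dots> \<le> (\<Sum>(k, i)\<in>gaps m. \<integral>\<^sup>+ s. ennreal (weight k) * indicator {s \<in> {0..?b}. h s \<in> gap k i} s \<partial>lborel)"
  proof (intro sum_mono, clarify)
    fix k i
    have "ennreal (weight k * \<bar>clamp (gap_lo k i) (gap_lo k i + q ^ k) (h 0) - clamp (gap_lo k i) (gap_lo k i + q ^ k) (h ?b)\<bar>) =
        ennreal (weight k) * ennreal \<bar>clamp (gap_lo k i) (gap_lo k i + q ^ k) (h 0) - clamp (gap_lo k i) (gap_lo k i + q ^ k) (h ?b)\<bar>"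
      by (rule ennreal_mult) (use weight_pos[of k] in auto)
    also have "\<dots> \<le> ennreal (weight k) * emeasure lborel {s \<in> {0..?b}. h s \<in> gap k i}"
      unfolding gap_def using qpow[of k] b h by (intro mult_left_mono clamp_crossing) auto
    also have "\<dots> = (\<integral>\<^sup>+ s. ennreal (weight k) * indicator {s \<in> {0..?b}. h s \<in> gap k i} s \<partial>lborel)"
      using meas[of k i] by (simp add: nn_integral_cmult_indicator)
    finally show "ennreal (weight k * \<bar>clamp (gap_lo k i) (gap_lo k i + q ^ k) (h 0) - clamp (gap_lo k i) (gap_lo k i + q ^ k) (h ?b)\<bar>) \<le>
        (\<integral>\<^sup>+ s. ennreal (weight k) * indicator {s \<in> {0..?b}. h s \<in> gap k i} s \<partial>lborel)" .
  qed
  also have "\<dots> = (\<integral>\<^sup>+ s. (\<Sum>(k, i)\<in>gaps m. ennreal (weight k) * indicator {s \<in> {0..?b}. h s \<in> gap k i} s) \<partial>lborel)"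
    unfolding case_prod_beta using meas by (intro nn_integral_sum[symmetric]) auto
  also have "\<dots> = curve_integral (length_dist X) \<gamma> (\<lambda>z. step_gradient m (snd z))"
    unfolding curve_integral_def step_gradient_def case_prod_beta sum_distrib_right h_def
    by (intro nn_integral_cong sum.cong refl) (auto simp: indicator_def)
  finally show "ennreal \<bar>cantor_step m (snd x) - cantor_step m (snd y)\<bar> \<le>
      curve_integral (length_dist X) \<gamma> (\<lambda>z. step_gradient m (snd z))" .
qed

text \<open>Even closed gaps are disjoint: a band of positive length lies between any two of
  them.\<close>

lemma gap_unique:
  assumes "y \<in> gap k i" "y \<in> gap k' i'" "i < 2 ^ k" "i' < 2 ^ k'"
  shows "k = k'" "i = i'"
proof -
  have "(k, i) = (k', i')"
  proof (rule ccontr)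
    assume "(k, i) \<noteq> (k', i')"
    then have "L * q ^ Suc (max k k') \<le> \<bar>y - y\<bar>" using assms by (intro gap_separated[of k i k' i']) auto
    moreover have "0 < L * q ^ Suc (max k k')" using L_bounds qpow(1)[of "Suc (max k k')"] by (intro mult_pos_pos) simp_all
    ultimately show False by simp
  qed
  then show "k = k'" "i = i'" by auto
qed

lemma emeasure_CC: "emeasure lborel (CC k) \<le> ennreal ((2 ^ \<nu> * q) ^ k)"
proof -
  have "emeasure lborel (CC k) \<le> (\<Sum>N<2 ^ (\<nu> * k). emeasure lborel (cantor_interval l (\<nu> * k) N))"
    unfolding CC_def cantor_level_def by (intro emeasure_subadditive_finite) (auto simp: cantor_interval_def)
  also have "\<dots> = (\<Sum>N<(2::nat) ^ (\<nu> * k). ennreal (q ^ k))"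
    using qpow[of k] by (intro sum.cong refl) (simp add: cantor_interval_def qpow_eq)
  also have "\<dots> = ennreal (2 ^ (\<nu> * k) * q ^ k)"
    using qpow[of k] by (simp add: ennreal_mult ennreal_power[symmetric] flip: ennreal_numeral)
  finally show ?thesis by (simp add: power_mult_distrib power_mult)
qed

lemma emeasure_X_gap:
  assumes "i < 2 ^ k"
  shows "emeasure lborel (X \<inter> UNIV \<times> gap k i) \<le> ennreal ((2 ^ \<nu> * q\<^sup>2) ^ k)"
proof -
  have closed: "closed (CC k)" unfolding CC_def by (rule C.closed_cantor_level)
  have "X \<inter> UNIV \<times> gap k i \<subseteq> CC k \<times> gap k i"
  proof
    fix z assume z: "z \<in> X \<inter> UNIV \<times> gap k i"
    obtain x y where xy: "z = (x, y)" by (cases z)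
    then have "(x, y) \<in> X" "y \<in> gap k i" using z by auto
    then have "x \<in> CC k" unfolding X_iff using gap_unique(1)[OF _ _ _ assms] cantor_set_subset_CC[of k] by blast
    then show "z \<in> CC k \<times> gap k i" using z xy by simp
  qed
  then have "emeasure lborel (X \<inter> UNIV \<times> gap k i) \<le> emeasure lborel (CC k \<times> gap k i)"
    using closed by (intro emeasure_mono) (auto intro!: borel_Times)
  also have "\<dots> = emeasure (lborel \<Otimes>\<^sub>M lborel) (CC k \<times> gap k i)" by (simp add: lborel_prod)
  also have "\<dots> = emeasure lborel (CC k) * emeasure lborel (gap k i)"
    using closed by (intro lborel.emeasure_pair_measure_Times) auto
  also have "\<dots> \<le> ennreal ((2 ^ \<nu> * q) ^ k) * ennreal (q ^ k)"
    using qpow[of k] by (intro mult_mono emeasure_CC) (auto simp: gap_def)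
  also have "\<dots> = ennreal ((2 ^ \<nu> * q\<^sup>2) ^ k)"
    using q_pos by (simp add: ennreal_mult[symmetric] power_mult_distrib[symmetric] power2_eq_square mult.assoc)
  finally show ?thesis .
qed

text \<open>The gaps are disjoint, so at most one summand is nonzero at \<open>y\<close> and the
  power may be taken inside the sum.\<close>

lemma step_gradient_powr:
  assumes "0 < p"
  shows "ennreal_powr (step_gradient m y) p = (\<Sum>(k, i)\<in>gaps m. ennreal (weight k powr p) * indicator (gap k i) y)"
proof (cases "\<exists>k i. (k, i) \<in> gaps m \<and> y \<in> gap k i")
  case True
  then obtain k i where ki: "(k, i) \<in> gaps m" "y \<in> gap k i" by blast
  have single: "(\<Sum>(k', i')\<in>gaps m. f k' * indicator (gap k' i') y) = f k" for f :: "nat \<Rightarrow> ennreal"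
  proof -
    have "(case x of (k', i') \<Rightarrow> f k' * indicator (gap k' i') y) = (if x = (k, i) then f k else 0)" if "x \<in> gaps m" for x
    proof (cases x)
      case (Pair k' i')
      have "k' = k \<and> i' = i" if "y \<in> gap k' i'"
        using gap_unique[OF that ki(2)] gaps_in_band(1)[OF ki(1)] gaps_in_band(1)[of k' i' m] \<open>x \<in> gaps m\<close> Pair by simp
      then show ?thesis using ki(2) by (cases "y \<in> gap k' i'") (simp_all add: Pair indicator_def, blast)
    qed
    then have "(\<Sum>(k', i')\<in>gaps m. f k' * indicator (gap k' i') y) = (\<Sum>x\<in>gaps m. if x = (k, i) then f k else 0)"
      by (intro sum.cong refl)
    then show ?thesis using finite_gaps[of m] ki(1) by simp
  qed
  show ?thesis
    unfolding step_gradient_def single using weight_pos[of k] by (simp add: ennreal_powr_ennreal)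
next
  case False
  then have "(\<Sum>(k, i)\<in>gaps m. f k * indicator (gap k i) y) = 0" for f :: "nat \<Rightarrow> ennreal"
    by (intro sum.neutral) (auto simp: indicator_def)
  then show ?thesis using assms by (simp add: step_gradient_def ennreal_powr_def)
qed

text \<open>Level \<open>k\<close> contributes \<open>2 ^ (k - 2)\<close> gaps, weight
  \<open>(2 * q) powr (- p * k)\<close> and area at most \<open>(2 ^ \<nu> * q ^ 2) ^ k\<close>
  each. The ratio is \<open>2 * (2 * q) powr (- p) * 2 ^ \<nu> * q ^ 2\<close>, which is the stated
  one because \<open>(2 * l) ^ \<nu> = 2 ^ \<nu> * q\<close>.\<close>

lemma step_energy:
  assumes "0 < p"
  shows "(\<integral>\<^sup>+ z\<in>X. ennreal_powr (step_gradient m (snd z)) p \<partial>lborel) \<le>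
    ennreal (\<Sum>k\<in>{2..<m + 2}. ((2 * q) powr (1 - p) * (2 * l) ^ \<nu>) ^ k / 4)"
proof -
  have Xs[measurable]: "X \<in> sets borel" using closed_X by simp
  have [measurable]: "UNIV \<times> gap k i \<in> sets (borel :: (real \<times> real) measure)" for k i by (intro borel_Times) auto
  have "(\<integral>\<^sup>+ z\<in>X. ennreal_powr (step_gradient m (snd z)) p \<partial>lborel) =
      (\<integral>\<^sup>+ z. (\<Sum>(k, i)\<in>gaps m. ennreal (weight k powr p) * indicator (X \<inter> UNIV \<times> gap k i) z) \<partial>lborel)"
    unfolding step_gradient_powr[OF assms] sum_distrib_right case_prod_beta
    by (intro nn_integral_cong sum.cong refl) (auto simp: indicator_def)
  also have "\<dots> = (\<Sum>(k, i)\<in>gaps m. ennreal (weight k powr p) * emeasure lborel (X \<inter> UNIV \<times> gap k i))"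
    unfolding case_prod_beta by (subst nn_integral_sum) (auto simp: nn_integral_cmult_indicator)
  also have "\<dots> \<le> (\<Sum>(k, i)\<in>gaps m. ennreal (weight k powr p * (2 ^ \<nu> * q\<^sup>2) ^ k))"
  proof (intro sum_mono, clarify)
    fix k i assume "(k, i) \<in> gaps m"
    then show "ennreal (weight k powr p) * emeasure lborel (X \<inter> UNIV \<times> gap k i) \<le>
        ennreal (weight k powr p * (2 ^ \<nu> * q\<^sup>2) ^ k)"
      using q_pos by (subst ennreal_mult) (auto intro!: mult_left_mono emeasure_X_gap gaps_in_band(1))
  qed
  also have "\<dots> = ennreal (\<Sum>(k, i)\<in>gaps m. weight k powr p * (2 ^ \<nu> * q\<^sup>2) ^ k)"
    unfolding case_prod_beta using q_pos by (intro sum_ennreal) auto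
  also have "(\<Sum>(k, i)\<in>gaps m. weight k powr p * (2 ^ \<nu> * q\<^sup>2) ^ k) =
      (\<Sum>k\<in>{2..<m + 2}. 2 ^ (k - 2) * (weight k powr p * (2 ^ \<nu> * q\<^sup>2) ^ k))"
    by (rule sum_gaps)
  also have "\<dots> = (\<Sum>k\<in>{2..<m + 2}. ((2 * q) powr (1 - p) * (2 * l) ^ \<nu>) ^ k / 4)"
  proof (intro sum.cong refl)
    fix k assume "k \<in> {2..<m + 2}"
    then have "k = k - 2 + 2" unfolding atLeastLessThan_iff by linarith
    then have "(2::real) ^ k = 2 ^ (k - 2 + 2)" by (rule arg_cong)
    then have 2: "(2::real) ^ (k - 2) = 2 ^ k / 4" by (simp only: power_add) simp
    have w: "weight k powr p = ((2 * q) powr (- p)) ^ k"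
    proof -
      have "weight k = (2 * q) powr (- real k)"
        using q_pos by (simp add: weight_def powr_minus powr_realpow divide_inverse)
      then have "weight k powr p = (2 * q) powr (- p * real k)" by (simp add: powr_powr mult.commute)
      also have "\<dots> = ((2 * q) powr (- p)) ^ k"
        using q_pos by (subst powr_powr[symmetric], subst powr_realpow) simp_all
      finally show ?thesis .
    qed
    have "(2 * q) powr (1 - p) = 2 * q * (2 * q) powr (- p)"
      using q_pos powr_add[of "2 * q" 1 "- p"] by simp
    then have "(2 * q) powr (1 - p) * (2 * l) ^ \<nu> = 2 * (2 * q) powr (- p) * (2 ^ \<nu> * q\<^sup>2)"
      by (simp add: power_mult_distrib q_def[symmetric] power2_eq_square)
    then show "2 ^ (k - 2) * (weight k powr p * (2 ^ \<nu> * q\<^sup>2) ^ k) = ((2 * q) powr (1 - p) * (2 * l) ^ \<nu>) ^ k / 4"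
      by (simp only: 2 w power_mult_distrib)
  qed
  finally show ?thesis .
qed

text \<open>The inequality is used for one ball, all of X: the oscillation of
  \<open>cantor_step m\<close> grows linearly in m, while the right-hand side grows like the energy
  to the power \<open>1 / p\<close>.\<close>

lemma step_growth:
  assumes P: "MX.supports_Poincare (restrict_space lborel X) p" and p: "1 \<le> p"
  shows "\<exists>K>0. \<forall>m. real m \<le> K * (\<Sum>k\<in>{2..<m + 2}. ((2 * q) powr (1 - p) * (2 * l) ^ \<nu>) ^ k / 4) powr (1 / p)"
proof -
  let ?\<mu> = "restrict_space lborel X"
  define S where "S m = (\<Sum>k\<in>{2..<m + 2}. ((2 * q) powr (1 - p) * (2 * l) ^ \<nu>) ^ k / 4)" for m
  have S0: "0 \<le> S m" for m unfolding S_def using l_pos by (intro sum_nonneg) simp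
  have Xs: "X \<inter> space lborel \<in> sets lborel" using closed_X by simp
  have Xm[measurable]: "X \<in> sets ?\<mu>" using closed_X by (simp add: sets_restrict_space_iff)
  obtain \<kappa> C where \<kappa>: "1 \<le> \<kappa>" and C: "0 < C" and ineq: "\<And>x r u g. x \<in> X \<Longrightarrow> 0 < r \<Longrightarrow>
      continuous_map (subtopology MX.mtopology (MX.mball x (\<kappa> * r))) euclideanreal u \<Longrightarrow>
      bounded (u ` MX.mball x (\<kappa> * r)) \<Longrightarrow> MX.upper_gradient_on (MX.mball x (\<kappa> * r)) u g \<Longrightarrow>
      ennreal (MX.mean_value ?\<mu> (MX.mball x r) (\<lambda>y. \<bar>u y - MX.mean_value ?\<mu> (MX.mball x r) u\<bar>)) \<le>
      ennreal (C * MX.mdiam (MX.mball x r)) * ennreal_powr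
        ((\<integral>\<^sup>+ y\<in>MX.mball x (\<kappa> * r). ennreal_powr (g y) p \<partial>?\<mu>) / emeasure ?\<mu> (MX.mball x (\<kappa> * r))) (1 / p)"
    using P unfolding MX.supports_Poincare_def by blast
  \<comment> \<open>One cube on either side of \<open>band 2 1\<close>, where the test function is 0
    and m / 4; the smaller area \<open>q ^ 2\<close> does not depend on m.\<close>
  define Q1 where "Q1 = cantor_interval l (\<nu> * 1) 0 \<times> gap 1 0"
  define Q2 where "Q2 = cantor_interval l (\<nu> * 0) 0 \<times> gap 0 0"
  have Q: "Q1 \<subseteq> X" "Q2 \<subseteq> X" unfolding Q1_def Q2_def by (intro cube_subset_X; simp)+
  have [measurable]: "Q1 \<in> sets borel" "Q2 \<in> sets borel"
    unfolding Q1_def Q2_def cantor_interval_def gap_def by (auto intro!: borel_Times)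
  have Qm[measurable]: "Q1 \<in> sets ?\<mu>" "Q2 \<in> sets ?\<mu>" using Q Xs by (simp_all add: sets_restrict_space_iff)
  have eQ: "emeasure lborel Q1 = ennreal (q\<^sup>2)" "emeasure lborel Q2 = 1"
    unfolding Q1_def Q2_def cantor_interval_def gap_def using q_pos qpow_eq[of 1]
    by (simp_all add: emeasure_lborel_rect power2_eq_square)
  have mQ: "measure ?\<mu> Q1 = q\<^sup>2" "measure ?\<mu> Q2 = 1"
    unfolding measure_def using Q Xs eQ by (simp_all add: emeasure_restrict_space)
  have disj: "Q1 \<inter> Q2 = {}"
    unfolding Q1_def Q2_def using gap_unique(1)[of _ 1 0 0 0] by auto
  have Xfin: "emeasure ?\<mu> X < \<infinity>"
  proof -
    have "X \<subseteq> {0..1} \<times> {0..L}" by (auto dest: X_fst X_snd)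
    moreover have "{0..1} \<times> {0..L} \<in> sets (lborel :: (real \<times> real) measure)" by (auto intro!: borel_Times)
    ultimately have "emeasure lborel X \<le> emeasure lborel ({0..1 :: real} \<times> {0..L})" by (rule emeasure_mono)
    also have "\<dots> < \<infinity>" using L_bounds by (simp add: emeasure_lborel_rect)
    finally show ?thesis using Xs by (simp add: emeasure_restrict_space)
  qed
  have X1: "1 \<le> emeasure ?\<mu> X"
    using emeasure_mono[OF Q(2), of ?\<mu>] Q Xs eQ by (simp add: emeasure_restrict_space)
  let ?M = "measure ?\<mu> X"
  have M: "0 < ?M" using X1 Xfin by (auto simp: measure_def enn2real_positive_iff intro: order.strict_trans2[of 0 1])
  have z0: "(0, gap_lo 0 0) \<in> Q2" unfolding Q2_def cantor_interval_def gap_def by simp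
  let ?z = "(0, gap_lo 0 0) :: real \<times> real"
  have zX: "?z \<in> X" using z0 Q by auto
  \<comment> \<open>Distances in X are at most 11 by \<open>ldist_tower\<close> at level 0, so the
    ball of radius 12 and its dilation by \<kappa> are both X.\<close>
  have ball: "MX.mball ?z r = X" if r: "12 \<le> r" for r
  proof -
    have "length_dist X ?z y \<le> 11" if "y \<in> X" for y
      using ldist_tower[of ?z 0 0 0 y] X_subset_tower zX that by (intro length_dist_le) auto
    then have "length_dist X ?z y < r" if "y \<in> X" for y using that r by fastforce
    then show ?thesis using zX by (auto simp: MX.mball_def)
  qed
  \<comment> \<open>\<open>max 0\<close> spares the sign of the diameter, and \<open>max 1\<close>
    makes \<open>K\<close> positive.\<close>
  define K where "K = max 1 (4 * ?M / q\<^sup>2 * max 0 (C * MX.mdiam X))"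
  have "real m \<le> K * S m powr (1 / p)" for m
  proof -
    let ?u = "\<lambda>z :: real \<times> real. cantor_step m (snd z)"
    define b where "b = (\<Sum>(k, i)\<in>gaps m. weight k * q ^ k)"
    have b: "\<bar>?u z\<bar> \<le> b" for z using cantor_step_bounds[of m "snd z"] by (simp add: b_def)
    define c where "c = MX.mean_value ?\<mu> X ?u"
    have um: "?u \<in> borel_measurable borel"
      by (intro borel_measurable_continuous_onI continuous_on_compose2[OF continuous_cantor_step] continuous_intros) auto
    have "continuous_on X ?u" by (intro continuous_on_compose2[OF continuous_cantor_step] continuous_intros) auto
    then have 1: "continuous_map (subtopology MX.mtopology X) euclideanreal ?u"
      unfolding subtopology_X[OF order_refl] by simp
    have 2: "bounded (?u ` X)" unfolding bounded_iff using b by (intro exI[of _ b]) simp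
    have le: "ennreal (MX.mean_value ?\<mu> X (\<lambda>y. \<bar>?u y - c\<bar>)) \<le> ennreal (C * MX.mdiam X) * ennreal_powr
        ((\<integral>\<^sup>+ y\<in>X. ennreal_powr (step_gradient m (snd y)) p \<partial>?\<mu>) / emeasure ?\<mu> X) (1 / p)"
      using ineq[OF zX, of 12 ?u "\<lambda>z. step_gradient m (snd z)"] \<kappa> 1 2 step_upper_gradient
      unfolding c_def by (simp add: ball)
    have "q\<^sup>2 * \<bar>0 - real m / 4\<bar> \<le> (LINT y:X|?\<mu>. \<bar>?u y - c\<bar>)"
    proof (rule mean_oscillation_ge[of Q1 _ Q2])
      show "q\<^sup>2 \<le> measure ?\<mu> Q2" using q_pos q_quarter mQ by (simp add: power_le_one)
      show "?u z = 0" if "z \<in> Q1" for z using that by (intro cantor_step_low) (auto simp: Q1_def)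
      show "?u z = real m / 4" if "z \<in> Q2" for z using that by (intro cantor_step_high) (auto simp: Q2_def)
      show "?u \<in> borel_measurable ?\<mu>" using um by (intro measurable_restrict_space1) simp
    qed (use Q Qm Xm disj Xfin mQ b in simp_all)
    then have low: "q\<^sup>2 * real m / (4 * ?M) \<le> MX.mean_value ?\<mu> X (\<lambda>y. \<bar>?u y - c\<bar>)"
      using M by (simp add: MX.mean_value_def field_simps)
    have "(\<integral>\<^sup>+ y\<in>X. ennreal_powr (step_gradient m (snd y)) p \<partial>?\<mu>) =
        (\<integral>\<^sup>+ y\<in>X. ennreal_powr (step_gradient m (snd y)) p \<partial>lborel)"
      unfolding nn_integral_restrict_space[OF Xs] by (intro nn_integral_cong) (auto simp: indicator_def)
    also have "\<dots> \<le> ennreal (S m)" unfolding S_def using p by (intro step_energy) simp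
    finally have I: "(\<integral>\<^sup>+ y\<in>X. ennreal_powr (step_gradient m (snd y)) p \<partial>?\<mu>) \<le> ennreal (S m)" .
    \<comment> \<open>X contains the unit cube \<open>Q2\<close>, so dividing by its area only
      decreases.\<close>
    have "(\<integral>\<^sup>+ y\<in>X. ennreal_powr (step_gradient m (snd y)) p \<partial>?\<mu>) / emeasure ?\<mu> X \<le> ennreal (S m)"
      using X1 I mult_mono[OF X1 I] by (intro divide_le_posI_ennreal) (auto intro: less_le_trans[of 0 1])
    then have "ennreal_powr ((\<integral>\<^sup>+ y\<in>X. ennreal_powr (step_gradient m (snd y)) p \<partial>?\<mu>) / emeasure ?\<mu> X) (1 / p) \<le>
        ennreal (S m powr (1 / p))"
      using p S0[of m] by (subst ennreal_powr_ennreal[symmetric]) (auto intro!: ennreal_powr_mono)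
    then have "ennreal (q\<^sup>2 * real m / (4 * ?M)) \<le> ennreal (C * MX.mdiam X) * ennreal (S m powr (1 / p))"
      using le low by (meson ennreal_leI mult_left_mono order_trans zero_le)
    also have "\<dots> \<le> ennreal (max 0 (C * MX.mdiam X)) * ennreal (S m powr (1 / p))"
      by (intro mult_right_mono ennreal_leI) auto
    also have "\<dots> = ennreal (max 0 (C * MX.mdiam X) * S m powr (1 / p))" by (rule ennreal_mult[symmetric]) auto
    finally have "q\<^sup>2 * real m / (4 * ?M) \<le> max 0 (C * MX.mdiam X) * S m powr (1 / p)"
      by (subst (asm) ennreal_le_iff) auto
    then have "real m \<le> 4 * ?M / q\<^sup>2 * max 0 (C * MX.mdiam X) * S m powr (1 / p)"
      using M q_pos by (simp add: field_simps)
    also have "\<dots> \<le> K * S m powr (1 / p)"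
      unfolding K_def by (intro mult_right_mono max.cobounded2) simp
    finally show ?thesis .
  qed
  moreover have "0 < K" by (simp add: K_def)
  ultimately show ?thesis unfolding S_def by blast
qed

text \<open>With ratio at most 1 the energy sum is at most m, so \<open>step_growth\<close> would
  give \<open>m \<le> K * m powr (1 / p)\<close>, which is absurd for large m if p > 1.\<close>

lemma not_supports_Poincare_subcritical:
  assumes p: "1 \<le> p" and \<theta>: "(2 * q) powr (1 - p) * (2 * l) ^ \<nu> \<le> 1"
  shows "\<not> MX.supports_Poincare (restrict_space lborel X) p"
proof
  assume P: "MX.supports_Poincare (restrict_space lborel X) p"
  define \<theta> where "\<theta> = (2 * q) powr (1 - p) * (2 * l) ^ \<nu>"
  have \<theta>01: "0 \<le> \<theta>" "\<theta> \<le> 1" using assms l_pos by (simp_all add: \<theta>_def)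
  obtain K where K: "0 < K" "\<And>m. real m \<le> K * (\<Sum>k\<in>{2..<m + 2}. \<theta> ^ k / 4) powr (1 / p)"
    using step_growth[OF P p] unfolding \<theta>_def by blast
  show False
  proof (cases "p = 1")
    case True
    \<comment> \<open>For p = 1 the bound \<open>m \<le> K * m\<close> is no contradiction; but then
      the ratio is \<open>(2 * l) ^ \<nu> < 1\<close>, and the geometric series keeps the energy
      bounded.\<close>
    have "(2 * l) ^ \<nu> < 1" using l_pos l_half \<nu> by (subst power_less_one_iff) simp_all
    then have \<theta>1: "\<theta> < 1" using True q_pos by (simp add: \<theta>_def)
    have "(\<Sum>k\<in>{2..<m + 2}. \<theta> ^ k / 4) \<le> 1 / (1 - \<theta>)" for m
    proof -
      have "(\<Sum>k\<in>{2..<m + 2}. \<theta> ^ k / 4) \<le> (\<Sum>k\<in>{2..<m + 2}. \<theta> ^ k)" using \<theta>01 by (intro sum_mono) simp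
      also have "\<dots> \<le> (\<Sum>k. \<theta> ^ k)" using \<theta>01 \<theta>1 by (intro sum_le_suminf summable_geometric) auto
      also have "\<dots> = 1 / (1 - \<theta>)" using \<theta>01 \<theta>1 by (simp add: suminf_geometric)
      finally show ?thesis .
    qed
    then have "(\<Sum>k\<in>{2..<m + 2}. \<theta> ^ k / 4) powr (1 / p) \<le> 1 / (1 - \<theta>)" for m
      using True sum_nonneg[of "{2..<m + 2}" "\<lambda>k. \<theta> ^ k / 4"] \<theta>01 by (simp del: sum.op_ivl_Suc)
    then have "real m \<le> K * (1 / (1 - \<theta>))" for m
      using K(2)[of m] K(1) by (meson mult_left_mono less_imp_le order_trans)
    then show False using reals_Archimedean2 not_le by blast
  next
    case False
    have "real m \<le> K powr (p / (p - 1))" if "0 < m" for m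
    proof -
      have "(\<Sum>k\<in>{2..<m + 2}. \<theta> ^ k / 4) \<le> (\<Sum>k\<in>{2..<m + 2}. 1)"
        using \<theta>01 power_le_one[OF \<theta>01] by (intro sum_mono) (smt (verit) divide_le_eq_1_pos)
      then have "(\<Sum>k\<in>{2..<m + 2}. \<theta> ^ k / 4) powr (1 / p) \<le> real m powr (1 / p)"
        using p \<theta>01 by (intro powr_mono2 sum_nonneg) simp_all
      then have "real m \<le> K * real m powr (1 / p)" using K(2)[of m] K(1) by (meson mult_left_mono less_imp_le order_trans)
      then have "real m powr 1 / real m powr (1 / p) \<le> K" using that by (simp add: divide_le_eq)
      then have "real m powr (1 - 1 / p) \<le> K" by (simp only: powr_diff)
      then have "(real m powr (1 - 1 / p)) powr (p / (p - 1)) \<le> K powr (p / (p - 1))"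
        using False p by (intro powr_mono2) auto
      moreover have "(1 - 1 / p) * (p / (p - 1)) = 1" using False p by (simp add: field_simps)
      ultimately show ?thesis using that by (simp only: powr_powr powr_one of_nat_0_le_iff)
    qed
    then show False using reals_Archimedean2[of "max 0 (K powr (p / (p - 1)))"] by (smt (verit) of_nat_0_less_iff)
  qed
qed

end

theorem theorem6p1:
  fixes l p :: real and \<nu> :: nat
  assumes "0 < l" and "l < 1 / 2" and "\<nu> \<ge> 2" and "1 \<le> p"
  shows "Metric_space.supports_Poincare (X_space l \<nu>) (length_dist (X_space l \<nu>))
           (restrict_space lborel (X_space l \<nu>)) p
         \<longleftrightarrow> p > (1 + real \<nu> + 2 * real \<nu> * log 2 l) / (1 + real \<nu> * log 2 l)"
proof -
  interpret cantor_space l \<nu> using assms by unfold_locales auto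
  define t where "t = log 2 l"
  have "log 2 l < log 2 (1 / 2)" using assms by (subst log_less_cancel_iff) auto
  then have t: "t < - 1" by (simp add: t_def log_divide)
  have lt: "l = 2 powr t" using assms by (simp add: t_def)
  have qt: "q = 2 powr (real \<nu> * t)" using assms by (simp add: q_def t_def log_powr[symmetric] powr_realpow flip: log_nat_power)
  have "real \<nu> * t \<le> 2 * t" using t assms by (intro mult_right_mono_neg) auto
  then have \<nu>t: "1 + real \<nu> * t < 0" using t by linarith
  \<comment> \<open>The critical exponent minus 1 equals
    \<open>\<nu> * (1 + t) / (1 + \<nu> * t)\<close>; the negative denominator reverses the
    inequality.\<close>
  have p0: "(1 + real \<nu> + 2 * real \<nu> * log 2 l) / (1 + real \<nu> * log 2 l) < p \<longleftrightarrow>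
      (p - 1) * (1 + real \<nu> * t) < real \<nu> * (1 + t)"
    unfolding t_def[symmetric] using \<nu>t by (simp add: divide_less_eq algebra_simps)
  have neg: "real \<nu> * (1 + t) < 0" using t assms by (intro mult_pos_neg) auto
  show ?thesis
  proof (cases "(p - 1) * (1 + real \<nu> * t) < real \<nu> * (1 + t)")
    case True
    \<comment> \<open>At p = 1 the case assumption would read \<open>0 < \<nu> * (1 + t)\<close>,
      against \<open>neg\<close>.\<close>
    then have p: "1 < p" using assms(4) neg by (cases "p = 1") auto
    define a where "a = (1 - (- 1 / t)) / (p - 1)"
    \<comment> \<open>\<open>- 1 / t\<close> is the dimension of the Cantor set, as
      \<open>l = 2 powr t\<close>; \<open>crit\<close> is the case assumption divided by
      \<open>p - 1\<close> and exponentiated.\<close>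
    interpret supercritical l \<nu> "- 1 / t" p a
    proof
      show "l powr (- 1 / t) = 1 / 2" using t by (simp add: lt powr_powr powr_minus_divide)
      have "real \<nu> * t * a = real \<nu> * (1 + t) / (p - 1)" using t p by (simp add: a_def field_simps)
      moreover have "1 + real \<nu> * t < real \<nu> * (1 + t) / (p - 1)" using True p by (simp add: less_divide_eq mult.commute)
      ultimately have "1 + real \<nu> * t * (1 - a) < 0" by (simp add: algebra_simps)
      then have "2 powr (1 + real \<nu> * t * (1 - a)) < 2 powr (0::real)" by (intro powr_less_mono) auto
      then show "2 * q powr (1 - a) < 1" by (simp add: qt powr_powr powr_add)
    qed (use p in \<open>simp_all add: a_def\<close>)
    show ?thesis unfolding p0 using supports_Poincare_supercritical True unfolding X_def by blast
  next
    case False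
    have "(2 * q) powr (1 - p) * (2 * l) ^ \<nu> = 2 powr ((1 + real \<nu> * t) * (1 - p)) * 2 powr ((1 + t) * real \<nu>)"
    proof -
      have "2 * q = 2 powr (1 + real \<nu> * t)" "2 * l = 2 powr (1 + t)"
        unfolding powr_add qt using lt by simp_all
      then show ?thesis by (simp add: powr_powr flip: powr_realpow)
    qed
    also have "\<dots> = 2 powr (real \<nu> * (1 + t) - (p - 1) * (1 + real \<nu> * t))"
      unfolding powr_add[symmetric] by (simp add: algebra_simps)
    also have "\<dots> \<le> 2 powr 0" using False by (intro powr_mono) auto
    finally have "(2 * q) powr (1 - p) * (2 * l) ^ \<nu> \<le> 1" by simp
    from not_supports_Poincare_subcritical[OF assms(4) this] show ?thesis
      unfolding p0 using False unfolding X_def by blast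
  qed
qed

end
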